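(* Let $m>1$, let $\Omega\subset\mathbb{R}^N$ be open and bounded, let $0<t_1<t_2$, and let $u$ be a nonnegative weak supersolution to the porous medium equation $\frac{\partial u}{\partial t}-\Delta u^m=0$ in $\Omega\times(t_1,t_2)$. Then $$u(x,t)=\operatorname*{ess\,lim\,inf}_{(y,s)\to(x,t)}u(y,s)=\lim_{r\to 0}\ \operatorname*{ess\,inf}_{(x,t)+Q(r,r^2)}u$$ at every Lebesgue point $(x,t)\in\Omega\times(t_1,t_2)$ of $u$ such that $u(x,t)<\infty$. In particular, $u$ has a lower semicontinuous representative, i.e. there is a lower semicontinuous function on $\Omega\times(t_1,t_2)$ (with values in $[0,\infty]$) that equals $u$ almost everywhere.
   Context: Notation: $Q(r,r^2)=B(0,r)\times(-r^2,r^2)\subset\mathbb{R}^N\times\mathbb{R}$, where $B(0,r)$ is the open ball in $\mathbb{R}^N$; $(x,t)+Q(r,r^2)$ is its translate. The essential limit inferior is by definition $\operatorname*{ess\,lim\,inf}_{(y,s)\to(x,t)}u(y,s):=\lim_{r\to0}\operatorname*{ess\,inf}_{(x,t)+Q(r,r^2)}u$. Weak supersolution: a nonnegative function $u$ on $\Omega\times(t_1,t_2)$ is a weak supersolution of $\frac{\partial u}{\partial t}-\Delta u^m=0$ in $\Omega\times(t_1,t_2)$ if $u^m\in L^2_{loc}(t_1,t_2;H^1_{loc}(\Omega))$ and $$\int_{t_1}^{t_2}\int_{\Omega}\Big(-u\,\frac{\partial\varphi}{\partial t}+\nabla u^m\cdot\nabla\varphi\Big)\,dx\,dt\ge 0$$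 for all nonnegative smooth test functions $\varphi$ compactly supported in $\Omega\times(t_1,t_2)$. Here $\nabla$ is the (weak) gradient in $x$, and $w\in L^2_{loc}(t_1,t_2;H^1_{loc}(\Omega))$ means that $w\in L^2(s_1,s_2;H^1(U))$ for every open $U\subset\Omega$ and $s_1<s_2$ such that the closure of $U\times(s_1,s_2)$ is a compact subset of $\Omega\times(t_1,t_2)$; that is, $w$ is measurable, $w(\cdot,t)\in H^1(U)$ for almost every $t\in(s_1,s_2)$, and $\int_{s_1}^{s_2}\int_U (|w|^2+|\nabla w|^2)\,dx\,dt<\infty$. Lebesgue point: $(x,t)$ is a Lebesgue point of $u$ if $$\lim_{r\to0}\frac{1}{|Q(r,r^2)|}\int_{(x,t)+Q(r,r^2)}|u(x,t)-u(y,s)|\,dy\,ds=0.$$ *)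

theory Defs
  imports "HOL-Analysis.Analysis"
begin

section \<open>Smooth test functions\<close>

text \<open>\<open>C^k\<close> on the whole space, by recursion on \<open>k\<close> via directional derivatives. On a
  finite-dimensional space this is the usual notion.\<close>

fun C_k :: "nat \<Rightarrow> ('a::euclidean_space \<Rightarrow> real) \<Rightarrow> bool" where
  "C_k 0 f \<longleftrightarrow> continuous_on UNIV f"
| "C_k (Suc k) f \<longleftrightarrow>
     (\<forall>x. f differentiable (at x)) \<and> (\<forall>v. C_k k (\<lambda>x. frechet_derivative f (at x) v))"

definition smooth :: "('a::euclidean_space \<Rightarrow> real) \<Rightarrow> bool" where
  "smooth f \<longleftrightarrow> (\<forall>k. C_k k f)"

text \<open>Elements of \<open>C_c^\<infinity>(S)\<close>, \<open>S\<close> open, extended by zero to the whole space.\<close>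

definition test_function :: "'a::euclidean_space set \<Rightarrow> ('a \<Rightarrow> real) \<Rightarrow> bool" where
  "test_function S \<phi> \<longleftrightarrow>
     smooth \<phi> \<and> compact (closure {x. \<phi> x \<noteq> 0}) \<and> closure {x. \<phi> x \<noteq> 0} \<subseteq> S"

definition grad :: "('a::euclidean_space \<Rightarrow> real) \<Rightarrow> 'a \<Rightarrow> 'a" where
  "grad f x = (\<Sum>i\<in>Basis. frechet_derivative f (at x) i *\<^sub>R i)"

section \<open>Sobolev spaces\<close>

definition L2_on :: "'a::euclidean_space set \<Rightarrow> ('a \<Rightarrow> 'b::euclidean_space) \<Rightarrow> bool" where
  "L2_on S f \<longleftrightarrow> f \<in> borel_measurable (lebesgue_on S) \<and>
     integrable (lebesgue_on S) (\<lambda>x. (norm (f x))\<^sup>2)"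

definition weak_gradient_on ::
    "'a::euclidean_space set \<Rightarrow> ('a \<Rightarrow> real) \<Rightarrow> ('a \<Rightarrow> 'a) \<Rightarrow> bool" where
  "weak_gradient_on U f g \<longleftrightarrow>
     (\<forall>\<psi>. test_function U \<psi> \<longrightarrow> (\<forall>i\<in>Basis.
        (LINT x|lebesgue_on U. f x * (grad \<psi> x \<bullet> i)) =
        - (LINT x|lebesgue_on U. (g x \<bullet> i) * \<psi> x)))"

text \<open>\<open>f \<in> H^1(U)\<close>, and \<open>g\<close> is a representative of its weak gradient.\<close>

definition H1_with_gradient ::
    "'a::euclidean_space set \<Rightarrow> ('a \<Rightarrow> real) \<Rightarrow> ('a \<Rightarrow> 'a) \<Rightarrow> bool" where
  "H1_with_gradient U f g \<longleftrightarrow> L2_on U f \<and> L2_on U g \<and> weak_gradient_on U f g"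

text \<open>\<open>w \<in> L^2(s\<^sub>1,s\<^sub>2;H^1(U))\<close>, and \<open>G\<close> is a jointly measurable representative of its weak
  gradient in the space variable.\<close>

definition L2_H1_with_gradient ::
    "'a::euclidean_space set \<Rightarrow> real \<Rightarrow> real \<Rightarrow> ('a \<times> real \<Rightarrow> real) \<Rightarrow> ('a \<times> real \<Rightarrow> 'a) \<Rightarrow> bool"
  where
  "L2_H1_with_gradient U s\<^sub>1 s\<^sub>2 w G \<longleftrightarrow>
     w \<in> borel_measurable (lebesgue_on (U \<times> {s\<^sub>1<..<s\<^sub>2})) \<and>
     G \<in> borel_measurable (lebesgue_on (U \<times> {s\<^sub>1<..<s\<^sub>2})) \<and>
     (AE t in lebesgue_on {s\<^sub>1<..<s\<^sub>2}. H1_with_gradient U (\<lambda>x. w (x, t)) (\<lambda>x. G (x, t))) \<and>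
     integrable (lebesgue_on (U \<times> {s\<^sub>1<..<s\<^sub>2})) (\<lambda>z. (w z)\<^sup>2 + (norm (G z))\<^sup>2)"

text \<open>One \<open>G\<close> serves all \<open>U\<close>, \<open>s\<^sub>1\<close>, \<open>s\<^sub>2\<close>: local weak gradients are unique up to null sets, hence
  glue along a countable exhaustion of the domain.\<close>

definition L2loc_H1loc_with_gradient ::
    "'a::euclidean_space set \<Rightarrow> real \<Rightarrow> real \<Rightarrow> ('a \<times> real \<Rightarrow> real) \<Rightarrow> ('a \<times> real \<Rightarrow> 'a) \<Rightarrow> bool"
  where
  "L2loc_H1loc_with_gradient \<Omega> t\<^sub>1 t\<^sub>2 w G \<longleftrightarrow>
     (\<forall>U s\<^sub>1 s\<^sub>2. open U \<and> U \<subseteq> \<Omega> \<and> s\<^sub>1 < s\<^sub>2 \<and>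
        compact (closure (U \<times> {s\<^sub>1<..<s\<^sub>2})) \<and>
        closure (U \<times> {s\<^sub>1<..<s\<^sub>2}) \<subseteq> \<Omega> \<times> {t\<^sub>1<..<t\<^sub>2} \<longrightarrow>
        L2_H1_with_gradient U s\<^sub>1 s\<^sub>2 w G)"

section \<open>Weak supersolutions of the porous medium equation\<close>

text \<open>\<open>u\<close> takes values in \<open>[0,\<infinity>]\<close>. Finiteness almost everywhere is part of \<open>u^m\<close> being locally in
  \<open>L^2\<close>; it has to be stated because \<open>enn2real\<close> sends \<open>\<infinity>\<close> to \<open>0\<close>. The integrand below is always
  integrable (\<open>u\<close> and \<open>G\<close> are square integrable on a neighbourhood of the support of \<open>\<phi>\<close>).\<close>

definition weak_supersolution ::
    "real \<Rightarrow> 'a::euclidean_space set \<Rightarrow> real \<Rightarrow> real \<Rightarrow> ('a \<times> real \<Rightarrow> ennreal) \<Rightarrow> bool" where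
  "weak_supersolution m \<Omega> t\<^sub>1 t\<^sub>2 u \<longleftrightarrow>
     (AE z in lebesgue_on (\<Omega> \<times> {t\<^sub>1<..<t\<^sub>2}). u z < \<infinity>) \<and>
     (\<exists>G. L2loc_H1loc_with_gradient \<Omega> t\<^sub>1 t\<^sub>2 (\<lambda>z. enn2real (u z) powr m) G \<and>
        (\<forall>\<phi>. test_function (\<Omega> \<times> {t\<^sub>1<..<t\<^sub>2}) \<phi> \<and> (\<forall>z. 0 \<le> \<phi> z) \<longrightarrow>
           0 \<le> (LINT (x, t)|lebesgue_on (\<Omega> \<times> {t\<^sub>1<..<t\<^sub>2}).
                  - enn2real (u (x, t)) * deriv (\<lambda>s. \<phi> (x, s)) t
                  + G (x, t) \<bullet> grad (\<lambda>y. \<phi> (y, t)) x)))"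

section \<open>Cylinders, Lebesgue points and essential limits\<close>

text \<open>The translate \<open>z + Q(r,r\<^sup>2)\<close>.\<close>

definition Q_cyl :: "'a::euclidean_space \<times> real \<Rightarrow> real \<Rightarrow> ('a \<times> real) set" where
  "Q_cyl z r = (\<lambda>w. z + w) ` (ball 0 r \<times> {- (r\<^sup>2)<..<r\<^sup>2})"

text \<open>Subtraction on \<open>ennreal\<close> is truncated, so that \<open>(a - b) + (b - a)\<close> is \<open>\<bar>a - b\<bar>\<close>. It is \<open>\<infinity>\<close> as
  soon as \<open>a\<close> is, so the predicate below never holds at points where \<open>u\<close> is infinite.\<close>

definition lebesgue_point :: "('a::euclidean_space \<times> real \<Rightarrow> ennreal) \<Rightarrow> 'a \<times> real \<Rightarrow> bool" where
  "lebesgue_point u z \<longleftrightarrow>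
     ((\<lambda>r. (\<integral>\<^sup>+w. (u z - u w) + (u w - u z) \<partial>lebesgue_on (Q_cyl z r)) / emeasure lebesgue (Q_cyl z r))
        \<longlongrightarrow> 0) (at_right 0)"

definition ess_inf :: "'a::euclidean_space set \<Rightarrow> ('a \<Rightarrow> ennreal) \<Rightarrow> ennreal" where
  "ess_inf S u = Sup {c. AE w in lebesgue_on S. c \<le> u w}"

definition ess_lim_inf :: "('a::euclidean_space \<times> real \<Rightarrow> ennreal) \<Rightarrow> 'a \<times> real \<Rightarrow> ennreal" where
  "ess_lim_inf u z = Lim (at_right 0) (\<lambda>r. ess_inf (Q_cyl z r) u)"

definition lower_semicontinuous_on :: "'a::topological_space set \<Rightarrow> ('a \<Rightarrow> ennreal) \<Rightarrow> bool" where
  "lower_semicontinuous_on S v \<longleftrightarrow> (\<forall>z\<in>S. \<forall>c<v z. \<forall>\<^sub>F w in at z within S. c < v w)"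

end

theory Submission
  imports Defs "HOL-Probability.Distributions" "HOL-Real_Asymp.Real_Asymp"
begin

text \<open>Truncation turns a supersolution \<open>u\<close> into a very weak subsolution: for every level \<open>\<kappa>\<close>,
  \<open>\<partial>\<^sub>t (\<kappa> - u)\<^sub>+ \<le> \<Delta> (\<kappa>\<^sup>m - u\<^sup>m)\<^sub>+\<close> in the sense of distributions. When \<open>\<kappa>\<close> stays in a compact
  subset of \<open>(0, \<infinity>)\<close>, the two truncations are comparable, so a De Giorgi iteration is possible. Its
  basic estimate comes from duality instead of Caccioppoli and Sobolev inequalities: one tests with a
  cutoff times the solution \<open>\<phi>\<close> of \<open>\<phi> - \<phi>\<^sub>t - \<Lambda> \<Delta>\<phi> = f\<close>. The result is: if \<open>u < q\<close> only on a small
  fraction of a parabolic cylinder, then \<open>u \<ge> q - \<epsilon>\<close> almost everywhere on a smaller one.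

  At a Lebesgue point with \<open>k = u(x,t)\<close>, the set \<open>{u < k - \<epsilon>}\<close> occupies a vanishing fraction of
  \<open>Q(r,r\<^sup>2)\<close>, which gives the lower bound for the essential limit inferior; the upper bound is
  immediate. The same criterion shows that the supremum over \<open>r\<close> of the essential infima, which is lower
  semicontinuous, equals \<open>u\<close> almost everywhere.\<close>

section \<open>Smooth bump functions and gradients\<close>

text \<open>Two obstacles shape the proof. A supersolution has no time derivative and
  \<open>u^m\<close> only a spatial gradient, so a nonlinear function of \<open>u\<close> is not
  admissible in the weak formulation. Test functions therefore contain a mollification of
  \<open>u^m\<close>, and the time derivative is traded for a finite time shift before the
  mollification is removed. In the truncated inequality the unknown ratio of the two truncations
  sits under the Laplacian as a merely measurable coefficient. It is treated as a perturbation of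
  the constant \<open>\<Lambda>\<close>; this closes because the resolvent estimate bounds
  \<open>\<Lambda> \<Delta>\<phi>\<close> by \<open>f\<close> with constant exactly 1, while the
  relative deviation is at most \<open>1 - \<Lambda>\<^sub>0 / \<Lambda> < 1\<close>. A sup bound
  for the heat resolvent supplies the smallness that an embedding theorem usually gives. The levels
  stay in \<open>[q - \<epsilon>, q]\<close>, so the degeneracy at \<open>u = 0\<close> is never
  met: the ellipticity constants depend on \<open>m\<close>, \<open>q\<close>,
  \<open>\<epsilon>\<close> alone, and the scaling \<open>(r x, r^2 t)\<close> preserves the
  equation without rescaling \<open>u\<close>. Hence one and the same threshold serves every
  cylinder.\<close>

definition exp_recip :: "nat \<Rightarrow> real \<Rightarrow> real" where
  "exp_recip n t = (if t > 0 then exp (- 1 / t) / t ^ n else 0)"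

lemma exp_recip_nonneg: "0 \<le> exp_recip n t"
  by (simp add: exp_recip_def)

text \<open>Indexing by \<open>n\<close> makes the family closed under differentiation, which turns
  smoothness of everything built from it into an induction. The only analysis is at 0, where
  \<open>exp (- 1 / h) / h ^ Suc n\<close> tends to 0 from the right.\<close>

lemma has_real_derivative_exp_recip:
  "(exp_recip n has_real_derivative exp_recip (n + 2) t - real n * exp_recip (Suc n) t) (at t)"
proof -
  consider "t > 0" | "t < 0" | "t = 0" by linarith
  then show ?thesis
  proof cases
    case 1
    have "((\<lambda>t. exp (- 1 / t) / t ^ n) has_real_derivative exp_recip (n + 2) t - real n * exp_recip (Suc n) t) (at t)"
    proof -
      have e: "((\<lambda>t. exp (- 1 / t)) has_real_derivative exp (- 1 / t) / t\<^sup>2) (at t)"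
        using 1 by (auto intro!: derivative_eq_intros simp: field_simps power2_eq_square)
      have "real n * t ^ (n - Suc 0) * t = real n * t ^ n"
        by (cases n) auto
      then show ?thesis
        using DERIV_divide[OF e DERIV_pow[of n t]] 1
        by (auto simp: exp_recip_def field_simps power2_eq_square elim!: DERIV_cong)
    qed
    then show ?thesis
      by (rule has_field_derivative_transform_within_open[where S="{0<..}"])
        (use 1 in \<open>auto simp: exp_recip_def\<close>)
  next
    case 2
    have "((\<lambda>t. 0) has_real_derivative exp_recip (n + 2) t - real n * exp_recip (Suc n) t) (at t)"
      using 2 by (simp add: exp_recip_def)
    then show ?thesis
      by (rule has_field_derivative_transform_within_open[where S="{..<0}"])
        (use 2 in \<open>auto simp: exp_recip_def\<close>)
  next
    case 3
    have "((\<lambda>h. exp (- 1 / h) / h ^ Suc n) \<longlongrightarrow> 0) (at_right (0::real))"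
      by real_asymp
    then have r: "((\<lambda>h. exp_recip n h / h) \<longlongrightarrow> 0) (at_right 0)"
      by (rule Lim_transform_eventually)
        (auto simp: eventually_at_filter exp_recip_def)
    have l: "((\<lambda>h. exp_recip n h / h) \<longlongrightarrow> 0) (at_left 0)"
      by (rule tendsto_eventually) (auto simp: eventually_at_filter exp_recip_def)
    have "((\<lambda>h. exp_recip n h / h) \<longlongrightarrow> 0) (at 0)"
      using r l by (simp add: filterlim_split_at)
    then show ?thesis
      using 3 by (simp add: DERIV_def exp_recip_def)
  qed
qed

section \<open>The \<open>C_k\<close> calculus of polynomials times \<open>exp_recip\<close>\<close>

lemma C_k_SucI:
  assumes "\<And>x. (f has_derivative f' x) (at x)" and "\<And>v. C_k k (\<lambda>x. f' x v)"
  shows "C_k (Suc k) f"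
proof -
  have "frechet_derivative f (at x) = f' x" for x
    using frechet_derivative_at[OF assms(1)[of x]] by simp
  then show ?thesis
    using assms by (auto simp: differentiable_def)
qed

lemma C_k_Suc_has_derivative:
  "C_k (Suc k) f \<Longrightarrow> (f has_derivative frechet_derivative f (at x)) (at x)"
  by (simp add: frechet_derivative_works[symmetric])

lemma C_k_continuous: "C_k k f \<Longrightarrow> continuous_on UNIV f"
  by (cases k) (auto simp: continuous_at_imp_continuous_on differentiable_imp_continuous_within)

lemma C_k_add: "C_k k f \<Longrightarrow> C_k k g \<Longrightarrow> C_k k (\<lambda>x. f x + g x)"
proof (induction k arbitrary: f g)
  case 0
  then show ?case by (simp add: continuous_on_add)
next
  case (Suc k)
  show ?case
  proof (rule C_k_SucI)
    show "((\<lambda>x. f x + g x) has_derivative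
        (\<lambda>v. frechet_derivative f (at x) v + frechet_derivative g (at x) v)) (at x)" for x
      by (intro has_derivative_add C_k_Suc_has_derivative[of k] Suc.prems)
    show "C_k k (\<lambda>x. frechet_derivative f (at x) v + frechet_derivative g (at x) v)" for v
      using Suc by simp
  qed
qed

lemma real_polynomial_function_has_derivative:
  assumes "real_polynomial_function (p :: 'b::euclidean_space \<Rightarrow> real)"
  shows "\<exists>p'. (\<forall>x. (p has_derivative p' x) (at x)) \<and> (\<forall>v. real_polynomial_function (\<lambda>x. p' x v))"
  using assms
proof induction
  case (linear f)
  then show ?case
    by (intro exI[of _ "\<lambda>x. f"]) (auto intro: bounded_linear_imp_has_derivative)
next
  case (const c)
  then show ?case
    by (intro exI[of _ "\<lambda>x v. 0"]) (auto intro: real_polynomial_function.intros(2))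
next
  case (add f g)
  then obtain f' g' where "\<forall>x. (f has_derivative f' x) (at x)" "\<forall>v. real_polynomial_function (\<lambda>x. f' x v)"
    "\<forall>x. (g has_derivative g' x) (at x)" "\<forall>v. real_polynomial_function (\<lambda>x. g' x v)" by blast
  then show ?case
    by (intro exI[of _ "\<lambda>x v. f' x v + g' x v"]) (auto intro: has_derivative_add real_polynomial_function.intros(3))
next
  case (mult f g)
  then obtain f' g' where "\<forall>x. (f has_derivative f' x) (at x)" "\<forall>v. real_polynomial_function (\<lambda>x. f' x v)"
    "\<forall>x. (g has_derivative g' x) (at x)" "\<forall>v. real_polynomial_function (\<lambda>x. g' x v)" by blast
  then show ?case
    using mult.hyps
    by (intro exI[of _ "\<lambda>x v. f x * g' x v + f' x v * g x"])
      (auto intro!: has_derivative_mult real_polynomial_function.intros(3) real_polynomial_function.intros(4))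
qed

text \<open>For fixed \<open>q\<close> the products \<open>p x * exp_recip n (q x)\<close> are
  closed under directional derivatives up to sums: every term of the product rule has the same shape
  with another \<open>p\<close> and \<open>n\<close>. So \<open>C_k_add\<close> is the only closure
  property of \<open>C_k\<close> that enters.\<close>

lemma C_k_polynomial_exp_recip:
  fixes p q :: "'b::euclidean_space \<Rightarrow> real"
  assumes q: "real_polynomial_function q" and p: "real_polynomial_function p"
  shows "C_k k (\<lambda>x. p x * exp_recip n (q x))"
  using p
proof (induction k arbitrary: n p)
  case 0
  obtain p' where p': "\<And>x. (p has_derivative p' x) (at x)"
    using real_polynomial_function_has_derivative[OF 0] by blast
  obtain q' where q': "\<And>x. (q has_derivative q' x) (at x)"
    using real_polynomial_function_has_derivative[OF q] by blast
  have "isCont (\<lambda>x. p x * exp_recip n (q x)) x" for x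
    by (intro continuous_mult has_derivative_continuous[OF p']
        isCont_o2[OF has_derivative_continuous[OF q'] DERIV_isCont[OF has_real_derivative_exp_recip]])
  then show ?case by (simp add: continuous_at_imp_continuous_on)
next
  case (Suc k)
  obtain p' where p': "\<And>x. (p has_derivative p' x) (at x)" "\<And>v. real_polynomial_function (\<lambda>x. p' x v)"
    using real_polynomial_function_has_derivative[OF Suc.prems] by blast
  obtain q' where q': "\<And>x. (q has_derivative q' x) (at x)" "\<And>v. real_polynomial_function (\<lambda>x. q' x v)"
    using real_polynomial_function_has_derivative[OF q] by blast
  show ?case
  proof (rule C_k_SucI)
    show "((\<lambda>x. p x * exp_recip n (q x)) has_derivative
      (\<lambda>v. p' x v * exp_recip n (q x) + ((p x * q' x v) * exp_recip (n + 2) (q x)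
          + (- real n * (p x * q' x v)) * exp_recip (Suc n) (q x)))) (at x)" for x
      using has_derivative_mult[OF p'(1)[of x] DERIV_compose_FDERIV[OF has_real_derivative_exp_recip[of n "q x"] q'(1)]]
      by (rule has_derivative_eq_rhs) (auto simp: algebra_simps)
    show "C_k k (\<lambda>x. p' x v * exp_recip n (q x) + ((p x * q' x v) * exp_recip (n + 2) (q x)
          + (- real n * (p x * q' x v)) * exp_recip (Suc n) (q x)))" for v
      by (intro C_k_add Suc.IH p' q' Suc.prems real_polynomial_function.intros(4) real_polynomial_function.intros(2))
  qed
qed

lemma smooth_exp_recip_polynomial:
  fixes q :: "'b::euclidean_space \<Rightarrow> real"
  assumes "real_polynomial_function q"
  shows "smooth (\<lambda>x. c * exp_recip n (q x))"
  unfolding smooth_def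
  using C_k_polynomial_exp_recip[OF assms real_polynomial_function.intros(2)] by blast

section \<open>The standard mollifier\<close>

definition bump :: "real \<Rightarrow> 'b::euclidean_space \<Rightarrow> real" where
  "bump e z = exp_recip 0 (1 - (norm z / e)\<^sup>2)"

definition moll :: "real \<Rightarrow> 'b::euclidean_space \<Rightarrow> real" where
  "moll e z = bump e z / (\<integral>y. bump e (y::'b) \<partial>lborel)"

lemma real_polynomial_function_norm_square:
  "real_polynomial_function (\<lambda>z::'b::euclidean_space. (norm (a - z))\<^sup>2)"
proof -
  have "(norm (a - z))\<^sup>2 = (\<Sum>i\<in>Basis. (a \<bullet> i - z \<bullet> i) * (a \<bullet> i - z \<bullet> i))" for z
    unfolding power2_norm_eq_inner by (subst euclidean_inner) (simp add: inner_diff_left)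
  then show ?thesis
    by (simp only:) (intro real_polynomial_function_sum real_polynomial_function.intros(4)
        real_polynomial_function_diff real_polynomial_function.intros(2)
        real_polynomial_function.intros(1)[OF bounded_linear_inner_left] finite_Basis)
qed

lemma smooth_bump: "smooth (\<lambda>z::'b::euclidean_space. c * bump e z)"
proof -
  have "real_polynomial_function (\<lambda>z::'b. 1 - (1 / e\<^sup>2) * (norm (0 - z))\<^sup>2)"
    by (intro real_polynomial_function_diff real_polynomial_function.intros(2)
        real_polynomial_function.intros(4) real_polynomial_function_norm_square)
  from smooth_exp_recip_polynomial[OF this, of c 0] show ?thesis
    by (simp add: bump_def power_divide)
qed

lemma smooth_continuous: "smooth f \<Longrightarrow> continuous_on UNIV f"
  unfolding smooth_def using C_k_continuous by blast

lemma continuous_bump: "continuous_on UNIV (bump e :: 'b::euclidean_space \<Rightarrow> real)"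
  using smooth_continuous[OF smooth_bump[of 1 e]] by simp

lemma bump_nonneg: "0 \<le> bump e z"
  by (simp add: bump_def exp_recip_nonneg)

lemma bump_eq_0: "e > 0 \<Longrightarrow> e \<le> norm z \<Longrightarrow> bump e z = 0"
  by (auto simp: bump_def exp_recip_def not_less)

lemma bump_pos: "e > 0 \<Longrightarrow> norm z < e \<Longrightarrow> 0 < bump e z"
  by (auto simp: bump_def exp_recip_def power_less_one_iff field_simps power_strict_mono)

lemma integrable_continuous_bounded_support:
  fixes f :: "'b::euclidean_space \<Rightarrow> 'c::{banach, second_countable_topology}"
  assumes "continuous_on UNIV f" "\<And>x. R \<le> norm x \<Longrightarrow> f x = 0"
  shows "integrable lborel f"
proof -
  have "integrable lborel (\<lambda>x. indicator (cball 0 R) x *\<^sub>R f x)"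
    using borel_integrable_compact[of "cball 0 R" f] assms(1)
    by (simp add: set_integrable_def continuous_on_subset)
  moreover have "indicator (cball 0 R) x *\<^sub>R f x = f x" for x
    using assms(2)[of x] by (auto simp: indicator_def)
  ultimately show ?thesis by simp
qed

lemma integral_bump_pos:
  assumes "e > 0"
  shows "0 < (\<integral>y. bump e (y::'b::euclidean_space) \<partial>lborel)"
proof -
  have i: "integrable lborel (bump e :: 'b \<Rightarrow> real)"
    by (rule integrable_continuous_bounded_support[OF continuous_bump]) (rule bump_eq_0[OF assms])
  have "(\<integral>y. bump e (y::'b) \<partial>lborel) \<noteq> 0"
  proof
    assume "(\<integral>y. bump e (y::'b) \<partial>lborel) = 0"
    then have "AE y in lborel. bump e (y::'b) = 0"
      using integral_nonneg_eq_0_iff_AE[OF i] bump_nonneg by auto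
    then have "AE y in lborel. (y::'b) \<notin> ball 0 e"
      by eventually_elim (use bump_pos[OF assms] in force)
    then have "ball (0::'b) e \<in> null_sets lborel"
      by (subst AE_iff_null_sets) auto
    then have "ball (0::'b) e \<in> null_sets lebesgue"
      by (rule null_sets_completionI)
    then show False
      using assms open_not_negligible[of "ball (0::'b) e"] negligible_iff_null_sets by force
  qed
  moreover have "0 \<le> (\<integral>y. bump e (y::'b) \<partial>lborel)"
    by (simp add: bump_nonneg integral_nonneg_AE)
  ultimately show ?thesis by simp
qed

lemma moll_nonneg: "e > 0 \<Longrightarrow> 0 \<le> moll e z"
  using integral_bump_pos by (auto simp: moll_def bump_nonneg less_imp_le)

lemma moll_eq_0: "e > 0 \<Longrightarrow> e \<le> norm z \<Longrightarrow> moll e z = 0"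
  by (simp add: moll_def bump_eq_0)

lemma smooth_moll: "smooth (moll e :: 'b::euclidean_space \<Rightarrow> real)"
  using smooth_bump[of "1 / (\<integral>y. bump e (y::'b) \<partial>lborel)" e] by (simp add: moll_def[abs_def])

lemma integrable_moll: "e > 0 \<Longrightarrow> integrable lborel (moll e :: 'b::euclidean_space \<Rightarrow> real)"
  by (rule integrable_continuous_bounded_support[OF smooth_continuous[OF smooth_moll]]) (rule moll_eq_0)

lemma integral_moll: "e > 0 \<Longrightarrow> (\<integral>y. moll e (y::'b::euclidean_space) \<partial>lborel) = 1"
  using integral_bump_pos[of e, where ?'b='b] by (simp add: moll_def)

text \<open>Weak gradients are given time slice by time slice, so the space-time mollifier has to
  serve as a test function in \<open>y\<close> with the time frozen. Freezing the time only changes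
  the constant term of the polynomial inside \<open>exp_recip\<close>.\<close>

lemma smooth_moll_slice:
  "smooth (\<lambda>y::'a::euclidean_space. moll e ((x, s) - (y, t :: real)))"
proof -
  let ?I = "\<integral>y. bump e (y::'a \<times> real) \<partial>lborel"
  have "real_polynomial_function (\<lambda>y::'a. (1 - (1 / e\<^sup>2) * (s - t)\<^sup>2) - (1 / e\<^sup>2) * (norm (x - y))\<^sup>2)"
    by (intro real_polynomial_function_diff real_polynomial_function.intros(2)
        real_polynomial_function.intros(4) real_polynomial_function_norm_square)
  from smooth_exp_recip_polynomial[OF this, of "1 / ?I" 0] show ?thesis
    by (simp add: moll_def bump_def power_divide norm_Pair algebra_simps add_divide_distrib)
qed

text \<open>Carrying the gradient as an explicit function \<open>D\<close>, instead of using
  \<open>grad f\<close>, keeps gradients of products, compositions and parametric integrals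
  computable, also when \<open>f\<close> is only C^1.\<close>

definition has_grad :: "('b::euclidean_space \<Rightarrow> real) \<Rightarrow> ('b \<Rightarrow> 'b) \<Rightarrow> bool" where
  "has_grad f D \<longleftrightarrow> (\<forall>z. (f has_derivative (\<lambda>v. D z \<bullet> v)) (at z))"

lemma has_gradD: "has_grad f D \<Longrightarrow> (f has_derivative (\<lambda>v. D z \<bullet> v)) (at z)"
  by (simp add: has_grad_def)

lemma has_grad_continuous: "has_grad f D \<Longrightarrow> continuous_on UNIV f"
  by (auto simp: has_grad_def intro: continuous_at_imp_continuous_on has_derivative_continuous)

lemma has_grad_grad:
  assumes "C_k (Suc k) f"
  shows "has_grad f (grad f)" "C_k k (\<lambda>z. grad f z \<bullet> v)"
proof -
  have d: "(f has_derivative frechet_derivative f (at z)) (at z)" for z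
    using C_k_Suc_has_derivative[OF assms] .
  have "frechet_derivative f (at z) v = grad f z \<bullet> v" for z v
  proof -
    interpret bounded_linear "frechet_derivative f (at z)"
      using has_derivative_bounded_linear[OF d] .
    have "frechet_derivative f (at z) v = frechet_derivative f (at z) (\<Sum>i\<in>Basis. (v \<bullet> i) *\<^sub>R i)"
      by (simp add: euclidean_representation)
    also have "\<dots> = (\<Sum>i\<in>Basis. (v \<bullet> i) * frechet_derivative f (at z) i)"
      by (simp add: sum scale)
    also have "\<dots> = grad f z \<bullet> v"
      by (simp add: grad_def inner_sum_left inner_commute[of v] mult.commute)
    finally show ?thesis .
  qed
  then have e: "frechet_derivative f (at z) = (\<lambda>v. grad f z \<bullet> v)" for z by auto
  show "has_grad f (grad f)" using d by (simp add: has_grad_def e)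
  show "C_k k (\<lambda>z. grad f z \<bullet> v)" using assms by (simp add: e)
qed

lemma grad_eqI:
  assumes "(f has_derivative (\<lambda>v. d \<bullet> v)) (at z)"
  shows "grad f z = d"
  using frechet_derivative_at[OF assms, symmetric]
  by (simp add: grad_def euclidean_representation)

lemma continuous_on_gradI:
  fixes D :: "'c::euclidean_space \<Rightarrow> 'b::euclidean_space"
  assumes "\<And>v. continuous_on S (\<lambda>z. D z \<bullet> v)"
  shows "continuous_on S D"
  by (subst continuous_on_componentwise) (use assms in auto)

lemma smooth_has_grad:
  assumes "smooth f"
  shows "has_grad f (grad f)" "smooth (\<lambda>z. grad f z \<bullet> v)" "continuous_on UNIV (grad f)"
proof -
  show "has_grad f (grad f)" using assms has_grad_grad(1)[of 0 f] by (simp add: smooth_def del: C_k.simps)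
  show s: "smooth (\<lambda>z. grad f z \<bullet> v)" for v using assms has_grad_grad(2)[of _ f] by (simp add: smooth_def del: C_k.simps)
  show "continuous_on UNIV (grad f)"
    by (rule continuous_on_gradI) (rule smooth_continuous[OF s])
qed

lemma has_grad_zero_outside:
  assumes "has_grad f D" "open S" "\<And>x. x \<in> S \<Longrightarrow> f x = 0" "x \<in> S"
  shows "D x = 0"
proof -
  have "((\<lambda>x. 0) has_derivative (\<lambda>v. D x \<bullet> v)) (at x)"
    by (rule has_derivative_transform_within_open[OF has_gradD[OF assms(1)] assms(2,4)])
       (simp add: assms(3))
  from grad_eqI[OF this] grad_eqI[of "\<lambda>x. 0" 0 x] show ?thesis by simp
qed

text \<open>Outside the closed ball \<open>f\<close> vanishes on an open set; on the sphere
  \<open>norm x = R\<close> the gradient vanishes by continuity along the ray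
  \<open>(1 + t) *\<^sub>R x\<close>. The ray degenerates only for \<open>x = 0\<close>, where
  \<open>R \<le> 0\<close> forces \<open>f\<close> to vanish identically.\<close>

lemma has_grad_zero_outside_cball:
  fixes f :: "'b::euclidean_space \<Rightarrow> real"
  assumes g: "has_grad f D" and c: "continuous_on UNIV D" and z: "\<And>x. R \<le> norm x \<Longrightarrow> f x = 0" and "R \<le> norm x"
  shows "D x = 0"
proof (cases "x = 0 \<and> R \<le> 0")
  case True
  then have "f y = 0" for y using z[of y] by (meson norm_ge_zero order_trans)
  then show ?thesis using has_grad_zero_outside[OF g, of UNIV] by auto
next
  case False
  have *: "D y = 0" if "R < norm y" for y
  proof (rule has_grad_zero_outside[OF g, of "- cball 0 R"])
    show "y \<in> - cball 0 R" using that by simp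
  qed (use z in auto)
  have x: "x \<noteq> 0" using False assms(4) by auto
  have "((\<lambda>t. D ((1 + t) *\<^sub>R x)) \<longlongrightarrow> D ((1 + 0) *\<^sub>R x)) (at_right 0)"
  proof (rule isCont_tendsto_compose[of _ D])
    show "isCont D ((1 + 0) *\<^sub>R x)" using c by (simp add: continuous_on_eq_continuous_at)
    show "((\<lambda>t. (1 + t) *\<^sub>R x) \<longlongrightarrow> (1 + 0) *\<^sub>R x) (at_right 0)" by (intro tendsto_intros)
  qed
  moreover have "((\<lambda>t. D ((1 + t) *\<^sub>R x)) \<longlongrightarrow> 0) (at_right 0)"
  proof (rule tendsto_eventually, rule eventually_at_rightI[of 0 1])
    fix t :: real assume t: "t \<in> {0<..<1}"
    then have "norm x < norm ((1 + t) *\<^sub>R x)" using x by simp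
    then show "D ((1 + t) *\<^sub>R x) = 0" using assms(4) by (intro *) linarith
  qed simp
  ultimately have "D ((1 + 0) *\<^sub>R x) = 0" using tendsto_unique trivial_limit_at_right_real by blast
  then show ?thesis by simp
qed

lemma uniformly_continuous_bounded_support:
  fixes f :: "'b::euclidean_space \<Rightarrow> 'c::real_normed_vector"
  assumes c: "continuous_on UNIV f" and z: "\<And>x. R \<le> norm x \<Longrightarrow> f x = 0"
  shows "uniformly_continuous_on UNIV f" "bounded (range f)"
proof -
  have cR: "continuous_on (cball 0 r) f" for r by (rule continuous_on_subset[OF c]) simp
  have u: "uniformly_continuous_on (cball 0 (R + 1)) f"
    by (rule compact_uniformly_continuous[OF cR compact_cball])
  show "uniformly_continuous_on UNIV f"
    unfolding uniformly_continuous_on_def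
  proof (intro allI impI)
    fix e :: real assume "e > 0"
    with u[unfolded uniformly_continuous_on_def, rule_format, of e]
    obtain d where d: "d > 0" "\<And>x y. x \<in> cball 0 (R + 1) \<Longrightarrow> y \<in> cball 0 (R + 1) \<Longrightarrow> dist y x < d \<Longrightarrow> dist (f y) (f x) < e"
      by metis
    have "dist (f y) (f x) < e" if "dist y x < min d 1" for x y
    proof (cases "x \<in> cball 0 (R + 1) \<and> y \<in> cball 0 (R + 1)")
      case True then show ?thesis using d(2)[of x y] that by simp
    next
      case False
      have "\<bar>norm y - norm x\<bar> < 1" using that norm_triangle_ineq3[of y x] by (auto simp: dist_norm)
      then have "R \<le> norm x" "R \<le> norm y" using False by auto
      then show ?thesis using z \<open>e > 0\<close> by simp
    qed
    then show "\<exists>d>0. \<forall>x\<in>UNIV. \<forall>x'\<in>UNIV. dist x' x < d \<longrightarrow> dist (f x') (f x) < e"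
      using d(1) by (intro exI[of _ "min d 1"]) auto
  qed
  have "bounded (f ` cball 0 R)"
  proof (rule compact_imp_bounded, rule compact_continuous_image)
    show "continuous_on (cball 0 R) f" by (rule cR)
    show "compact (cball (0::'b) R)" by (rule compact_cball)
  qed
  moreover have "range f \<subseteq> insert 0 (f ` cball 0 R)"
  proof
    fix y assume "y \<in> range f"
    then obtain x where "y = f x" by auto
    then show "y \<in> insert 0 (f ` cball 0 R)" using z[of x] by (cases "R \<le> norm x") (simp_all add: image_eqI[of _ _ x])
  qed
  ultimately show "bounded (range f)" by (meson bounded_insert bounded_subset)
qed

lemma continuous_borel_measurable: "continuous_on UNIV f \<Longrightarrow> f \<in> borel_measurable borel"
  by (rule borel_measurable_continuous_onI)

lemma integrable_mult_bounded:
  fixes F :: "'w \<Rightarrow> 'c::{banach,second_countable_topology}"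
  assumes "integrable M k" "F \<in> borel_measurable M" "\<And>w. norm (F w) \<le> B"
  shows "integrable M (\<lambda>w. k w *\<^sub>R F w)"
proof (rule Bochner_Integration.integrable_bound[of M "\<lambda>w. B * k w"])
  show "AE w in M. norm (k w *\<^sub>R F w) \<le> norm (B * k w)"
  proof (rule AE_I2)
    fix w
    have "norm (F w) \<le> \<bar>B\<bar>" using assms(3)[of w] by linarith
    then show "norm (k w *\<^sub>R F w) \<le> norm (B * k w)"
      by (simp add: abs_mult mult.commute[of "\<bar>B\<bar>"] mult_left_mono)
  qed
qed (use assms in auto)

text \<open>Mean value inequality for \<open>F\<close> minus its linear part. The remainder depends
  only on the oscillation of \<open>D\<close> near \<open>x\<close>, so it is uniform in
  \<open>x\<close> once \<open>D\<close> is uniformly continuous.\<close>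

lemma grad_linearization:
  assumes g: "has_grad F D" and D: "\<And>y. norm (y - x) < d \<Longrightarrow> norm (D y - D x) \<le> e" and v: "norm v < d"
  shows "\<bar>F (x + v) - F x - D x \<bullet> v\<bar> \<le> e * norm v"
proof -
  have "norm ((F (x + v) - D x \<bullet> (x + v)) - (F x - D x \<bullet> x)) \<le> e * norm (x + v - x)"
  proof (rule differentiable_bound[where S = "ball x d" and f' = "\<lambda>y v. (D y - D x) \<bullet> v"])
    fix y assume y: "y \<in> ball x d"
    show "((\<lambda>y. F y - D x \<bullet> y) has_derivative (\<lambda>v. (D y - D x) \<bullet> v)) (at y within ball x d)"
      by (auto intro!: derivative_eq_intros has_derivative_at_withinI[OF has_gradD[OF g]] simp: inner_diff_left)
    show "onorm (\<lambda>v. (D y - D x) \<bullet> v) \<le> e"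
    proof (rule onorm_le)
      fix v
      have "norm (D y - D x) \<le> e" using D[of y] y by (simp add: dist_norm norm_minus_commute[of x])
      then show "norm ((D y - D x) \<bullet> v) \<le> e * norm v"
        using Cauchy_Schwarz_ineq2[of "D y - D x" v] by (simp add: order_trans[OF _ mult_right_mono])
    qed
  next
    show "x \<in> ball x d" using v le_less_trans[OF norm_ge_zero v] by simp
  qed (use v in \<open>auto simp: dist_norm\<close>)
  then show ?thesis by (simp add: inner_add_right algebra_simps)
qed

lemma has_grad_parametric_integral:
  fixes F :: "'b::euclidean_space \<Rightarrow> real"
  assumes g: "has_grad F D" and uc: "uniformly_continuous_on UNIV D"
    and bF: "bounded (range F)" and bD: "bounded (range D)"
    and k: "integrable M k" and X[measurable]: "X \<in> borel_measurable M"
  shows "has_grad (\<lambda>z. \<integral>w. k w * F (z + X w) \<partial>M) (\<lambda>z. \<integral>w. k w *\<^sub>R D (z + X w) \<partial>M)"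
  unfolding has_grad_def has_derivative_at_alt
proof (intro allI conjI impI)
  have [measurable]: "F \<in> borel_measurable borel" "D \<in> borel_measurable borel"
    using continuous_borel_measurable has_grad_continuous[OF g] uniformly_continuous_imp_continuous[OF uc] by auto
  obtain BF where "\<And>z. norm (F z) \<le> BF" using bF unfolding bounded_iff by auto
  then have iF: "integrable M (\<lambda>w. k w * F (z + X w))" for z
    using integrable_mult_bounded[OF k, of "\<lambda>w. F (z + X w)" BF] by simp
  obtain BD where "\<And>z. norm (D z) \<le> BD" using bD unfolding bounded_iff by auto
  then have iD: "integrable M (\<lambda>w. k w *\<^sub>R D (z + X w))" for z
    using integrable_mult_bounded[OF k, of "\<lambda>w. D (z + X w)" BD] by simp
  let ?C = "(\<integral>w. \<bar>k w\<bar> \<partial>M) + 1"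
  have "0 \<le> (\<integral>w. \<bar>k w\<bar> \<partial>M)" by (rule integral_nonneg_AE) auto
  then have C: "?C > 0" by linarith
  fix z and e :: real
  show "bounded_linear (\<lambda>v. (\<integral>w. k w *\<^sub>R D (z + X w) \<partial>M) \<bullet> v)" by (rule bounded_linear_inner_right)
  assume "e > 0"
  define e2 where "e2 = e / ?C"
  have e': "e2 > 0" using C \<open>e > 0\<close> by (simp add: e2_def)
  then obtain d where d: "d > 0" "\<And>x y. dist y x < d \<Longrightarrow> dist (D y) (D x) < e2"
    using uc[unfolded uniformly_continuous_on_def, rule_format, OF e'] by auto
  have "norm ((\<integral>w. k w * F (y + X w) \<partial>M) - (\<integral>w. k w * F (z + X w) \<partial>M)
       - (\<integral>w. k w *\<^sub>R D (z + X w) \<partial>M) \<bullet> (y - z)) \<le> e * norm (y - z)" if y: "norm (y - z) < d" for y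
  proof -
    let ?r = "\<lambda>w. F (y + X w) - F (z + X w) - D (z + X w) \<bullet> (y - z)"
    have r: "\<bar>?r w\<bar> \<le> e2 * norm (y - z)" for w
      using grad_linearization[OF g, of "z + X w" d "e2" "y - z"] d(2) y
      by (simp add: dist_norm less_imp_le algebra_simps)
    have i: "integrable M (\<lambda>w. k w * (D (z + X w) \<bullet> (y - z)))"
    proof -
      have "integrable M (\<lambda>w. (k w *\<^sub>R D (z + X w)) \<bullet> (y - z))"
        by (rule integrable_inner_left) (rule iD)
      then show ?thesis by simp
    qed
    have "(\<integral>w. k w * F (y + X w) \<partial>M) - (\<integral>w. k w * F (z + X w) \<partial>M)
       - (\<integral>w. k w *\<^sub>R D (z + X w) \<partial>M) \<bullet> (y - z) =
       (\<integral>w. k w * F (y + X w) - k w * F (z + X w) - k w * (D (z + X w) \<bullet> (y - z)) \<partial>M)"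
      using iF i iD[of z] by (simp add: integral_inner_left[symmetric])
    also have "\<dots> = (\<integral>w. k w * ?r w \<partial>M)" by (simp add: algebra_simps)
    finally have eq: "(\<integral>w. k w * F (y + X w) \<partial>M) - (\<integral>w. k w * F (z + X w) \<partial>M)
       - (\<integral>w. k w *\<^sub>R D (z + X w) \<partial>M) \<bullet> (y - z) = (\<integral>w. k w * ?r w \<partial>M)" .
    have "norm (\<integral>w. k w * ?r w \<partial>M) \<le> (\<integral>w. norm (k w * ?r w) \<partial>M)" by (rule integral_norm_bound)
    also have "\<dots> \<le> (\<integral>w. \<bar>k w\<bar> * (e2 * norm (y - z)) \<partial>M)"
    proof (rule integral_mono)
      show "integrable M (\<lambda>w. norm (k w * ?r w))"
        using iF i by (auto intro!: integrable_norm simp: right_diff_distrib)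
      show "norm (k w * ?r w) \<le> \<bar>k w\<bar> * (e2 * norm (y - z))" for w
        using r[of w] by (simp add: abs_mult mult_left_mono)
    qed (use k in simp)
    also have "\<dots> = (\<integral>w. \<bar>k w\<bar> \<partial>M) * (e2 * norm (y - z))" by simp
    also have "\<dots> \<le> ?C * (e2 * norm (y - z))"
      using e' by (intro mult_right_mono) auto
    also have "\<dots> = e * norm (y - z)" using C by (simp add: e2_def)
    finally show ?thesis unfolding eq .
  qed
  then show "\<exists>d>0. \<forall>y. norm (y - z) < d \<longrightarrow> norm ((\<integral>w. k w * F (y + X w) \<partial>M) - (\<integral>w. k w * F (z + X w) \<partial>M)
       - (\<integral>w. k w *\<^sub>R D (z + X w) \<partial>M) \<bullet> (y - z)) \<le> e * norm (y - z)"
    using d(1) by blast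
qed

text \<open>Each derivative falls on \<open>F\<close>, and \<open>grad F z \<bullet> v\<close> is
  again smooth and zero outside the same ball, so the induction varies \<open>F\<close> and keeps
  \<open>k\<close> and \<open>X\<close> fixed.\<close>

lemma smooth_parametric_integral:
  fixes F :: "'b::euclidean_space \<Rightarrow> real"
  assumes F: "smooth F" "\<And>x. R \<le> norm x \<Longrightarrow> F x = 0"
    and k: "integrable M k" and X[measurable]: "X \<in> borel_measurable M"
  shows "smooth (\<lambda>z. \<integral>w. k w * F (z + X w) \<partial>M)"
  unfolding smooth_def
proof
  fix n
  have zero: "grad F x = 0" if "smooth F" "\<And>x. R \<le> norm x \<Longrightarrow> F x = 0" "R \<le> norm x" for F and x :: 'b
    using has_grad_zero_outside_cball[OF smooth_has_grad(1)[OF that(1)] smooth_has_grad(3)[OF that(1)] that(2,3)] .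
  have hg: "has_grad (\<lambda>z. \<integral>w. k w * F (z + X w) \<partial>M) (\<lambda>z. \<integral>w. k w *\<^sub>R grad F (z + X w) \<partial>M)"
    if "smooth F" "\<And>x. R \<le> norm x \<Longrightarrow> F x = 0" for F :: "'b \<Rightarrow> real"
    using uniformly_continuous_bounded_support[OF smooth_continuous[OF that(1)] that(2)]
      uniformly_continuous_bounded_support[OF smooth_has_grad(3)[OF that(1)] zero[OF that]]
    by (intro has_grad_parametric_integral smooth_has_grad that k X) auto
  show "C_k n (\<lambda>z. \<integral>w. k w * F (z + X w) \<partial>M)"
    using F
  proof (induction n arbitrary: F)
    case 0
    then show ?case using has_grad_continuous[OF hg] by simp
  next
    case (Suc n)
    show ?case
    proof (rule C_k_SucI)
      show "((\<lambda>z. \<integral>w. k w * F (z + X w) \<partial>M) has_derivative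
         (\<lambda>v. (\<integral>w. k w *\<^sub>R grad F (z + X w) \<partial>M) \<bullet> v)) (at z)" for z
        using has_gradD[OF hg[OF Suc.prems]] .
      fix v
      note u = uniformly_continuous_bounded_support[OF smooth_has_grad(3)[OF Suc.prems(1)] zero[OF Suc.prems]]
      have [measurable]: "grad F \<in> borel_measurable borel"
        using continuous_borel_measurable smooth_has_grad(3)[OF Suc.prems(1)] .
      obtain B where "\<And>z. norm (grad F z) \<le> B" using u(2) unfolding bounded_iff by auto
      then have "integrable M (\<lambda>w. k w *\<^sub>R grad F (z + X w))" for z
        using integrable_mult_bounded[OF k, of "\<lambda>w. grad F (z + X w)" B] by simp
      then have "(\<lambda>z. (\<integral>w. k w *\<^sub>R grad F (z + X w) \<partial>M) \<bullet> v) = (\<lambda>z. \<integral>w. k w * (grad F (z + X w) \<bullet> v) \<partial>M)"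
        by (simp add: integral_inner_left[symmetric])
      then show "C_k n (\<lambda>z. (\<integral>w. k w *\<^sub>R grad F (z + X w) \<partial>M) \<bullet> v)"
        using Suc.IH[of "\<lambda>z. grad F z \<bullet> v"] smooth_has_grad(2)[OF Suc.prems(1)] zero[OF Suc.prems] by simp
    qed
  qed
qed

section \<open>Translations, reflections and integration by parts\<close>

lemma lborel_translation:
  fixes f :: "'b::euclidean_space \<Rightarrow> 'c::{banach,second_countable_topology}"
  assumes [measurable]: "f \<in> borel_measurable borel"
  shows "(\<integral>z. f (z + a) \<partial>lborel) = (\<integral>z. f z \<partial>lborel)"
    and "integrable lborel (\<lambda>z. f (z + a)) \<longleftrightarrow> integrable lborel f"
proof -
  have *: "distr lborel borel (\<lambda>z. z + a) = lborel" using lborel_distr_plus[of a] by (simp add: add.commute[of _ a] cong: distr_cong)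
  show "(\<integral>z. f (z + a) \<partial>lborel) = (\<integral>z. f z \<partial>lborel)"
    using integral_distr[of "\<lambda>z. z + a" lborel borel f] by (simp add: *)
  show "integrable lborel (\<lambda>z. f (z + a)) \<longleftrightarrow> integrable lborel f"
    using integrable_distr_eq[of "\<lambda>z. z + a" lborel borel f] by (simp add: *)
qed

lemma lborel_reflection:
  fixes f :: "'b::euclidean_space \<Rightarrow> 'c::{banach,second_countable_topology}"
  assumes [measurable]: "f \<in> borel_measurable borel"
  shows "(\<integral>z. f (a - z) \<partial>lborel) = (\<integral>z. f z \<partial>lborel)"
    and "integrable lborel (\<lambda>z. f (a - z)) \<longleftrightarrow> integrable lborel f"
proof -
  have *: "distr lborel borel (\<lambda>z. a - z) = (lborel :: 'b measure)"
    using lborel_affine[of "-1" a] by (simp add: density_1)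
  show "(\<integral>z. f (a - z) \<partial>lborel) = (\<integral>z. f z \<partial>lborel)"
    using integral_distr[of "\<lambda>z. a - z" lborel borel f] by (simp add: *)
  show "integrable lborel (\<lambda>z. f (a - z)) \<longleftrightarrow> integrable lborel f"
    using integrable_distr_eq[of "\<lambda>z. a - z" lborel borel f] by (simp add: *)
qed

text \<open>Translation invariance of the integral of \<open>F\<close> replaces integration by parts, so that no decay
  of \<open>F\<close> beyond integrability is needed.\<close>

lemma integral_directional_derivative_eq_0:
  fixes F :: "'b::euclidean_space \<Rightarrow> real"
  assumes g: "has_grad F D" and c: "continuous_on UNIV D"
    and F: "integrable lborel F" and D: "integrable lborel (\<lambda>z. D z \<bullet> v)"
  shows "(\<integral>z. D z \<bullet> v \<partial>lborel) = 0"
proof -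
  have [measurable]: "F \<in> borel_measurable borel" "D \<in> borel_measurable borel"
    using continuous_borel_measurable has_grad_continuous[OF g] c by auto
  let ?f = "\<lambda>s z. indicator {0..1::real} s *\<^sub>R (D (z + s *\<^sub>R v) \<bullet> v)"
  have ftc: "(\<integral>s. ?f s z \<partial>lborel) = F (z + v) - F z" for z
  proof -
    have "has_bochner_integral lborel (\<lambda>s. indicator {0..1} s *\<^sub>R (D (z + s *\<^sub>R v) \<bullet> v)) (F (z + 1 *\<^sub>R v) - F (z + 0 *\<^sub>R v))"
    proof (rule has_bochner_integral_FTC_Icc)
      fix s :: real
      have "((\<lambda>s. F (z + s *\<^sub>R v)) has_derivative (\<lambda>t. D (z + s *\<^sub>R v) \<bullet> (t *\<^sub>R v))) (at s)"
        by (rule has_derivative_compose[OF _ has_gradD[OF g]]) (auto intro!: derivative_eq_intros)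
      then show "((\<lambda>s. F (z + s *\<^sub>R v)) has_vector_derivative D (z + s *\<^sub>R v) \<bullet> v) (at s within {0..1})"
        by (simp add: has_vector_derivative_def has_derivative_at_withinI)
      show "continuous_on {0..1} (\<lambda>s. D (z + s *\<^sub>R v) \<bullet> v)"
        by (intro continuous_intros continuous_on_compose2[OF c]) auto
    qed auto
    then show ?thesis by (simp add: has_bochner_integral_iff)
  qed
  have t: "(\<integral>z. norm (D (z + s *\<^sub>R v) \<bullet> v) \<partial>lborel) = (\<integral>z. norm (D z \<bullet> v) \<partial>lborel)" for s
    using lborel_translation(1)[of "\<lambda>z. norm (D z \<bullet> v)" "s *\<^sub>R v"] by simp
  have i: "integrable (lborel \<Otimes>\<^sub>M lborel) (\<lambda>(s, z). ?f s z)"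
  proof (rule lborel_pair.Fubini_integrable)
    show "AE s in lborel. integrable lborel (\<lambda>z. (case (s, z) of (s, z) \<Rightarrow> ?f s z))"
      using D lborel_translation(2)[of "\<lambda>z. D z \<bullet> v"] by auto
    show "integrable lborel (\<lambda>s. \<integral>z. norm (case (s, z) of (s, z) \<Rightarrow> ?f s z) \<partial>lborel)"
      by (simp add: abs_mult t[simplified])
  qed measurable
  have "(\<integral>z. F (z + v) - F z \<partial>lborel) = (\<integral>z. (\<integral>s. ?f s z \<partial>lborel) \<partial>lborel)" by (simp only: ftc)
  also have "\<dots> = (\<integral>s. (\<integral>z. ?f s z \<partial>lborel) \<partial>lborel)"
    using lborel_pair.Fubini_integral[OF i] .
  also have "\<dots> = (\<integral>s. indicator {0..1::real} s *\<^sub>R (\<integral>z. D z \<bullet> v \<partial>lborel) \<partial>lborel)"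
    using lborel_translation(1)[of "\<lambda>z. D z \<bullet> v"] by simp
  also have "\<dots> = (\<integral>z. D z \<bullet> v \<partial>lborel)" by simp
  also have "(\<integral>z. F (z + v) - F z \<partial>lborel) = 0"
    using F lborel_translation[of F v] by simp
  finally show ?thesis by simp
qed

section \<open>Translations and mollification\<close>

text \<open>The polynomial \<open>t\<^sup>2 * ?A - 2 * t * ?I + ?B\<close> is nonnegative for all
  \<open>t\<close>; \<open>t = ?I / ?A\<close> gives the inequality. If \<open>?A = 0\<close> it is
  affine in \<open>t\<close>, and \<open>?I \<noteq> 0\<close> would make it negative at
  \<open>t = (?B + 1) / ?I\<close>.\<close>

lemma integral_inner_Cauchy_Schwarz:
  fixes f g :: "'w \<Rightarrow> 'c::euclidean_space"
  assumes [measurable]: "f \<in> borel_measurable M" "g \<in> borel_measurable M"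
    and f: "integrable M (\<lambda>w. (norm (f w))\<^sup>2)" and g: "integrable M (\<lambda>w. (norm (g w))\<^sup>2)"
  shows "integrable M (\<lambda>w. f w \<bullet> g w)"
    and "\<bar>\<integral>w. f w \<bullet> g w \<partial>M\<bar> \<le> sqrt (\<integral>w. (norm (f w))\<^sup>2 \<partial>M) * sqrt (\<integral>w. (norm (g w))\<^sup>2 \<partial>M)"
proof -
  have b: "\<bar>f w \<bullet> g w\<bar> \<le> (norm (f w))\<^sup>2 + (norm (g w))\<^sup>2" for w
  proof -
    have "\<bar>f w \<bullet> g w\<bar> \<le> norm (f w) * norm (g w)" by (rule Cauchy_Schwarz_ineq2)
    also have "\<dots> \<le> (norm (f w))\<^sup>2 + (norm (g w))\<^sup>2"
    proof -
      have "0 \<le> norm (f w) * norm (g w)" by simp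
      then show ?thesis using sum_squares_bound[of "norm (f w)" "norm (g w)"] by linarith
    qed
    finally show ?thesis .
  qed
  show i: "integrable M (\<lambda>w. f w \<bullet> g w)"
    by (rule Bochner_Integration.integrable_bound[OF Bochner_Integration.integrable_add[OF f g]])
      (use b in \<open>auto simp: \<close>)
  let ?A = "\<integral>w. (norm (f w))\<^sup>2 \<partial>M" and ?B = "\<integral>w. (norm (g w))\<^sup>2 \<partial>M" and ?I = "\<integral>w. f w \<bullet> g w \<partial>M"
  have q: "0 \<le> t\<^sup>2 * ?A - 2 * t * ?I + ?B" for t
  proof -
    have "0 \<le> (\<integral>w. (norm (t *\<^sub>R f w - g w))\<^sup>2 \<partial>M)" by simp
    also have "(\<lambda>w. (norm (t *\<^sub>R f w - g w))\<^sup>2) = (\<lambda>w. t\<^sup>2 * (norm (f w))\<^sup>2 - 2 * t * (f w \<bullet> g w) + (norm (g w))\<^sup>2)"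
      unfolding power2_norm_eq_inner
      by (auto simp: inner_diff_left inner_diff_right inner_commute power2_eq_square algebra_simps)
    also have "(\<integral>w. t\<^sup>2 * (norm (f w))\<^sup>2 - 2 * t * (f w \<bullet> g w) + (norm (g w))\<^sup>2 \<partial>M) = t\<^sup>2 * ?A - 2 * t * ?I + ?B"
      using f g i by simp
    finally show ?thesis .
  qed
  have A: "0 \<le> ?A" by simp
  have "?I\<^sup>2 \<le> ?A * ?B"
  proof (cases "?A = 0")
    case True
    have "?I = 0"
    proof (rule ccontr)
      assume "?I \<noteq> 0"
      then have "0 \<le> - (2 * (?B + 1)) + ?B" using q[of "(?B + 1) / ?I"] True by simp
      moreover have "0 \<le> ?B" by simp
      moreover have "b < 0" if "0 \<le> - (2 * (b + 1)) + b" for b :: real using that by (simp add: algebra_simps)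
      ultimately show False by fastforce
    qed
    then show ?thesis using True by simp
  next
    case False
    have "0 \<le> ?A * ((?I / ?A)\<^sup>2 * ?A - 2 * (?I / ?A) * ?I + ?B)"
      using q[of "?I / ?A"] A by (rule mult_nonneg_nonneg[rotated])
    also have "\<dots> = ?A * ?B - ?I\<^sup>2"
      using False by (simp add: field_simps power2_eq_square)
    finally show ?thesis by simp
  qed
  then show "\<bar>?I\<bar> \<le> sqrt ?A * sqrt ?B"
    by (metis real_sqrt_abs real_sqrt_le_mono real_sqrt_mult)
qed

text \<open>Squeeze \<open>A\<close> between a compact \<open>K\<close> and an open \<open>U\<close>
  with \<open>U - K\<close> of measure at most \<open>e / 2\<close>. A sufficiently short shift
  keeps \<open>K\<close> inside \<open>U\<close>, so \<open>z\<close> and \<open>z + a\<close> can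
  disagree about \<open>A\<close> only if one of them lies in \<open>U - K\<close>.\<close>

lemma indicator_translation_small:
  fixes A :: "'b::euclidean_space set"
  assumes A[measurable]: "A \<in> sets borel" and fin: "emeasure lborel A < \<infinity>" and e: "e > 0"
  shows "\<exists>d>0. \<forall>a. norm a < d \<longrightarrow> (\<integral>z. \<bar>indicator A (z + a) - indicator A z\<bar> \<partial>lborel) \<le> (e::real)"
proof -
  have lm: "A \<in> lmeasurable" using A fin by (auto simp: fmeasurable_def)
  obtain T where T: "closed T" "T \<subseteq> A" "A - T \<in> lmeasurable" "emeasure lebesgue (A - T) < ennreal (e / 8)"
    using sets_lebesgue_inner_closed[of A "e / 8"] lm e by (auto dest: fmeasurableD)
  have mT: "measure lebesgue (A - T) < e / 8"
    using T(3,4) e by (simp add: emeasure_eq_measure2 ennreal_less_iff)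
  obtain U where U: "open U" "A \<subseteq> U" "U - A \<in> lmeasurable" "emeasure lebesgue (U - A) < ennreal (e / 4)"
    using sets_lebesgue_outer_open[of A "e / 4"] lm e by (auto dest: fmeasurableD)
  have mU: "measure lebesgue (U - A) < e / 4"
    using U(3,4) e by (simp add: emeasure_eq_measure2 ennreal_less_iff)
  have "(\<lambda>n. \<integral>z. indicator (A - cball 0 (real n)) z \<partial>lborel) \<longlonglongrightarrow> (\<integral>z. (0::real) \<partial>(lborel :: 'b measure))"
  proof (rule integral_dominated_convergence[where w = "indicator A"])
    show "integrable lborel (indicat_real A)" using fin by simp
    show "AE z in lborel. (\<lambda>n. indicat_real (A - cball 0 (real n)) z) \<longlonglongrightarrow> 0"
    proof (rule AE_I2, rule tendsto_eventually)
      fix z :: 'b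
      show "\<forall>\<^sub>F n in sequentially. indicat_real (A - cball 0 (real n)) z = 0"
        using eventually_ge_at_top[of "nat \<lceil>norm z\<rceil>"] by eventually_elim (auto simp: indicator_def)
    qed
  qed (auto simp: indicator_def)
  then have "\<forall>\<^sub>F n in sequentially. (\<integral>z. indicator (A - cball 0 (real n)) z \<partial>lborel) < e / 8"
    using e by (intro order_tendstoD) auto
  then obtain n :: nat where n: "measure lborel (A - cball 0 (real n)) < e / 8"
    by (auto simp: eventually_sequentially)
  \<comment> \<open>The closed inner approximation \<open>T\<close> may be unbounded, hence the
    intersection with a large ball; each of the two cuts costs \<open>e / 8\<close>.\<close>
  define K where "K = T \<inter> cball 0 (real n)"
  have K1: "compact K" "K \<subseteq> A" using T by (auto simp: K_def closed_Int_compact)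
  have lc: "A - cball 0 (real n) \<in> lmeasurable" by (rule fmeasurable_Diff[OF lm]) simp
  have AK: "A - K = (A - T) \<union> (A - cball 0 (real n))" by (auto simp: K_def)
  have "measure lebesgue (A - K) \<le> measure lebesgue (A - T) + measure lebesgue (A - cball 0 (real n))"
    unfolding AK using T lc by (intro measure_Un_le) (auto dest: fmeasurableD)
  with n mT have "measure lebesgue (A - K) < e / 4" by simp
  moreover have "A - K \<in> lmeasurable" unfolding AK using T lc by (intro fmeasurable.Un) auto
  ultimately have K: "compact K" "K \<subseteq> A" "A - K \<in> lmeasurable" "measure lebesgue (A - K) < e / 4"
    using K1 by auto
  have "K \<subseteq> U" using K U by auto
  then obtain d where d: "d > 0" "(\<Union>x\<in>K. ball x d) \<subseteq> U"
    using compact_subset_open_imp_ball_epsilon_subset[OF K(1) U(1)] by blast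
  let ?S = "U - K"
  have [measurable]: "?S \<in> sets borel" using K(1) U(1) by (auto intro!: sets.Diff simp: borel_compact)
  have S_eq: "?S = (A - K) \<union> (U - A)" using K U by auto
  have lS: "?S \<in> lmeasurable" unfolding S_eq using K U by (intro fmeasurable.Un) auto
  have "measure lebesgue ?S \<le> e / 4 + e / 4"
    unfolding S_eq using measure_Un_le[of "A - K" lebesgue "U - A"] K U(3) mU by (auto dest: fmeasurableD)
  then have mS: "measure lborel ?S \<le> e / 2" by simp
  have iS: "integrable lborel (indicator ?S :: 'b \<Rightarrow> real)"
    using lS by (auto simp: fmeasurable_def)
  have "(\<integral>z. \<bar>indicator A (z + a) - indicator A z\<bar> \<partial>lborel) \<le> e" if a: "norm a < d" for a
  proof -
    have "(\<integral>z. \<bar>indicator A (z + a) - indicator A z\<bar> \<partial>lborel) \<le> (\<integral>z. indicator ?S (z + a) + indicat_real ?S z \<partial>lborel)"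
    proof (rule integral_mono')
      show "integrable lborel (\<lambda>z. indicator ?S (z + a) + indicat_real ?S z)"
        using iS lborel_translation(2)[of "indicat_real ?S" a] by auto
      fix z
      have "z + a \<in> U" if "z \<in> K" using that d(2) a by (force simp: dist_norm)
      moreover have "z \<in> U" if "z + a \<in> K"
        using that d(2) a by (force simp: dist_norm)
      ultimately show "\<bar>indicator A (z + a) - indicator A z\<bar> \<le> indicator ?S (z + a) + indicat_real ?S z"
        using K(2) U(2) by (auto simp: indicator_def)
    qed auto
    also have "\<dots> = 2 * measure lborel ?S"
      using iS lborel_translation[of "indicat_real ?S" a] by simp
    finally show ?thesis using mS by simp
  qed
  then show ?thesis using d(1) by blast
qed

lemma L1_translation_continuous:
  fixes f :: "'b::euclidean_space \<Rightarrow> 'c::{banach,second_countable_topology}"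
  assumes "integrable lborel f" "e > 0"
  shows "\<exists>d>0. \<forall>a. norm a < d \<longrightarrow> (\<integral>z. norm (f (z + a) - f z) \<partial>lborel) \<le> e"
  using assms
proof (induction arbitrary: e rule: integrable_induct)
  case (base A c)
  show ?case
  proof (cases "c = 0")
    case False
    then obtain d where d: "d > 0" "\<And>a. norm a < d \<Longrightarrow> (\<integral>z. \<bar>indicator A (z + a) - indicator A z\<bar> \<partial>lborel) \<le> e / norm c"
      using indicator_translation_small[of A "e / norm c"] base by auto
    have "(\<integral>z. norm (indicator A (z + a) *\<^sub>R c - indicator A z *\<^sub>R c) \<partial>lborel) \<le> e" if "norm a < d" for a
    proof -
      have "norm (indicat_real A (z + a) *\<^sub>R c - indicator A z *\<^sub>R c) = \<bar>indicator A (z + a) - indicator A z\<bar> * norm c" for z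
        by (simp add: scaleR_left_diff_distrib[symmetric])
      then show ?thesis using d(2)[OF that] False by (simp add: pos_le_divide_eq)
    qed
    then show ?thesis using d(1) by blast
  qed (use base in \<open>auto intro: exI[of _ 1]\<close>)
next
  case (add f g)
  have [measurable]: "f \<in> borel_measurable borel" "g \<in> borel_measurable borel"
    using add.hyps by auto
  have "e / 2 > 0" using add.prems by simp
  obtain d1 where d1: "d1 > 0" "\<And>a. norm a < d1 \<Longrightarrow> (\<integral>z. norm (f (z + a) - f z) \<partial>lborel) \<le> e / 2"
    using add.IH(1)[OF \<open>e / 2 > 0\<close>] by blast
  obtain d2 where d2: "d2 > 0" "\<And>a. norm a < d2 \<Longrightarrow> (\<integral>z. norm (g (z + a) - g z) \<partial>lborel) \<le> e / 2"
    using add.IH(2)[OF \<open>e / 2 > 0\<close>] by blast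
  have "(\<integral>z. norm ((f (z + a) + g (z + a)) - (f z + g z)) \<partial>lborel) \<le> e" if "norm a < min d1 d2" for a
  proof -
    have i: "integrable lborel (\<lambda>z. norm (f (z + a) - f z))" "integrable lborel (\<lambda>z. norm (g (z + a) - g z))"
      using add.hyps by (auto simp: lborel_translation(2))
    have "(\<integral>z. norm ((f (z + a) + g (z + a)) - (f z + g z)) \<partial>lborel)
      \<le> (\<integral>z. norm (f (z + a) - f z) + norm (g (z + a) - g z) \<partial>lborel)"
      using i by (intro integral_mono') (auto simp: add_diff_add intro: norm_triangle_ineq)
    also have "\<dots> \<le> e / 2 + e / 2" using i d1(2)[of a] d2(2)[of a] that by simp
    finally show ?thesis by simp
  qed
  then show ?case using d1(1) d2(1) by (intro exI[of _ "min d1 d2"]) auto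
next
  case (lim f s)
  have [measurable]: "f \<in> borel_measurable borel" "\<And>i. s i \<in> borel_measurable borel"
    using lim.hyps by auto
  have "(\<lambda>i. \<integral>z. norm (s i z - f z) \<partial>lborel) \<longlonglongrightarrow> (\<integral>z. norm (f z - f z) \<partial>lborel)"
  proof (rule integral_dominated_convergence[where w = "\<lambda>z. 3 * norm (f z)"])
    show "AE z in lborel. (\<lambda>i. norm (s i z - f z)) \<longlonglongrightarrow> norm (f z - f z)"
    proof (rule AE_I2)
      fix z :: 'b assume "z \<in> space lborel"
      then have "(\<lambda>i. s i z) \<longlonglongrightarrow> f z" by (rule lim.hyps)
      then show "(\<lambda>i. norm (s i z - f z)) \<longlonglongrightarrow> norm (f z - f z)" by (intro tendsto_intros)
    qed
    have "norm (s i z - f z) \<le> 3 * norm (f z)" for i z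
      using norm_triangle_ineq4[of "s i z" "f z"] lim.hyps(3)[of z i] by simp
    then show "AE z in lborel. norm (norm (s i z - f z)) \<le> 3 * norm (f z)" for i by simp
  qed (use lim.hyps in auto)
  then have "eventually (\<lambda>i. (\<integral>z. norm (s i z - f z) \<partial>lborel) < e / 3) sequentially"
    using lim.prems by (intro order_tendstoD) auto
  then obtain i where i: "(\<integral>z. norm (s i z - f z) \<partial>lborel) < e / 3"
    by (auto simp: eventually_sequentially)
  obtain d where d: "d > 0" "\<And>a. norm a < d \<Longrightarrow> (\<integral>z. norm (s i (z + a) - s i z) \<partial>lborel) \<le> e / 3"
    using lim.IH[of "e / 3" i] lim.prems by auto
  have "(\<integral>z. norm (f (z + a) - f z) \<partial>lborel) \<le> e" if "norm a < d" for a
  proof -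
    have j: "integrable lborel (\<lambda>z. norm (s i (z + a) - s i z))" "integrable lborel (\<lambda>z. norm (s i z - f z))"
      "integrable lborel (\<lambda>z. norm (s i (z + a) - f (z + a)))"
      using lim.hyps by (auto simp: lborel_translation(2))
    have "(\<integral>z. norm (f (z + a) - f z) \<partial>lborel) \<le>
       (\<integral>z. norm (s i (z + a) - s i z) + norm (s i z - f z) + norm (s i (z + a) - f (z + a)) \<partial>lborel)"
    proof (rule integral_mono')
      fix z
      have "f (z + a) - f z = (s i (z + a) - s i z) + (s i z - f z) - (s i (z + a) - f (z + a))" by simp
      then show "norm (f (z + a) - f z) \<le> norm (s i (z + a) - s i z) + norm (s i z - f z) + norm (s i (z + a) - f (z + a))"
        by (smt (verit) norm_triangle_ineq norm_triangle_ineq4)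
    qed (use j in auto)
    also have "\<dots> \<le> e / 3 + e / 3 + e / 3"
      using j i d(2)[OF that] lborel_translation(1)[of "\<lambda>z. norm (s i z - f z)" a] by simp
    finally show ?thesis by simp
  qed
  then show ?case using d(1) by blast
qed

lemma power2_norm_diff: "(norm (a - b))\<^sup>2 = (norm a)\<^sup>2 - 2 * (a \<bullet> b) + (norm b)\<^sup>2"
  for a b :: "'c::real_inner"
  unfolding power2_norm_eq_inner by (simp add: inner_diff_left inner_diff_right inner_commute)

text \<open>Strong monotonicity of \<open>v \<mapsto> norm v *\<^sub>R v\<close>: pairing the
  difference with \<open>a - b\<close> gives at least \<open>(norm a + norm b) / 2\<close> times the
  square of \<open>norm (a - b)\<close>, and \<open>norm (a - b) \<le> norm a + norm b\<close>. This
  reduces continuity of translations in L^2 to L^1, applied to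
  \<open>norm f *\<^sub>R f\<close>.\<close>

lemma power2_norm_diff_le:
  fixes a b :: "'c::real_inner"
  shows "(norm (a - b))\<^sup>2 \<le> 2 * norm (norm a *\<^sub>R a - norm b *\<^sub>R b)"
proof (cases "a = b")
  case False
  let ?p = "norm a" and ?q = "norm b"
  have "(?p *\<^sub>R a - ?q *\<^sub>R b) \<bullet> (a - b) = ?p * (?p\<^sup>2 - a \<bullet> b) - ?q * (a \<bullet> b - ?q\<^sup>2)"
    by (simp add: inner_diff_left inner_diff_right inner_commute[of b a] dot_square_norm algebra_simps)
  moreover have "(norm (a - b))\<^sup>2 = ?p\<^sup>2 - 2 * (a \<bullet> b) + ?q\<^sup>2"
    by (rule power2_norm_diff)
  ultimately have "(?p *\<^sub>R a - ?q *\<^sub>R b) \<bullet> (a - b) - (?p + ?q) * (norm (a - b))\<^sup>2 / 2 = (?p + ?q) * (?p - ?q)\<^sup>2 / 2"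
    by (simp only:) (simp add: power2_eq_square field_simps)
  then have "(?p + ?q) * (norm (a - b))\<^sup>2 / 2 \<le> (?p *\<^sub>R a - ?q *\<^sub>R b) \<bullet> (a - b)"
    by (smt (verit) divide_nonneg_nonneg mult_nonneg_nonneg norm_ge_zero zero_le_power2)
  also have "\<dots> \<le> norm (?p *\<^sub>R a - ?q *\<^sub>R b) * norm (a - b)" by (rule norm_cauchy_schwarz)
  finally have *: "((?p + ?q) * norm (a - b) / 2) * norm (a - b) \<le> norm (?p *\<^sub>R a - ?q *\<^sub>R b) * norm (a - b)"
    by (simp add: power2_eq_square mult.assoc)
  have "norm (a - b) > 0" using False by simp
  with * have "(?p + ?q) * norm (a - b) / 2 \<le> norm (?p *\<^sub>R a - ?q *\<^sub>R b)"
    by (rule mult_right_le_imp_le)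
  moreover have "norm (a - b) * norm (a - b) \<le> (?p + ?q) * norm (a - b)"
    using norm_triangle_ineq4[of a b] by (intro mult_right_mono) auto
  ultimately show ?thesis by (simp add: power2_eq_square)
qed simp

lemma L2_translation_continuous:
  fixes f :: "'b::euclidean_space \<Rightarrow> 'c::euclidean_space"
  assumes [measurable]: "f \<in> borel_measurable borel" and f: "integrable lborel (\<lambda>z. (norm (f z))\<^sup>2)" and e: "e > 0"
  shows "\<exists>d>0. \<forall>a. norm a < d \<longrightarrow> integrable lborel (\<lambda>z. (norm (f (z + a) - f z))\<^sup>2) \<and>
     (\<integral>z. (norm (f (z + a) - f z))\<^sup>2 \<partial>lborel) \<le> e"
proof -
  let ?g = "\<lambda>z. norm (f z) *\<^sub>R f z"
  have "integrable lborel (\<lambda>z. norm (?g z))" using f by (simp add: power2_eq_square)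
  then have g: "integrable lborel ?g" by (rule integrable_norm_cancel) simp
  then obtain d where d: "d > 0" "\<And>a. norm a < d \<Longrightarrow> (\<integral>z. norm (?g (z + a) - ?g z) \<partial>lborel) \<le> e / 2"
    using L1_translation_continuous[of ?g "e / 2"] e by auto
  have "integrable lborel (\<lambda>z. (norm (f (z + a) - f z))\<^sup>2) \<and> (\<integral>z. (norm (f (z + a) - f z))\<^sup>2 \<partial>lborel) \<le> e" if "norm a < d" for a
  proof -
    have i: "integrable lborel (\<lambda>z. 2 * norm (?g (z + a) - ?g z))"
      using g lborel_translation(2)[of ?g a] by auto
    have j: "integrable lborel (\<lambda>z. (norm (f (z + a) - f z))\<^sup>2)"
      by (rule Bochner_Integration.integrable_bound[OF i]) (auto intro!: power2_norm_diff_le)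
    have "(\<integral>z. (norm (f (z + a) - f z))\<^sup>2 \<partial>lborel) \<le> (\<integral>z. 2 * norm (?g (z + a) - ?g z) \<partial>lborel)"
      by (rule integral_mono[OF j i]) (rule power2_norm_diff_le)
    then show ?thesis using d(2)[OF that] j by simp
  qed
  then show ?thesis using d(1) by blast
qed

section \<open>Convolution with the mollifier\<close>

definition conv :: "real \<Rightarrow> ('b::euclidean_space \<Rightarrow> 'c::euclidean_space) \<Rightarrow> 'b \<Rightarrow> 'c" where
  "conv e f z = (\<integral>y. moll e (z - y) *\<^sub>R f y \<partial>lborel)"

lemma moll_measurable[measurable]: "moll e \<in> borel_measurable borel"
  by (rule continuous_borel_measurable[OF smooth_continuous[OF smooth_moll]])

lemma moll_bounded:
  assumes "e > 0" obtains B where "\<And>z::'b::euclidean_space. \<bar>moll e z\<bar> \<le> B"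
  using uniformly_continuous_bounded_support(2)[OF smooth_continuous[OF smooth_moll] moll_eq_0[OF assms]]
  unfolding bounded_iff by auto

lemma conv_alt:
  assumes [measurable]: "f \<in> borel_measurable borel"
  shows "conv e f z = (\<integral>y. moll e y *\<^sub>R f (z - y) \<partial>lborel)"
  using lborel_reflection(1)[of "\<lambda>y. moll e (z - y) *\<^sub>R f y" z] by (simp add: conv_def)

lemma conv_measurable[measurable]:
  assumes [measurable]: "f \<in> borel_measurable borel"
  shows "conv e f \<in> borel_measurable borel"
  unfolding conv_def[abs_def] by measurable

lemma conv_eq_0:
  assumes "e > 0" "\<And>y. norm (z - y) < e \<Longrightarrow> f y = 0"
  shows "conv e f z = 0"
proof -
  have *: "moll e (z - y) *\<^sub>R f y = 0" for y
    using assms moll_eq_0[of e "z - y"] by (cases "norm (z - y) < e") auto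
  show ?thesis unfolding conv_def * by simp
qed

lemma integrable_moll_shift:
  fixes f :: "'b::euclidean_space \<Rightarrow> 'c::euclidean_space"
  assumes f: "integrable lborel f" and e: "e > 0"
  shows "integrable lborel (\<lambda>y. moll e y *\<^sub>R f (z - y))" "integrable lborel (\<lambda>y. moll e (z - y) *\<^sub>R f y)"
proof -
  have [measurable]: "f \<in> borel_measurable borel" using f by auto
  obtain B where B: "\<And>z::'b. \<bar>moll e z\<bar> \<le> B" using moll_bounded[OF e] by blast
  have *: "integrable lborel (\<lambda>y. X y *\<^sub>R g y)" if g: "integrable lborel g"
    and [measurable]: "X \<in> borel_measurable borel" and X: "\<And>y. \<bar>X y\<bar> \<le> B" for X and g :: "'b \<Rightarrow> 'c"
  proof (rule Bochner_Integration.integrable_bound[of _ "\<lambda>y. B *\<^sub>R g y"])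
    have "norm (X y *\<^sub>R g y) \<le> norm (B *\<^sub>R g y)" for y
      using X[of y] by (auto intro!: mult_right_mono)
    then show "AE y in lborel. norm (X y *\<^sub>R g y) \<le> norm (B *\<^sub>R g y)" by simp
  qed (use g in auto)
  show "integrable lborel (\<lambda>y. moll e y *\<^sub>R f (z - y))"
    by (rule *) (use f lborel_reflection(2)[of f z] B in auto)
  show "integrable lborel (\<lambda>y. moll e (z - y) *\<^sub>R f y)"
    by (rule *) (use f B in auto)
qed

lemma conv_diff:
  fixes f :: "'b::euclidean_space \<Rightarrow> 'c::euclidean_space"
  assumes f: "integrable lborel f" and e: "e > 0"
  shows "conv e f z - f z = (\<integral>y. moll e y *\<^sub>R (f (z - y) - f z) \<partial>lborel)"
    "integrable lborel (\<lambda>y. moll e y *\<^sub>R (f (z - y) - f z))"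
proof -
  have [measurable]: "f \<in> borel_measurable borel" using f by auto
  have i: "integrable lborel (\<lambda>y. moll e (y::'b) *\<^sub>R f z)" by (intro integrable_scaleR_left integrable_moll e)
  have m: "(\<integral>y. moll e (y::'b) *\<^sub>R f z \<partial>lborel) = f z"
    by (simp add: integrable_moll[OF e] integral_moll[OF e])
  show "conv e f z - f z = (\<integral>y. moll e y *\<^sub>R (f (z - y) - f z) \<partial>lborel)"
    using i m integrable_moll_shift(1)[OF f e, of z] by (simp add: conv_alt scaleR_diff_right)
  show "integrable lborel (\<lambda>y. moll e y *\<^sub>R (f (z - y) - f z))"
    using i integrable_moll_shift(1)[OF f e, of z] by (simp add: scaleR_diff_right)
qed

text \<open>Averaging over the mollifier preserves any bound that holds for each small shift
  \<open>y\<close>: interchange the integrals and use that \<open>moll e\<close> has mass 1. With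
  \<open>\<Phi>\<close> the norm, or the squared norm, of \<open>f (z - y) - f z\<close> this yields
  convergence of mollifications in L^1 and L^2. Working with nonnegative integrals makes
  integrability of \<open>h\<close> part of the conclusion.\<close>

lemma moll_average_small:
  fixes \<Phi> :: "'b::euclidean_space \<Rightarrow> 'b \<Rightarrow> real" and h :: "'b \<Rightarrow> real"
  assumes [measurable]: "(\<lambda>(z, y). \<Phi> z y) \<in> borel_measurable (borel \<Otimes>\<^sub>M borel)" "h \<in> borel_measurable borel"
    and nn: "\<And>z y. 0 \<le> \<Phi> z y" and e: "0 < e"
    and small: "\<And>y. norm y < e \<Longrightarrow> integrable lborel (\<lambda>z. \<Phi> z y) \<and> (\<integral>z. \<Phi> z y \<partial>lborel) \<le> c"
    and h: "\<And>z. 0 \<le> h z" "\<And>z. h z \<le> (\<integral>y. moll e y * \<Phi> z y \<partial>lborel)"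
  shows "integrable lborel h" "(\<integral>z. h z \<partial>lborel) \<le> c"
proof -
  have "0 \<le> (\<integral>z. \<Phi> z 0 \<partial>lborel)" using nn by simp
  with small[of 0] e have c: "0 \<le> c" by simp
  have "(\<integral>\<^sup>+z. h z \<partial>lborel) \<le> (\<integral>\<^sup>+z. (\<integral>\<^sup>+y. ennreal (moll e y * \<Phi> z y) \<partial>lborel) \<partial>lborel)"
  proof (rule nn_integral_mono)
    fix z
    have "ennreal (h z) \<le> ennreal (\<integral>y. moll e y * \<Phi> z y \<partial>lborel)" by (rule ennreal_leI) (rule h)
    also have "\<dots> \<le> (\<integral>\<^sup>+y. ennreal (moll e y * \<Phi> z y) \<partial>lborel)"
      by (subst integral_eq_nn_integral) (auto simp: nn moll_nonneg[OF e] ennreal_enn2real_if)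
    finally show "ennreal (h z) \<le> (\<integral>\<^sup>+y. ennreal (moll e y * \<Phi> z y) \<partial>lborel)" .
  qed
  also have "\<dots> = (\<integral>\<^sup>+y. (\<integral>\<^sup>+z. ennreal (moll e y * \<Phi> z y) \<partial>lborel) \<partial>lborel)"
    by (rule lborel_pair.Fubini') measurable
  also have "\<dots> = (\<integral>\<^sup>+y. ennreal (moll e y) * (\<integral>\<^sup>+z. ennreal (\<Phi> z y) \<partial>lborel) \<partial>lborel)"
    by (simp add: ennreal_mult nn moll_nonneg[OF e] nn_integral_cmult)
  also have "\<dots> \<le> (\<integral>\<^sup>+y. ennreal (moll e (y::'b)) * ennreal c \<partial>lborel)"
  proof (rule nn_integral_mono)
    fix y :: 'b
    show "ennreal (moll e y) * (\<integral>\<^sup>+z. ennreal (\<Phi> z y) \<partial>lborel) \<le> ennreal (moll e y) * ennreal c"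
    proof (cases "norm y < e")
      case True
      then have "(\<integral>\<^sup>+z. ennreal (\<Phi> z y) \<partial>lborel) \<le> ennreal c"
        using small[OF True] by (subst nn_integral_eq_integral) (auto simp: nn intro: ennreal_leI)
      then show ?thesis by (intro mult_left_mono) auto
    qed (use moll_eq_0[OF e, of y] in auto)
  qed
  also have "\<dots> = ennreal c"
    by (simp add: nn_integral_multc nn_integral_eq_integral moll_nonneg[OF e] integrable_moll[OF e] integral_moll[OF e])
  finally have le: "(\<integral>\<^sup>+z. h z \<partial>lborel) \<le> ennreal c" .
  show i: "integrable lborel h"
    using le h(1) by (intro integrableI_nonneg) (auto simp: top.extremum_strict le_less_trans)
  show "(\<integral>z. h z \<partial>lborel) \<le> c"
    using le c h(1) by (subst (asm) nn_integral_eq_integral[OF i]) auto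
qed

lemma conv_L1:
  fixes f :: "'b::euclidean_space \<Rightarrow> 'c::euclidean_space"
  assumes f: "integrable lborel f" and c: "c > 0"
  shows "\<exists>d>0. \<forall>e. 0 < e \<and> e < d \<longrightarrow> integrable lborel (\<lambda>z. norm (conv e f z - f z)) \<and>
     (\<integral>z. norm (conv e f z - f z) \<partial>lborel) \<le> c"
proof -
  have [measurable]: "f \<in> borel_measurable borel" using f by auto
  obtain d where d: "d > 0" "\<And>a. norm a < d \<Longrightarrow> (\<integral>z. norm (f (z + a) - f z) \<partial>lborel) \<le> c"
    using L1_translation_continuous[OF f c] by blast
  have "integrable lborel (\<lambda>z. norm (conv e f z - f z)) \<and> (\<integral>z. norm (conv e f z - f z) \<partial>lborel) \<le> c"
    if e: "0 < e" "e < d" for e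
  proof -
    note * = moll_average_small[of "\<lambda>z y. norm (f (z - y) - f z)" "\<lambda>z. norm (conv e f z - f z)" e c]
    have s: "integrable lborel (\<lambda>z. norm (f (z - y) - f z)) \<and> (\<integral>z. norm (f (z - y) - f z) \<partial>lborel) \<le> c" if "norm y < e" for y
      using d(2)[of "- y"] that e f lborel_translation(2)[of f "- y"] by auto
    have h: "norm (conv e f z - f z) \<le> (\<integral>y. moll e y * norm (f (z - y) - f z) \<partial>lborel)" for z
      using integral_norm_bound[of lborel "\<lambda>y. moll e y *\<^sub>R (f (z - y) - f z)"]
      by (simp add: conv_diff(1)[OF f e(1)] abs_of_nonneg[OF moll_nonneg[OF e(1)]])
    show ?thesis using *(1,2) s h e by auto
  qed
  then show ?thesis using d(1) by blast
qed

lemma conv_L2: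
  fixes f :: "'b::euclidean_space \<Rightarrow> 'c::euclidean_space"
  assumes f: "integrable lborel f" and f2: "integrable lborel (\<lambda>z. (norm (f z))\<^sup>2)" and c: "c > 0"
  shows "\<exists>d>0. \<forall>e. 0 < e \<and> e < d \<longrightarrow> integrable lborel (\<lambda>z. (norm (conv e f z - f z))\<^sup>2) \<and>
     (\<integral>z. (norm (conv e f z - f z))\<^sup>2 \<partial>lborel) \<le> c"
proof -
  have [measurable]: "f \<in> borel_measurable borel" using f by auto
  obtain d where d: "d > 0" "\<And>a. norm a < d \<Longrightarrow> integrable lborel (\<lambda>z. (norm (f (z + a) - f z))\<^sup>2) \<and>
    (\<integral>z. (norm (f (z + a) - f z))\<^sup>2 \<partial>lborel) \<le> c"
    using L2_translation_continuous[OF _ f2 c] by auto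
  have "integrable lborel (\<lambda>z. (norm (conv e f z - f z))\<^sup>2) \<and> (\<integral>z. (norm (conv e f z - f z))\<^sup>2 \<partial>lborel) \<le> c"
    if e: "0 < e" "e < d" for e
  proof -
    note * = moll_average_small[of "\<lambda>z y. (norm (f (z - y) - f z))\<^sup>2" "\<lambda>z. (norm (conv e f z - f z))\<^sup>2" e c]
    have s: "integrable lborel (\<lambda>z. (norm (f (z - y) - f z))\<^sup>2) \<and> (\<integral>z. (norm (f (z - y) - f z))\<^sup>2 \<partial>lborel) \<le> c" if "norm y < e" for y
      using d(2)[of "- y"] that e by auto
    have h: "(norm (conv e f z - f z))\<^sup>2 \<le> (\<integral>y. moll e y * (norm (f (z - y) - f z))\<^sup>2 \<partial>lborel)" for z
    proof -
      let ?v = "\<lambda>y. f (z - y) - f z" and ?w = "conv e f z - f z"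
      note i1 = conv_diff(2)[OF f e(1), of z]
      have i2: "integrable lborel (\<lambda>y. moll e y * (norm (?v y))\<^sup>2)"
      proof -
        have "integrable lborel (\<lambda>y. (norm (f (z - y)))\<^sup>2)"
          using f2 lborel_reflection(2)[of "\<lambda>y. (norm (f y))\<^sup>2" z] by simp
        from integrable_moll_shift(1)[OF f2 e(1), of z]
        have "integrable lborel (\<lambda>y. 2 * (moll e y * (norm (f (z - y)))\<^sup>2) + 2 * (moll e y * (norm (f z))\<^sup>2))"
          by (intro Bochner_Integration.integrable_add integrable_mult_right integrable_mult_left integrable_moll e)
            simp
        then show ?thesis
        proof (rule Bochner_Integration.integrable_bound)
          have "(norm (a - b))\<^sup>2 \<le> 2 * (norm a)\<^sup>2 + 2 * (norm b)\<^sup>2" for a b :: 'c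
          proof -
            have "(norm (a - b))\<^sup>2 \<le> (norm a + norm b)\<^sup>2" by (intro power_mono norm_triangle_ineq4) auto
            also have "\<dots> \<le> 2 * (norm a)\<^sup>2 + 2 * (norm b)\<^sup>2"
              using sum_squares_bound[of "norm a" "norm b"] by (simp add: power2_sum)
            finally show ?thesis .
          qed
          then have "moll e y * (norm (?v y))\<^sup>2 \<le> moll e y * (2 * (norm (f (z - y)))\<^sup>2 + 2 * (norm (f z))\<^sup>2)" for y
            by (intro mult_left_mono moll_nonneg[OF e(1)])
          then show "AE y in lborel. norm (moll e y * (norm (?v y))\<^sup>2)
             \<le> norm (2 * (moll e y * (norm (f (z - y)))\<^sup>2) + 2 * (moll e y * (norm (f z))\<^sup>2))"
            by (auto simp: algebra_simps moll_nonneg[OF e(1)])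
        qed simp
      qed
      \<comment> \<open>Jensen's inequality as nonnegativity of a variance: \<open>?w\<close> is the
        mean of \<open>?v\<close> under the probability density \<open>moll e\<close>.\<close>
      have "0 \<le> (\<integral>y. moll e y * (norm (?v y - ?w))\<^sup>2 \<partial>lborel)"
        by (intro integral_nonneg_AE) (simp add: moll_nonneg[OF e(1)])
      also have "(\<lambda>y. moll e y * (norm (?v y - ?w))\<^sup>2) =
        (\<lambda>y. moll e y * (norm (?v y))\<^sup>2 - 2 * ((moll e y *\<^sub>R ?v y) \<bullet> ?w) + moll e y * (norm ?w)\<^sup>2)"
      proof
        fix y
        have "(norm (?v y - ?w))\<^sup>2 = (norm (?v y))\<^sup>2 - 2 * (?v y \<bullet> ?w) + (norm ?w)\<^sup>2"
          by (rule power2_norm_diff)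
        then show "moll e y * (norm (?v y - ?w))\<^sup>2 =
          moll e y * (norm (?v y))\<^sup>2 - 2 * ((moll e y *\<^sub>R ?v y) \<bullet> ?w) + moll e y * (norm ?w)\<^sup>2"
          by (simp add: distrib_left right_diff_distrib)
      qed
      also have "(\<integral>y. moll e y * (norm (?v y))\<^sup>2 - 2 * ((moll e y *\<^sub>R ?v y) \<bullet> ?w) + moll e y * (norm ?w)\<^sup>2 \<partial>lborel)
        = (\<integral>y. moll e y * (norm (?v y))\<^sup>2 \<partial>lborel) - 2 * ((\<integral>y. moll e y *\<^sub>R ?v y \<partial>lborel) \<bullet> ?w) + (norm ?w)\<^sup>2"
      proof -
        have a: "integrable lborel (\<lambda>y. 2 * ((moll e y *\<^sub>R ?v y) \<bullet> ?w))"
          by (intro integrable_mult_right integrable_inner_left i1)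
        have b: "integrable lborel (\<lambda>y::'b. moll e y * (norm ?w)\<^sup>2)"
          by (intro integrable_mult_left integrable_moll e)
        have "(\<integral>y. 2 * ((moll e y *\<^sub>R ?v y) \<bullet> ?w) \<partial>lborel) = 2 * ((\<integral>y. moll e y *\<^sub>R ?v y \<partial>lborel) \<bullet> ?w)"
          using integral_inner_left[of ?w lborel "\<lambda>y. moll e y *\<^sub>R ?v y"] i1 by (simp only: integral_mult_right_zero)
        moreover have "(\<integral>y. moll e (y::'b) * (norm ?w)\<^sup>2 \<partial>lborel) = (norm ?w)\<^sup>2"
          by (simp add: integral_moll[OF e(1)])
        ultimately show ?thesis
          using Bochner_Integration.integral_add[OF Bochner_Integration.integrable_diff[OF i2 a] b]
            Bochner_Integration.integral_diff[OF i2 a] by simp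
      qed
      also have "\<dots> = (\<integral>y. moll e y * (norm (?v y))\<^sup>2 \<partial>lborel) - (norm ?w)\<^sup>2"
        unfolding conv_diff(1)[OF f e(1), symmetric] by (simp add: power2_norm_eq_inner)
      finally show ?thesis by simp
    qed
    show ?thesis using *(1,2) s h e by auto
  qed
  then show ?thesis using d(1) by blast
qed

section \<open>Truncation of supersolutions\<close>

lemma smooth_conv:
  fixes f :: "'b::euclidean_space \<Rightarrow> real"
  assumes f: "integrable lborel f" and e: "e > 0"
  shows "smooth (conv e f)"
    and "grad (conv e f) z = (\<integral>y. f y *\<^sub>R grad (moll e) (z - y) \<partial>lborel)"
proof -
  have eq: "conv e f = (\<lambda>z. \<integral>y. f y * moll e (z + - y) \<partial>lborel)"
    by (simp add: conv_def fun_eq_iff mult.commute)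
  note sm = smooth_has_grad[OF smooth_moll[of e, where 'b='b]]
  show "smooth (conv e f)"
    unfolding eq by (rule smooth_parametric_integral[OF smooth_moll moll_eq_0[OF e] f]) measurable
  have "has_grad (conv e f) (\<lambda>z. \<integral>y. f y *\<^sub>R grad (moll e) (z + - y) \<partial>lborel)"
    unfolding eq
    using uniformly_continuous_bounded_support[OF smooth_continuous[OF smooth_moll] moll_eq_0[OF e]]
      uniformly_continuous_bounded_support[OF sm(3) has_grad_zero_outside_cball[OF sm(1,3) moll_eq_0[OF e]]]
    by (intro has_grad_parametric_integral sm f) auto
  from grad_eqI[OF has_gradD[OF this]]
  show "grad (conv e f) z = (\<integral>y. f y *\<^sub>R grad (moll e) (z - y) \<partial>lborel)" by simp
qed

text \<open>Here the derivative falls on \<open>f\<close> instead of the mollifier, so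
  \<open>conv_uniform\<close> applies to the gradient as well. The form with the derivative on
  \<open>moll\<close> is the one for \<open>w\<close>, which has no classical gradient.\<close>

lemma conv_has_grad_smooth:
  fixes f :: "'b::euclidean_space \<Rightarrow> real"
  assumes f: "has_grad f D" "continuous_on UNIV D" "\<And>x. R \<le> norm x \<Longrightarrow> f x = 0" and e: "e > 0"
  shows "grad (conv e f) z = conv e D z"
proof -
  have z: "D x = 0" if "R \<le> norm x" for x
    using has_grad_zero_outside_cball[OF f(1-3) that] .
  note u = uniformly_continuous_bounded_support[OF has_grad_continuous[OF f(1)] f(3)]
    uniformly_continuous_bounded_support[OF f(2) z]
  have [measurable]: "f \<in> borel_measurable borel" "D \<in> borel_measurable borel"
    using continuous_borel_measurable has_grad_continuous[OF f(1)] f(2) by auto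
  have eq: "conv e f = (\<lambda>z. \<integral>y. moll e y * f (z + - y) \<partial>lborel)"
    by (simp add: conv_alt fun_eq_iff)
  have "has_grad (conv e f) (\<lambda>z. \<integral>y. moll e y *\<^sub>R D (z + - y) \<partial>lborel)"
    unfolding eq using u by (intro has_grad_parametric_integral f integrable_moll e) auto
  from grad_eqI[OF has_gradD[OF this]]
  show ?thesis by (simp add: conv_alt)
qed

lemma grad_moll_bounded:
  assumes "e > 0" obtains B where "\<And>z::'b::euclidean_space. norm (grad (moll e) z) \<le> B"
proof -
  note sm = smooth_has_grad[OF smooth_moll[of e, where 'b='b]]
  have "bounded (range (grad (moll e :: 'b \<Rightarrow> real)))"
    by (rule uniformly_continuous_bounded_support(2)[OF sm(3)])
      (rule has_grad_zero_outside_cball[OF sm(1,3) moll_eq_0[OF assms]])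
  then show thesis using that unfolding bounded_iff by auto
qed

lemma conv_uniform:
  fixes f :: "'b::euclidean_space \<Rightarrow> 'c::euclidean_space"
  assumes f: "integrable lborel f" "uniformly_continuous_on UNIV f" and c: "c > 0"
  shows "\<exists>d>0. \<forall>e. 0 < e \<and> e < d \<longrightarrow> (\<forall>z. norm (conv e f z - f z) \<le> c)"
proof -
  obtain d where d: "d > 0" "\<And>x y. dist y x < d \<Longrightarrow> dist (f y) (f x) < c"
    using f(2)[unfolded uniformly_continuous_on_def, rule_format, OF c] by auto
  have "norm (conv e f z - f z) \<le> c" if e: "0 < e" "e < d" for e z
  proof -
    have "norm (conv e f z - f z) \<le> (\<integral>y. norm (moll e y *\<^sub>R (f (z - y) - f z)) \<partial>lborel)"
      unfolding conv_diff(1)[OF f(1) e(1)] by (rule integral_norm_bound)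
    also have "\<dots> \<le> (\<integral>y. moll e (y::'b) * c \<partial>lborel)"
    proof (rule integral_mono)
      show "integrable lborel (\<lambda>y. norm (moll e y *\<^sub>R (f (z - y) - f z)))"
        by (intro integrable_norm conv_diff(2) f e)
      show "integrable lborel (\<lambda>y::'b. moll e y * c)"
        by (intro integrable_mult_left integrable_moll e)
      fix y :: 'b
      show "norm (moll e y *\<^sub>R (f (z - y) - f z)) \<le> moll e y * c"
      proof (cases "norm y < e")
        case True
        then have "norm (f (z - y) - f z) \<le> c" using d(2)[of "z - y" z] e by (simp add: dist_norm)
        then show ?thesis by (simp add: moll_nonneg[OF e(1)] mult_left_mono)
      qed (simp add: moll_eq_0[OF e(1)])
    qed
    also have "\<dots> = c" by (simp add: integral_moll[OF e(1)])
    finally show ?thesis .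
  qed
  then show ?thesis using d(1) by blast
qed

text \<open>\<open>K'\<close> is \<open>K\<close> fattened by a closed ball; it holds the supports
  of mollified and of time-shifted test functions at all scales up to \<open>r\<close>.\<close>

lemma compact_neighbourhood:
  fixes K :: "'b::euclidean_space set"
  assumes "compact K" "open D" "K \<subseteq> D"
  obtains r K' where "r > 0" "compact K'" "K' \<subseteq> D" "\<And>x y. x \<in> K \<Longrightarrow> norm y \<le> r \<Longrightarrow> x + y \<in> K'"
proof -
  obtain r where r: "r > 0" "(\<Union>x\<in>K. cball x r) \<subseteq> D"
    using compact_subset_open_imp_cball_epsilon_subset[OF assms] by blast
  let ?K = "{x + y |x y. x \<in> K \<and> y \<in> cball 0 r}"
  have "?K \<subseteq> D"
  proof
    fix z assume "z \<in> ?K"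
    then obtain x y where "z = x + y" "x \<in> K" "norm y \<le> r" by auto
    then have "z \<in> cball x r" by (simp add: dist_norm)
    then show "z \<in> D" using r \<open>x \<in> K\<close> by blast
  qed
  moreover have "compact ?K" by (intro compact_sums assms compact_cball)
  ultimately show thesis using that[of r ?K] r(1) by fastforce
qed

lemma compact_in_ball:
  fixes K :: "'b::euclidean_space set"
  assumes "compact K"
  obtains R where "\<And>z. R \<le> norm z \<Longrightarrow> z \<notin> K"
proof -
  obtain B where "\<And>z. z \<in> K \<Longrightarrow> norm z \<le> B" using compact_imp_bounded[OF assms] unfolding bounded_iff by auto
  then show thesis by (intro that[of "B + 1"]) force
qed

section \<open>Supersolutions on one cylinder, extended by zero\<close>

lemma borel_measurable_fst_snd[measurable]:
  "fst \<in> borel_measurable (borel :: ('c::euclidean_space \<times> 'd::euclidean_space) measure)"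
  "snd \<in> borel_measurable (borel :: ('c::euclidean_space \<times> 'd::euclidean_space) measure)"
  by (auto intro!: borel_measurable_continuous_onI continuous_intros)

text \<open>Borel functions on the whole space, zero outside \<open>D\<close>, so that mollification
  and translation need no domains; the price is that \<open>w\<close> may jump at the boundary and
  has the gradient \<open>G\<close> only inside. The basic unknown is \<open>w\<close>, standing for
  \<open>u^m\<close>, because it is the function with a gradient; \<open>u\<close> is recovered as
  its root.\<close>

locale local_supersolution =
  fixes m :: real and U :: "'a::euclidean_space set" and s\<^sub>1 s\<^sub>2 :: real
    and w :: "'a \<times> real \<Rightarrow> real" and G :: "'a \<times> real \<Rightarrow> 'a"
  assumes m: "1 < m" and U: "open U" "bounded U"
    and w_meas[measurable]: "w \<in> borel_measurable borel" and G_meas[measurable]: "G \<in> borel_measurable borel"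
    and w_nonneg: "\<And>z. 0 \<le> w z"
    and w_outside: "\<And>z. z \<notin> U \<times> {s\<^sub>1<..<s\<^sub>2} \<Longrightarrow> w z = 0"
    and G_outside: "\<And>z. z \<notin> U \<times> {s\<^sub>1<..<s\<^sub>2} \<Longrightarrow> G z = 0"
    and w2: "integrable lborel (\<lambda>z. (w z)\<^sup>2)" and G2: "integrable lborel (\<lambda>z. (norm (G z))\<^sup>2)"
    and weak_gradient: "AE t in lborel. s\<^sub>1 < t \<and> t < s\<^sub>2 \<longrightarrow> (\<forall>\<psi>. test_function U \<psi> \<longrightarrow> (\<forall>i\<in>Basis.
        (\<integral>x. w (x, t) * (grad \<psi> x \<bullet> i) \<partial>lborel) = - (\<integral>x. (G (x, t) \<bullet> i) * \<psi> x \<partial>lborel)))"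
    and supersolution: "\<And>\<phi>. test_function (U \<times> {s\<^sub>1<..<s\<^sub>2}) \<phi> \<Longrightarrow> (\<And>z. 0 \<le> \<phi> z) \<Longrightarrow>
        0 \<le> (\<integral>z. - (w z powr (1 / m)) * (grad \<phi> z \<bullet> (0, 1)) + G z \<bullet> fst (grad \<phi> z) \<partial>lborel)"
begin

abbreviation D :: "('a \<times> real) set" where "D \<equiv> U \<times> {s\<^sub>1<..<s\<^sub>2}"

definition u :: "'a \<times> real \<Rightarrow> real" where "u z = w z powr (1 / m)"

lemma u_meas[measurable]: "u \<in> borel_measurable borel"
  unfolding u_def[abs_def] by measurable

lemma u_nonneg: "0 \<le> u z" by (simp add: u_def)

lemma u_powr: "u z powr m = w z"
  using m w_nonneg[of z] by (simp add: u_def powr_powr)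

lemma u_outside: "z \<notin> D \<Longrightarrow> u z = 0"
  by (simp add: u_def w_outside)

lemma open_D: "open D" and bounded_D: "bounded D"
  using U by (auto intro!: open_Times bounded_Times)

lemma integrable_bounded_on_D:
  fixes f :: "'a \<times> real \<Rightarrow> 'c::{banach,second_countable_topology}"
  assumes [measurable]: "f \<in> borel_measurable borel" and "\<And>z. z \<notin> D \<Longrightarrow> f z = 0" "\<And>z. norm (f z) \<le> B"
  shows "integrable lborel f"
proof (rule integrableI_bounded_set[of D _ _ B])
  show "emeasure lborel D < \<infinity>" using emeasure_bounded_finite[OF bounded_D] by simp
  show "D \<in> sets lborel" using borel_open[OF open_D] by simp
qed (use assms in auto)

lemma integrable_of_square:
  fixes f :: "'a \<times> real \<Rightarrow> 'c::{banach,second_countable_topology}"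
  assumes [measurable]: "f \<in> borel_measurable borel" and f: "\<And>z. z \<notin> D \<Longrightarrow> f z = 0" and i: "integrable lborel (\<lambda>z. (norm (f z))\<^sup>2)"
  shows "integrable lborel f"
proof (rule Bochner_Integration.integrable_bound)
  have [measurable]: "D \<in> sets borel" using borel_open[OF open_D] .
  have "integrable lborel (indicat_real D)"
    by (rule integrable_bounded_on_D[where B = 1]) (auto simp: indicator_def)
  then show "integrable lborel (\<lambda>z. indicator D z + (norm (f z))\<^sup>2)" using i by simp
  have "norm (f z) \<le> indicator D z + (norm (f z))\<^sup>2" for z
  proof (cases "z \<in> D")
    case True
    have "0 \<le> (norm (f z) - 1)\<^sup>2 + norm (f z) * 1" by simp
    then show ?thesis using True by (simp add: power2_eq_square algebra_simps)
  qed (use f in auto)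
  then show "AE z in lborel. norm (f z) \<le> norm (indicator D z + (norm (f z))\<^sup>2)"
    by (auto simp: abs_of_nonneg)
qed simp

lemma w_integrable: "integrable lborel w"
  by (rule integrable_of_square) (use w2 w_outside in auto)

lemma G_integrable: "integrable lborel G"
  by (rule integrable_of_square) (use G2 G_outside in auto)

lemma u_integrable: "integrable lborel u"
proof (rule Bochner_Integration.integrable_bound)
  have [measurable]: "D \<in> sets borel" using borel_open[OF open_D] .
  have "integrable lborel (indicat_real D)"
    by (rule integrable_bounded_on_D[where B = 1]) (auto simp: indicator_def)
  then show "integrable lborel (\<lambda>z. indicator D z + w z)" using w_integrable by simp
  have "u z \<le> indicator D z + w z" for z
  proof (cases "z \<in> D")
    case True
    show ?thesis
    proof (cases "u z \<le> 1")
      case False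
      then have "u z powr 1 \<le> u z powr m" using m by (intro powr_mono) auto
      then show ?thesis using False by (simp add: u_powr indicator_def)
    qed (use True w_nonneg[of z] in auto)
  qed (use u_outside w_nonneg in auto)
  then show "AE z in lborel. norm (u z) \<le> norm (indicator D z + w z)"
    using u_nonneg w_nonneg by (auto simp: abs_of_nonneg)
qed simp

text \<open>The test functions to come involve \<open>\<psi> (conv e w)\<close> with
  \<open>\<psi>\<close> only C^1. Mollifying \<open>\<phi>\<close> gives admissible functions with
  support in \<open>K'\<close> whose gradients converge uniformly, so the integral moves by at most
  \<open>c\<close> times the integral of \<open>u + norm G\<close>.\<close>

lemma supersolution_C1:
  assumes \<phi>: "has_grad \<phi> D\<phi>" "continuous_on UNIV D\<phi>" "\<And>z. 0 \<le> \<phi> z"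
    and K: "compact K" "K \<subseteq> D" "\<And>z. z \<notin> K \<Longrightarrow> \<phi> z = 0"
  shows "0 \<le> (\<integral>z. - u z * (D\<phi> z \<bullet> (0, 1)) + G z \<bullet> fst (D\<phi> z) \<partial>lborel)"
proof -
  obtain r K' where r: "r > 0" "compact K'" "K' \<subseteq> D" "\<And>x y. x \<in> K \<Longrightarrow> norm y \<le> r \<Longrightarrow> x + y \<in> K'"
    using compact_neighbourhood[OF K(1) open_D K(2)] by metis
  obtain R where R: "\<And>z. R \<le> norm z \<Longrightarrow> \<phi> z = 0"
    using compact_in_ball[OF K(1)] K(3) by metis
  have D0: "D\<phi> z = 0" if "R \<le> norm z" for z
    using has_grad_zero_outside_cball[OF \<phi>(1,2) R that] .
  note ucD = uniformly_continuous_bounded_support[OF \<phi>(2), of R, OF D0]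
  have iD: "integrable lborel D\<phi>" by (rule integrable_continuous_bounded_support[OF \<phi>(2) D0])
  have i\<phi>: "integrable lborel \<phi>" by (rule integrable_continuous_bounded_support[OF has_grad_continuous[OF \<phi>(1)] R])
  have [measurable]: "D\<phi> \<in> borel_measurable borel" using continuous_borel_measurable[OF \<phi>(2)] .
  have int: "integrable lborel (\<lambda>z. - u z * (X z \<bullet> (0, 1)) + G z \<bullet> fst (X z))"
    if [measurable]: "X \<in> borel_measurable borel" and B: "\<And>z. norm (X z) \<le> B"
    for X :: "'a \<times> real \<Rightarrow> 'a \<times> real" and B :: real
  proof (rule Bochner_Integration.integrable_bound)
    show "integrable lborel (\<lambda>z. B * (u z + norm (G z)))"
      using u_integrable G_integrable by simp
    have "norm (- u z * (X z \<bullet> (0, 1)) + G z \<bullet> fst (X z)) \<le> B * (u z + norm (G z))" for z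
    proof -
      have "\<bar>X z \<bullet> (0, 1)\<bar> \<le> norm (X z)"
        using Cauchy_Schwarz_ineq2[of "X z" "(0, 1)"] by (simp add: norm_Pair)
      then have 1: "\<bar>X z \<bullet> (0, 1)\<bar> \<le> B" using B[of z] by linarith
      have 2: "norm (fst (X z)) \<le> B" using B[of z] norm_fst_le[of "fst (X z)" "snd (X z)"] by simp
      have "\<bar>u z * (X z \<bullet> (0, 1))\<bar> \<le> B * u z"
        using mult_left_mono[OF 1 u_nonneg[of z]] by (simp add: abs_mult u_nonneg mult.commute[of B])
      moreover have "\<bar>G z \<bullet> fst (X z)\<bar> \<le> B * norm (G z)"
        using Cauchy_Schwarz_ineq2[of "G z" "fst (X z)"] mult_left_mono[OF 2 norm_ge_zero[of "G z"]]
        by (simp add: mult.commute[of B])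
      ultimately show ?thesis by (simp add: distrib_left)
    qed
    then show "AE z in lborel. norm (- u z * (X z \<bullet> (0, 1)) + G z \<bullet> fst (X z)) \<le> norm (B * (u z + norm (G z)))"
      by (intro AE_I2) (smt (verit) real_norm_def)
  qed simp
  obtain B where B: "\<And>z. norm (D\<phi> z) \<le> B" using ucD(2) unfolding bounded_iff by blast
  let ?I = "\<integral>z. - u z * (D\<phi> z \<bullet> (0, 1)) + G z \<bullet> fst (D\<phi> z) \<partial>lborel"
  let ?C = "(\<integral>z. u z + norm (G z) \<partial>lborel)"
  have approx: "0 \<le> ?I + c * ?C" if c: "c > 0" for c
  proof -
    obtain d where d: "d > 0" "\<And>e z. 0 < e \<Longrightarrow> e < d \<Longrightarrow> norm (conv e D\<phi> z - D\<phi> z) \<le> c"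
      using conv_uniform[OF iD ucD(1) c] by blast
    define e where "e = min d r / 2"
    have e: "0 < e" "e < d" "e < r" using d(1) r(1) by (auto simp: e_def)
    have gr: "grad (conv e \<phi>) z = conv e D\<phi> z" for z
      by (rule conv_has_grad_smooth[OF \<phi>(1,2) R e(1)])
    have supp: "conv e \<phi> z = 0" if "z \<notin> K'" for z
    proof (rule conv_eq_0[OF e(1)])
      fix y assume "norm (z - y) < e"
      then show "\<phi> y = 0" using r(4)[of y "z - y"] that e(3) K(3)[of y] by (cases "y \<in> K") auto
    qed
    have cl: "closure {z. conv e \<phi> z \<noteq> 0} \<subseteq> K'"
      by (rule closure_minimal) (use supp r(2) compact_imp_closed in auto)
    have "test_function D (conv e \<phi>)"
      unfolding test_function_def
    proof (intro conjI)
      show "smooth (conv e \<phi>)" by (rule smooth_conv[OF i\<phi> e(1)])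
      show "compact (closure {z. conv e \<phi> z \<noteq> 0})"
        using compact_Int_closed[OF r(2) closed_closure, of "{z. conv e \<phi> z \<noteq> 0}"] cl by (simp add: Int_absorb1)
    qed (use cl r(3) in auto)
    moreover have "0 \<le> conv e \<phi> z" for z
      unfolding conv_def using \<phi>(3) by (intro integral_nonneg_AE) (simp add: moll_nonneg[OF e(1)])
    ultimately have "0 \<le> (\<integral>z. - u z * (conv e D\<phi> z \<bullet> (0, 1)) + G z \<bullet> fst (conv e D\<phi> z) \<partial>lborel)"
      using supersolution[of "conv e \<phi>"] by (simp add: gr u_def)
    also have "\<dots> \<le> (\<integral>z. (- u z * (D\<phi> z \<bullet> (0, 1)) + G z \<bullet> fst (D\<phi> z)) + c * (u z + norm (G z)) \<partial>lborel)"
    proof (rule integral_mono)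
      have "norm (conv e D\<phi> z) \<le> B + c" for z
        using norm_triangle_ineq2[of "conv e D\<phi> z" "D\<phi> z"] d(2)[OF e(1,2), of z] B[of z] by linarith
      then show "integrable lborel (\<lambda>z. - u z * (conv e D\<phi> z \<bullet> (0, 1)) + G z \<bullet> fst (conv e D\<phi> z))"
        by (intro int) auto
      show "integrable lborel (\<lambda>z. (- u z * (D\<phi> z \<bullet> (0, 1)) + G z \<bullet> fst (D\<phi> z)) + c * (u z + norm (G z)))"
        using int[OF _ B] u_integrable G_integrable by simp
      fix z
      let ?d = "conv e D\<phi> z - D\<phi> z"
      have n: "norm ?d \<le> c" by (rule d(2)[OF e(1,2)])
      have "\<bar>?d \<bullet> (0, 1)\<bar> \<le> norm ?d"
        using Cauchy_Schwarz_ineq2[of ?d "(0, 1)"] by (simp add: norm_Pair)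
      then have 1: "- (?d \<bullet> (0, 1)) \<le> c" using n by linarith
      have 2: "norm (fst ?d) \<le> c" using n norm_fst_le[of "fst ?d" "snd ?d"] by (simp del: fst_diff snd_diff)
      have "u z * (- (?d \<bullet> (0, 1))) \<le> u z * c" by (rule mult_left_mono[OF 1 u_nonneg])
      moreover have "G z \<bullet> fst ?d \<le> norm (G z) * c"
        using norm_cauchy_schwarz[of "G z" "fst ?d"] mult_left_mono[OF 2 norm_ge_zero[of "G z"]] by linarith
      ultimately show "- u z * (conv e D\<phi> z \<bullet> (0, 1)) + G z \<bullet> fst (conv e D\<phi> z)
         \<le> (- u z * (D\<phi> z \<bullet> (0, 1)) + G z \<bullet> fst (D\<phi> z)) + c * (u z + norm (G z))"
        by (simp add: inner_diff_left inner_diff_right algebra_simps)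
    qed
    also have "\<dots> = ?I + c * ?C"
      using int[OF _ B] u_integrable G_integrable by simp
    finally show ?thesis .
  qed
  have C: "0 \<le> ?C" using u_nonneg by (intro integral_nonneg_AE) auto
  show ?thesis
  proof (rule field_le_epsilon)
    fix e :: real assume "e > 0"
    then have "0 \<le> ?I + e / (?C + 1) * ?C" using C by (intro approx) simp
    also have "e / (?C + 1) * ?C \<le> e" using C \<open>e > 0\<close> by (simp add: field_simps)
    finally show "0 \<le> ?I + e" by simp
  qed
qed

text \<open>Integrate slice by slice, with the mollifier frozen in time as the test function of
  \<open>weak_gradient\<close>; the reflected argument \<open>z - y\<close> supplies a sign that
  cancels the one of the weak gradient. \<open>cball z e \<subseteq> D\<close> keeps the support of
  each slice inside \<open>U\<close>: across the boundary the extension by zero need not have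
  gradient \<open>G\<close>.\<close>

lemma grad_conv_w:
  assumes e: "e > 0" and z: "cball z e \<subseteq> D"
  shows "fst (grad (conv e w) z) = conv e G z"
proof (rule euclidean_eqI)
  fix i :: 'a assume i: "i \<in> Basis"
  let ?g = "grad (moll e :: 'a \<times> real \<Rightarrow> real)"
  note sm = smooth_has_grad[OF smooth_moll[of e, where 'b="'a \<times> real"]]
  have [measurable]: "?g \<in> borel_measurable borel" using continuous_borel_measurable[OF sm(3)] .
  obtain B where B: "\<And>y. norm (?g y) \<le> B"
    using grad_moll_bounded[OF e, where 'b = "'a \<times> real"] by blast
  have i1: "integrable lborel (\<lambda>y. w y *\<^sub>R ?g (z - y))"
    by (rule integrable_mult_bounded[OF w_integrable _ B]) simp
  have i2: "integrable lborel (\<lambda>y. w y * (?g (z - y) \<bullet> (i, 0)))"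
    using integrable_inner_left[OF i1, of "(i, 0)"] by simp
  have i3: "integrable lborel (\<lambda>y. (G y \<bullet> i) * moll e (z - y))"
    using integrable_inner_left[OF integrable_moll_shift(2)[OF G_integrable e, of z], of i] by (simp add: mult.commute)
  have "fst (grad (conv e w) z) \<bullet> i = grad (conv e w) z \<bullet> (i, 0)" by (simp add: inner_prod_def)
  also have "\<dots> = (\<integral>y. w y * (?g (z - y) \<bullet> (i, 0)) \<partial>lborel)"
    using integral_inner_left[of "(i, 0)" lborel "\<lambda>y. w y *\<^sub>R ?g (z - y)"] i1
    by (simp add: smooth_conv(2)[OF w_integrable e])
  also have "\<dots> = (\<integral>t. (\<integral>x. w (x, t) * (?g (z - (x, t)) \<bullet> (i, 0)) \<partial>lborel) \<partial>lborel)"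
    using lborel_pair.integral_snd[of "\<lambda>x t. w (x, t) * (?g (z - (x, t)) \<bullet> (i, 0))"] i2
    by (simp add: lborel_prod case_prod_unfold)
  also have "\<dots> = (\<integral>t. (\<integral>x. (G (x, t) \<bullet> i) * moll e (z - (x, t)) \<partial>lborel) \<partial>lborel)"
  proof (rule integral_cong_AE)
    show "AE t in lborel. (\<integral>x. w (x, t) * (?g (z - (x, t)) \<bullet> (i, 0)) \<partial>lborel)
        = (\<integral>x. (G (x, t) \<bullet> i) * moll e (z - (x, t)) \<partial>lborel)"
      using weak_gradient
    proof eventually_elim
      case (elim t)
      show ?case
      proof (cases "s\<^sub>1 < t \<and> t < s\<^sub>2")
        case False
        then show ?thesis by (auto simp: w_outside G_outside)
      next
        case True
        define \<psi> where "\<psi> = (\<lambda>x. moll e (z - (x, t)))"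
        have s: "smooth \<psi>" using smooth_moll_slice[of e "fst z" "snd z" t] by (simp add: \<psi>_def)
        have sub: "{x. \<psi> x \<noteq> 0} \<subseteq> cball (fst z) e"
        proof
          fix x assume "x \<in> {x. \<psi> x \<noteq> 0}"
          then have "norm (z - (x, t)) < e" using moll_eq_0[OF e, of "z - (x, t)"] by (force simp: \<psi>_def)
          then show "x \<in> cball (fst z) e"
            using norm_fst_le[of "fst z - x" "snd z - t"] by (cases z) (simp add: dist_norm)
        qed
        have clo: "closed {x. norm (z - (x, t)) \<le> e}"
          by (intro closed_Collect_le continuous_intros)
        have sub2: "closure {x. \<psi> x \<noteq> 0} \<subseteq> {x. norm (z - (x, t)) \<le> e}"
        proof (rule closure_minimal[OF _ clo], rule)
          fix x assume "x \<in> {x. \<psi> x \<noteq> 0}"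
          then show "x \<in> {x. norm (z - (x, t)) \<le> e}" using moll_eq_0[OF e, of "z - (x, t)"] by (force simp: \<psi>_def)
        qed
        have "{x. norm (z - (x, t)) \<le> e} \<subseteq> U"
        proof
          fix x assume "x \<in> {x. norm (z - (x, t)) \<le> e}"
          then have "(x, t) \<in> cball z e" by (simp add: dist_norm)
          then show "x \<in> U" using z by blast
        qed
        then have "test_function U \<psi>"
          unfolding test_function_def using s sub2 bounded_subset[OF bounded_cball sub]
          by (auto simp: compact_eq_bounded_closed)
        with elim True i have *: "(\<integral>x. w (x, t) * (grad \<psi> x \<bullet> i) \<partial>lborel) = - (\<integral>x. (G (x, t) \<bullet> i) * \<psi> x \<partial>lborel)"
          by blast
        have "grad \<psi> x \<bullet> i = - (?g (z - (x, t)) \<bullet> (i, 0))" for x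
        proof -
          have "(\<psi> has_derivative (\<lambda>v. ?g (z - (x, t)) \<bullet> - (v, 0))) (at x)"
            unfolding \<psi>_def
            by (rule has_derivative_compose[OF _ has_gradD[OF sm(1)]]) (auto intro!: derivative_eq_intros)
          then have "(\<psi> has_derivative (\<lambda>v. (- fst (?g (z - (x, t)))) \<bullet> v)) (at x)"
            by (rule has_derivative_eq_rhs) (auto simp: inner_prod_def)
          from grad_eqI[OF this] show ?thesis by (simp add: inner_prod_def)
        qed
        with * have "(\<integral>x. w (x, t) * (?g (z - (x, t)) \<bullet> (i, 0)) \<partial>lborel) = (\<integral>x. (G (x, t) \<bullet> i) * \<psi> x \<partial>lborel)"
          by simp
        then show ?thesis by (simp add: \<psi>_def)
      qed
    qed
  qed measurable
  also have "\<dots> = (\<integral>y. (G y \<bullet> i) * moll e (z - y) \<partial>lborel)"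
    using lborel_pair.integral_snd[of "\<lambda>x t. (G (x, t) \<bullet> i) * moll e (z - (x, t))"] i3
    by (simp add: lborel_prod case_prod_unfold)
  also have "\<dots> = conv e G z \<bullet> i"
    unfolding conv_def using integral_inner_left[of i lborel "\<lambda>y. moll e (z - y) *\<^sub>R G y"]
      integrable_moll_shift(2)[OF G_integrable e, of z] by (simp add: mult.commute)
  finally show "fst (grad (conv e w) z) \<bullet> i = conv e G z \<bullet> i" .
qed

end

text \<open>\<open>H v\<close> is the gradient of the directional derivative along \<open>v\<close>,
  so \<open>f\<close> is of class C^2. This is the class of test functions that contains both the
  resolvent and the cutoff used below, the latter being C^2 and no smoother.\<close>

definition has_hess :: "('b::euclidean_space \<Rightarrow> real) \<Rightarrow> ('b \<Rightarrow> 'b) \<Rightarrow> ('b \<Rightarrow> 'b \<Rightarrow> 'b) \<Rightarrow> bool" where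
  "has_hess f D H \<longleftrightarrow> has_grad f D \<and> (\<forall>v. has_grad (\<lambda>z. D z \<bullet> v) (H v)) \<and> (\<forall>v. continuous_on UNIV (H v))"

definition lap_x :: "('a::euclidean_space \<times> real \<Rightarrow> 'a \<times> real \<Rightarrow> 'a \<times> real) \<Rightarrow> 'a \<times> real \<Rightarrow> real" where
  "lap_x H z = (\<Sum>i\<in>Basis. H (i, 0) z \<bullet> (i, 0))"

lemma has_hessD:
  assumes "has_hess f D H"
  shows "has_grad f D" "has_grad (\<lambda>z. D z \<bullet> v) (H v)" "continuous_on UNIV (H v)" "continuous_on UNIV D"
proof -
  show "has_grad f D" and g: "has_grad (\<lambda>z. D z \<bullet> v) (H v)" and "continuous_on UNIV (H v)" for v
    using assms unfolding has_hess_def by metis+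
  show "continuous_on UNIV D"
    by (rule continuous_on_gradI) (rule has_grad_continuous[OF g])
qed

lemma has_grad_shift: "has_grad f D \<Longrightarrow> has_grad (\<lambda>z. f (z + a)) (\<lambda>z. D (z + a))"
  unfolding has_grad_def
proof (intro allI)
  fix z assume "\<forall>z. (f has_derivative (\<lambda>v. D z \<bullet> v)) (at z)"
  then show "((\<lambda>z. f (z + a)) has_derivative (\<lambda>v. D (z + a) \<bullet> v)) (at z)"
    by (intro has_derivative_compose[where g = f and f = "\<lambda>z. z + a"]) (auto intro!: derivative_eq_intros)
qed

lemma has_grad_mult:
  assumes "has_grad f D" "has_grad g E"
  shows "has_grad (\<lambda>z. f z * g z) (\<lambda>z. g z *\<^sub>R D z + f z *\<^sub>R E z)"
  unfolding has_grad_def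
  by (intro allI, rule has_derivative_eq_rhs[OF has_derivative_mult[OF has_gradD[OF assms(1)] has_gradD[OF assms(2)]]])
    (auto simp: inner_add_left)

lemma has_grad_compose:
  assumes "has_grad f D" "\<And>s. (p has_real_derivative p' s) (at s)"
  shows "has_grad (\<lambda>z. p (f z)) (\<lambda>z. p' (f z) *\<^sub>R D z)"
  unfolding has_grad_def
proof
  fix z
  show "((\<lambda>z. p (f z)) has_derivative (\<lambda>v. (p' (f z) *\<^sub>R D z) \<bullet> v)) (at z)"
    using DERIV_compose_FDERIV[OF assms(2) has_gradD[OF assms(1)]]
    by (rule has_derivative_eq_rhs) (auto simp: mult.commute)
qed

lemma time_shift_cancel:
  fixes z :: "'a::real_vector \<times> real"
  shows "z + (0, s) + (0, - s) = z" "z + (0, - s) + (0, s) = z"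
  by (auto simp: prod_eq_iff)

lemma norm_add_square_le:
  fixes a b :: "'c::real_inner"
  shows "(norm (a + b))\<^sup>2 \<le> 2 * (norm a)\<^sup>2 + 2 * (norm b)\<^sup>2"
proof -
  have "(norm (a + b))\<^sup>2 \<le> (norm a + norm b)\<^sup>2" by (intro power_mono norm_triangle_ineq) auto
  also have "\<dots> \<le> 2 * (norm a)\<^sup>2 + 2 * (norm b)\<^sup>2"
    using sum_squares_bound[of "norm a" "norm b"] by (simp add: power2_sum)
  finally show ?thesis .
qed

section \<open>Mollified supersolutions and time shifts\<close>

context local_supersolution
begin

text \<open>Convergence in L^1 gives convergence almost everywhere along a subsequence, which the
  nonlinear functions of \<open>conv e w\<close> require; the L^2 convergence of
  \<open>conv e G\<close> survives the passage to it.\<close>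

lemma mollification_sequence:
  assumes "\<rho> > 0"
  shows "\<exists>e :: nat \<Rightarrow> real. (\<forall>n. 0 < e n \<and> e n < \<rho>) \<and> (AE z in lborel. (\<lambda>n. conv (e n) w z) \<longlonglongrightarrow> w z) \<and>
    (\<forall>n. integrable lborel (\<lambda>z. (norm (conv (e n) G z - G z))\<^sup>2)) \<and>
    (\<lambda>n. \<integral>z. (norm (conv (e n) G z - G z))\<^sup>2 \<partial>lborel) \<longlonglongrightarrow> 0"
proof -
  have "\<exists>e. 0 < e \<and> e < \<rho> \<and> integrable lborel (\<lambda>z. norm (conv e w z - w z)) \<and> (\<integral>z. norm (conv e w z - w z) \<partial>lborel) \<le> 1 / real (Suc n) \<and>
    integrable lborel (\<lambda>z. (norm (conv e G z - G z))\<^sup>2) \<and> (\<integral>z. (norm (conv e G z - G z))\<^sup>2 \<partial>lborel) \<le> 1 / real (Suc n)" for n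
  proof -
    have p: "1 / real (Suc n) > 0" by simp
    obtain d1 where d1: "d1 > 0" "\<forall>e. 0 < e \<and> e < d1 \<longrightarrow> integrable lborel (\<lambda>z. norm (conv e w z - w z)) \<and>
      (\<integral>z. norm (conv e w z - w z) \<partial>lborel) \<le> 1 / real (Suc n)"
      using conv_L1[OF w_integrable p] by blast
    obtain d2 where d2: "d2 > 0" "\<forall>e. 0 < e \<and> e < d2 \<longrightarrow> integrable lborel (\<lambda>z. (norm (conv e G z - G z))\<^sup>2) \<and>
      (\<integral>z. (norm (conv e G z - G z))\<^sup>2 \<partial>lborel) \<le> 1 / real (Suc n)"
      using conv_L2[OF G_integrable G2 p] by blast
    have "0 < min \<rho> (min d1 d2) / 2" "min \<rho> (min d1 d2) / 2 < \<rho>" "min \<rho> (min d1 d2) / 2 < d1" "min \<rho> (min d1 d2) / 2 < d2"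
      using assms d1(1) d2(1) by (auto simp: min_def)
    then show ?thesis using d1(2) d2(2) by blast
  qed
  from choice[OF allI[OF this]] obtain e where *: "\<forall>n. 0 < e n \<and> e n < \<rho> \<and> integrable lborel (\<lambda>z. norm (conv (e n) w z - w z)) \<and> (\<integral>z. norm (conv (e n) w z - w z) \<partial>lborel) \<le> 1 / real (Suc n) \<and>
    integrable lborel (\<lambda>z. (norm (conv (e n) G z - G z))\<^sup>2) \<and> (\<integral>z. (norm (conv (e n) G z - G z))\<^sup>2 \<partial>lborel) \<le> 1 / real (Suc n)"
    by (rule exE)
  then have e: "\<And>n. 0 < e n" "\<And>n. e n < \<rho>"
    "\<And>n. integrable lborel (\<lambda>z. norm (conv (e n) w z - w z))"
    "\<And>n. (\<integral>z. norm (conv (e n) w z - w z) \<partial>lborel) \<le> 1 / real (Suc n)"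
    "\<And>n. integrable lborel (\<lambda>z. (norm (conv (e n) G z - G z))\<^sup>2)"
    "\<And>n. (\<integral>z. (norm (conv (e n) G z - G z))\<^sup>2 \<partial>lborel) \<le> 1 / real (Suc n)"
    by (simp_all only: *)
  have lim: "(\<lambda>n. 1 / real (Suc n)) \<longlonglongrightarrow> 0" by (rule lim_1_over_n[THEN LIMSEQ_Suc])
  have "(\<lambda>n. \<integral>z. norm (conv (e n) w z - w z) \<partial>lborel) \<longlonglongrightarrow> 0"
    by (rule tendsto_sandwich[OF _ _ tendsto_const lim]) (use e(4) in auto)
  moreover have "integrable lborel (\<lambda>z. conv (e n) w z - w z)" for n
    by (rule integrable_norm_cancel[OF e(3)]) measurable
  ultimately obtain r :: "nat \<Rightarrow> nat" where r: "strict_mono r" "AE z in lborel. (\<lambda>n. conv (e (r n)) w z - w z) \<longlonglongrightarrow> 0"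
    using tendsto_L1_AE_subseq[of lborel "\<lambda>n z. conv (e n) w z - w z"] by blast
  have "(\<lambda>n. \<integral>z. (norm (conv (e n) G z - G z))\<^sup>2 \<partial>lborel) \<longlonglongrightarrow> 0"
    by (rule tendsto_sandwich[OF _ _ tendsto_const lim]) (use e(6) in auto)
  from LIMSEQ_subseq_LIMSEQ[OF this r(1)]
  have G: "(\<lambda>n. \<integral>z. (norm (conv (e (r n)) G z - G z))\<^sup>2 \<partial>lborel) \<longlonglongrightarrow> 0" by (simp add: o_def)
  show ?thesis
    by (intro exI[of _ "\<lambda>n. e (r n)"] conjI allI e G) (use r(2) in \<open>auto simp: LIM_zero_iff\<close>)
qed

text \<open>The test function will be \<open>\<phi> * \<psi> (conv e w)\<close>, whose time
  derivative is out of control as \<open>e\<close> shrinks. The mean value theorem in the shift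
  replaces that derivative by a difference over the step \<open>h\<close> and leaves only the
  spatial gradient. The intermediate shift \<open>s\<close> is unknown, so later estimates have to
  be uniform in it.\<close>

lemma time_translation_inequality:
  assumes \<Phi>: "has_grad \<Phi> D\<Phi>" "continuous_on UNIV D\<Phi>" "\<And>z. 0 \<le> \<Phi> z"
    and K: "\<And>z. z \<notin> K \<Longrightarrow> \<Phi> z = 0" "compact K"
    and r: "compact K'" "K' \<subseteq> D" "\<And>x y. x \<in> K \<Longrightarrow> norm y \<le> r \<Longrightarrow> x + y \<in> K'"
    and h: "0 < h" "h \<le> r"
  shows "\<exists>s. 0 < s \<and> s < h \<and> (\<integral>z. u z * (\<Phi> (z + (0, h)) - \<Phi> z) \<partial>lborel)
      \<le> h * (\<integral>z. G z \<bullet> fst (D\<Phi> (z + (0, s))) \<partial>lborel)"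
proof -
  obtain R where R: "\<And>z. R \<le> norm z \<Longrightarrow> \<Phi> z = 0"
    using compact_in_ball[OF K(2)] K(1) by metis
  have D0: "D\<Phi> z = 0" if "R \<le> norm z" for z
    using has_grad_zero_outside_cball[OF \<Phi>(1,2) R that] .
  note uc = uniformly_continuous_bounded_support[OF has_grad_continuous[OF \<Phi>(1)], of R, OF R]
    uniformly_continuous_bounded_support[OF \<Phi>(2), of R, OF D0]
  have [measurable]: "\<Phi> \<in> borel_measurable borel" "D\<Phi> \<in> borel_measurable borel"
    using continuous_borel_measurable has_grad_continuous[OF \<Phi>(1)] \<Phi>(2) by auto
  obtain B1 where B1: "\<And>z. norm (\<Phi> z) \<le> B1" using uc(2) unfolding bounded_iff by blast
  obtain B2 where B2: "\<And>z. norm (D\<Phi> z) \<le> B2" using uc(4) unfolding bounded_iff by blast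
  have iu\<Phi>: "integrable lborel (\<lambda>z. u z * \<Phi> (z + y))" for y
    using integrable_mult_bounded[OF u_integrable, of "\<lambda>z. \<Phi> (z + y)" B1] B1 by simp
  have iuD: "integrable lborel (\<lambda>z. u z *\<^sub>R D\<Phi> (z + y))" for y
    using integrable_mult_bounded[OF u_integrable, of "\<lambda>z. D\<Phi> (z + y)" B2] B2 by simp
  have iuDi: "integrable lborel (\<lambda>z. u z * (D\<Phi> (z + y) \<bullet> (0, 1)))" for y
    using integrable_inner_left[OF iuD[of y], of "(0, 1)"] by simp
  have iGD: "integrable lborel (\<lambda>z. G z \<bullet> fst (D\<Phi> (z + y)))" for y
  proof (rule Bochner_Integration.integrable_bound)
    show "integrable lborel (\<lambda>z. B2 * norm (G z))" using G_integrable by simp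
    have "\<bar>G z \<bullet> fst (D\<Phi> (z + y))\<bar> \<le> B2 * norm (G z)" for z
    proof -
      have "norm (fst (D\<Phi> (z + y))) \<le> B2"
        using B2[of "z + y"] norm_fst_le[of "fst (D\<Phi> (z + y))" "snd (D\<Phi> (z + y))"] by simp
      then show ?thesis
        using Cauchy_Schwarz_ineq2[of "G z" "fst (D\<Phi> (z + y))"] mult_left_mono[of _ B2 "norm (G z)"]
        by (smt (verit, best) mult.commute norm_ge_zero)
    qed
    then show "AE z in lborel. norm (G z \<bullet> fst (D\<Phi> (z + y))) \<le> norm (B2 * norm (G z))"
      by (intro AE_I2) (smt (verit) real_norm_def)
  qed simp
  define a where "a s = (\<integral>z. u z * \<Phi> ((0, s) + z) \<partial>lborel)" for s
  have "has_grad (\<lambda>y. \<integral>z. u z * \<Phi> (y + z) \<partial>lborel) (\<lambda>y. \<integral>z. u z *\<^sub>R D\<Phi> (y + z) \<partial>lborel)"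
    by (rule has_grad_parametric_integral[OF \<Phi>(1) uc(3,2,4) u_integrable]) measurable
  note A = has_gradD[OF this]
  have da: "(a has_real_derivative (\<integral>z. u z * (D\<Phi> (z + (0, s)) \<bullet> (0, 1)) \<partial>lborel)) (at s)" for s
  proof -
    have "((\<lambda>s. (0, s)) has_derivative (\<lambda>t. t *\<^sub>R (0 :: 'a, 1 :: real))) (at s)"
      by (auto intro!: derivative_eq_intros)
    from has_derivative_compose[OF this A]
    have "(a has_derivative (\<lambda>t. (\<integral>z. u z *\<^sub>R D\<Phi> ((0, s) + z) \<partial>lborel) \<bullet> (t *\<^sub>R (0, 1)))) (at s)"
      by (simp add: a_def[abs_def])
    then have *: "(a has_derivative (\<lambda>t. t * ((\<integral>z. u z *\<^sub>R D\<Phi> ((0, s) + z) \<partial>lborel) \<bullet> (0, 1)))) (at s)"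
      by (simp only: inner_scaleR_right)
    have eq: "(\<integral>z. u z *\<^sub>R D\<Phi> ((0, s) + z) \<partial>lborel) \<bullet> (0, 1) = (\<integral>z. u z * (D\<Phi> (z + (0, s)) \<bullet> (0, 1)) \<partial>lborel)"
      using integral_inner_left[of "(0, 1)" lborel "\<lambda>z. u z *\<^sub>R D\<Phi> (z + (0, s))"] iuD[of "(0, s)"]
      by (simp add: add.commute)
    show ?thesis
      unfolding has_field_derivative_def
      by (rule has_derivative_eq_rhs[OF *[unfolded eq]]) (simp add: fun_eq_iff mult.commute)
  qed
  obtain s where s: "0 < s" "s < h" "a h - a 0 = (h - 0) * (\<integral>z. u z * (D\<Phi> (z + (0, s)) \<bullet> (0, 1)) \<partial>lborel)"
    using MVT2[OF h(1), of a "\<lambda>s. \<integral>z. u z * (D\<Phi> (z + (0, s)) \<bullet> (0, 1)) \<partial>lborel"] da by blast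
  have "0 \<le> (\<integral>z. - u z * (D\<Phi> (z + (0, s)) \<bullet> (0, 1)) + G z \<bullet> fst (D\<Phi> (z + (0, s))) \<partial>lborel)"
  proof (rule supersolution_C1[OF has_grad_shift[OF \<Phi>(1)] _ \<Phi>(3) r(1,2)])
    show "continuous_on UNIV (\<lambda>z. D\<Phi> (z + (0, s)))"
      by (rule continuous_on_compose2[OF \<Phi>(2)]) (auto intro!: continuous_intros)
    fix z assume "z \<notin> K'"
    then have "z + (0, s) \<notin> K" using r(3)[of "z + (0, s)" "(0, - s)"] s h by (auto simp: norm_Pair time_shift_cancel)
    then show "\<Phi> (z + (0, s)) = 0" by (rule K(1))
  qed
  then have "(\<integral>z. u z * (D\<Phi> (z + (0, s)) \<bullet> (0, 1)) \<partial>lborel) \<le> (\<integral>z. G z \<bullet> fst (D\<Phi> (z + (0, s))) \<partial>lborel)"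
    using iuDi iGD by simp
  then have "a h - a 0 \<le> h * (\<integral>z. G z \<bullet> fst (D\<Phi> (z + (0, s))) \<partial>lborel)"
    using s h by simp
  moreover have "a h - a 0 = (\<integral>z. u z * (\<Phi> (z + (0, h)) - \<Phi> z) \<partial>lborel)"
    using iu\<Phi>[of "(0, h)"] iu\<Phi>[of 0] by (simp add: a_def right_diff_distrib add.commute zero_prod_def[symmetric])
  ultimately show ?thesis using s by auto
qed

end

text \<open>Formally the equation is tested with \<open>\<phi> * \<psi> (w)\<close>, where
  \<open>\<psi>\<close> is a decreasing C^1 approximation of the indicator of small values of
  \<open>w\<close>. Time terms collect in \<open>F (u)\<close>, space terms in \<open>P (w)\<close>.
  In the application \<open>F\<close> is a primitive of
  \<open>s \<mapsto> \<psi> (s powr m)\<close>, and the last condition on \<open>F\<close> is its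
  concavity.\<close>

locale truncated_test = local_supersolution m U s\<^sub>1 s\<^sub>2 w G
  for m and U :: "'a::euclidean_space set" and s\<^sub>1 s\<^sub>2 and w :: "'a \<times> real \<Rightarrow> real" and G :: "'a \<times> real \<Rightarrow> 'a" +
  fixes \<phi> :: "'a \<times> real \<Rightarrow> real" and D\<phi> H K
    and \<psi> \<psi>' P F :: "real \<Rightarrow> real" and C B \<kappa> :: real
  assumes hess: "has_hess \<phi> D\<phi> H" and \<phi>_nonneg: "\<And>z. 0 \<le> \<phi> z"
    and K: "compact K" "K \<subseteq> U \<times> {s\<^sub>1<..<s\<^sub>2}" "\<And>z. z \<notin> K \<Longrightarrow> \<phi> z = 0"
    and \<psi>: "\<And>s. (\<psi> has_real_derivative \<psi>' s) (at s)" "continuous_on UNIV \<psi>'"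
      "\<And>s. \<bar>\<psi>' s\<bar> \<le> C" "\<And>s. \<psi>' s \<le> 0" "\<And>s. 0 \<le> \<psi> s" "\<And>s. \<psi> s \<le> 1"
    and P: "\<And>s. (P has_real_derivative - \<psi> s) (at s)" "\<And>s. 0 \<le> s \<Longrightarrow> \<bar>P s\<bar> \<le> B"
    and F: "F \<in> borel_measurable borel" "F 0 = 0" "\<And>s. \<bar>F s\<bar> \<le> \<kappa>"
      "\<And>a b. 0 \<le> a \<Longrightarrow> 0 \<le> b \<Longrightarrow> (b - a) * \<psi> (b powr m) \<le> F b - F a"
begin

lemma \<phi>_continuous: "continuous_on UNIV \<phi>" and D\<phi>_continuous: "continuous_on UNIV D\<phi>"
  and H_continuous: "continuous_on UNIV (H v)"
  using has_hessD[OF hess] has_grad_continuous by auto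

lemma continuous_\<psi>: "continuous_on UNIV \<psi>" and continuous_P: "continuous_on UNIV P"
  using \<psi>(1) P(1) by (auto intro!: continuous_at_imp_continuous_on intro: DERIV_isCont)

lemma [measurable]: "\<phi> \<in> borel_measurable borel" "D\<phi> \<in> borel_measurable borel" "H v \<in> borel_measurable borel"
  "\<psi> \<in> borel_measurable borel" "\<psi>' \<in> borel_measurable borel" "P \<in> borel_measurable borel" "F \<in> borel_measurable borel"
  using \<phi>_continuous D\<phi>_continuous H_continuous[of v] continuous_\<psi> continuous_P \<psi>(2) F(1)
  by (blast intro: continuous_borel_measurable)+

lemma D\<phi>_outside: "z \<notin> K \<Longrightarrow> D\<phi> z = 0"
  by (rule has_grad_zero_outside[OF has_hessD(1)[OF hess], of "- K"])
    (use K(3) compact_imp_closed[OF K(1)] in \<open>auto simp: open_Compl\<close>)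

lemma H_outside: "z \<notin> K \<Longrightarrow> H v z = 0"
  by (rule has_grad_zero_outside[OF has_hessD(2)[OF hess], of "- K"])
    (use D\<phi>_outside compact_imp_closed[OF K(1)] in \<open>auto simp: open_Compl\<close>)

lemma bounded_by_compact:
  fixes f :: "'a \<times> real \<Rightarrow> 'c::euclidean_space"
  assumes "continuous_on UNIV f" "\<And>z. z \<notin> K \<Longrightarrow> f z = 0"
  shows "\<exists>M. \<forall>z. norm (f z) \<le> M" "integrable lborel f" "integrable lborel (\<lambda>z. (norm (f z))\<^sup>2)"
proof -
  obtain R where R: "\<And>z. R \<le> norm z \<Longrightarrow> z \<notin> K"
    using compact_in_ball[OF K(1)] by metis
  have z: "f z = 0" if "R \<le> norm z" for z using R assms(2) that by metis
  from uniformly_continuous_bounded_support(2)[OF assms(1), of R, OF z]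
  show "\<exists>M. \<forall>z. norm (f z) \<le> M" unfolding bounded_iff by blast
  show "integrable lborel f" by (rule integrable_continuous_bounded_support[OF assms(1) z])
  show "integrable lborel (\<lambda>z. (norm (f z))\<^sup>2)"
    by (rule integrable_continuous_bounded_support[of _ R])
      (use assms(1) z in \<open>auto intro!: continuous_intros\<close>)
qed

text \<open>The spatial gradient that the inadmissible test function
  \<open>\<phi> * \<psi> (w)\<close> would have by the product and chain rules. For small
  \<open>e\<close>, \<open>Ze e\<close> is the true spatial gradient of
  \<open>\<phi> * \<psi> (conv e w)\<close>, by \<open>grad_conv_w\<close>.\<close>

definition Z :: "'a \<times> real \<Rightarrow> 'a" where
  "Z z = \<psi> (w z) *\<^sub>R fst (D\<phi> z) + (\<phi> z * \<psi>' (w z)) *\<^sub>R G z"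

definition Ze :: "real \<Rightarrow> 'a \<times> real \<Rightarrow> 'a" where
  "Ze e z = \<psi> (conv e w z) *\<^sub>R fst (D\<phi> z) + (\<phi> z * \<psi>' (conv e w z)) *\<^sub>R conv e G z"

lemma Z_meas[measurable]: "Z \<in> borel_measurable borel" "Ze e \<in> borel_measurable borel"
  unfolding Z_def[abs_def] Ze_def[abs_def] by measurable

lemma fstD\<phi>: "integrable lborel (\<lambda>z. (norm (fst (D\<phi> z)))\<^sup>2)"
  "integrable lborel (\<lambda>z. fst (D\<phi> z))" "\<exists>M. \<forall>z. norm (fst (D\<phi> z)) \<le> M"
  by (rule bounded_by_compact; use D\<phi>_continuous D\<phi>_outside in \<open>auto intro!: continuous_intros\<close>)+

lemma Z_square: "integrable lborel (\<lambda>z. (norm (Z z))\<^sup>2)"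
proof -
  obtain M where M: "\<And>z. norm (\<phi> z) \<le> M" using bounded_by_compact(1)[OF \<phi>_continuous K(3)] by blast
  show ?thesis
  proof (rule Bochner_Integration.integrable_bound)
    show "integrable lborel (\<lambda>z. 2 * (norm (fst (D\<phi> z)))\<^sup>2 + 2 * (M * C)\<^sup>2 * (norm (G z))\<^sup>2)"
      using fstD\<phi>(1) G2 by simp
    have "(norm (Z z))\<^sup>2 \<le> 2 * (norm (fst (D\<phi> z)))\<^sup>2 + 2 * (M * C)\<^sup>2 * (norm (G z))\<^sup>2" for z
    proof -
      have 1: "(norm (\<psi> (w z) *\<^sub>R fst (D\<phi> z)))\<^sup>2 \<le> (norm (fst (D\<phi> z)))\<^sup>2"
        using \<psi>(5,6)[of "w z"] by (intro power_mono) (auto intro: mult_left_le_one_le)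
      have "norm ((\<phi> z * \<psi>' (w z)) *\<^sub>R G z) \<le> (M * C) * norm (G z)"
      proof -
        have "\<bar>\<phi> z\<bar> * \<bar>\<psi>' (w z)\<bar> \<le> M * C"
          using M[of z] \<psi>(3)[of "w z"] by (intro mult_mono) auto
        then show ?thesis unfolding norm_scaleR abs_mult by (rule mult_right_mono) simp
      qed
      then have 2: "(norm ((\<phi> z * \<psi>' (w z)) *\<^sub>R G z))\<^sup>2 \<le> (M * C)\<^sup>2 * (norm (G z))\<^sup>2"
        using power_mono[of "norm ((\<phi> z * \<psi>' (w z)) *\<^sub>R G z)" "(M * C) * norm (G z)" 2]
        by (simp add: power_mult_distrib)
      show ?thesis
        unfolding Z_def using norm_add_square_le[of "\<psi> (w z) *\<^sub>R fst (D\<phi> z)" "(\<phi> z * \<psi>' (w z)) *\<^sub>R G z"] 1 2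
        by linarith
    qed
    then show "AE z in lborel. norm ((norm (Z z))\<^sup>2) \<le> norm (2 * (norm (fst (D\<phi> z)))\<^sup>2 + 2 * (M * C)\<^sup>2 * (norm (G z))\<^sup>2)"
      by (intro AE_I2) (smt (verit) real_norm_def zero_le_power2)
  qed simp
qed

context
  fixes e :: "nat \<Rightarrow> real"
  assumes e: "\<And>n. 0 < e n" "AE z in lborel. (\<lambda>n. conv (e n) w z) \<longlonglongrightarrow> w z"
    "\<And>n. integrable lborel (\<lambda>z. (norm (conv (e n) G z - G z))\<^sup>2)"
    "(\<lambda>n. \<integral>z. (norm (conv (e n) G z - G z))\<^sup>2 \<partial>lborel) \<longlonglongrightarrow> 0"
begin

lemma \<psi>_conv_tendsto:
  "AE z in lborel. (\<lambda>n. \<psi> (conv (e n) w z)) \<longlonglongrightarrow> \<psi> (w z)"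
  "AE z in lborel. (\<lambda>n. \<psi>' (conv (e n) w z)) \<longlonglongrightarrow> \<psi>' (w z)"
  "AE z in lborel. (\<lambda>n. P (conv (e n) w z)) \<longlonglongrightarrow> P (w z)"
proof -
  have c: "isCont \<psi> s" "isCont \<psi>' s" "isCont P s" for s
    using continuous_\<psi> continuous_P \<psi>(2) by (simp_all add: continuous_on_eq_continuous_at)
  show "AE z in lborel. (\<lambda>n. \<psi> (conv (e n) w z)) \<longlonglongrightarrow> \<psi> (w z)"
    using e(2) by eventually_elim (rule isCont_tendsto_compose[OF c(1)])
  show "AE z in lborel. (\<lambda>n. \<psi>' (conv (e n) w z)) \<longlonglongrightarrow> \<psi>' (w z)"
    using e(2) by eventually_elim (rule isCont_tendsto_compose[OF c(2)])
  show "AE z in lborel. (\<lambda>n. P (conv (e n) w z)) \<longlonglongrightarrow> P (w z)"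
    using e(2) by eventually_elim (rule isCont_tendsto_compose[OF c(3)])
qed

text \<open>The difference splits into changes of the coefficients \<open>\<psi>\<close> and
  \<open>\<psi>'\<close>, which multiply fixed L^2 functions and yield to dominated convergence, and
  a bounded coefficient times \<open>conv (e n) G - G\<close>. The latter is small in L^2 without a
  common majorant, so it is kept apart.\<close>

lemma Ze_tendsto:
  "integrable lborel (\<lambda>z. (norm (Ze (e n) z - Z z))\<^sup>2)"
  "(\<lambda>n. \<integral>z. (norm (Ze (e n) z - Z z))\<^sup>2 \<partial>lborel) \<longlonglongrightarrow> 0"
proof -
  obtain M where M: "\<And>z. norm (\<phi> z) \<le> M" using bounded_by_compact(1)[OF \<phi>_continuous K(3)] by blast
  have M0: "0 \<le> M" using M[of 0] norm_ge_zero order_trans by blast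
  have C0: "0 \<le> C" using \<psi>(3)[of 0] by linarith
  let ?g = "\<lambda>n z. (norm (conv (e n) G z - G z))\<^sup>2"
  let ?R = "\<lambda>n z. 4 * ((\<psi> (conv (e n) w z) - \<psi> (w z))\<^sup>2 * (norm (fst (D\<phi> z)))\<^sup>2) + 4 * (M\<^sup>2 * (\<psi>' (conv (e n) w z) - \<psi>' (w z))\<^sup>2 * (norm (G z))\<^sup>2)"
  have le: "(norm (Ze (e n) z - Z z))\<^sup>2 \<le> ?R n z + 4 * ((M * C)\<^sup>2 * ?g n z)" for n z
  proof -
    let ?a = "(\<psi> (conv (e n) w z) - \<psi> (w z)) *\<^sub>R fst (D\<phi> z)"
    let ?b = "(\<phi> z * (\<psi>' (conv (e n) w z) - \<psi>' (w z))) *\<^sub>R G z"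
    let ?c = "(\<phi> z * \<psi>' (conv (e n) w z)) *\<^sub>R (conv (e n) G z - G z)"
    have "Ze (e n) z - Z z = ?a + (?b + ?c)"
      by (simp add: Ze_def Z_def algebra_simps)
    then have "(norm (Ze (e n) z - Z z))\<^sup>2 \<le> 2 * (norm ?a)\<^sup>2 + 4 * (norm ?b)\<^sup>2 + 4 * (norm ?c)\<^sup>2"
      using norm_add_square_le[of ?a "?b + ?c"] norm_add_square_le[of ?b ?c] by simp
    moreover have "(norm ?a)\<^sup>2 = (\<psi> (conv (e n) w z) - \<psi> (w z))\<^sup>2 * (norm (fst (D\<phi> z)))\<^sup>2"
      by (simp add: power_mult_distrib)
    moreover have "(norm ?b)\<^sup>2 \<le> M\<^sup>2 * (\<psi>' (conv (e n) w z) - \<psi>' (w z))\<^sup>2 * (norm (G z))\<^sup>2"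
      using power_mono[OF M[of z], of 2] by (auto simp: power_mult_distrib intro!: mult_right_mono)
    moreover have "(norm ?c)\<^sup>2 \<le> (M * C)\<^sup>2 * ?g n z"
    proof -
      have "(\<psi>' (conv (e n) w z))\<^sup>2 \<le> C\<^sup>2" using power_mono[OF \<psi>(3)[of "conv (e n) w z"], of 2] by simp
      then show ?thesis
        using power_mono[OF M[of z], of 2] by (auto simp: power_mult_distrib intro!: mult_right_mono mult_mono)
    qed
    moreover have "0 \<le> (\<psi> (conv (e n) w z) - \<psi> (w z))\<^sup>2 * (norm (fst (D\<phi> z)))\<^sup>2" by simp
    ultimately show ?thesis by linarith
  qed
  let ?W = "\<lambda>z. 4 * (norm (fst (D\<phi> z)))\<^sup>2 + 4 * M\<^sup>2 * (2 * C)\<^sup>2 * (norm (G z))\<^sup>2"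
  have W: "integrable lborel ?W" using fstD\<phi>(1) G2 by simp
  have RW: "\<bar>?R n z\<bar> \<le> ?W z" for n z
  proof -
    have "\<bar>\<psi> (conv (e n) w z) - \<psi> (w z)\<bar> \<le> 1"
      using \<psi>(5,6)[of "w z"] \<psi>(5,6)[of "conv (e n) w z"] by linarith
    then have 1: "(\<psi> (conv (e n) w z) - \<psi> (w z))\<^sup>2 \<le> 1" by (simp add: abs_square_le_1)
    have "\<bar>\<psi>' (conv (e n) w z) - \<psi>' (w z)\<bar> \<le> 2 * C"
      using \<psi>(3)[of "w z"] \<psi>(3)[of "conv (e n) w z"] by linarith
    from power_mono[OF this, of 2] have 2: "(\<psi>' (conv (e n) w z) - \<psi>' (w z))\<^sup>2 \<le> (2 * C)\<^sup>2" by simp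
    have "0 \<le> ?R n z" by simp
    moreover have "?R n z \<le> ?W z"
      using mult_right_mono[OF 1, of "4 * (norm (fst (D\<phi> z)))\<^sup>2"] mult_right_mono[OF 2, of "4 * M\<^sup>2 * (norm (G z))\<^sup>2"]
      by (simp add: mult_ac)
    ultimately show ?thesis by linarith
  qed
  have R: "(\<lambda>n. \<integral>z. ?R n z \<partial>lborel) \<longlonglongrightarrow> (\<integral>z. (0::real) \<partial>(lborel :: ('a \<times> real) measure))"
  proof (rule integral_dominated_convergence[OF _ _ W])
    show "AE z in lborel. (\<lambda>n. ?R n z) \<longlonglongrightarrow> 0"
      using \<psi>_conv_tendsto(1,2)
    proof eventually_elim
      case (elim z)
      have "(\<lambda>n. ?R n z) \<longlonglongrightarrow> 4 * ((\<psi> (w z) - \<psi> (w z))\<^sup>2 * (norm (fst (D\<phi> z)))\<^sup>2) + 4 * (M\<^sup>2 * (\<psi>' (w z) - \<psi>' (w z))\<^sup>2 * (norm (G z))\<^sup>2)"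
        by (intro tendsto_intros elim)
      then show ?case by simp
    qed
    show "AE z in lborel. norm (?R n z) \<le> ?W z" for n using RW by simp
  qed measurable
  have iR: "integrable lborel (?R n)" for n
  proof (rule Bochner_Integration.integrable_bound[OF W])
    show "AE z in lborel. norm (?R n z) \<le> norm (?W z)"
      unfolding real_norm_def by (intro AE_I2 order_trans[OF RW abs_ge_self])
  qed measurable
  have iRg: "integrable lborel (\<lambda>z. ?R n z + 4 * ((M * C)\<^sup>2 * ?g n z))" for n
  proof (rule Bochner_Integration.integrable_add)
    show "integrable lborel (?R n)" by (rule iR)
    show "integrable lborel (\<lambda>z. 4 * ((M * C)\<^sup>2 * ?g n z))" by (intro integrable_mult_right e(3))
  qed
  show iZ: "integrable lborel (\<lambda>z. (norm (Ze (e n) z - Z z))\<^sup>2)" for n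
  proof (rule Bochner_Integration.integrable_bound[OF iRg[of n]])
    have "norm ((norm (Ze (e n) z - Z z))\<^sup>2) \<le> norm (?R n z + 4 * ((M * C)\<^sup>2 * ?g n z))" for z
    proof -
      have "(norm (Ze (e n) z - Z z))\<^sup>2 \<le> ?R n z + 4 * ((M * C)\<^sup>2 * ?g n z)" by (rule le)
      also have "\<dots> \<le> \<bar>?R n z + 4 * ((M * C)\<^sup>2 * ?g n z)\<bar>" by (rule abs_ge_self)
      finally show ?thesis by (simp only: real_norm_def abs_power2)
    qed
    then show "AE z in lborel. norm ((norm (Ze (e n) z - Z z))\<^sup>2) \<le> norm (?R n z + 4 * ((M * C)\<^sup>2 * ?g n z))"
      by (intro AE_I2)
  qed measurable
  define I where "I n = (\<integral>z. (norm (Ze (e n) z - Z z))\<^sup>2 \<partial>lborel)" for n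
  define J where "J n = (\<integral>z. ?R n z \<partial>lborel)" for n
  define g where "g n = (\<integral>z. ?g n z \<partial>lborel)" for n
  have IJ: "I n \<le> J n + 4 * ((M * C)\<^sup>2 * g n)" for n
  proof -
    have "I n \<le> (\<integral>z. ?R n z + 4 * ((M * C)\<^sup>2 * ?g n z) \<partial>lborel)"
      unfolding I_def
    proof (rule integral_mono)
      show "integrable lborel (\<lambda>z. (norm (Ze (e n) z - Z z))\<^sup>2)" by (rule iZ)
      show "integrable lborel (\<lambda>z. ?R n z + 4 * ((M * C)\<^sup>2 * ?g n z))" by (rule iRg)
    qed (rule le)
    also have "\<dots> = J n + (\<integral>z. 4 * ((M * C)\<^sup>2 * ?g n z) \<partial>lborel)"
      unfolding J_def
    proof (rule Bochner_Integration.integral_add)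
      show "integrable lborel (?R n)" by (rule iR)
      show "integrable lborel (\<lambda>z. 4 * ((M * C)\<^sup>2 * ?g n z))" by (intro integrable_mult_right e(3))
    qed
    also have "(\<integral>z. 4 * ((M * C)\<^sup>2 * ?g n z) \<partial>lborel) = 4 * ((M * C)\<^sup>2 * g n)"
      unfolding g_def by (simp only: integral_mult_right_zero)
    finally show ?thesis .
  qed
  have "J \<longlonglongrightarrow> 0" using R by (simp add: J_def[abs_def])
  moreover have "g \<longlonglongrightarrow> 0" using e(4) by (simp add: g_def[abs_def])
  ultimately have "(\<lambda>n. J n + 4 * ((M * C)\<^sup>2 * g n)) \<longlonglongrightarrow> 0 + 4 * ((M * C)\<^sup>2 * 0)"
    by (intro tendsto_add tendsto_mult tendsto_const)
  moreover have "0 \<le> I n" for n by (simp add: I_def)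
  ultimately have "I \<longlonglongrightarrow> 0"
    using IJ by (intro tendsto_sandwich[OF _ _ tendsto_const, of _ I _ "\<lambda>n. J n + 4 * ((M * C)\<^sup>2 * g n)"]) simp_all
  then show "(\<lambda>n. \<integral>z. (norm (Ze (e n) z - Z z))\<^sup>2 \<partial>lborel) \<longlonglongrightarrow> 0"
    by (simp only: I_def[abs_def])
qed

end

end

section \<open>Removing the mollification and the time step\<close>

context truncated_test
begin

lemma integrable_u_mult:
  assumes [measurable]: "f \<in> borel_measurable borel" and "\<And>z. \<bar>f z\<bar> \<le> M"
  shows "integrable lborel (\<lambda>z. u (z + a) * f z)"
proof -
  have "integrable lborel (\<lambda>z. u (z + a))"
    using u_integrable by (simp add: lborel_translation(2))
  from integrable_mult_bounded[OF this, of f M] assms(2) show ?thesis by simp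
qed

text \<open>The mollification is removed first, at a fixed step \<open>h\<close>. The intermediate
  shift \<open>s\<close> from \<open>time_translation_inequality\<close> changes with
  \<open>n\<close>, so no limit of it is taken; the shifted \<open>G\<close> is compared with
  \<open>G\<close> through the bound \<open>\<eta>\<close>, valid for all
  \<open>s < h\<close>.\<close>

lemma truncated_step:
  assumes r: "r > 0" "compact K'" "K' \<subseteq> D" "\<And>x y. x \<in> K \<Longrightarrow> norm y \<le> r \<Longrightarrow> x + y \<in> K'"
    and h: "0 < h" "h \<le> r"
    and \<eta>: "\<And>s. 0 < s \<Longrightarrow> s < h \<Longrightarrow> integrable lborel (\<lambda>z. (norm (G (z + (0, - s)) - G z))\<^sup>2) \<and>
        (\<integral>z. (norm (G (z + (0, - s)) - G z))\<^sup>2 \<partial>lborel) \<le> \<eta>"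
  shows "(\<integral>z. (u (z + (0, - h)) - u z) * (\<phi> z * \<psi> (w z)) \<partial>lborel)
      \<le> h * ((\<integral>z. G z \<bullet> Z z \<partial>lborel) + sqrt \<eta> * sqrt (\<integral>z. (norm (Z z))\<^sup>2 \<partial>lborel))"
proof -
  obtain e :: "nat \<Rightarrow> real" where e: "\<And>n. 0 < e n" "\<And>n. e n < r" "AE z in lborel. (\<lambda>n. conv (e n) w z) \<longlonglongrightarrow> w z"
    "\<And>n. integrable lborel (\<lambda>z. (norm (conv (e n) G z - G z))\<^sup>2)"
    "(\<lambda>n. \<integral>z. (norm (conv (e n) G z - G z))\<^sup>2 \<partial>lborel) \<longlonglongrightarrow> 0"
    using mollification_sequence[OF r(1)] by blast
  note Ze = Ze_tendsto[of e, OF e(1,3,4,5)]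
  obtain M where M: "\<And>z. norm (\<phi> z) \<le> M" using bounded_by_compact(1)[OF \<phi>_continuous K(3)] by blast
  have M\<psi>: "\<bar>\<phi> z * \<psi> s\<bar> \<le> M" for z s
    using mult_mono[of "\<bar>\<phi> z\<bar>" M "\<bar>\<psi> s\<bar>" 1] M[of z] \<psi>(5,6)[of s] by (simp add: abs_mult)
  define L where "L n = (\<integral>z. (u (z + (0, - h)) - u z) * (\<phi> z * \<psi> (conv (e n) w z)) \<partial>lborel)" for n
  define I where "I n = (\<integral>z. (norm (Ze (e n) z - Z z))\<^sup>2 \<partial>lborel)" for n
  define c where "c = (\<integral>z. G z \<bullet> Z z \<partial>lborel) + sqrt \<eta> * sqrt (\<integral>z. (norm (Z z))\<^sup>2 \<partial>lborel)"
  define g where "g = sqrt (\<integral>z. (norm (G z))\<^sup>2 \<partial>lborel)"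
  have "L n \<le> h * (c + g * sqrt (I n))" for n
  proof -
    define \<Phi> where "\<Phi> = (\<lambda>z. \<phi> z * \<psi> (conv (e n) w z))"
    define D\<Phi> where "D\<Phi> = (\<lambda>z. \<psi> (conv (e n) w z) *\<^sub>R D\<phi> z + \<phi> z *\<^sub>R (\<psi>' (conv (e n) w z) *\<^sub>R grad (conv (e n) w) z))"
    have [measurable]: "\<Phi> \<in> borel_measurable borel" unfolding \<Phi>_def by measurable
    note sc = smooth_has_grad[OF smooth_conv(1)[OF w_integrable e(1)[of n]]]
    have cw: "continuous_on UNIV (conv (e n) w)" using has_grad_continuous[OF sc(1)] .
    have gr: "has_grad \<Phi> D\<Phi>"
      unfolding \<Phi>_def D\<Phi>_def
      by (rule has_grad_mult[OF has_hessD(1)[OF hess] has_grad_compose[OF sc(1) \<psi>(1)]])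
    have co: "continuous_on UNIV D\<Phi>"
      unfolding D\<Phi>_def
      by (intro continuous_intros continuous_on_compose2[OF continuous_\<psi> cw] continuous_on_compose2[OF \<psi>(2) cw]
          D\<phi>_continuous \<phi>_continuous sc(3)) auto
    have nn: "0 \<le> \<Phi> z" for z unfolding \<Phi>_def using \<phi>_nonneg \<psi>(5) by simp
    have out: "\<Phi> z = 0" if "z \<notin> K" for z unfolding \<Phi>_def using K(3)[OF that] by simp
    have fst: "fst (D\<Phi> z) = Ze (e n) z" for z
    proof (cases "z \<in> K")
      case True
      have "cball z (e n) \<subseteq> K'"
      proof
        fix y assume "y \<in> cball z (e n)"
        then have "norm (y - z) \<le> r" using e(2)[of n] by (simp add: dist_norm norm_minus_commute)
        from r(4)[OF True this] show "y \<in> K'" by simp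
      qed
      then have "fst (grad (conv (e n) w) z) = conv (e n) G z"
        using r(3) by (intro grad_conv_w e) auto
      then show ?thesis by (simp add: D\<Phi>_def Ze_def)
    next
      case False
      then show ?thesis by (simp add: D\<Phi>_def Ze_def K(3))
    qed
    obtain s where s: "0 < s" "s < h"
      "(\<integral>z. u z * (\<Phi> (z + (0, h)) - \<Phi> z) \<partial>lborel) \<le> h * (\<integral>z. G z \<bullet> Ze (e n) (z + (0, s)) \<partial>lborel)"
      using time_translation_inequality[OF gr co nn out K(1) r(2-4) h] unfolding fst by blast
    have b\<Phi>: "\<bar>\<Phi> z\<bar> \<le> M" for z unfolding \<Phi>_def by (rule M\<psi>)
    have i1: "integrable lborel (\<lambda>z. u (z + (0, - h)) * \<Phi> z)" and i2: "integrable lborel (\<lambda>z. u z * \<Phi> z)"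
      using integrable_u_mult[of \<Phi> M "(0, - h)"] integrable_u_mult[of \<Phi> M 0] b\<Phi> by auto
    have t: "(\<lambda>z. u z * \<Phi> (z + (0, h))) = (\<lambda>z. (\<lambda>z. u (z + (0, - h)) * \<Phi> z) (z + (0, h)))"
      by (simp add: time_shift_cancel)
    have i3: "integrable lborel (\<lambda>z. u z * \<Phi> (z + (0, h)))"
      unfolding t by (subst lborel_translation(2)) (use i1 in auto)
    have t1: "(\<integral>z. u z * \<Phi> (z + (0, h)) \<partial>lborel) = (\<integral>z. u (z + (0, - h)) * \<Phi> z \<partial>lborel)"
      unfolding t by (subst lborel_translation(1)) auto
    have "L n = (\<integral>z. u (z + (0, - h)) * \<Phi> z - u z * \<Phi> z \<partial>lborel)"
      unfolding L_def \<Phi>_def by (simp add: algebra_simps)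
    also have "\<dots> = (\<integral>z. u z * (\<Phi> (z + (0, h)) - \<Phi> z) \<partial>lborel)"
      using i1 i2 i3 t1 by (simp add: right_diff_distrib)
    also have "\<dots> \<le> h * (\<integral>z. G z \<bullet> Ze (e n) (z + (0, s)) \<partial>lborel)" by (rule s)
    also have "(\<integral>z. G z \<bullet> Ze (e n) (z + (0, s)) \<partial>lborel) = (\<integral>z. G (z + (0, - s)) \<bullet> Ze (e n) z \<partial>lborel)"
      using lborel_translation(1)[of "\<lambda>z. G (z + (0, - s)) \<bullet> Ze (e n) z" "(0, s)"]
      by (simp add: time_shift_cancel)
    \<comment> \<open>Three parts: the mollification error, which vanishes with \<open>n\<close>;
      the shift error, bounded through \<open>\<eta>\<close> uniformly in \<open>s\<close>; and the
      pairing of \<open>G\<close> with \<open>Z\<close>, the intended limit.\<close>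
    also have "\<dots> \<le> c + g * sqrt (I n)"
    proof -
      let ?Gs = "\<lambda>z. G (z + (0, - s))"
      have Gs2: "integrable lborel (\<lambda>z. (norm (?Gs z))\<^sup>2)" "(\<integral>z. (norm (?Gs z))\<^sup>2 \<partial>lborel) = (\<integral>z. (norm (G z))\<^sup>2 \<partial>lborel)"
        using lborel_translation[of "\<lambda>z. (norm (G z))\<^sup>2" "(0, - s)"] G2 by auto
      have "?Gs \<in> borel_measurable lborel" by measurable
      note cs1 = integral_inner_Cauchy_Schwarz[OF this _ Gs2(1) Ze(1)[of n]]
      note cs2 = integral_inner_Cauchy_Schwarz[OF _ _ conjunct1[OF \<eta>[OF s(1,2)]] Z_square]
      note cs3 = integral_inner_Cauchy_Schwarz[OF _ _ G2 Z_square]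
      have j1: "integrable lborel (\<lambda>z. ?Gs z \<bullet> (Ze (e n) z - Z z))" by (rule cs1(1)) measurable
      have j2: "integrable lborel (\<lambda>z. (?Gs z - G z) \<bullet> Z z)" by (rule cs2(1)) measurable
      have j3: "integrable lborel (\<lambda>z. G z \<bullet> Z z)" by (rule cs3(1)) measurable
      have "(\<integral>z. ?Gs z \<bullet> (Ze (e n) z - Z z) \<partial>lborel) \<le> g * sqrt (I n)"
        using cs1(2) unfolding Gs2(2) g_def I_def by (simp add: abs_le_iff)
      moreover have "(\<integral>z. (?Gs z - G z) \<bullet> Z z \<partial>lborel) \<le> sqrt \<eta> * sqrt (\<integral>z. (norm (Z z))\<^sup>2 \<partial>lborel)"
      proof -
        have "(\<integral>z. (?Gs z - G z) \<bullet> Z z \<partial>lborel) \<le> sqrt (\<integral>z. (norm (?Gs z - G z))\<^sup>2 \<partial>lborel) * sqrt (\<integral>z. (norm (Z z))\<^sup>2 \<partial>lborel)"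
          using cs2(2) by (simp add: abs_le_iff)
        also have "\<dots> \<le> sqrt \<eta> * sqrt (\<integral>z. (norm (Z z))\<^sup>2 \<partial>lborel)"
          using \<eta>[OF s(1,2)] by (intro mult_right_mono) auto
        finally show ?thesis .
      qed
      moreover have "(\<integral>z. ?Gs z \<bullet> Ze (e n) z \<partial>lborel) =
         (\<integral>z. ?Gs z \<bullet> (Ze (e n) z - Z z) \<partial>lborel) + (\<integral>z. (?Gs z - G z) \<bullet> Z z \<partial>lborel) + (\<integral>z. G z \<bullet> Z z \<partial>lborel)"
      proof -
        have "(\<lambda>z. ?Gs z \<bullet> Ze (e n) z) = (\<lambda>z. ?Gs z \<bullet> (Ze (e n) z - Z z) + (?Gs z - G z) \<bullet> Z z + G z \<bullet> Z z)"
          by (simp add: inner_diff_left inner_diff_right)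
        then show ?thesis
          using Bochner_Integration.integral_add[OF Bochner_Integration.integrable_add[OF j1 j2] j3]
            Bochner_Integration.integral_add[OF j1 j2] by (simp only:)
      qed
      ultimately show ?thesis unfolding c_def by linarith
    qed
    finally show ?thesis using h by simp
  qed
  moreover have "L \<longlonglongrightarrow> (\<integral>z. (u (z + (0, - h)) - u z) * (\<phi> z * \<psi> (w z)) \<partial>lborel)"
    unfolding L_def[abs_def]
  proof (rule integral_dominated_convergence)
    show "integrable lborel (\<lambda>z. M * (u (z + (0, - h)) + u z))"
      using u_integrable by (simp add: lborel_translation(2))
    show "AE z in lborel. (\<lambda>n. (u (z + (0, - h)) - u z) * (\<phi> z * \<psi> (conv (e n) w z)))
        \<longlonglongrightarrow> (u (z + (0, - h)) - u z) * (\<phi> z * \<psi> (w z))"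
      using \<psi>_conv_tendsto(1)[of e, OF e(1,3,4,5)] by eventually_elim (intro tendsto_intros)
    show "AE z in lborel. norm ((u (z + (0, - h)) - u z) * (\<phi> z * \<psi> (conv (e n) w z))) \<le> M * (u (z + (0, - h)) + u z)" for n
    proof (rule AE_I2)
      fix z
      have "\<bar>u (z + (0, - h)) - u z\<bar> * \<bar>\<phi> z * \<psi> (conv (e n) w z)\<bar> \<le> (u (z + (0, - h)) + u z) * M"
        using M\<psi>[of z "conv (e n) w z"] u_nonneg[of "z + (0, - h)"] u_nonneg[of z] by (intro mult_mono) auto
      then show "norm ((u (z + (0, - h)) - u z) * (\<phi> z * \<psi> (conv (e n) w z))) \<le> M * (u (z + (0, - h)) + u z)"
        by (simp add: abs_mult mult.commute[of M])
    qed
  qed measurable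
  moreover have "I \<longlonglongrightarrow> 0" using Ze(2) by (simp only: I_def[abs_def])
  then have "(\<lambda>n. h * (c + g * sqrt (I n))) \<longlonglongrightarrow> h * (c + g * sqrt 0)"
    by (intro tendsto_mult tendsto_add tendsto_const tendsto_real_sqrt)
  ultimately have "(\<integral>z. (u (z + (0, - h)) - u z) * (\<phi> z * \<psi> (w z)) \<partial>lborel) \<le> h * (c + g * sqrt 0)"
    by (intro LIMSEQ_le) auto
  then show ?thesis by (simp add: c_def)
qed

lemma F_u: "integrable lborel (\<lambda>z. F (u z))"
  by (rule integrable_bounded_on_D[where B = \<kappa>]) (use u_outside F in auto)

text \<open>The left side is the derivative at 0 of \<open>b\<close>, the integral of
  \<open>F (u)\<close> against time translates of \<open>\<phi>\<close>. Its difference quotients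
  from the right are bounded through the concavity condition on \<open>F\<close> and
  \<open>truncated_step\<close>, with an error made small by continuity of translations in
  L^2.\<close>

lemma truncated_time_derivative:
  "(\<integral>z. F (u z) * (D\<phi> z \<bullet> (0, 1)) \<partial>lborel) \<le> (\<integral>z. G z \<bullet> Z z \<partial>lborel)"
proof (rule field_le_epsilon)
  fix \<epsilon> :: real assume \<epsilon>: "\<epsilon> > 0"
  obtain r K' where r: "r > 0" "compact K'" "K' \<subseteq> D" "\<And>x y. x \<in> K \<Longrightarrow> norm y \<le> r \<Longrightarrow> x + y \<in> K'"
    using compact_neighbourhood[OF K(1) open_D K(2)] by metis
  obtain M where M: "\<And>z. norm (\<phi> z) \<le> M" using bounded_by_compact(1)[OF \<phi>_continuous K(3)] by blast
  let ?z = "sqrt (\<integral>z. (norm (Z z))\<^sup>2 \<partial>lborel)"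
  \<comment> \<open>Chosen so that the shift error \<open>sqrt \<eta> * ?z\<close> is at most
    \<open>\<epsilon>\<close>; the \<open>+ 1\<close> covers a vanishing \<open>Z\<close>.\<close>
  define \<eta> where "\<eta> = (\<epsilon> / (?z + 1))\<^sup>2"
  have z0: "0 \<le> ?z" by simp
  have \<eta>: "\<eta> > 0" "sqrt \<eta> * ?z \<le> \<epsilon>"
  proof -
    have p: "0 < \<epsilon> / (?z + 1)" using \<epsilon> z0 by (intro divide_pos_pos) linarith+
    then show "\<eta> > 0" unfolding \<eta>_def by (rule zero_less_power)
    have "\<epsilon> / (a + 1) * a \<le> \<epsilon>" if "0 \<le> a" for a using that \<epsilon> by (simp add: field_simps)
    from this[OF z0] show "sqrt \<eta> * ?z \<le> \<epsilon>" unfolding \<eta>_def real_sqrt_abs abs_of_pos[OF p] .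
  qed
  obtain d where d: "d > 0" "\<And>a. norm a < d \<Longrightarrow> integrable lborel (\<lambda>z. (norm (G (z + a) - G z))\<^sup>2) \<and>
     (\<integral>z. (norm (G (z + a) - G z))\<^sup>2 \<partial>lborel) \<le> \<eta>"
    using L2_translation_continuous[OF G_meas G2 \<eta>(1)] by blast
  let ?c = "(\<integral>z. G z \<bullet> Z z \<partial>lborel) + \<epsilon>"
  define b where "b s = (\<integral>z. F (u z) * \<phi> ((0, s) + z) \<partial>lborel)" for s
  obtain R where R: "\<And>z. R \<le> norm z \<Longrightarrow> z \<notin> K" using compact_in_ball[OF K(1)] by metis
  note uc1 = uniformly_continuous_bounded_support[OF \<phi>_continuous, of R, OF K(3)[OF R]]
  note uc2 = uniformly_continuous_bounded_support[OF D\<phi>_continuous, of R, OF D\<phi>_outside[OF R]]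
  have iF: "integrable lborel (\<lambda>z. F (u z) * \<phi> (z + a))" for a
    using integrable_mult_bounded[OF F_u, of "\<lambda>z. \<phi> (z + a)" M] M by simp
  have "has_grad (\<lambda>y. \<integral>z. F (u z) * \<phi> (y + z) \<partial>lborel) (\<lambda>y. \<integral>z. F (u z) *\<^sub>R D\<phi> (y + z) \<partial>lborel)"
    by (rule has_grad_parametric_integral[OF has_hessD(1)[OF hess] uc2(1) uc1(2) uc2(2) F_u]) measurable
  note A = has_gradD[OF this, of "(0, 0)"]
  have db: "(b has_real_derivative (\<integral>z. F (u z) * (D\<phi> z \<bullet> (0, 1)) \<partial>lborel)) (at 0)"
  proof -
    have "((\<lambda>s. (0, s)) has_derivative (\<lambda>t. t *\<^sub>R (0 :: 'a, 1 :: real))) (at 0)"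
      by (auto intro!: derivative_eq_intros)
    moreover have "((\<lambda>y. \<integral>z. F (u z) * \<phi> (y + z) \<partial>lborel) has_derivative
       (\<lambda>v. (\<integral>z. F (u z) *\<^sub>R D\<phi> z \<partial>lborel) \<bullet> v)) (at (0, 0))"
    proof -
      have "(0, 0) + z = z" for z :: "'a \<times> real" by (cases z) simp
      then show ?thesis using A by simp
    qed
    ultimately have "(b has_derivative (\<lambda>t. (\<integral>z. F (u z) *\<^sub>R D\<phi> z \<partial>lborel) \<bullet> (t *\<^sub>R (0, 1)))) (at 0)"
      unfolding b_def[abs_def] by (rule has_derivative_compose)
    then have *: "(b has_derivative (\<lambda>t. t * ((\<integral>z. F (u z) *\<^sub>R D\<phi> z \<partial>lborel) \<bullet> (0, 1)))) (at 0)"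
      by (simp only: inner_scaleR_right)
    obtain M' where "\<And>z. norm (D\<phi> z) \<le> M'" using uc2(2) unfolding bounded_iff by blast
    then have "integrable lborel (\<lambda>z. F (u z) *\<^sub>R D\<phi> z)"
      using integrable_mult_bounded[OF F_u, of D\<phi> M'] by simp
    then have eq: "(\<integral>z. F (u z) *\<^sub>R D\<phi> z \<partial>lborel) \<bullet> (0, 1) = (\<integral>z. F (u z) * (D\<phi> z \<bullet> (0, 1)) \<partial>lborel)"
      using integral_inner_left[of "(0, 1)" lborel "\<lambda>z. F (u z) *\<^sub>R D\<phi> z"] by simp
    show ?thesis
      unfolding has_field_derivative_def
      by (rule has_derivative_eq_rhs[OF *[unfolded eq]]) (simp add: fun_eq_iff mult.commute)
  qed
  have "((\<lambda>h. (b h - b 0) / h) \<longlongrightarrow> (\<integral>z. F (u z) * (D\<phi> z \<bullet> (0, 1)) \<partial>lborel)) (at_right 0)"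
    using db unfolding has_field_derivative_iff by (simp add: filterlim_at_split)
  moreover have "\<forall>\<^sub>F h in at_right 0. (b h - b 0) / h \<le> ?c"
  proof (rule eventually_at_rightI)
    show "0 < min d r" using d(1) r(1) by simp
    fix h assume "h \<in> {0<..<min d r}"
    then have h: "0 < h" "h < d" "h \<le> r" by auto
    have iFu: "integrable lborel (\<lambda>z. F (u (z + a)) * \<phi> z)" for a
    proof -
      have "integrable lborel (\<lambda>z. F (u (z + a)))"
        using F_u lborel_translation(2)[of "\<lambda>z. F (u z)" a] by simp
      from integrable_mult_bounded[OF this, of \<phi> M] M show ?thesis by simp
    qed
    have M\<psi>: "\<bar>\<phi> z * \<psi> (w z)\<bar> \<le> M" for z
      using mult_mono[of "\<bar>\<phi> z\<bar>" M "\<bar>\<psi> (w z)\<bar>" 1] M[of z] \<psi>(5,6)[of "w z"] by (simp add: abs_mult)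
    have "b h - b 0 = (\<integral>z. F (u z) * \<phi> (z + (0, h)) \<partial>lborel) - (\<integral>z. F (u z) * \<phi> z \<partial>lborel)"
      by (simp add: b_def add.commute zero_prod_def[symmetric])
    also have "(\<integral>z. F (u z) * \<phi> (z + (0, h)) \<partial>lborel) = (\<integral>z. F (u (z + (0, - h))) * \<phi> z \<partial>lborel)"
      using lborel_translation(1)[of "\<lambda>z. F (u (z + (0, - h))) * \<phi> z" "(0, h)"]
      by (simp add: time_shift_cancel)
    also have "\<dots> - (\<integral>z. F (u z) * \<phi> z \<partial>lborel) = (\<integral>z. F (u (z + (0, - h))) * \<phi> z - F (u z) * \<phi> z \<partial>lborel)"
      using iFu[of "(0, - h)"] iFu[of 0] by simp
    also have "\<dots> \<le> (\<integral>z. (u (z + (0, - h)) - u z) * (\<phi> z * \<psi> (w z)) \<partial>lborel)"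
    proof (rule integral_mono)
      show "integrable lborel (\<lambda>z. F (u (z + (0, - h))) * \<phi> z - F (u z) * \<phi> z)"
        using iFu[of "(0, - h)"] iFu[of 0] by simp
      show "integrable lborel (\<lambda>z. (u (z + (0, - h)) - u z) * (\<phi> z * \<psi> (w z)))"
        using integrable_u_mult[of "\<lambda>z. \<phi> z * \<psi> (w z)" M "(0, - h)"] integrable_u_mult[of "\<lambda>z. \<phi> z * \<psi> (w z)" M 0] M\<psi>
        by (simp add: left_diff_distrib)
      fix z
      \<comment> \<open>Concavity with the tangent taken at the later time, because the test
        function evaluates \<open>\<psi>\<close> at the unshifted point.\<close>
      have "(u z - u (z + (0, - h))) * \<psi> (w z) \<le> F (u z) - F (u (z + (0, - h)))"
        using F(4)[OF u_nonneg[of "z + (0, - h)"] u_nonneg[of z]] by (simp add: u_powr)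
      from mult_right_mono[OF this \<phi>_nonneg[of z]]
      show "F (u (z + (0, - h))) * \<phi> z - F (u z) * \<phi> z \<le> (u (z + (0, - h)) - u z) * (\<phi> z * \<psi> (w z))"
        by (simp add: algebra_simps)
    qed
    also have "\<dots> \<le> h * ((\<integral>z. G z \<bullet> Z z \<partial>lborel) + sqrt \<eta> * ?z)"
    proof (rule truncated_step[OF r h(1,3)])
      fix s assume "0 < s" "s < h"
      then have "norm (0 :: 'a, - s) < d" using h by (simp add: norm_Pair)
      from d(2)[OF this]
      show "integrable lborel (\<lambda>z. (norm (G (z + (0, - s)) - G z))\<^sup>2) \<and>
        (\<integral>z. (norm (G (z + (0, - s)) - G z))\<^sup>2 \<partial>lborel) \<le> \<eta>" .
    qed
    also have "\<dots> \<le> h * ?c" using \<eta>(2) h by (intro mult_left_mono) auto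
    finally show "(b h - b 0) / h \<le> ?c" using h by (simp add: field_simps)
  qed
  ultimately show "(\<integral>z. F (u z) * (D\<phi> z \<bullet> (0, 1)) \<partial>lborel) \<le> ?c"
    by (rule tendsto_upperbound) simp
qed

lemma integrable_\<psi>G: "integrable lborel (\<lambda>z. \<psi> (w z) * (G z \<bullet> fst (D\<phi> z)))"
proof -
  have i: "integrable lborel (\<lambda>z. G z \<bullet> fst (D\<phi> z))"
    by (rule integral_inner_Cauchy_Schwarz(1)) (use G2 fstD\<phi>(1) in auto)
  show ?thesis
    using integrable_mult_bounded[OF i, of "\<lambda>z. \<psi> (w z)" 1] \<psi>(5,6) by (simp add: mult.commute)
qed

text \<open>The term quadratic in \<open>G\<close> has a favourable sign because
  \<open>\<psi>\<close> decreases. Once it is dropped, what remains is linear in \<open>G\<close>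
  and can be integrated by parts.\<close>

lemma G_Z_le: "(\<integral>z. G z \<bullet> Z z \<partial>lborel) \<le> (\<integral>z. \<psi> (w z) * (G z \<bullet> fst (D\<phi> z)) \<partial>lborel)"
proof (rule integral_mono)
  show "integrable lborel (\<lambda>z. G z \<bullet> Z z)"
    by (rule integral_inner_Cauchy_Schwarz(1)) (use G2 Z_square in auto)
  fix z
  have "\<phi> z * \<psi>' (w z) * (G z \<bullet> G z) \<le> 0"
    using \<phi>_nonneg[of z] \<psi>(4)[of "w z"] by (intro mult_nonpos_nonneg mult_nonneg_nonpos) auto
  then show "G z \<bullet> Z z \<le> \<psi> (w z) * (G z \<bullet> fst (D\<phi> z))"
    by (simp add: Z_def inner_add_right)
qed (rule integrable_\<psi>G)

lemma lap_x_continuous: "continuous_on UNIV (lap_x H)"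
  unfolding lap_x_def[abs_def] by (intro continuous_intros H_continuous)

lemma lap_x_outside: "z \<notin> K \<Longrightarrow> lap_x H z = 0"
  by (simp add: lap_x_def H_outside)

text \<open>At the mollified level the chain rule is classical: \<open>P' = - \<psi>\<close>, so
  \<open>\<psi> (conv e w)\<close> times the gradient of \<open>conv e w\<close> is minus the
  gradient of \<open>P (conv e w)\<close>. One integration by parts in each space direction then
  puts both derivatives on \<open>\<phi>\<close>.\<close>

lemma conv_integral_by_parts:
  assumes e: "e > 0" "\<And>z. z \<in> K \<Longrightarrow> cball z e \<subseteq> D"
  shows "(\<integral>z. \<psi> (conv e w z) * (conv e G z \<bullet> fst (D\<phi> z)) \<partial>lborel) = (\<integral>z. P (conv e w z) * lap_x H z \<partial>lborel)"
proof -
  note sc = smooth_has_grad[OF smooth_conv(1)[OF w_integrable e(1)]]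
  have cw: "continuous_on UNIV (conv e w)" using has_grad_continuous[OF sc(1)] .
  let ?g = "grad (conv e w)"
  let ?p = "\<lambda>i z. P (conv e w z) * (H (i, 0) z \<bullet> (i, 0))"
  let ?q = "\<lambda>i z. \<psi> (conv e w z) * (?g z \<bullet> (i, 0)) * (D\<phi> z \<bullet> (i, 0))"
  have cp: "continuous_on UNIV (?p i)" for i
    by (intro continuous_intros continuous_on_compose2[OF continuous_P cw] H_continuous) auto
  have cq: "continuous_on UNIV (?q i)" for i
    by (intro continuous_intros continuous_on_compose2[OF continuous_\<psi> cw] D\<phi>_continuous sc(3)) auto
  have ip: "integrable lborel (?p i)" for i
    by (rule bounded_by_compact(2)[OF cp]) (simp add: H_outside)
  have iq: "integrable lborel (?q i)" for i
    by (rule bounded_by_compact(2)[OF cq]) (simp add: D\<phi>_outside)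
  have eq: "(\<integral>z. ?p i z \<partial>lborel) = (\<integral>z. ?q i z \<partial>lborel)" for i
  proof -
    let ?F = "\<lambda>z. (D\<phi> z \<bullet> (i, 0)) * P (conv e w z)"
    let ?DF = "\<lambda>z. P (conv e w z) *\<^sub>R H (i, 0) z + (D\<phi> z \<bullet> (i, 0)) *\<^sub>R ((- \<psi> (conv e w z)) *\<^sub>R ?g z)"
    have g: "has_grad ?F ?DF"
      by (rule has_grad_mult[OF has_hessD(2)[OF hess] has_grad_compose[OF sc(1) P(1)]])
    have c: "continuous_on UNIV ?DF"
      by (intro continuous_intros continuous_on_compose2[OF continuous_P cw]
          continuous_on_compose2[OF continuous_\<psi> cw] H_continuous D\<phi>_continuous sc(3)) auto
    have DF: "?DF z \<bullet> (i, 0) = ?p i z - ?q i z" for z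
      by (simp add: inner_add_left inner_diff_left)
    have "(\<integral>z. ?DF z \<bullet> (i, 0) \<partial>lborel) = 0"
    proof (rule integral_directional_derivative_eq_0[OF g c])
      show "integrable lborel ?F"
        by (rule bounded_by_compact(2)[OF has_grad_continuous[OF g]]) (simp add: D\<phi>_outside)
      show "integrable lborel (\<lambda>z. ?DF z \<bullet> (i, 0))"
        unfolding DF by (intro Bochner_Integration.integrable_diff ip iq)
    qed
    then show ?thesis unfolding DF using ip iq by simp
  qed
  have "\<psi> (conv e w z) * (conv e G z \<bullet> fst (D\<phi> z)) = (\<Sum>i\<in>Basis. ?q i z)" for z
  proof (cases "z \<in> K")
    case True
    have "conv e G z \<bullet> fst (D\<phi> z) = fst (?g z) \<bullet> fst (D\<phi> z)"
      using grad_conv_w[OF e(1) e(2)[OF True]] by simp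
    also have "\<dots> = (\<Sum>i\<in>Basis. (fst (?g z) \<bullet> i) * (fst (D\<phi> z) \<bullet> i))" by (rule euclidean_inner)
    finally show ?thesis by (simp add: sum_distrib_left inner_prod_def mult.assoc)
  qed (simp add: D\<phi>_outside)
  then have "(\<integral>z. \<psi> (conv e w z) * (conv e G z \<bullet> fst (D\<phi> z)) \<partial>lborel) = (\<Sum>i\<in>Basis. \<integral>z. ?q i z \<partial>lborel)"
    using iq by simp
  also have "\<dots> = (\<Sum>i\<in>Basis. \<integral>z. ?p i z \<partial>lborel)" using eq by simp
  also have "\<dots> = (\<integral>z. P (conv e w z) * lap_x H z \<partial>lborel)"
    using ip by (simp add: lap_x_def sum_distrib_left)
  finally show ?thesis .
qed

text \<open>Limit of \<open>conv_integral_by_parts\<close>. Replacing \<open>conv (e n) G\<close> by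
  \<open>G\<close> costs an L^2 error paired with a function bounded in L^2; the other factors
  converge almost everywhere with integrable majorants.\<close>

lemma integral_by_parts:
  "(\<integral>z. \<psi> (w z) * (G z \<bullet> fst (D\<phi> z)) \<partial>lborel) = (\<integral>z. P (w z) * lap_x H z \<partial>lborel)"
proof -
  obtain r K' where r: "r > 0" "compact K'" "K' \<subseteq> D" "\<And>x y. x \<in> K \<Longrightarrow> norm y \<le> r \<Longrightarrow> x + y \<in> K'"
    using compact_neighbourhood[OF K(1) open_D K(2)] by metis
  obtain e :: "nat \<Rightarrow> real" where e: "\<And>n. 0 < e n" "\<And>n. e n < r" "AE z in lborel. (\<lambda>n. conv (e n) w z) \<longlonglongrightarrow> w z"
    "\<And>n. integrable lborel (\<lambda>z. (norm (conv (e n) G z - G z))\<^sup>2)"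
    "(\<lambda>n. \<integral>z. (norm (conv (e n) G z - G z))\<^sup>2 \<partial>lborel) \<longlonglongrightarrow> 0"
    using mollification_sequence[OF r(1)] by blast
  note T = \<psi>_conv_tendsto[of e, OF e(1,3,4,5)]
  define X where "X n = (\<integral>z. \<psi> (conv (e n) w z) * (G z \<bullet> fst (D\<phi> z)) \<partial>lborel)" for n
  define Y where "Y n = (\<integral>z. \<psi> (conv (e n) w z) * ((conv (e n) G z - G z) \<bullet> fst (D\<phi> z)) \<partial>lborel)" for n
  define I where "I n = (\<integral>z. (norm (conv (e n) G z - G z))\<^sup>2 \<partial>lborel)" for n
  define g where "g = sqrt (\<integral>z. (norm (fst (D\<phi> z)))\<^sup>2 \<partial>lborel)"
  have iG: "integrable lborel (\<lambda>z. G z \<bullet> fst (D\<phi> z))"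
    by (rule integral_inner_Cauchy_Schwarz(1)) (use G2 fstD\<phi>(1) in auto)
  have \<psi>1: "norm (\<psi> s) \<le> 1" for s using \<psi>(5,6)[of s] by simp
  have iX: "integrable lborel (\<lambda>z. \<psi> (conv (e n) w z) * (G z \<bullet> fst (D\<phi> z)))" for n
    using integrable_mult_bounded[OF iG, of "\<lambda>z. \<psi> (conv (e n) w z)" 1] \<psi>1 by (simp add: mult.commute)
  have X: "X \<longlonglongrightarrow> (\<integral>z. \<psi> (w z) * (G z \<bullet> fst (D\<phi> z)) \<partial>lborel)"
    unfolding X_def[abs_def]
  proof (rule integral_dominated_convergence[OF _ _ integrable_norm[OF iG]])
    show "AE z in lborel. (\<lambda>n. \<psi> (conv (e n) w z) * (G z \<bullet> fst (D\<phi> z))) \<longlonglongrightarrow> \<psi> (w z) * (G z \<bullet> fst (D\<phi> z))"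
      using T(1) by eventually_elim (intro tendsto_intros)
    show "AE z in lborel. norm (\<psi> (conv (e n) w z) * (G z \<bullet> fst (D\<phi> z))) \<le> norm (G z \<bullet> fst (D\<phi> z))" for n
      using \<psi>1 by (intro AE_I2) (auto simp: abs_mult intro: mult_left_le_one_le)
  qed measurable
  have iY0: "integrable lborel (\<lambda>z. (conv (e n) G z - G z) \<bullet> fst (D\<phi> z))" for n
    by (rule integral_inner_Cauchy_Schwarz(1)) (use e(4) fstD\<phi>(1) in auto)
  have iY: "integrable lborel (\<lambda>z. \<psi> (conv (e n) w z) * ((conv (e n) G z - G z) \<bullet> fst (D\<phi> z)))" for n
    using integrable_mult_bounded[OF iY0, of "\<lambda>z. \<psi> (conv (e n) w z)" 1] \<psi>1 by (simp add: mult.commute)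
  have "\<bar>Y n\<bar> \<le> sqrt (I n) * g" for n
  proof -
    have q: "integrable lborel (\<lambda>z. (norm (\<psi> (conv (e n) w z) *\<^sub>R fst (D\<phi> z)))\<^sup>2)"
      and le: "(\<integral>z. (norm (\<psi> (conv (e n) w z) *\<^sub>R fst (D\<phi> z)))\<^sup>2 \<partial>lborel) \<le> (\<integral>z. (norm (fst (D\<phi> z)))\<^sup>2 \<partial>lborel)"
    proof -
      have 1: "(norm (\<psi> (conv (e n) w z) *\<^sub>R fst (D\<phi> z)))\<^sup>2 \<le> (norm (fst (D\<phi> z)))\<^sup>2" for z
        using \<psi>1[of "conv (e n) w z"] by (intro power_mono) (auto intro: mult_left_le_one_le)
      show q: "integrable lborel (\<lambda>z. (norm (\<psi> (conv (e n) w z) *\<^sub>R fst (D\<phi> z)))\<^sup>2)"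
        by (rule Bochner_Integration.integrable_bound[OF fstD\<phi>(1)]) (use 1 in auto)
      show "(\<integral>z. (norm (\<psi> (conv (e n) w z) *\<^sub>R fst (D\<phi> z)))\<^sup>2 \<partial>lborel) \<le> (\<integral>z. (norm (fst (D\<phi> z)))\<^sup>2 \<partial>lborel)"
        by (rule integral_mono[OF q fstD\<phi>(1) 1])
    qed
    have "\<bar>\<integral>z. (conv (e n) G z - G z) \<bullet> (\<psi> (conv (e n) w z) *\<^sub>R fst (D\<phi> z)) \<partial>lborel\<bar>
       \<le> sqrt (I n) * sqrt (\<integral>z. (norm (\<psi> (conv (e n) w z) *\<^sub>R fst (D\<phi> z)))\<^sup>2 \<partial>lborel)"
      unfolding I_def by (rule integral_inner_Cauchy_Schwarz(2)[OF _ _ e(4) q]) measurable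
    also have "\<dots> \<le> sqrt (I n) * g"
      unfolding g_def using le by (intro mult_left_mono) (auto simp: I_def)
    finally show ?thesis by (simp add: Y_def)
  qed
  moreover have "(\<lambda>n. sqrt (I n) * g) \<longlonglongrightarrow> sqrt 0 * g"
    using e(5) by (intro tendsto_mult tendsto_const tendsto_real_sqrt) (simp only: I_def[abs_def])
  ultimately have "Y \<longlonglongrightarrow> 0"
    by (intro Lim_null_comparison[of Y "\<lambda>n. sqrt (I n) * g"]) auto
  from tendsto_add[OF X this]
  have "(\<lambda>n. X n + Y n) \<longlonglongrightarrow> (\<integral>z. \<psi> (w z) * (G z \<bullet> fst (D\<phi> z)) \<partial>lborel)" by simp
  moreover have "X n + Y n = (\<integral>z. P (conv (e n) w z) * lap_x H z \<partial>lborel)" for n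
  proof -
    have "X n + Y n = (\<integral>z. \<psi> (conv (e n) w z) * (conv (e n) G z \<bullet> fst (D\<phi> z)) \<partial>lborel)"
      unfolding X_def Y_def
      by (subst Bochner_Integration.integral_add[symmetric, OF iX iY]) (simp add: inner_diff_left algebra_simps)
    also have "\<dots> = (\<integral>z. P (conv (e n) w z) * lap_x H z \<partial>lborel)"
    proof (rule conv_integral_by_parts[OF e(1)])
      fix z assume z: "z \<in> K"
      show "cball z (e n) \<subseteq> D"
      proof
        fix y assume "y \<in> cball z (e n)"
        then have "norm (y - z) \<le> r" using e(2)[of n] by (simp add: dist_norm norm_minus_commute)
        from r(4)[OF z this] show "y \<in> D" using r(3) by auto
      qed
    qed
    finally show ?thesis .
  qed
  ultimately have 1: "(\<lambda>n. \<integral>z. P (conv (e n) w z) * lap_x H z \<partial>lborel) \<longlonglongrightarrow> (\<integral>z. \<psi> (w z) * (G z \<bullet> fst (D\<phi> z)) \<partial>lborel)"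
    by simp
  have [measurable]: "lap_x H \<in> borel_measurable borel"
    by (rule continuous_borel_measurable[OF lap_x_continuous])
  have iL: "integrable lborel (\<lambda>z. B * \<bar>lap_x H z\<bar>)"
    using bounded_by_compact(2)[OF lap_x_continuous lap_x_outside] by simp
  have 2: "(\<lambda>n. \<integral>z. P (conv (e n) w z) * lap_x H z \<partial>lborel) \<longlonglongrightarrow> (\<integral>z. P (w z) * lap_x H z \<partial>lborel)"
  proof (rule integral_dominated_convergence[OF _ _ iL])
    show "AE z in lborel. (\<lambda>n. P (conv (e n) w z) * lap_x H z) \<longlonglongrightarrow> P (w z) * lap_x H z"
      using T(3) by eventually_elim (intro tendsto_intros)
    show "AE z in lborel. norm (P (conv (e n) w z) * lap_x H z) \<le> B * \<bar>lap_x H z\<bar>" for n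
    proof (rule AE_I2)
      fix z
      \<comment> \<open>The bound on \<open>P\<close> holds for nonnegative arguments only;
        nonnegativity of the mollifier keeps the mollified \<open>w\<close> in that range.\<close>
      have "0 \<le> conv (e n) w z"
        unfolding conv_def by (intro integral_nonneg_AE) (simp add: moll_nonneg[OF e(1)] w_nonneg)
      from mult_right_mono[OF P(2)[OF this], of "\<bar>lap_x H z\<bar>"]
      show "norm (P (conv (e n) w z) * lap_x H z) \<le> B * \<bar>lap_x H z\<bar>" by (simp add: abs_mult)
    qed
  qed measurable
  show ?thesis using LIMSEQ_unique[OF 1 2] .
qed

theorem truncated_inequality:
  "(\<integral>z. F (u z) * (D\<phi> z \<bullet> (0, 1)) \<partial>lborel) \<le> (\<integral>z. P (w z) * lap_x H z \<partial>lborel)"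
  using truncated_time_derivative G_Z_le integral_by_parts by linarith

end

section \<open>A C^1 approximation of truncation at a level\<close>

lemma DERIV_cutoff:
  fixes g g' :: "real \<Rightarrow> real"
  assumes g: "\<And>s. (g has_real_derivative g' s) (at s)" and "g 0 = 0" "g' 0 = 0"
  shows "((\<lambda>s. if s \<le> 0 then 0 else g s) has_real_derivative (if s \<le> 0 then 0 else g' s)) (at s)"
proof -
  let ?f = "\<lambda>s. if s \<le> 0 then 0 else g s"
  consider "s > 0" | "s < 0" | "s = 0" by linarith
  then show ?thesis
  proof cases
    case 1
    have "(?f has_real_derivative g' s) (at s)"
      by (rule has_field_derivative_transform_within_open[OF g, of "{0<..}"]) (use 1 in auto)
    then show ?thesis using 1 by simp
  next
    case 2
    have "((\<lambda>_. 0) has_real_derivative 0) (at s)" by simp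
    then have "(?f has_real_derivative 0) (at s)"
      by (rule has_field_derivative_transform_within_open[of _ _ _ "{..<0}"]) (use 2 in auto)
    then show ?thesis using 2 by simp
  next
    case 3
    have "((\<lambda>h. g h / h) \<longlongrightarrow> 0) (at 0)"
      using g[of 0] assms(2,3) by (simp add: DERIV_def)
    have "((\<lambda>h. ?f h / h) \<longlongrightarrow> 0) (at 0)"
    proof (rule Lim_null_comparison)
      show "\<forall>\<^sub>F h in at 0. norm (?f h / h) \<le> norm (g h / h)"
        unfolding real_norm_def by (intro always_eventually allI) (simp del: abs_divide)
    qed (rule tendsto_norm_zero, fact)
    then show ?thesis using 3 by (simp add: has_field_derivative_iff)
  qed
qed

text \<open>A C^1 replacement for the Heaviside function with the elementary primitive
  \<open>s - arctan s\<close>. For growing \<open>N\<close>, \<open>cut (N * (k - s))\<close> tends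
  to the indicator of \<open>s < k\<close>, and \<open>cut_int (N * (k - s)) / N\<close> stays
  within \<open>2 / N\<close> of \<open>max 0 (k - s)\<close>, as \<open>arctan\<close> is below
  2.\<close>

definition cut :: "real \<Rightarrow> real" where "cut s = (if s \<le> 0 then 0 else s\<^sup>2 / (1 + s\<^sup>2))"
definition cut_deriv :: "real \<Rightarrow> real" where "cut_deriv s = (if s \<le> 0 then 0 else 2 * s / (1 + s\<^sup>2)\<^sup>2)"
definition cut_int :: "real \<Rightarrow> real" where "cut_int s = (if s \<le> 0 then 0 else s - arctan s)"

lemma one_plus_square_neq_0: "1 + s\<^sup>2 \<noteq> (0::real)"
  using zero_le_power2[of s] by linarith

lemma one_plus_square_not_neg: "\<not> 1 + s\<^sup>2 < (0::real)"
  using zero_le_power2[of s] by linarith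

lemma DERIV_cut: "(cut has_real_derivative cut_deriv s) (at s)"
  unfolding cut_def[abs_def] cut_deriv_def
proof (rule DERIV_cutoff)
  fix s :: real
  have "((\<lambda>s. s\<^sup>2 / (1 + s\<^sup>2)) has_real_derivative (2 * s * (1 + s\<^sup>2) - s\<^sup>2 * (2 * s)) / ((1 + s\<^sup>2) * (1 + s\<^sup>2))) (at s)"
    using one_plus_square_neq_0[of s] by (auto intro!: derivative_eq_intros)
  moreover have "2 * s * (1 + s\<^sup>2) - s\<^sup>2 * (2 * s) = 2 * s" by (simp add: algebra_simps)
  ultimately show "((\<lambda>s. s\<^sup>2 / (1 + s\<^sup>2)) has_real_derivative 2 * s / (1 + s\<^sup>2)\<^sup>2) (at s)"
    by (simp add: power2_eq_square[of "1 + s\<^sup>2"])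
qed auto

lemma DERIV_cut_int: "(cut_int has_real_derivative cut s) (at s)"
  unfolding cut_int_def[abs_def] cut_def
proof (rule DERIV_cutoff)
  fix s :: real
  have "((\<lambda>s. s - arctan s) has_real_derivative 1 - 1 / (1 + s\<^sup>2)) (at s)"
    by (auto intro!: derivative_eq_intros simp: inverse_eq_divide)
  moreover have "1 - 1 / (1 + s\<^sup>2) = s\<^sup>2 / (1 + s\<^sup>2)"
    using one_plus_square_neq_0[of s] by (simp add: field_simps)
  ultimately show "((\<lambda>s. s - arctan s) has_real_derivative s\<^sup>2 / (1 + s\<^sup>2)) (at s)" by simp
qed auto

lemma cut_bounds: "0 \<le> cut s" "cut s \<le> 1" "0 \<le> cut_deriv s" "cut_deriv s \<le> 1"
proof -
  show "0 \<le> cut s" "cut s \<le> 1" "0 \<le> cut_deriv s"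
    by (auto simp: cut_def cut_deriv_def divide_le_eq one_plus_square_not_neg)
  have "2 * s \<le> 1 + s\<^sup>2" using sum_squares_bound[of 1 s] by simp
  also have "\<dots> \<le> (1 + s\<^sup>2)\<^sup>2" by (simp add: power2_eq_square[of "1 + s\<^sup>2"] algebra_simps)
  finally have "2 * s / (1 + s\<^sup>2)\<^sup>2 \<le> 1" by (simp add: divide_le_eq)
  then show "cut_deriv s \<le> 1" by (simp add: cut_deriv_def)
qed

lemma continuous_cut_deriv: "continuous_on UNIV cut_deriv"
proof -
  have eq: "cut_deriv = (\<lambda>s. 2 * max 0 s / (1 + s\<^sup>2)\<^sup>2)" by (auto simp: cut_deriv_def max_def)
  have "continuous_on UNIV (\<lambda>s :: real. 2 * max 0 s / (1 + s\<^sup>2)\<^sup>2)"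
    by (intro continuous_intros) (simp add: one_plus_square_neq_0)
  then show ?thesis by (simp only: eq)
qed

lemma cut_mono: "s \<le> t \<Longrightarrow> cut s \<le> cut t"
  by (rule DERIV_nonneg_imp_nondecreasing) (use DERIV_cut cut_bounds(3) in blast)+

lemma cut_int_bounds: "0 \<le> cut_int s" "cut_int s \<le> max 0 s" "max 0 s - 2 \<le> cut_int s"
proof -
  have "cut_int 0 \<le> cut_int s" if "0 \<le> s"
    by (rule DERIV_nonneg_imp_nondecreasing[OF that]) (use DERIV_cut_int cut_bounds(1) in blast)
  then show "0 \<le> cut_int s" by (cases "s \<le> 0") (auto simp: cut_int_def)
  show "cut_int s \<le> max 0 s" using arctan_less_zero_iff[of s] by (auto simp: cut_int_def max_def not_le)
  have "arctan s \<le> 2" using arctan_ubound[of s] pi_less_4 by linarith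
  then show "max 0 s - 2 \<le> cut_int s" by (auto simp: cut_int_def)
qed

text \<open>Abstracts \<open>s \<mapsto> \<psi> (s powr m)\<close>, whose primitive is the
  \<open>F\<close> of the truncated test. Monotonicity of the integrand gives the concavity
  inequality directly by comparing integrals; values in \<open>[0, 1]\<close> that vanish beyond
  \<open>\<kappa>\<close> give the bound \<open>min (max 0 x) \<kappa>\<close>.\<close>

locale decreasing_weight =
  fixes g :: "real \<Rightarrow> real" and \<kappa> :: real
  assumes g: "continuous_on {0..} g" "\<And>s t. 0 \<le> s \<Longrightarrow> s \<le> t \<Longrightarrow> g t \<le> g s" "\<And>s. 0 \<le> g s" "\<And>s. g s \<le> 1"
    "\<And>s. \<kappa> \<le> s \<Longrightarrow> g s = 0" and \<kappa>: "0 < \<kappa>"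
begin

definition primitive :: "real \<Rightarrow> real" where "primitive x = integral {0..x} g"

lemma integrable: "0 \<le> a \<Longrightarrow> g integrable_on {a..b}"
  by (rule integrable_continuous_interval) (auto intro: continuous_on_subset[OF g(1)])

lemma primitive_diff:
  assumes "0 \<le> a" "a \<le> b"
  shows "(b - a) * g b \<le> primitive b - primitive a" "primitive b - primitive a \<le> (b - a) * g a"
proof -
  have eq: "primitive b - primitive a = integral {a..b} g"
    using Henstock_Kurzweil_Integration.integral_combine[OF assms integrable[of 0 b]] by (simp add: primitive_def)
  have "integral {a..b} (\<lambda>_. g b) \<le> integral {a..b} g"
    by (rule integral_le) (use assms g(2) integrable in auto)
  then show "(b - a) * g b \<le> primitive b - primitive a" using assms by (simp add: eq)
  have "integral {a..b} g \<le> integral {a..b} (\<lambda>_. g a)"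
    by (rule integral_le) (use assms g(2) integrable in auto)
  then show "primitive b - primitive a \<le> (b - a) * g a" using assms by (simp add: eq)
qed

lemma primitive_0[simp]: "x \<le> 0 \<Longrightarrow> primitive x = 0"
  by (cases "x = 0") (auto simp: primitive_def)

lemma primitive_le: "primitive x \<le> min (max 0 x) \<kappa>" and primitive_nonneg: "0 \<le> primitive x"
proof -
  show "0 \<le> primitive x"
  proof (cases "0 \<le> x")
    case True
    have "0 \<le> (x - 0) * g x" using True g(3) by simp
    then show ?thesis using primitive_diff(1)[of 0 x] True by simp
  qed simp
  have le: "primitive y \<le> y" if "0 \<le> y" for y
    using primitive_diff(2)[of 0 y] that mult_left_mono[OF g(4)[of 0] that] by simp
  show "primitive x \<le> min (max 0 x) \<kappa>"
  proof (cases "\<kappa> \<le> x")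
    case True
    have "primitive x \<le> primitive \<kappa>" using primitive_diff(2)[of \<kappa> x] True \<kappa> g(5)[of \<kappa>] by simp
    then show ?thesis using le[of \<kappa>] \<kappa> True by simp
  next
    case False
    then show ?thesis using le[of x] \<kappa> by (cases "0 \<le> x") auto
  qed
qed

lemma primitive_concave: "0 \<le> a \<Longrightarrow> 0 \<le> b \<Longrightarrow> (b - a) * g b \<le> primitive b - primitive a"
proof (cases "a \<le> b")
  case False
  assume "0 \<le> a" "0 \<le> b"
  with primitive_diff(2)[of b a] False show ?thesis by (simp add: algebra_simps)
qed (rule primitive_diff)

lemma primitive_mono: "x \<le> y \<Longrightarrow> primitive x \<le> primitive y"
proof (cases "0 \<le> x")
  case True
  assume "x \<le> y"
  then have "0 \<le> (y - x) * g y" using g(3)[of y] by (intro mult_nonneg_nonneg) auto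
  then show ?thesis using primitive_diff(1)[OF True \<open>x \<le> y\<close>] by linarith
qed (simp add: primitive_nonneg)

lemma primitive_measurable: "primitive \<in> borel_measurable borel"
  by (rule borel_measurable_mono) (auto intro: monoI primitive_mono)

lemma primitive_ge: "0 \<le> c \<Longrightarrow> c \<le> x \<Longrightarrow> c * g c \<le> primitive x"
  using primitive_diff(1)[of 0 c] primitive_mono[of c x] by simp

end

section \<open>The truncated inequality at a sharp level\<close>

context local_supersolution
begin

text \<open>As the cutoffs sharpen, \<open>F n (u)\<close> tends to \<open>min u \<kappa>\<close>
  and \<open>P n (w)\<close> to the positive part of \<open>\<kappa> powr m - w\<close>. The time
  derivative of \<open>\<phi>\<close> integrates to 0, so \<open>\<kappa>\<close> may be subtracted
  from \<open>min u \<kappa>\<close>, which turns it into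
  \<open>- max 0 (\<kappa> - u)\<close>.\<close>

theorem truncation:
  assumes \<kappa>: "0 < \<kappa>"
    and hess: "has_hess \<phi> D\<phi> H" and nonneg: "\<And>z. 0 \<le> \<phi> z"
    and K: "compact K" "K \<subseteq> D" "\<And>z. z \<notin> K \<Longrightarrow> \<phi> z = 0"
  shows "0 \<le> (\<integral>z. max 0 (\<kappa> - u z) * (D\<phi> z \<bullet> (0, 1)) + max 0 (\<kappa> powr m - w z) * lap_x H z \<partial>lborel)"
proof -
  define k where "k = \<kappa> powr m"
  have k: "0 < k" using \<kappa> by (simp add: k_def)
  define \<psi> where "\<psi> n s = cut (real (Suc n) * (k - s))" for n s
  define \<psi>' where "\<psi>' n s = - (real (Suc n) * cut_deriv (real (Suc n) * (k - s)))" for n s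
  define P where "P n s = cut_int (real (Suc n) * (k - s)) / real (Suc n)" for n s
  define F where "F n = decreasing_weight.primitive (\<lambda>s. \<psi> n (s powr m))" for n
  have Pb: "0 \<le> P n s" "P n s \<le> max 0 (k - s)" "max 0 (k - s) - 2 / real (Suc n) \<le> P n s" for n s
  proof -
    let ?N = "real (Suc n)"
    have N: "?N > 0" by simp
    have mx: "max 0 (?N * (k - s)) = ?N * max 0 (k - s)"
      by (auto simp: max_def mult_le_0_iff zero_le_mult_iff)
    show "0 \<le> P n s" using cut_int_bounds(1) by (simp add: P_def)
    have "P n s \<le> (?N * max 0 (k - s)) / ?N"
      unfolding P_def using cut_int_bounds(2)[of "?N * (k - s)"] N mx by (intro divide_right_mono) auto
    then show "P n s \<le> max 0 (k - s)" using N by (simp del: of_nat_Suc)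
    have "(?N * max 0 (k - s) - 2) / ?N \<le> P n s"
      unfolding P_def using cut_int_bounds(3)[of "?N * (k - s)"] N mx by (intro divide_right_mono) auto
    then show "max 0 (k - s) - 2 / ?N \<le> P n s" using N by (simp add: diff_divide_distrib del: of_nat_Suc)
  qed
  have dw: "decreasing_weight (\<lambda>s. \<psi> n (s powr m)) \<kappa>" for n
  proof
    have "continuous_on UNIV cut" using DERIV_cut by (auto intro: continuous_at_imp_continuous_on DERIV_isCont)
    then show "continuous_on {0..} (\<lambda>s. \<psi> n (s powr m))"
      unfolding \<psi>_def by (rule continuous_on_compose2) (use m in \<open>auto intro!: continuous_intros continuous_on_powr'\<close>)
    show "\<psi> n (t powr m) \<le> \<psi> n (s powr m)" if "0 \<le> s" "s \<le> t" for s t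
      unfolding \<psi>_def using m that by (intro cut_mono mult_left_mono diff_left_mono powr_mono2) auto
    show "\<psi> n (s powr m) = 0" if "\<kappa> \<le> s" for s
    proof -
      have "k \<le> s powr m" unfolding k_def using that \<kappa> m by (intro powr_mono2) auto
      then show ?thesis by (simp add: \<psi>_def cut_def mult_le_0_iff)
    qed
  qed (use \<kappa> in \<open>auto simp: \<psi>_def cut_bounds\<close>)
  note [measurable] = decreasing_weight.primitive_measurable[OF dw, folded F_def]
  have tt: "truncated_test m U s\<^sub>1 s\<^sub>2 w G \<phi> D\<phi> H K (\<psi> n) (\<psi>' n) (P n) (F n) (real (Suc n)) k \<kappa>" for n
  proof
    show "has_hess \<phi> D\<phi> H" "compact K" "K \<subseteq> D" by fact+
    show "0 \<le> \<phi> z" for z by (rule nonneg)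
    show "\<phi> z = 0" if "z \<notin> K" for z using K(3)[OF that] .
    have d: "((\<lambda>s. real (Suc n) * (k - s)) has_real_derivative - real (Suc n)) (at s)" for s
      by (auto intro!: derivative_eq_intros)
    show "(\<psi> n has_real_derivative \<psi>' n s) (at s)" for s
      unfolding \<psi>_def[abs_def] \<psi>'_def
      by (rule DERIV_cong[OF DERIV_chain2[OF DERIV_cut d]]) (simp del: of_nat_Suc)
    show "continuous_on UNIV (\<psi>' n)"
      unfolding \<psi>'_def[abs_def] by (intro continuous_intros continuous_on_compose2[OF continuous_cut_deriv]) auto
    have "real (Suc n) * cut_deriv x \<le> real (Suc n) * 1" for x
      using cut_bounds(4) by (intro mult_left_mono) auto
    then show "\<bar>\<psi>' n s\<bar> \<le> real (Suc n)" for s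
      unfolding \<psi>'_def abs_minus_cancel abs_mult by (simp add: cut_bounds(3) abs_of_nonneg)
    show "\<psi>' n s \<le> 0" for s
      unfolding \<psi>'_def by (simp add: cut_bounds(3))
    show "0 \<le> \<psi> n s" "\<psi> n s \<le> 1" for s by (auto simp: \<psi>_def cut_bounds)
    have "((\<lambda>s. cut_int (real (Suc n) * (k - s)) / real (Suc n)) has_real_derivative
       cut (real (Suc n) * (k - s)) * (- real (Suc n)) / real (Suc n)) (at s)" for s
      by (intro DERIV_cdivide DERIV_chain2[OF DERIV_cut_int d])
    then show "(P n has_real_derivative - \<psi> n s) (at s)" for s
      unfolding P_def[abs_def] \<psi>_def by (rule DERIV_cong) (simp del: of_nat_Suc)
    show "\<bar>P n s\<bar> \<le> k" if "0 \<le> s" for s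
      using Pb(1,2)[of n s] that k by auto
    show "F n \<in> borel_measurable borel" by measurable
    show "F n 0 = 0" unfolding F_def by (rule decreasing_weight.primitive_0[OF dw]) simp
    show "\<bar>F n s\<bar> \<le> \<kappa>" for s
      using decreasing_weight.primitive_nonneg[OF dw, of n s] decreasing_weight.primitive_le[OF dw, of n s] by (simp add: F_def)
    show "(b - a) * \<psi> n (b powr m) \<le> F n b - F n a" if "0 \<le> a" "0 \<le> b" for a b
      unfolding F_def by (rule decreasing_weight.primitive_concave[OF dw that])
  qed
  interpret T: truncated_test m U s\<^sub>1 s\<^sub>2 w G \<phi> D\<phi> H K "\<psi> 0" "\<psi>' 0" "P 0" "F 0" "real (Suc 0)" k \<kappa>
    by (rule tt)
  have iD: "integrable lborel (\<lambda>z. D\<phi> z \<bullet> (0, 1))"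
    by (rule T.bounded_by_compact(2)) (auto intro!: continuous_intros T.D\<phi>_continuous simp: T.D\<phi>_outside)
  have [measurable]: "lap_x H \<in> borel_measurable borel"
    by (rule continuous_borel_measurable[OF T.lap_x_continuous])
  have iL: "integrable lborel (lap_x H)"
    by (rule T.bounded_by_compact(2)[OF T.lap_x_continuous T.lap_x_outside])
  have F: "(\<lambda>n. F n x) \<longlonglongrightarrow> min x \<kappa>" if x: "0 \<le> x" for x
  proof (rule tendstoI)
    fix \<epsilon> :: real assume \<epsilon>: "\<epsilon> > 0"
    \<comment> \<open>A point just below \<open>min x \<kappa>\<close> and strictly below
      \<open>\<kappa>\<close>, where the sharpened weight tends to 1; as the weight decreases, the
      primitive at \<open>x\<close> is at least \<open>c\<close> times its value there.\<close>
    define c where "c = max 0 (min x \<kappa> - \<epsilon> / 2)"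
    have c: "0 \<le> c" "c \<le> x" "c < \<kappa>" "min x \<kappa> - \<epsilon> / 2 \<le> c" using x \<epsilon> \<kappa> by (auto simp: c_def)
    have pos: "0 < k - c powr m"
      using powr_less_mono2[of m c \<kappa>] c m by (simp add: k_def)
    have "(\<lambda>n. cut (real (Suc n) * (k - c powr m))) \<longlonglongrightarrow> 1"
    proof -
      define a where "a = k - c powr m"
      have a: "a > 0" using pos by (simp add: a_def)
      have "((\<lambda>y. (y * a)\<^sup>2 / (1 + (y * a)\<^sup>2)) \<longlongrightarrow> 1) at_top"
        using a by real_asymp
      then have "(\<lambda>n. (real n * a)\<^sup>2 / (1 + (real n * a)\<^sup>2)) \<longlonglongrightarrow> 1"
        by (rule filterlim_compose[OF _ filterlim_real_sequentially])
      from LIMSEQ_Suc[OF this]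
      show ?thesis using a unfolding cut_def a_def[symmetric] by (simp add: mult_le_0_iff del: of_nat_Suc)
    qed
    then have "(\<lambda>n. c * \<psi> n (c powr m)) \<longlonglongrightarrow> c * 1"
      unfolding \<psi>_def by (intro tendsto_intros)
    then have "\<forall>\<^sub>F n in sequentially. c - \<epsilon> / 2 < c * \<psi> n (c powr m)"
      using \<epsilon> by (intro order_tendstoD) auto
    then show "\<forall>\<^sub>F n in sequentially. dist (F n x) (min x \<kappa>) < \<epsilon>"
    proof eventually_elim
      case (elim n)
      have "c * \<psi> n (c powr m) \<le> F n x"
        unfolding F_def by (rule decreasing_weight.primitive_ge[OF dw c(1,2)])
      moreover have "F n x \<le> min x \<kappa>"
        using decreasing_weight.primitive_le[OF dw, of n x] x by (simp add: F_def)
      ultimately show ?case using elim c(4) by (auto simp: dist_real_def)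
    qed
  qed
  have P: "(\<lambda>n. P n s) \<longlonglongrightarrow> max 0 (k - s)" for s
  proof (rule tendsto_sandwich)
    show "\<forall>\<^sub>F n in sequentially. max 0 (k - s) - 2 / real (Suc n) \<le> P n s" using Pb(3) by (intro always_eventually allI)
    show "\<forall>\<^sub>F n in sequentially. P n s \<le> max 0 (k - s)" using Pb(2) by (intro always_eventually allI)
    have "(\<lambda>n. 2 * (1 / real (Suc n))) \<longlonglongrightarrow> 2 * 0"
      by (intro tendsto_intros lim_1_over_n[THEN LIMSEQ_Suc])
    from tendsto_diff[OF tendsto_const this]
    show "(\<lambda>n. max 0 (k - s) - 2 / real (Suc n)) \<longlonglongrightarrow> max 0 (k - s)" by simp
  qed (rule tendsto_const)
  have L1: "(\<lambda>n. \<integral>z. F n (u z) * (D\<phi> z \<bullet> (0, 1)) \<partial>lborel) \<longlonglongrightarrow> (\<integral>z. min (u z) \<kappa> * (D\<phi> z \<bullet> (0, 1)) \<partial>lborel)"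
  proof (rule integral_dominated_convergence)
    show "integrable lborel (\<lambda>z. \<kappa> * \<bar>D\<phi> z \<bullet> (0, 1)\<bar>)" using iD by simp
    show "AE z in lborel. (\<lambda>n. F n (u z) * (D\<phi> z \<bullet> (0, 1))) \<longlonglongrightarrow> min (u z) \<kappa> * (D\<phi> z \<bullet> (0, 1))"
      by (intro AE_I2 tendsto_mult F tendsto_const u_nonneg)
    show "AE z in lborel. norm (F n (u z) * (D\<phi> z \<bullet> (0, 1))) \<le> \<kappa> * \<bar>D\<phi> z \<bullet> (0, 1)\<bar>" for n
    proof (rule AE_I2)
      fix z
      have "\<bar>F n (u z)\<bar> \<le> \<kappa>" using truncated_test.F(3)[OF tt] .
      from mult_right_mono[OF this, of "\<bar>D\<phi> z \<bullet> (0, 1)\<bar>"]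
      show "norm (F n (u z) * (D\<phi> z \<bullet> (0, 1))) \<le> \<kappa> * \<bar>D\<phi> z \<bullet> (0, 1)\<bar>" by (simp add: abs_mult)
    qed
  qed measurable
  have L2: "(\<lambda>n. \<integral>z. P n (w z) * lap_x H z \<partial>lborel) \<longlonglongrightarrow> (\<integral>z. max 0 (k - w z) * lap_x H z \<partial>lborel)"
  proof (rule integral_dominated_convergence)
    show "integrable lborel (\<lambda>z. k * \<bar>lap_x H z\<bar>)" using iL by simp
    show "AE z in lborel. (\<lambda>n. P n (w z) * lap_x H z) \<longlonglongrightarrow> max 0 (k - w z) * lap_x H z"
      by (intro AE_I2 tendsto_mult P tendsto_const)
    show "AE z in lborel. norm (P n (w z) * lap_x H z) \<le> k * \<bar>lap_x H z\<bar>" for n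
    proof (rule AE_I2)
      fix z
      from mult_right_mono[OF truncated_test.P(2)[OF tt w_nonneg[of z]], of "\<bar>lap_x H z\<bar>" n]
      show "norm (P n (w z) * lap_x H z) \<le> k * \<bar>lap_x H z\<bar>" by (simp add: abs_mult)
    qed
    have "continuous_on UNIV (P n)" for n by (rule truncated_test.continuous_P[OF tt])
    then have [measurable]: "P n \<in> borel_measurable borel" for n by (rule continuous_borel_measurable)
    show "(\<lambda>z. P n (w z) * lap_x H z) \<in> borel_measurable lborel" for n by measurable
  qed measurable
  have le: "(\<integral>z. min (u z) \<kappa> * (D\<phi> z \<bullet> (0, 1)) \<partial>lborel) \<le> (\<integral>z. max 0 (k - w z) * lap_x H z \<partial>lborel)"
    by (rule LIMSEQ_le[OF L1 L2]) (use truncated_test.truncated_inequality[OF tt] in blast)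
  have z: "(\<integral>z. D\<phi> z \<bullet> (0, 1) \<partial>lborel) = 0"
    by (rule integral_directional_derivative_eq_0[OF has_hessD(1)[OF hess] T.D\<phi>_continuous _ iD])
      (rule T.bounded_by_compact(2)[OF T.\<phi>_continuous K(3)])
  have b1: "integrable lborel (\<lambda>z. (D\<phi> z \<bullet> (0, 1)) *\<^sub>R min (u z) \<kappa>)"
    by (rule integrable_mult_bounded[OF iD, of _ \<kappa>]) (use u_nonneg \<kappa> in auto)
  have b2: "integrable lborel (\<lambda>z. lap_x H z *\<^sub>R max 0 (k - w z))"
    by (rule integrable_mult_bounded[OF iL, of _ k]) (use w_nonneg k in auto)
  have "(\<integral>z. max 0 (\<kappa> - u z) * (D\<phi> z \<bullet> (0, 1)) + max 0 (\<kappa> powr m - w z) * lap_x H z \<partial>lborel)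
    = (\<integral>z. (\<kappa> * (D\<phi> z \<bullet> (0, 1)) - min (u z) \<kappa> * (D\<phi> z \<bullet> (0, 1))) + max 0 (k - w z) * lap_x H z \<partial>lborel)"
  proof (rule Bochner_Integration.integral_cong[OF refl])
    fix z
    have "max 0 (\<kappa> - u z) = \<kappa> - min (u z) \<kappa>" by simp
    then show "max 0 (\<kappa> - u z) * (D\<phi> z \<bullet> (0, 1)) + max 0 (\<kappa> powr m - w z) * lap_x H z =
      (\<kappa> * (D\<phi> z \<bullet> (0, 1)) - min (u z) \<kappa> * (D\<phi> z \<bullet> (0, 1))) + max 0 (k - w z) * lap_x H z"
      by (simp only: k_def left_diff_distrib)
  qed
  also have "\<dots> = \<kappa> * (\<integral>z. D\<phi> z \<bullet> (0, 1) \<partial>lborel) - (\<integral>z. min (u z) \<kappa> * (D\<phi> z \<bullet> (0, 1)) \<partial>lborel) + (\<integral>z. max 0 (k - w z) * lap_x H z \<partial>lborel)"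
    using b1 b2 iD by (simp add: mult.commute)
  finally show ?thesis using le z by simp
qed

end

section \<open>The heat resolvent\<close>

definition gauss :: "'a::euclidean_space \<Rightarrow> real" where "gauss x = exp (- (norm x)\<^sup>2 / 2)"

lemma gauss_pos: "0 < gauss x" and gauss_le_1: "gauss x \<le> 1"
  by (auto simp: gauss_def)

lemma integrable_exp_norm_square:
  assumes "0 < b"
  shows "integrable lborel (\<lambda>x::'a::euclidean_space. exp (- b * (norm x)\<^sup>2))"
proof (rule integrableI_nonneg)
  have 1: "integrable lborel (\<lambda>x::real. exp (- b * x\<^sup>2))"
  proof -
    define \<sigma> where "\<sigma> = sqrt (1 / (2 * b))"
    have \<sigma>: "2 * \<sigma>\<^sup>2 = 1 / b" "0 < \<sigma>" using assms by (auto simp: \<sigma>_def)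
    then have "exp (- b * x\<^sup>2) = sqrt (2 * pi * \<sigma>\<^sup>2) * normal_density 0 \<sigma> x" for x
      by (simp add: normal_density_def mult.commute)
    then show ?thesis using \<sigma>(2) by (simp add: integrable_normal_density)
  qed
  have "(\<integral>\<^sup>+x. ennreal (exp (- b * (norm (x::'a))\<^sup>2)) \<partial>lborel) =
    (\<integral>\<^sup>+x. (\<Prod>i\<in>Basis. ennreal (exp (- b * ((x::'a) \<bullet> i)\<^sup>2))) \<partial>lborel)"
  proof (rule nn_integral_cong)
    fix x :: 'a
    have "(norm x)\<^sup>2 = (\<Sum>i\<in>Basis. (x \<bullet> i)\<^sup>2)"
      unfolding power2_norm_eq_inner by (subst euclidean_inner) (simp add: power2_eq_square)
    then show "ennreal (exp (- b * (norm x)\<^sup>2)) = (\<Prod>i\<in>Basis. ennreal (exp (- b * (x \<bullet> i)\<^sup>2)))"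
      by (simp add: prod_ennreal exp_sum[symmetric] sum_distrib_left sum_negf)
  qed
  also have "\<dots> = (\<Prod>i\<in>(Basis::'a set). \<integral>\<^sup>+x. ennreal (exp (- b * x\<^sup>2)) \<partial>lborel)"
    by (rule nn_integral_lborel_prod) auto
  also have "\<dots> < \<infinity>"
    using 1 by (simp add: nn_integral_eq_integral ennreal_power integral_nonneg_AE)
  finally show "(\<integral>\<^sup>+x. ennreal (exp (- b * (norm (x::'a))\<^sup>2)) \<partial>lborel) < \<infinity>" .
qed auto

lemma gauss_measurable[measurable]: "gauss \<in> borel_measurable borel"
  unfolding gauss_def[abs_def] by measurable

lemma integrable_gauss: "integrable lborel (gauss :: 'a::euclidean_space \<Rightarrow> real)"
  using integrable_exp_norm_square[of "1/2", where 'a='a] by (simp add: gauss_def[abs_def])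

lemma integrable_gauss_norm: "integrable lborel (\<lambda>x::'a::euclidean_space. gauss x * norm x)"
proof (rule Bochner_Integration.integrable_bound)
  show "integrable lborel (\<lambda>x::'a. 2 * exp (- (1/4) * (norm x)\<^sup>2))"
    by (intro integrable_mult_right integrable_exp_norm_square) simp
  have "gauss x * norm x \<le> 2 * exp (- (1/4) * (norm x)\<^sup>2)" for x :: 'a
  proof -
    have "norm x \<le> 1 + (norm x)\<^sup>2 / 4"
      using zero_le_power2[of "norm x / 2 - 1"] by (simp add: power2_eq_square algebra_simps)
    moreover have "0 \<le> (norm x)\<^sup>2" by simp
    ultimately have "norm x \<le> 2 + (norm x)\<^sup>2 / 2" by linarith
    also have "\<dots> = 2 * (1 + (1/4) * (norm x)\<^sup>2)" by simp
    also have "\<dots> \<le> 2 * exp ((1/4) * (norm x)\<^sup>2)"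
      by (intro mult_left_mono exp_ge_add_one_self) auto
    finally have "gauss x * norm x \<le> gauss x * (2 * exp ((1/4) * (norm x)\<^sup>2))"
      using gauss_pos[of x] by (intro mult_left_mono) auto
    also have "\<dots> = 2 * exp (- (1/4) * (norm x)\<^sup>2)"
      by (simp add: gauss_def exp_add[symmetric])
    finally show ?thesis .
  qed
  then show "AE x::'a in lborel. norm (gauss x * norm x) \<le> norm (2 * exp (- (1/4) * (norm x)\<^sup>2))"
    by (intro AE_I2) (simp add: abs_mult abs_of_pos[OF gauss_pos])
qed measurable

lemma integral_gauss_pos: "0 < (\<integral>x. gauss (x::'a::euclidean_space) \<partial>lborel)"
proof -
  have "\<not> (AE x::'a in lborel. gauss x = 0)"
  proof
    assume "AE x::'a in lborel. gauss x = 0"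
    then have "AE x::'a in lborel. False" using gauss_pos by (auto elim!: eventually_mono simp: less_le)
    then have "emeasure lborel (UNIV :: 'a set) = 0" by (auto simp: AE_iff_null null_sets_def)
    then show False by simp
  qed
  moreover have nn: "AE x in lborel. 0 \<le> gauss (x::'a)" by (intro AE_I2) (simp add: gauss_pos less_imp_le)
  ultimately have "(\<integral>x. gauss (x::'a) \<partial>lborel) \<noteq> 0"
    using integral_nonneg_eq_0_iff_AE[OF integrable_gauss nn] by simp
  moreover have "0 \<le> (\<integral>x. gauss (x::'a) \<partial>lborel)"
    by (rule integral_nonneg_AE[OF nn])
  ultimately show ?thesis by simp
qed

lemma has_grad_gauss: "has_grad gauss (\<lambda>x. - gauss x *\<^sub>R x)"
  unfolding has_grad_def gauss_def[abs_def] power2_norm_eq_inner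
  by (auto intro!: derivative_eq_intros simp: inner_commute)

lemma integrable_product:
  fixes q :: "'a::euclidean_space \<Rightarrow> real" and p :: "real \<Rightarrow> real"
  assumes q: "integrable lborel q" and p: "integrable lborel p"
  shows "integrable lborel (\<lambda>(x, s). q x * p s)"
proof -
  have [measurable]: "q \<in> borel_measurable borel" "p \<in> borel_measurable borel" using q p by auto
  have "integrable (lborel \<Otimes>\<^sub>M lborel) (\<lambda>(x, s). q x * p s)"
  proof (rule lborel_pair.Fubini_integrable)
    show "integrable lborel (\<lambda>x. \<integral>s. norm (case (x, s) of (x, s) \<Rightarrow> q x * p s) \<partial>lborel)"
      using q by (simp add: abs_mult)
    show "AE x in lborel. integrable lborel (\<lambda>s. case (x, s) of (x, s) \<Rightarrow> q x * p s)"
      using p by simp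
  qed measurable
  then show ?thesis by (simp add: lborel_prod)
qed

lemma lborel_Fubini:
  fixes f :: "'a::euclidean_space \<times> real \<Rightarrow> real"
  assumes "integrable lborel f"
  shows "(\<integral>x. (\<integral>s. f (x, s) \<partial>lborel) \<partial>lborel) = (\<integral>z. f z \<partial>lborel)"
    and "(\<integral>s. (\<integral>x. f (x, s) \<partial>lborel) \<partial>lborel) = (\<integral>z. f z \<partial>lborel)"
proof -
  have i: "integrable (lborel \<Otimes>\<^sub>M lborel) f" using assms by (simp add: lborel_prod)
  show "(\<integral>x. (\<integral>s. f (x, s) \<partial>lborel) \<partial>lborel) = (\<integral>z. f z \<partial>lborel)"
    using lborel_pair.integral_fst'[OF i] by (simp add: lborel_prod)
  show "(\<integral>s. (\<integral>x. f (x, s) \<partial>lborel) \<partial>lborel) = (\<integral>z. f z \<partial>lborel)"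
    using lborel_pair.integral_snd[of "\<lambda>x s. f (x, s)"] i by (simp add: lborel_prod)
qed

lemma integral_FTC_atLeast_bounded:
  fixes g g' :: "real \<Rightarrow> real"
  assumes d: "\<And>s. (g has_real_derivative g' s) (at s)" and c: "continuous_on UNIV g'"
    and i: "integrable lborel (\<lambda>s. indicator {0<..} s * g' s)" and lim: "(g \<longlongrightarrow> 0) at_top"
  shows "(\<integral>s. indicator {0<..} s * g' s \<partial>lborel) = - g 0"
proof -
  have "((\<lambda>y. \<integral>s. indicator {..y} s *\<^sub>R (indicator {0<..} s * g' s) \<partial>lborel) \<longlongrightarrow> (\<integral>s. indicator {0<..} s * g' s \<partial>lborel)) at_top"
    by (rule tendsto_integral_at_top[OF _ i]) simp
  moreover have "((\<lambda>y. g y - g 0) \<longlongrightarrow> 0 - g 0) at_top" by (intro tendsto_intros lim)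
  then have "((\<lambda>y. \<integral>s. indicator {..y} s *\<^sub>R (indicator {0<..} s * g' s) \<partial>lborel) \<longlongrightarrow> 0 - g 0) at_top"
  proof (rule Lim_transform_eventually)
    show "\<forall>\<^sub>F y in at_top. g y - g 0 = (\<integral>s. indicator {..y} s *\<^sub>R (indicator {0<..} s * g' s) \<partial>lborel)"
      using eventually_ge_at_top[of 0]
    proof eventually_elim
      case (elim y)
      have "has_bochner_integral lborel (\<lambda>s. indicator {0..y} s *\<^sub>R g' s) (g y - g 0)"
        by (rule has_bochner_integral_FTC_Icc[OF elim])
          (use d c in \<open>auto simp: has_real_derivative_iff_has_vector_derivative intro: has_vector_derivative_at_within continuous_on_subset\<close>)
      then have "g y - g 0 = (\<integral>s. indicator {0..y} s *\<^sub>R g' s \<partial>lborel)" by (simp add: has_bochner_integral_iff)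
      also have "\<dots> = (\<integral>s. indicator {..y} s *\<^sub>R (indicator {0<..} s * g' s) \<partial>lborel)"
      proof (rule integral_cong_AE)
        have "AE s in lborel. s \<noteq> (0::real)" by (rule AE_lborel_singleton)
        then show "AE s in lborel. indicator {0..y} s *\<^sub>R g' s = indicator {..y} s *\<^sub>R (indicator {0<..} s * g' s)"
          by eventually_elim (auto simp: indicator_def)
      qed (use continuous_borel_measurable[OF c] in measurable)
      finally show ?case .
    qed
  qed
  ultimately show ?thesis using tendsto_unique[OF trivial_limit_at_top_linorder] by fastforce
qed

text \<open>Multiplied by \<open>2 * s\<close> this is the density of the square root of a standard
  exponential variable. The bare weight appears when that factor is spent on the spatial
  derivative.\<close>

definition half_weight :: "real \<Rightarrow> real" where "half_weight s = indicator {0<..} s * exp (- s\<^sup>2)"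

lemma half_weight_measurable[measurable]: "half_weight \<in> borel_measurable borel"
  unfolding half_weight_def[abs_def] by measurable

lemma half_weight_integrable: "integrable lborel half_weight"
proof -
  have "integrable lborel (\<lambda>s::real. exp (- 1 * (norm s)\<^sup>2))" by (rule integrable_exp_norm_square) simp
  then have "integrable lborel (\<lambda>s::real. indicator {0<..} s *\<^sub>R exp (- s\<^sup>2))"
    by (intro integrable_mult_indicator) auto
  then show ?thesis by (simp add: half_weight_def[abs_def])
qed

lemma half_weight_moment:
  "integrable lborel (\<lambda>s. 2 * s * half_weight s)" "(\<integral>s. 2 * s * half_weight s \<partial>lborel) = 1"
proof -
  have "(\<integral>\<^sup>+s. ennreal (2 * s * exp (- s\<^sup>2)) * indicator {0..} s \<partial>lborel) = 0 - (- exp (- 0\<^sup>2) :: real)"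
  proof (rule nn_integral_FTC_atLeast)
    show "((\<lambda>s::real. - exp (- s\<^sup>2)) \<longlongrightarrow> 0) at_top" by real_asymp
  qed (auto intro!: derivative_eq_intros)
  also have "(\<integral>\<^sup>+s. ennreal (2 * s * exp (- s\<^sup>2)) * indicator {0..} s \<partial>lborel) = (\<integral>\<^sup>+s. ennreal (2 * s * half_weight s) \<partial>lborel)"
    by (intro nn_integral_cong) (auto simp: half_weight_def indicator_def)
  finally have eq: "(\<integral>\<^sup>+s. ennreal (2 * s * half_weight s) \<partial>lborel) = 1" by simp
  have nn: "0 \<le> 2 * s * half_weight s" for s by (auto simp: half_weight_def indicator_def)
  show i: "integrable lborel (\<lambda>s. 2 * s * half_weight s)"
    by (rule integrableI_nonneg) (use eq nn in auto)
  show "(\<integral>s. 2 * s * half_weight s \<partial>lborel) = 1"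
    using eq by (subst integral_eq_nn_integral) (use nn in auto)
qed

text \<open>The goal is to solve \<open>\<phi> - \<phi>_t - c \<Delta>\<phi> = f\<close> on all of
  space-time, a backward heat equation with damping. The solution is the expectation of
  \<open>f\<close> along space-time Brownian motion stopped at an exponential time. The damping
  makes the kernel a probability density, so bounds on \<open>f\<close> pass to
  \<open>\<phi>\<close>.\<close>

locale heat_resolvent =
  fixes c :: real and f :: "'a::euclidean_space \<times> real \<Rightarrow> real" and Df Hf R
  assumes c: "0 < c" and f: "has_hess f Df Hf" and f_outside: "\<And>z. R \<le> norm z \<Longrightarrow> f z = 0"
begin

definition a :: real where "a = sqrt (2 * c)"

lemma a: "0 < a" "a\<^sup>2 = 2 * c" using c by (auto simp: a_def)

definition \<gamma> :: real where "\<gamma> = (\<integral>x. gauss (x::'a) \<partial>lborel)"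

lemma \<gamma>: "0 < \<gamma>" unfolding \<gamma>_def by (rule integral_gauss_pos)

text \<open>With \<open>S\<close> a standard exponential time and \<open>\<xi>\<close> a standard Gaussian vector, the substitution
  \<open>S = \<sigma>\<^sup>2\<close> makes the space-time position \<open>(\<surd>(2 c S) \<xi>, S)\<close> of the heat process at time \<open>S\<close> a
  smooth function of \<open>(\<xi>, \<sigma>)\<close>.\<close>

definition Y :: "'a \<times> real \<Rightarrow> 'a \<times> real" where "Y w = ((a * snd w) *\<^sub>R fst w, (snd w)\<^sup>2)"

definition kw :: "'a \<times> real \<Rightarrow> real" where
  "kw w = gauss (fst w) / \<gamma> * (2 * snd w * half_weight (snd w))"

lemma Y_measurable[measurable]: "Y \<in> borel_measurable borel"
  unfolding Y_def[abs_def] by (intro borel_measurable_continuous_onI continuous_intros)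

lemma kw_measurable[measurable]: "kw \<in> borel_measurable borel"
  unfolding kw_def[abs_def] by measurable

lemma kw_nonneg: "0 \<le> kw w"
  using \<gamma> gauss_pos[of "fst w"] by (auto simp: kw_def half_weight_def indicator_def)

lemma kw_integrable: "integrable lborel kw"
proof -
  have "integrable lborel (\<lambda>(x::'a, s). gauss x / \<gamma> * (2 * s * half_weight s))"
    by (intro integrable_product half_weight_moment(1) integrable_divide integrable_gauss)
  then show ?thesis by (simp add: kw_def[abs_def] case_prod_unfold)
qed

lemma kw_integral: "(\<integral>w. kw w \<partial>lborel) = 1"
  unfolding lborel_Fubini(1)[OF kw_integrable, symmetric]
  using \<gamma> half_weight_moment(2) by (simp add: kw_def \<gamma>_def[symmetric])

lemma continuous: "continuous_on UNIV f" "continuous_on UNIV Df" "continuous_on UNIV (Hf v)"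
  using has_hessD[OF f] has_grad_continuous by auto

lemma outside: "R \<le> norm z \<Longrightarrow> Df z = 0" "R \<le> norm z \<Longrightarrow> Hf v z = 0"
proof -
  show D: "Df z = 0" if "R \<le> norm z" for z
    by (rule has_grad_zero_outside_cball[OF has_hessD(1,4)[OF f] f_outside that])
  show "Hf v z = 0" if "R \<le> norm z" for z
    by (rule has_grad_zero_outside_cball[OF has_hessD(2,3)[OF f] _ that]) (simp add: D)
qed

lemmas ucf = uniformly_continuous_bounded_support[OF continuous(1), of R, OF f_outside]
lemmas ucD = uniformly_continuous_bounded_support[OF continuous(2), of R, OF outside(1)]
lemmas ucH = uniformly_continuous_bounded_support[OF continuous(3), of R, OF outside(2)]

lemma f_measurable[measurable]: "f \<in> borel_measurable borel" "Df \<in> borel_measurable borel" "Hf v \<in> borel_measurable borel"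
  using continuous continuous_borel_measurable by blast+

definition \<phi> :: "'a \<times> real \<Rightarrow> real" where "\<phi> z = (\<integral>w. kw w * f (z + Y w) \<partial>lborel)"
definition D\<phi> :: "'a \<times> real \<Rightarrow> 'a \<times> real" where "D\<phi> z = (\<integral>w. kw w *\<^sub>R Df (z + Y w) \<partial>lborel)"
definition H\<phi> :: "'a \<times> real \<Rightarrow> 'a \<times> real \<Rightarrow> 'a \<times> real" where "H\<phi> v z = (\<integral>w. kw w *\<^sub>R Hf v (z + Y w) \<partial>lborel)"

lemma kw_f_integrable:
  "integrable lborel (\<lambda>w. kw w * f (z + Y w))"
  "integrable lborel (\<lambda>w. kw w *\<^sub>R Df (z + Y w))"
  "integrable lborel (\<lambda>w. kw w *\<^sub>R Hf v (z + Y w))"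
proof -
  obtain B where "\<And>z. norm (f z) \<le> B" using ucf(2) unfolding bounded_iff by blast
  then show "integrable lborel (\<lambda>w. kw w * f (z + Y w))"
    using integrable_mult_bounded[OF kw_integrable, of "\<lambda>w. f (z + Y w)" B] by simp
  obtain B where "\<And>z. norm (Df z) \<le> B" using ucD(2) unfolding bounded_iff by blast
  then show "integrable lborel (\<lambda>w. kw w *\<^sub>R Df (z + Y w))"
    using integrable_mult_bounded[OF kw_integrable, of "\<lambda>w. Df (z + Y w)" B] by simp
  obtain B where "\<And>z. norm (Hf v z) \<le> B" using ucH(2) unfolding bounded_iff by blast
  then show "integrable lborel (\<lambda>w. kw w *\<^sub>R Hf v (z + Y w))"
    using integrable_mult_bounded[OF kw_integrable, of "\<lambda>w. Hf v (z + Y w)" B] by simp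
qed

text \<open>Averages of translates against the probability density \<open>kw\<close> inherit sup
  bounds and moduli of continuity and, by interchanging integrals, integrability over space-time.
  Compact support is lost, so integrability takes its place in all later integrations by
  parts.\<close>

lemma averaged:
  fixes g :: "'a \<times> real \<Rightarrow> 'c::euclidean_space"
  assumes g: "continuous_on UNIV g" "\<And>z. R \<le> norm z \<Longrightarrow> g z = 0"
  shows "uniformly_continuous_on UNIV (\<lambda>z. \<integral>w. kw w *\<^sub>R g (z + Y w) \<partial>lborel)"
    and "\<And>B. (\<And>z. norm (g z) \<le> B) \<Longrightarrow> norm (\<integral>w. kw w *\<^sub>R g (z + Y w) \<partial>lborel) \<le> B"
    and "bounded (range (\<lambda>z. \<integral>w. kw w *\<^sub>R g (z + Y w) \<partial>lborel))"
    and "integrable lborel (\<lambda>z. \<integral>w. kw w *\<^sub>R g (z + Y w) \<partial>lborel)"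
proof -
  have [measurable]: "g \<in> borel_measurable borel" using g(1) by (rule continuous_borel_measurable)
  note uc = uniformly_continuous_bounded_support[OF g(1), of R, OF g(2)]
  obtain B0 where B0: "\<And>z. norm (g z) \<le> B0" using uc(2) unfolding bounded_iff by blast
  have i: "integrable lborel (\<lambda>w. kw w *\<^sub>R g (z + Y w))" for z
    using integrable_mult_bounded[OF kw_integrable, of "\<lambda>w. g (z + Y w)" B0] B0 by simp
  have le: "norm (\<integral>w. kw w *\<^sub>R h w \<partial>lborel) \<le> B"
    if "\<And>w. norm (h w) \<le> B" "integrable lborel (\<lambda>w. kw w *\<^sub>R h w)" for h :: "'a \<times> real \<Rightarrow> 'c" and B
  proof -
    have "norm (\<integral>w. kw w *\<^sub>R h w \<partial>lborel) \<le> (\<integral>w. norm (kw w *\<^sub>R h w) \<partial>lborel)" by (rule integral_norm_bound)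
    also have "\<dots> \<le> (\<integral>w. kw w * B \<partial>lborel)"
      using that kw_nonneg by (intro integral_mono integrable_norm integrable_mult_left kw_integrable)
        (auto intro!: mult_left_mono)
    also have "\<dots> = B" by (simp add: kw_integral)
    finally show ?thesis .
  qed
  show bound: "norm (\<integral>w. kw w *\<^sub>R g (z + Y w) \<partial>lborel) \<le> B" if "\<And>z. norm (g z) \<le> B" for B z
    by (rule le) (use that i in auto)
  then show "bounded (range (\<lambda>z. \<integral>w. kw w *\<^sub>R g (z + Y w) \<partial>lborel))"
    unfolding bounded_iff using B0 by blast
  show "uniformly_continuous_on UNIV (\<lambda>z. \<integral>w. kw w *\<^sub>R g (z + Y w) \<partial>lborel)"
    unfolding uniformly_continuous_on_def
  proof (intro allI impI)
    fix e :: real assume "e > 0"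
    then obtain d where d: "d > 0" "\<And>x y. dist y x < d \<Longrightarrow> dist (g y) (g x) < e / 2"
      using uc(1)[unfolded uniformly_continuous_on_def, rule_format, of "e / 2"] by auto
    have "dist (\<integral>w. kw w *\<^sub>R g (y + Y w) \<partial>lborel) (\<integral>w. kw w *\<^sub>R g (x + Y w) \<partial>lborel) < e" if "dist y x < d" for x y
    proof -
      have eq: "(\<integral>w. kw w *\<^sub>R g (y + Y w) \<partial>lborel) - (\<integral>w. kw w *\<^sub>R g (x + Y w) \<partial>lborel) = (\<integral>w. kw w *\<^sub>R (g (y + Y w) - g (x + Y w)) \<partial>lborel)"
        using i by (simp add: scaleR_diff_right)
      have "norm (\<integral>w. kw w *\<^sub>R (g (y + Y w) - g (x + Y w)) \<partial>lborel) \<le> e / 2"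
      proof (rule le)
        show "norm (g (y + Y w) - g (x + Y w)) \<le> e / 2" for w
          using d(2)[of "y + Y w" "x + Y w"] that by (simp add: dist_norm)
        show "integrable lborel (\<lambda>w. kw w *\<^sub>R (g (y + Y w) - g (x + Y w)))"
          using Bochner_Integration.integrable_diff[OF i[of y] i[of x]] by (simp add: scaleR_diff_right)
      qed
      then show ?thesis using \<open>e > 0\<close> eq by (simp add: dist_norm)
    qed
    then show "\<exists>d>0. \<forall>x\<in>UNIV. \<forall>y\<in>UNIV. dist y x < d \<longrightarrow> dist (\<integral>w. kw w *\<^sub>R g (y + Y w) \<partial>lborel) (\<integral>w. kw w *\<^sub>R g (x + Y w) \<partial>lborel) < e"
      using d(1) by blast
  qed
  have ig: "integrable lborel g" by (rule integrable_continuous_bounded_support[OF g(1), of R, OF g(2)])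
  have "integrable (lborel \<Otimes>\<^sub>M lborel) (\<lambda>(w, z). kw w *\<^sub>R g (z + Y w))"
  proof (rule lborel_pair.Fubini_integrable)
    have "(\<integral>z. norm (kw w *\<^sub>R g (z + Y w)) \<partial>lborel) = kw w * (\<integral>z. norm (g z) \<partial>lborel)" for w
      using lborel_translation(1)[of "\<lambda>z. norm (g z)" "Y w"] by (simp add: kw_nonneg)
    then show "integrable lborel (\<lambda>w. \<integral>z. norm (case (w, z) of (w, z) \<Rightarrow> kw w *\<^sub>R g (z + Y w)) \<partial>lborel)"
      using kw_integrable by simp
    show "AE w in lborel. integrable lborel (\<lambda>z. case (w, z) of (w, z) \<Rightarrow> kw w *\<^sub>R g (z + Y w))"
      using ig lborel_translation(2)[of g] by simp
  qed measurable
  from lborel_pair.integrable_snd[OF this]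
  show "integrable lborel (\<lambda>z. \<integral>w. kw w *\<^sub>R g (z + Y w) \<partial>lborel)" .
qed

lemma \<phi>_hess: "has_hess \<phi> D\<phi> H\<phi>"
  unfolding has_hess_def
proof (intro conjI allI)
  show "has_grad \<phi> D\<phi>"
    unfolding \<phi>_def[abs_def] D\<phi>_def[abs_def]
    by (rule has_grad_parametric_integral[OF has_hessD(1)[OF f] ucD(1) ucf(2) ucD(2) kw_integrable]) measurable
  fix v
  have e: "D\<phi> z \<bullet> v = (\<integral>w. kw w * (Df (z + Y w) \<bullet> v) \<partial>lborel)" for z
    unfolding D\<phi>_def using integral_inner_left[of v lborel "\<lambda>w. kw w *\<^sub>R Df (z + Y w)"] kw_f_integrable(2) by simp
  have "continuous_on UNIV (\<lambda>z. Df z \<bullet> v)" by (intro continuous_intros continuous)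
  from uniformly_continuous_bounded_support(2)[OF this, of R]
  have b: "bounded (range (\<lambda>z. Df z \<bullet> v))" using outside(1) by simp
  show "has_grad (\<lambda>z. D\<phi> z \<bullet> v) (H\<phi> v)"
    unfolding e H\<phi>_def[abs_def]
    by (rule has_grad_parametric_integral[OF has_hessD(2)[OF f] ucH(1) b ucH(2) kw_integrable]) measurable
  show "continuous_on UNIV (H\<phi> v)"
    unfolding H\<phi>_def[abs_def]
    by (rule uniformly_continuous_imp_continuous[OF averaged(1)[OF continuous(3) outside(2)]])
qed

end

text \<open>Change of variables \<open>s = t + \<sigma>\<^sup>2\<close>. It is an inequality because
  the substitution reaches only times after \<open>t\<close>.\<close>

lemma nn_integral_square_substitution:
  fixes g :: "real \<Rightarrow> real"
  assumes [measurable]: "g \<in> borel_measurable borel" and nn: "\<And>s. 0 \<le> g s"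
  shows "(\<integral>\<^sup>+\<sigma>. ennreal (2 * \<sigma> * g (t + \<sigma>\<^sup>2)) * indicator {0<..} \<sigma> \<partial>lborel) \<le> (\<integral>\<^sup>+s. ennreal (g s) \<partial>lborel)"
proof -
  let ?f = "\<lambda>n \<sigma>. ennreal (2 * \<sigma> * g (t + \<sigma>\<^sup>2)) * indicator {0..real n} \<sigma>"
  have le: "(\<integral>\<^sup>+\<sigma>. ?f n \<sigma> \<partial>lborel) \<le> (\<integral>\<^sup>+s. ennreal (g s) \<partial>lborel)" for n
  proof -
    have "(\<integral>\<^sup>+\<sigma>. ?f n \<sigma> \<partial>lborel) = (\<integral>\<^sup>+\<sigma>. ennreal (g (t + \<sigma>\<^sup>2) * (2 * \<sigma>) * indicator {0..real n} \<sigma>) \<partial>lborel)"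
      by (intro nn_integral_cong) (auto simp: indicator_def mult.commute)
    also have "\<dots> = (\<integral>\<^sup>+s. ennreal (g s * indicator {t + 0\<^sup>2..t + (real n)\<^sup>2} s) \<partial>lborel)"
    proof (rule nn_integral_substitution[symmetric])
      show "((\<lambda>\<sigma>. t + \<sigma>\<^sup>2) has_real_derivative 2 * \<sigma>) (at \<sigma>)" for \<sigma> by (auto intro!: derivative_eq_intros)
      show "set_borel_measurable borel {t + 0\<^sup>2..t + (real n)\<^sup>2} g"
        unfolding set_borel_measurable_def by measurable
    qed (auto intro!: continuous_intros)
    also have "\<dots> \<le> (\<integral>\<^sup>+s. ennreal (g s) \<partial>lborel)"
      by (intro nn_integral_mono) (auto simp: indicator_def nn)
    finally show ?thesis .
  qed
  have "(\<integral>\<^sup>+\<sigma>. ennreal (2 * \<sigma> * g (t + \<sigma>\<^sup>2)) * indicator {0<..} \<sigma> \<partial>lborel) \<le> (\<integral>\<^sup>+\<sigma>. (SUP n. ?f n \<sigma>) \<partial>lborel)"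
  proof (rule nn_integral_mono)
    fix \<sigma> :: real
    obtain n :: nat where "\<sigma> \<le> real n" using real_arch_simple by blast
    then have "ennreal (2 * \<sigma> * g (t + \<sigma>\<^sup>2)) * indicator {0<..} \<sigma> \<le> ?f n \<sigma>" by (auto simp: indicator_def)
    also have "\<dots> \<le> (SUP n. ?f n \<sigma>)" by (rule SUP_upper) simp
    finally show "ennreal (2 * \<sigma> * g (t + \<sigma>\<^sup>2)) * indicator {0<..} \<sigma> \<le> (SUP n. ?f n \<sigma>)" .
  qed
  also have "\<dots> = (SUP n. \<integral>\<^sup>+\<sigma>. ?f n \<sigma> \<partial>lborel)"
    by (rule nn_integral_monotone_convergence_SUP)
      (auto simp: incseq_def le_fun_def indicator_def)
  also have "\<dots> \<le> (\<integral>\<^sup>+s. ennreal (g s) \<partial>lborel)" by (rule SUP_least) (rule le)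
  finally show ?thesis .
qed

lemma nn_integral_scaled_translate:
  fixes g :: "'a::euclidean_space \<Rightarrow> real"
  assumes [measurable]: "g \<in> borel_measurable borel" and r: "0 < r"
  shows "(\<integral>\<^sup>+y. ennreal (g (x + r *\<^sub>R y)) \<partial>lborel) = ennreal (1 / r ^ DIM('a)) * (\<integral>\<^sup>+y. ennreal (g y) \<partial>lborel)"
proof -
  have "(\<integral>\<^sup>+y. ennreal (g y) \<partial>lborel) = (\<integral>\<^sup>+y. ennreal (g y) \<partial>density (distr lborel borel (\<lambda>y. x + r *\<^sub>R y)) (\<lambda>_. ennreal (\<bar>r\<bar> ^ DIM('a))))"
    using lborel_affine[of r x] r by simp
  also have "\<dots> = ennreal (r ^ DIM('a)) * (\<integral>\<^sup>+y. ennreal (g (x + r *\<^sub>R y)) \<partial>lborel)"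
    using r by (simp add: nn_integral_density nn_integral_distr nn_integral_cmult)
  finally have "ennreal (1 / r ^ DIM('a)) * (\<integral>\<^sup>+y. ennreal (g y) \<partial>lborel) =
     (ennreal (1 / r ^ DIM('a)) * ennreal (r ^ DIM('a))) * (\<integral>\<^sup>+y. ennreal (g (x + r *\<^sub>R y)) \<partial>lborel)"
    by (simp add: mult.assoc)
  also have "ennreal (1 / r ^ DIM('a)) * ennreal (r ^ DIM('a)) = 1"
    using r by (simp add: ennreal_mult[symmetric])
  finally show ?thesis by simp
qed

section \<open>The resolvent equation\<close>

context heat_resolvent
begin

lemma lap_continuous: "continuous_on UNIV (lap_x Hf)"
  unfolding lap_x_def[abs_def] by (intro continuous_intros continuous)

lemma lap_outside: "R \<le> norm z \<Longrightarrow> lap_x Hf z = 0"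
  by (simp add: lap_x_def outside)

lemma lap_measurable[measurable]: "lap_x Hf \<in> borel_measurable borel"
  by (rule continuous_borel_measurable[OF lap_continuous])

lemma bounds:
  obtains B where "0 \<le> B" "\<And>z. \<bar>f z\<bar> \<le> B" "\<And>z. norm (Df z) \<le> B" "\<And>z. \<bar>lap_x Hf z\<bar> \<le> B"
proof -
  note ucL = uniformly_continuous_bounded_support[OF lap_continuous, of R, OF lap_outside]
  obtain B1 where B1: "\<And>z. norm (f z) \<le> B1" using ucf(2) unfolding bounded_iff by blast
  obtain B2 where B2: "\<And>z. norm (Df z) \<le> B2" using ucD(2) unfolding bounded_iff by blast
  obtain B3 where B3: "\<And>z. norm (lap_x Hf z) \<le> B3" using ucL(2) unfolding bounded_iff by blast
  show thesis
    by (rule that[of "max 0 (max B1 (max B2 B3))"]) (use B1 B2 B3 in \<open>auto simp: le_max_iff_disj\<close>)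
qed

lemma kw_bounded_integrable:
  assumes [measurable]: "g \<in> borel_measurable borel" and "\<And>z. \<bar>g z\<bar> \<le> B"
  shows "integrable lborel (\<lambda>w. kw w * g (z + Y w))"
  using integrable_mult_bounded[OF kw_integrable, of "\<lambda>w. g (z + Y w)" B] assms(2) by simp

lemma D\<phi>_inner: "D\<phi> z \<bullet> v = (\<integral>w. kw w * (Df (z + Y w) \<bullet> v) \<partial>lborel)"
  unfolding D\<phi>_def using integral_inner_left[of v lborel "\<lambda>w. kw w *\<^sub>R Df (z + Y w)"] kw_f_integrable(2) by simp

lemma lap_\<phi>: "lap_x H\<phi> z = (\<integral>w. kw w * lap_x Hf (z + Y w) \<partial>lborel)"
proof -
  have e: "H\<phi> v z \<bullet> v = (\<integral>w. kw w * (Hf v (z + Y w) \<bullet> v) \<partial>lborel)" for v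
    unfolding H\<phi>_def using integral_inner_left[of v lborel "\<lambda>w. kw w *\<^sub>R Hf v (z + Y w)"] kw_f_integrable(3) by simp
  have i: "integrable lborel (\<lambda>w. kw w * (Hf v (z + Y w) \<bullet> v))" for v
    using integrable_inner_left[OF kw_f_integrable(3)[where v = v and z = z], of v] by simp
  show ?thesis using i by (simp add: lap_x_def e sum_distrib_left)
qed

text \<open>Gaussian integration by parts in \<open>\<xi>\<close> for fixed \<open>\<sigma>\<close>:
  the gradient of \<open>gauss\<close> is \<open>- gauss \<xi> *\<^sub>R \<xi>\<close>, and
  differentiating \<open>Df (z + Y (\<xi>, \<sigma>))\<close> in \<open>\<xi>\<close> produces the
  factor \<open>a * \<sigma>\<close>.\<close>

lemma Stein:
  assumes \<sigma>: "0 < \<sigma>"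
  shows "(\<integral>\<xi>. gauss \<xi> * (Df (z + Y (\<xi>, \<sigma>)) \<bullet> (\<xi>, 0)) \<partial>lborel) = a * \<sigma> * (\<integral>\<xi>. gauss \<xi> * lap_x Hf (z + Y (\<xi>, \<sigma>)) \<partial>lborel)"
proof -
  let ?Q = "\<lambda>\<xi>::'a. z + Y (\<xi>, \<sigma>)"
  have Qd: "(?Q has_derivative (\<lambda>v. ((a * \<sigma>) *\<^sub>R v, 0))) (at \<xi>)" for \<xi>
    unfolding Y_def by (auto intro!: derivative_eq_intros)
  have Qc: "continuous_on UNIV ?Q" unfolding Y_def by (auto intro!: continuous_intros)
  have cD: "continuous_on UNIV (\<lambda>\<xi>. Df (?Q \<xi>))" by (rule continuous_on_compose2[OF continuous(2) Qc]) simp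
  have cH: "continuous_on UNIV (\<lambda>\<xi>. Hf v (?Q \<xi>))" for v by (rule continuous_on_compose2[OF continuous(3) Qc]) simp
  note [measurable] = continuous_borel_measurable[OF cD] continuous_borel_measurable[OF cH]
  obtain B where B: "0 \<le> B" "\<And>z. norm (Df z) \<le> B" using bounds by metis
  have Bi: "\<bar>Df p \<bullet> (i, 0)\<bar> \<le> B" if "i \<in> Basis" for i :: 'a and p
    using Cauchy_Schwarz_ineq2[of "Df p" "(i, 0)"] B(2)[of p] that by (simp add: norm_Pair)
  have iH: "integrable lborel (\<lambda>\<xi>. gauss \<xi> * (Hf (i, 0) (?Q \<xi>) \<bullet> (i, 0)))" for i
  proof -
    obtain B' where "\<And>z. norm (Hf (i, 0) z) \<le> B'" using ucH(2) unfolding bounded_iff by blast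
    then have "integrable lborel (\<lambda>\<xi>. gauss \<xi> *\<^sub>R Hf (i, 0) (?Q \<xi>))"
      using integrable_mult_bounded[OF integrable_gauss, of "\<lambda>\<xi>. Hf (i, 0) (?Q \<xi>)" B'] by simp
    from integrable_inner_left[OF this, of "(i, 0)"] show ?thesis by simp
  qed
  have iD: "integrable lborel (\<lambda>\<xi>. gauss \<xi> * (\<xi> \<bullet> i) * (Df (?Q \<xi>) \<bullet> (i, 0)))" if i: "i \<in> Basis" for i
  proof (rule Bochner_Integration.integrable_bound)
    show "integrable lborel (\<lambda>\<xi>::'a. B * (gauss \<xi> * norm \<xi>))" by (intro integrable_mult_right integrable_gauss_norm)
    have "\<bar>gauss \<xi> * (\<xi> \<bullet> i) * (Df (?Q \<xi>) \<bullet> (i, 0))\<bar> \<le> B * (gauss \<xi> * norm \<xi>)" for \<xi>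
    proof -
      have "\<bar>\<xi> \<bullet> i\<bar> \<le> norm \<xi>" using Basis_le_norm[OF i, of \<xi>] .
      then have "gauss \<xi> * \<bar>\<xi> \<bullet> i\<bar> * \<bar>Df (?Q \<xi>) \<bullet> (i, 0)\<bar> \<le> gauss \<xi> * norm \<xi> * B"
        using gauss_pos[of \<xi>] Bi[OF i] by (intro mult_mono mult_left_mono) auto
      then show ?thesis using gauss_pos[of \<xi>] by (simp add: abs_mult mult_ac)
    qed
    then show "AE \<xi> in lborel. norm (gauss \<xi> * (\<xi> \<bullet> i) * (Df (?Q \<xi>) \<bullet> (i, 0))) \<le> norm (B * (gauss \<xi> * norm \<xi>))"
      by (intro AE_I2) (smt (verit) real_norm_def)
  qed measurable
  have eq: "(\<integral>\<xi>. gauss \<xi> * (\<xi> \<bullet> i) * (Df (?Q \<xi>) \<bullet> (i, 0)) \<partial>lborel) = a * \<sigma> * (\<integral>\<xi>. gauss \<xi> * (Hf (i, 0) (?Q \<xi>) \<bullet> (i, 0)) \<partial>lborel)"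
    if i: "i \<in> Basis" for i
  proof -
    let ?F = "\<lambda>\<xi>. gauss \<xi> * (Df (?Q \<xi>) \<bullet> (i, 0))"
    let ?DF = "\<lambda>\<xi>. (Df (?Q \<xi>) \<bullet> (i, 0)) *\<^sub>R (- gauss \<xi> *\<^sub>R \<xi>) + gauss \<xi> *\<^sub>R ((a * \<sigma>) *\<^sub>R fst (Hf (i, 0) (?Q \<xi>)))"
    have "has_grad (\<lambda>\<xi>. Df (?Q \<xi>) \<bullet> (i, 0)) (\<lambda>\<xi>. (a * \<sigma>) *\<^sub>R fst (Hf (i, 0) (?Q \<xi>)))"
      unfolding has_grad_def
    proof
      fix \<xi>
      have "((\<lambda>\<xi>. Df (?Q \<xi>) \<bullet> (i, 0)) has_derivative (\<lambda>v. Hf (i, 0) (?Q \<xi>) \<bullet> ((a * \<sigma>) *\<^sub>R v, 0))) (at \<xi>)"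
        by (rule has_derivative_compose[OF Qd has_gradD[OF has_hessD(2)[OF f]]])
      then show "((\<lambda>\<xi>. Df (?Q \<xi>) \<bullet> (i, 0)) has_derivative (\<lambda>v. ((a * \<sigma>) *\<^sub>R fst (Hf (i, 0) (?Q \<xi>))) \<bullet> v)) (at \<xi>)"
        by (rule has_derivative_eq_rhs) (auto simp: inner_prod_def)
    qed
    from has_grad_mult[OF has_grad_gauss this] have g: "has_grad ?F ?DF" .
    have c: "continuous_on UNIV ?DF"
      by (intro continuous_intros cD cH has_grad_continuous[OF has_grad_gauss])
    have DF: "?DF \<xi> \<bullet> i = a * \<sigma> * (gauss \<xi> * (Hf (i, 0) (?Q \<xi>) \<bullet> (i, 0))) - gauss \<xi> * (\<xi> \<bullet> i) * (Df (?Q \<xi>) \<bullet> (i, 0))" for \<xi>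
      by (simp add: inner_add_left inner_diff_left inner_prod_def)
    have "(\<integral>\<xi>. ?DF \<xi> \<bullet> i \<partial>lborel) = 0"
    proof (rule integral_directional_derivative_eq_0[OF g c])
      show "integrable lborel ?F"
        using integrable_mult_bounded[OF integrable_gauss, of "\<lambda>\<xi>. Df (?Q \<xi>) \<bullet> (i, 0)" B] Bi[OF i] by simp
      show "integrable lborel (\<lambda>\<xi>. ?DF \<xi> \<bullet> i)"
        unfolding DF by (intro Bochner_Integration.integrable_diff integrable_mult_right iH iD i)
    qed
    then show ?thesis unfolding DF using iH[of i] iD[OF i] by simp
  qed
  have "gauss \<xi> * (Df (?Q \<xi>) \<bullet> (\<xi>, 0)) = (\<Sum>i\<in>Basis. gauss \<xi> * (\<xi> \<bullet> i) * (Df (?Q \<xi>) \<bullet> (i, 0)))" for \<xi>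
  proof -
    have "Df (?Q \<xi>) \<bullet> (\<xi>, 0) = fst (Df (?Q \<xi>)) \<bullet> \<xi>" by (simp add: inner_prod_def)
    also have "\<dots> = (\<Sum>i\<in>Basis. (fst (Df (?Q \<xi>)) \<bullet> i) * (\<xi> \<bullet> i))" by (rule euclidean_inner)
    finally show ?thesis by (simp add: sum_distrib_left inner_prod_def mult_ac)
  qed
  then have "(\<integral>\<xi>. gauss \<xi> * (Df (?Q \<xi>) \<bullet> (\<xi>, 0)) \<partial>lborel) = (\<Sum>i\<in>Basis. \<integral>\<xi>. gauss \<xi> * (\<xi> \<bullet> i) * (Df (?Q \<xi>) \<bullet> (i, 0)) \<partial>lborel)"
    using iD by simp
  also have "\<dots> = (\<Sum>i\<in>Basis. a * \<sigma> * (\<integral>\<xi>. gauss \<xi> * (Hf (i, 0) (?Q \<xi>) \<bullet> (i, 0)) \<partial>lborel))" using eq by simp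
  also have "\<dots> = a * \<sigma> * (\<integral>\<xi>. gauss \<xi> * lap_x Hf (?Q \<xi>) \<partial>lborel)"
    using iH by (simp add: lap_x_def sum_distrib_left)
  finally show ?thesis .
qed

text \<open>For fixed \<open>\<xi>\<close>, \<open>T1 + T2\<close> is \<open>gauss \<xi>\<close>
  times the derivative in \<open>\<sigma>\<close> of
  \<open>exp (- \<sigma>\<^sup>2) * f (z + Y (\<xi>, \<sigma>))\<close>, so it integrates to the
  boundary term at 0. For fixed \<open>\<sigma>\<close>, \<open>T2\<close> and \<open>T3\<close>
  have the same integral by \<open>Stein\<close>, where \<open>a\<^sup>2 = 2 * c\<close> restores
  the weight \<open>2 * \<sigma>\<close>. Fubini in both orders combines the two facts.\<close>

lemma resolvent_equation: "\<phi> z - D\<phi> z \<bullet> (0, 1) - c * lap_x H\<phi> z = f z"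
proof -
  obtain B where B: "0 \<le> B" "\<And>z. \<bar>f z\<bar> \<le> B" "\<And>z. norm (Df z) \<le> B" "\<And>z. \<bar>lap_x Hf z\<bar> \<le> B" using bounds by blast
  have Bt: "\<bar>Df p \<bullet> (0, 1)\<bar> \<le> B" for p
    using Cauchy_Schwarz_ineq2[of "Df p" "(0, 1)"] B(3)[of p] by (simp add: norm_Pair)
  have Bx: "\<bar>Df p \<bullet> (\<xi>, 0)\<bar> \<le> B * norm \<xi>" for p \<xi>
    using Cauchy_Schwarz_ineq2[of "Df p" "(\<xi>, 0)"] mult_right_mono[OF B(3)[of p], of "norm \<xi>"] by (simp add: norm_Pair)
  \<comment> \<open>All terms carry a factor \<open>\<gamma>\<close> to clear the normalization of
    the Gaussian: \<open>T1\<close> has the time derivative minus the value, \<open>T2\<close> the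
    first-order spatial term, \<open>T3\<close> the Laplacian.\<close>
  define T1 where "T1 w = \<gamma> * (kw w * (Df (z + Y w) \<bullet> (0, 1) - f (z + Y w)))" for w
  define T2 where "T2 w = gauss (fst w) * (half_weight (snd w) * (a * (Df (z + Y w) \<bullet> (fst w, 0))))" for w
  define T3 where "T3 w = \<gamma> * (c * (kw w * lap_x Hf (z + Y w)))" for w
  have "\<bar>Df p \<bullet> (0, 1) - f p\<bar> \<le> B + B" for p using Bt[of p] B(2)[of p] by linarith
  then have i1: "integrable lborel T1"
    unfolding T1_def by (intro integrable_mult_right kw_bounded_integrable[of "\<lambda>p. Df p \<bullet> (0, 1) - f p"]) measurable
  have i3: "integrable lborel T3"
    unfolding T3_def using kw_bounded_integrable[OF lap_measurable B(4)] by (intro integrable_mult_right)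
  have [measurable]: "T2 \<in> borel_measurable borel"
  proof -
    have [measurable]: "(\<lambda>w::'a \<times> real. (fst w, 0::real)) \<in> borel_measurable borel"
      by (intro borel_measurable_continuous_onI continuous_intros)
    show ?thesis unfolding T2_def[abs_def] by measurable
  qed
  have i2: "integrable lborel T2"
  proof (rule Bochner_Integration.integrable_bound)
    have "integrable lborel (\<lambda>(\<xi>::'a, s). (gauss \<xi> * norm \<xi>) * half_weight s)"
      by (intro integrable_product integrable_gauss_norm half_weight_integrable)
    then show "integrable lborel (\<lambda>w::'a \<times> real. a * B * ((gauss (fst w) * norm (fst w)) * half_weight (snd w)))"
      by (simp add: case_prod_unfold)
    have hw: "0 \<le> half_weight s" for s by (simp add: half_weight_def)
    have "\<bar>T2 w\<bar> \<le> a * B * ((gauss (fst w) * norm (fst w)) * half_weight (snd w))" for w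
    proof -
      have "(gauss (fst w) * half_weight (snd w) * a) * \<bar>Df (z + Y w) \<bullet> (fst w, 0)\<bar> \<le> (gauss (fst w) * half_weight (snd w) * a) * (B * norm (fst w))"
        using Bx a(1) gauss_pos[of "fst w"] hw by (intro mult_left_mono) (auto intro: mult_nonneg_nonneg less_imp_le)
      then show ?thesis
        using a(1) gauss_pos[of "fst w"] hw[of "snd w"] by (simp add: T2_def abs_mult mult_ac)
    qed
    then show "AE w in lborel. norm (T2 w) \<le> norm (a * B * ((gauss (fst w) * norm (fst w)) * half_weight (snd w)))"
      by (intro AE_I2) (smt (verit) real_norm_def)
  qed simp
  have T12: "(\<integral>s. T1 (\<xi>, s) + T2 (\<xi>, s) \<partial>lborel) = - (gauss \<xi> * f z)" for \<xi>
  proof -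
    let ?p = "\<lambda>s. z + Y (\<xi>, s)"
    define g where "g s = exp (- s\<^sup>2) * f (?p s)" for s
    define g' where "g' s = exp (- s\<^sup>2) * (2 * s * (Df (?p s) \<bullet> (0, 1) - f (?p s)) + a * (Df (?p s) \<bullet> (\<xi>, 0)))" for s
    have pd: "(?p has_derivative (\<lambda>t. t *\<^sub>R (a *\<^sub>R \<xi>, 2 * s))) (at s)" for s
      unfolding Y_def by (auto intro!: derivative_eq_intros simp: mult_ac)
    have pc: "continuous_on UNIV ?p" unfolding Y_def by (auto intro!: continuous_intros)
    have d: "(g has_real_derivative g' s) (at s)" for s
    proof -
      have "((\<lambda>s. f (?p s)) has_derivative (\<lambda>t. Df (?p s) \<bullet> (t *\<^sub>R (a *\<^sub>R \<xi>, 2 * s)))) (at s)"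
        by (rule has_derivative_compose[OF pd has_gradD[OF has_hessD(1)[OF f]]])
      then have "((\<lambda>s. f (?p s)) has_real_derivative (Df (?p s) \<bullet> (a *\<^sub>R \<xi>, 2 * s))) (at s)"
        unfolding has_field_derivative_def
        by (rule has_derivative_eq_rhs) (simp add: fun_eq_iff inner_scaleR_right mult.commute del: scaleR_Pair)
      moreover have "Df (?p s) \<bullet> (a *\<^sub>R \<xi>, 2 * s) = a * (Df (?p s) \<bullet> (\<xi>, 0)) + 2 * s * (Df (?p s) \<bullet> (0, 1))"
        by (simp add: inner_prod_def)
      ultimately have "((\<lambda>s. f (?p s)) has_real_derivative (a * (Df (?p s) \<bullet> (\<xi>, 0)) + 2 * s * (Df (?p s) \<bullet> (0, 1)))) (at s)" by simp
      then show ?thesis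
        unfolding g_def[abs_def] g'_def
        by (auto intro!: derivative_eq_intros simp: algebra_simps)
    qed
    have c: "continuous_on UNIV g'"
      unfolding g'_def[abs_def]
      by (intro continuous_intros continuous_on_compose2[OF continuous(1) pc] continuous_on_compose2[OF continuous(2) pc]) auto
    have eq: "T1 (\<xi>, s) + T2 (\<xi>, s) = gauss \<xi> * (indicator {0<..} s * g' s)" for s
    proof -
      have "\<gamma> * kw (\<xi>, s) = gauss \<xi> * (2 * s * half_weight s)" using \<gamma> by (simp add: kw_def)
      then have "T1 (\<xi>, s) = gauss \<xi> * (2 * s * half_weight s) * (Df (?p s) \<bullet> (0, 1) - f (?p s))"
        unfolding T1_def by (simp only: mult.assoc[symmetric])
      then show ?thesis by (simp add: T2_def half_weight_def g'_def algebra_simps)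
    qed
    have i: "integrable lborel (\<lambda>s. indicator {0<..} s * g' s)"
    proof (rule Bochner_Integration.integrable_bound)
      show "integrable lborel (\<lambda>s. 2 * B * (2 * s * half_weight s) + (a * (B * norm \<xi>)) * half_weight s)"
        by (intro Bochner_Integration.integrable_add integrable_mult_right half_weight_moment(1) half_weight_integrable)
      have "norm (indicator {0<..} s * g' s) \<le> norm (2 * B * (2 * s * half_weight s) + (a * (B * norm \<xi>)) * half_weight s)" for s
      proof (cases "0 < s")
        case True
        have "\<bar>2 * s * (Df (?p s) \<bullet> (0, 1) - f (?p s)) + a * (Df (?p s) \<bullet> (\<xi>, 0))\<bar>
           \<le> \<bar>2 * s * (Df (?p s) \<bullet> (0, 1) - f (?p s))\<bar> + \<bar>a * (Df (?p s) \<bullet> (\<xi>, 0))\<bar>" by (rule abs_triangle_ineq)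
        also have "\<dots> \<le> 2 * s * (2 * B) + a * (B * norm \<xi>)"
        proof (rule add_mono)
          have "\<bar>Df (?p s) \<bullet> (0, 1) - f (?p s)\<bar> \<le> 2 * B" using Bt[of "?p s"] B(2)[of "?p s"] by linarith
          from mult_left_mono[OF this, of "2 * s"] True
          show "\<bar>2 * s * (Df (?p s) \<bullet> (0, 1) - f (?p s))\<bar> \<le> 2 * s * (2 * B)" by (simp add: abs_mult)
          from mult_left_mono[OF Bx[of "?p s" \<xi>], of a] a(1)
          show "\<bar>a * (Df (?p s) \<bullet> (\<xi>, 0))\<bar> \<le> a * (B * norm \<xi>)" by (simp add: abs_mult)
        qed
        finally have "\<bar>g' s\<bar> \<le> exp (- s\<^sup>2) * (2 * s * (2 * B) + a * (B * norm \<xi>))"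
          unfolding g'_def abs_mult by (intro mult_mono) auto
        also have "\<dots> = 2 * B * (2 * s * half_weight s) + (a * (B * norm \<xi>)) * half_weight s"
          using True by (simp add: half_weight_def algebra_simps)
        finally show ?thesis using True by (simp add: order_trans[OF _ abs_ge_self])
      qed simp
      then show "AE s in lborel. norm (indicator {0<..} s * g' s) \<le> norm (2 * B * (2 * s * half_weight s) + (a * (B * norm \<xi>)) * half_weight s)"
        by (intro AE_I2)
    qed (use continuous_borel_measurable[OF c] in measurable)
    have lim: "(g \<longlongrightarrow> 0) at_top"
    proof (rule Lim_null_comparison)
      show "\<forall>\<^sub>F s in at_top. norm (g s) \<le> B * exp (- s\<^sup>2)"
        unfolding g_def using B(2) by (intro always_eventually allI) (simp add: abs_mult mult.commute)
      have "((\<lambda>s::real. exp (- s\<^sup>2)) \<longlongrightarrow> 0) at_top" by real_asymp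
      from tendsto_mult[OF tendsto_const[of B] this] show "((\<lambda>s. B * exp (- s\<^sup>2)) \<longlongrightarrow> 0) at_top" by simp
    qed
    have "g 0 = f z" by (cases z) (simp add: g_def Y_def)
    then show ?thesis
      unfolding eq using integral_FTC_atLeast_bounded[OF d c i lim] by simp
  qed
  have T23: "(\<integral>\<xi>. T2 (\<xi>, s) \<partial>lborel) = (\<integral>\<xi>. T3 (\<xi>, s) \<partial>lborel)" for s
  proof (cases "0 < s")
    case False
    then show ?thesis by (simp add: T2_def T3_def kw_def half_weight_def)
  next
    case True
    have "(\<integral>\<xi>. T2 (\<xi>, s) \<partial>lborel) = (\<integral>\<xi>. (half_weight s * a) * (gauss \<xi> * (Df (z + Y (\<xi>, s)) \<bullet> (\<xi>, 0))) \<partial>lborel)"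
      by (simp add: T2_def mult_ac)
    also have "\<dots> = half_weight s * a * (a * s * (\<integral>\<xi>. gauss \<xi> * lap_x Hf (z + Y (\<xi>, s)) \<partial>lborel))"
      by (simp add: Stein[OF True])
    also have "\<dots> = (half_weight s * s * a\<^sup>2) * (\<integral>\<xi>. gauss \<xi> * lap_x Hf (z + Y (\<xi>, s)) \<partial>lborel)"
      by (simp add: power2_eq_square mult_ac)
    also have "\<dots> = (\<integral>\<xi>. (half_weight s * s * (2 * c)) * (gauss \<xi> * lap_x Hf (z + Y (\<xi>, s))) \<partial>lborel)"
      by (simp add: a(2))
    also have "\<dots> = (\<integral>\<xi>. T3 (\<xi>, s) \<partial>lborel)"
      using \<gamma> by (intro Bochner_Integration.integral_cong[OF refl]) (simp add: T3_def kw_def)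
    finally show ?thesis .
  qed
  have "(\<integral>w. T1 w \<partial>lborel) + (\<integral>w. T2 w \<partial>lborel) = (\<integral>w. T1 w + T2 w \<partial>lborel)" using i1 i2 by simp
  also have "\<dots> = (\<integral>\<xi>. - (gauss (\<xi>::'a) * f z) \<partial>lborel)"
    by (subst lborel_Fubini(1)[symmetric]) (use i1 i2 T12 in simp_all)
  also have "\<dots> = - (\<gamma> * f z)" by (simp add: \<gamma>_def)
  finally have 1: "(\<integral>w. T1 w \<partial>lborel) + (\<integral>w. T2 w \<partial>lborel) = - (\<gamma> * f z)" .
  have 2: "(\<integral>w. T2 w \<partial>lborel) = (\<integral>w. T3 w \<partial>lborel)"
    unfolding lborel_Fubini(2)[OF i2, symmetric] lborel_Fubini(2)[OF i3, symmetric] T23 ..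
  have 3: "(\<integral>w. T3 w \<partial>lborel) = \<gamma> * (c * lap_x H\<phi> z)"
    unfolding T3_def by (simp add: lap_\<phi>)
  have 4: "(\<integral>w. T1 w \<partial>lborel) = \<gamma> * (D\<phi> z \<bullet> (0, 1) - \<phi> z)"
  proof -
    have "integrable lborel (\<lambda>w. kw w * (Df (z + Y w) \<bullet> (0, 1)))"
      by (rule kw_bounded_integrable[of "\<lambda>p. Df p \<bullet> (0, 1)" B]) (use Bt in auto)
    then show ?thesis
      unfolding T1_def using kw_f_integrable(1) by (simp add: right_diff_distrib D\<phi>_inner \<phi>_def)
  qed
  have "\<gamma> * (D\<phi> z \<bullet> (0, 1) - \<phi> z + c * lap_x H\<phi> z) = \<gamma> * (- f z)"
    using 1 2 3 4 by (simp add: algebra_simps)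
  then have "D\<phi> z \<bullet> (0, 1) - \<phi> z + c * lap_x H\<phi> z = - f z"
    using \<gamma> unfolding mult_cancel_left by auto
  then show ?thesis by simp
qed

end

section \<open>Energy estimates and sup bound for the resolvent\<close>

context heat_resolvent
begin

lemma \<phi>_parts:
  shows "uniformly_continuous_on UNIV D\<phi>" "bounded (range \<phi>)" "bounded (range D\<phi>)"
    and "integrable lborel \<phi>" "integrable lborel D\<phi>" "integrable lborel (H\<phi> v)"
    and "continuous_on UNIV \<phi>" "continuous_on UNIV D\<phi>" "continuous_on UNIV (H\<phi> v)" "bounded (range (H\<phi> v))"
proof -
  show "uniformly_continuous_on UNIV D\<phi>" "bounded (range D\<phi>)" "integrable lborel D\<phi>"
    unfolding D\<phi>_def[abs_def] using averaged(1,3,4)[OF continuous(2) outside(1)] by blast+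
  show "bounded (range \<phi>)" "integrable lborel \<phi>"
    unfolding \<phi>_def[abs_def] using averaged(3,4)[OF continuous(1) f_outside] by simp_all
  show "integrable lborel (H\<phi> v)" "bounded (range (H\<phi> v))"
    unfolding H\<phi>_def[abs_def] using averaged(3,4)[OF continuous(3) outside(2)] by blast+
  show "continuous_on UNIV \<phi>" "continuous_on UNIV D\<phi>" "continuous_on UNIV (H\<phi> v)"
    using has_hessD[OF \<phi>_hess] has_grad_continuous by auto
qed

lemma \<phi>_measurable[measurable]: "\<phi> \<in> borel_measurable borel" "D\<phi> \<in> borel_measurable borel" "H\<phi> v \<in> borel_measurable borel"
  using \<phi>_parts(7-9) continuous_borel_measurable by blast+

lemma integrable_bounded_mult:
  assumes "integrable lborel (p :: 'a \<times> real \<Rightarrow> real)" "bounded (range q)" "q \<in> borel_measurable borel"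
  shows "integrable lborel (\<lambda>z. p z * (q z :: real))"
proof -
  obtain B where "\<And>z. norm (q z) \<le> B" using assms(2) unfolding bounded_iff by blast
  then show ?thesis using integrable_mult_bounded[OF assms(1), of q B] assms(3) by simp
qed

lemma bounded_inner: "bounded (range g) \<Longrightarrow> bounded (range (\<lambda>z. g z \<bullet> v))" for g :: "'a \<times> real \<Rightarrow> 'a \<times> real"
proof -
  assume "bounded (range g)"
  then have "bounded ((\<lambda>x. x \<bullet> v) ` range g)" by (rule bounded_linear_image) (rule bounded_linear_inner_left)
  then show ?thesis by (simp add: image_image)
qed

lemma inner_parts:
  "integrable lborel (\<lambda>z. D\<phi> z \<bullet> v)" "integrable lborel (\<lambda>z. H\<phi> v' z \<bullet> v)"
  "bounded (range (\<lambda>z. D\<phi> z \<bullet> v))" "bounded (range (\<lambda>z. H\<phi> v' z \<bullet> v))"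
proof -
  show "integrable lborel (\<lambda>z. D\<phi> z \<bullet> v)" "integrable lborel (\<lambda>z. H\<phi> v' z \<bullet> v)"
    using \<phi>_parts(5) \<phi>_parts(6)[of v'] by (auto intro: integrable_inner_left)
  show "bounded (range (\<lambda>z. D\<phi> z \<bullet> v))" by (rule bounded_inner[OF \<phi>_parts(3)])
  show "bounded (range (\<lambda>z. H\<phi> v' z \<bullet> v))" by (rule bounded_inner[OF \<phi>_parts(10)])
qed

lemma bounded_shift: "bounded (range g) \<Longrightarrow> bounded (range (\<lambda>z. g (z + y)))" for g :: "'a \<times> real \<Rightarrow> real"
  by (rule bounded_subset) auto

text \<open>For \<open>y = 0\<close> this is the energy identity. For a time shift \<open>y\<close>
  the right side is even in the shift by translation invariance, which
  \<open>integral_hess_time\<close> exploits.\<close>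

lemma shifted_integral_by_parts:
  "(\<integral>z. (H\<phi> v z \<bullet> v) * \<phi> (z + y) \<partial>lborel) = - (\<integral>z. (D\<phi> z \<bullet> v) * (D\<phi> (z + y) \<bullet> v) \<partial>lborel)"
proof -
  let ?F = "\<lambda>z. (D\<phi> z \<bullet> v) * \<phi> (z + y)"
  let ?DF = "\<lambda>z. \<phi> (z + y) *\<^sub>R H\<phi> v z + (D\<phi> z \<bullet> v) *\<^sub>R D\<phi> (z + y)"
  have g: "has_grad ?F ?DF"
    by (rule has_grad_mult[OF has_hessD(2)[OF \<phi>_hess] has_grad_shift[OF has_hessD(1)[OF \<phi>_hess]]])
  have sc: "continuous_on UNIV (\<lambda>z. z + y)" by (intro continuous_intros)
  have c: "continuous_on UNIV ?DF"
    by (intro continuous_intros \<phi>_parts continuous_on_compose2[OF \<phi>_parts(7) sc] continuous_on_compose2[OF \<phi>_parts(8) sc]) auto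
  have i1: "integrable lborel (\<lambda>z. (H\<phi> v z \<bullet> v) * \<phi> (z + y))"
    by (rule integrable_bounded_mult[OF inner_parts(2) bounded_shift[OF \<phi>_parts(2)]]) measurable
  have i2: "integrable lborel (\<lambda>z. (D\<phi> z \<bullet> v) * (D\<phi> (z + y) \<bullet> v))"
    by (rule integrable_bounded_mult[OF inner_parts(1) bounded_shift[OF inner_parts(3)]]) measurable
  have DF: "?DF z \<bullet> v = (H\<phi> v z \<bullet> v) * \<phi> (z + y) + (D\<phi> z \<bullet> v) * (D\<phi> (z + y) \<bullet> v)" for z
    by (simp add: inner_add_left)
  have "(\<integral>z. ?DF z \<bullet> v \<partial>lborel) = 0"
  proof (rule integral_directional_derivative_eq_0[OF g c])
    show "integrable lborel ?F"
      by (rule integrable_bounded_mult[OF inner_parts(1) bounded_shift[OF \<phi>_parts(2)]]) measurable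
    show "integrable lborel (\<lambda>z. ?DF z \<bullet> v)"
      unfolding DF by (intro Bochner_Integration.integrable_add i1 i2)
  qed
  then show ?thesis unfolding DF using i1 i2 by simp
qed

lemma integral_\<phi>_time: "(\<integral>z. \<phi> z * (D\<phi> z \<bullet> (0, 1)) \<partial>lborel) = 0"
proof -
  let ?DF = "\<lambda>z. \<phi> z *\<^sub>R D\<phi> z + \<phi> z *\<^sub>R D\<phi> z"
  have g: "has_grad (\<lambda>z. \<phi> z * \<phi> z) ?DF"
    by (rule has_grad_mult[OF has_hessD(1)[OF \<phi>_hess] has_hessD(1)[OF \<phi>_hess]])
  have c: "continuous_on UNIV ?DF" by (intro continuous_intros \<phi>_parts)
  have i: "integrable lborel (\<lambda>z. \<phi> z * (D\<phi> z \<bullet> (0, 1)))"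
    by (rule integrable_bounded_mult[OF \<phi>_parts(4) inner_parts(3)]) measurable
  have DF: "?DF z \<bullet> (0, 1) = 2 * (\<phi> z * (D\<phi> z \<bullet> (0, 1)))" for z by (simp add: inner_add_left)
  have "(\<integral>z. ?DF z \<bullet> (0, 1) \<partial>lborel) = 0"
  proof (rule integral_directional_derivative_eq_0[OF g c])
    show "integrable lborel (\<lambda>z. \<phi> z * \<phi> z)"
      by (rule integrable_bounded_mult[OF \<phi>_parts(4,2)]) measurable
    show "integrable lborel (\<lambda>z. ?DF z \<bullet> (0, 1))" unfolding DF by (intro integrable_mult_right i)
  qed
  then show ?thesis unfolding DF by simp
qed

text \<open>The correlation of \<open>\<partial>\<^sub>v \<partial>\<^sub>v \<phi>\<close> with the time translates of \<open>\<phi>\<close> is an even function of the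
  translation, so its derivative at \<open>0\<close> vanishes; this avoids mixed third derivatives.\<close>

lemma integral_hess_time: "(\<integral>z. (H\<phi> v z \<bullet> v) * (D\<phi> z \<bullet> (0, 1)) \<partial>lborel) = 0"
proof -
  define b where "b s = (\<integral>z. (H\<phi> v z \<bullet> v) * \<phi> ((0, s) + z) \<partial>lborel)" for s
  have even: "b (- s) = b s" for s
  proof -
    have e: "b s = - (\<integral>z. (D\<phi> z \<bullet> v) * (D\<phi> (z + (0, s)) \<bullet> v) \<partial>lborel)" for s
      using shifted_integral_by_parts[of v "(0, s)"] by (simp add: b_def add.commute)
    have "(\<integral>z. (D\<phi> z \<bullet> v) * (D\<phi> (z + (0, - s)) \<bullet> v) \<partial>lborel) = (\<integral>z. (D\<phi> z \<bullet> v) * (D\<phi> (z + (0, s)) \<bullet> v) \<partial>lborel)"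
      using lborel_translation(1)[of "\<lambda>z. (D\<phi> z \<bullet> v) * (D\<phi> (z + (0, - s)) \<bullet> v)" "(0, s)"]
      by (simp add: time_shift_cancel mult.commute)
    then show ?thesis by (simp add: e)
  qed
  have hg: "has_grad (\<lambda>y. \<integral>z. (H\<phi> v z \<bullet> v) * \<phi> (y + z) \<partial>lborel) (\<lambda>y. \<integral>z. (H\<phi> v z \<bullet> v) *\<^sub>R D\<phi> (y + z) \<partial>lborel)"
    by (rule has_grad_parametric_integral[OF has_hessD(1)[OF \<phi>_hess] \<phi>_parts(1-3) inner_parts(2)]) measurable
  let ?d = "\<integral>z. (H\<phi> v z \<bullet> v) * (D\<phi> z \<bullet> (0, 1)) \<partial>lborel"
  have d: "(b has_real_derivative ?d) (at 0)"
  proof -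
    have "((\<lambda>s. (0, s)) has_derivative (\<lambda>t. t *\<^sub>R (0 :: 'a, 1 :: real))) (at 0)"
      by (auto intro!: derivative_eq_intros)
    moreover have "((\<lambda>y. \<integral>z. (H\<phi> v z \<bullet> v) * \<phi> (y + z) \<partial>lborel) has_derivative
       (\<lambda>x. (\<integral>z. (H\<phi> v z \<bullet> v) *\<^sub>R D\<phi> z \<partial>lborel) \<bullet> x)) (at (0, 0))"
    proof -
      have "(0, 0) + z = z" for z :: "'a \<times> real" by (cases z) simp
      then show ?thesis using has_gradD[OF hg, of "(0, 0)"] by simp
    qed
    ultimately have "(b has_derivative (\<lambda>t. (\<integral>z. (H\<phi> v z \<bullet> v) *\<^sub>R D\<phi> z \<partial>lborel) \<bullet> (t *\<^sub>R (0, 1)))) (at 0)"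
      unfolding b_def[abs_def] by (rule has_derivative_compose)
    then have *: "(b has_derivative (\<lambda>t. t * ((\<integral>z. (H\<phi> v z \<bullet> v) *\<^sub>R D\<phi> z \<partial>lborel) \<bullet> (0, 1)))) (at 0)"
      by (simp only: inner_scaleR_right)
    obtain B where "\<And>z. norm (D\<phi> z) \<le> B" using \<phi>_parts(3) unfolding bounded_iff by blast
    then have "integrable lborel (\<lambda>z. (H\<phi> v z \<bullet> v) *\<^sub>R D\<phi> z)"
      using integrable_mult_bounded[OF inner_parts(2)[of v v], of D\<phi> B] by simp
    then have eq: "(\<integral>z. (H\<phi> v z \<bullet> v) *\<^sub>R D\<phi> z \<partial>lborel) \<bullet> (0, 1) = ?d"
      using integral_inner_left[of "(0, 1)" lborel "\<lambda>z. (H\<phi> v z \<bullet> v) *\<^sub>R D\<phi> z"] by simp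
    show ?thesis
      unfolding has_field_derivative_def
      by (rule has_derivative_eq_rhs[OF *[unfolded eq]]) (simp add: fun_eq_iff mult.commute)
  qed
  have "((\<lambda>s. b (- s)) has_real_derivative ?d * (- 1)) (at 0)"
    by (rule DERIV_chain2) (use d in \<open>auto intro!: derivative_eq_intros\<close>)
  then have "(b has_real_derivative - ?d) (at 0)" by (simp add: even)
  from DERIV_unique[OF d this] show ?thesis by simp
qed

definition energy :: real where "energy = (\<Sum>i\<in>Basis. \<integral>z. (D\<phi> z \<bullet> (i, 0))\<^sup>2 \<partial>lborel)"

lemma energy_nonneg: "0 \<le> energy" by (simp add: energy_def sum_nonneg)

lemma lap_\<phi>_parts: "integrable lborel (lap_x H\<phi>)" "bounded (range (lap_x H\<phi>))" "lap_x H\<phi> \<in> borel_measurable borel"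
proof -
  show "integrable lborel (lap_x H\<phi>)" unfolding lap_x_def[abs_def] using inner_parts(2) by auto
  have L: "lap_x H\<phi> = (\<lambda>z. \<integral>w. kw w *\<^sub>R lap_x Hf (z + Y w) \<partial>lborel)" by (simp add: fun_eq_iff lap_\<phi>)
  show "bounded (range (lap_x H\<phi>))"
    unfolding L by (rule averaged(3)[OF lap_continuous lap_outside])
  show "lap_x H\<phi> \<in> borel_measurable borel"
    unfolding lap_x_def[abs_def] by measurable
qed

lemma integral_lap:
  "(\<integral>z. \<phi> z * lap_x H\<phi> z \<partial>lborel) = - energy"
  "(\<integral>z. (D\<phi> z \<bullet> (0, 1)) * lap_x H\<phi> z \<partial>lborel) = 0"
proof -
  have "(\<integral>z. \<phi> z * lap_x H\<phi> z \<partial>lborel) = (\<Sum>i\<in>Basis. \<integral>z. (H\<phi> (i, 0) z \<bullet> (i, 0)) * \<phi> z \<partial>lborel)"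
  proof -
    have "integrable lborel (\<lambda>z. (H\<phi> (i, 0) z \<bullet> (i, 0)) * \<phi> z)" for i
      by (rule integrable_bounded_mult[OF inner_parts(2) \<phi>_parts(2)]) measurable
    then show ?thesis by (simp add: lap_x_def sum_distrib_left mult.commute)
  qed
  also have "\<dots> = - energy"
    using shifted_integral_by_parts[where y = 0] by (simp add: energy_def power2_eq_square sum_negf)
  finally show "(\<integral>z. \<phi> z * lap_x H\<phi> z \<partial>lborel) = - energy" .
  have "(\<integral>z. (D\<phi> z \<bullet> (0, 1)) * lap_x H\<phi> z \<partial>lborel) = (\<Sum>i\<in>Basis. \<integral>z. (H\<phi> (i, 0) z \<bullet> (i, 0)) * (D\<phi> z \<bullet> (0, 1)) \<partial>lborel)"
  proof -
    have "integrable lborel (\<lambda>z. (H\<phi> (i, 0) z \<bullet> (i, 0)) * (D\<phi> z \<bullet> (0, 1)))" for i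
      by (rule integrable_bounded_mult[OF inner_parts(2) inner_parts(3)]) measurable
    then show ?thesis by (simp add: lap_x_def sum_distrib_left mult.commute)
  qed
  also have "\<dots> = 0" by (simp add: integral_hess_time)
  finally show "(\<integral>z. (D\<phi> z \<bullet> (0, 1)) * lap_x H\<phi> z \<partial>lborel) = 0" .
qed

text \<open>Square \<open>f = \<phi> - \<phi>_t - c \<Delta>\<phi>\<close> and integrate: the
  products of the time derivative with \<open>\<phi>\<close> and with the Laplacian integrate to 0,
  and \<open>- 2 c \<phi> \<Delta>\<phi>\<close> contributes \<open>2 * c * energy\<close>, which is
  nonnegative. This gives the first bound with constant 1; a larger constant would spoil the
  absorption in the duality argument. Multiplying the equation by \<open>\<phi>\<close> gives the
  second bound.\<close>

lemma energy_estimates: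
  "c\<^sup>2 * (\<integral>z. (lap_x H\<phi> z)\<^sup>2 \<partial>lborel) \<le> (\<integral>z. (f z)\<^sup>2 \<partial>lborel)"
  "c * energy \<le> (\<integral>z. f z * \<phi> z \<partial>lborel)"
  "integrable lborel (\<lambda>z. (lap_x H\<phi> z)\<^sup>2)"
proof -
  let ?t = "\<lambda>z. D\<phi> z \<bullet> (0, 1)" and ?L = "lap_x H\<phi>"
  note [measurable] = lap_\<phi>_parts(3)
  have i1: "integrable lborel (\<lambda>z. \<phi> z * \<phi> z)" by (rule integrable_bounded_mult[OF \<phi>_parts(4,2)]) measurable
  have i2: "integrable lborel (\<lambda>z. ?t z * ?t z)" by (rule integrable_bounded_mult[OF inner_parts(1,3)]) measurable
  have i3: "integrable lborel (\<lambda>z. ?L z * ?L z)" by (rule integrable_bounded_mult[OF lap_\<phi>_parts(1,2)]) measurable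
  have i4: "integrable lborel (\<lambda>z. \<phi> z * ?t z)" by (rule integrable_bounded_mult[OF \<phi>_parts(4) inner_parts(3)]) measurable
  have i5: "integrable lborel (\<lambda>z. \<phi> z * ?L z)" by (rule integrable_bounded_mult[OF \<phi>_parts(4) lap_\<phi>_parts(2)]) measurable
  have i6: "integrable lborel (\<lambda>z. ?t z * ?L z)" by (rule integrable_bounded_mult[OF inner_parts(1) lap_\<phi>_parts(2)]) measurable
  have f_eq: "f z = \<phi> z - ?t z - c * ?L z" for z using resolvent_equation[of z] by simp
  show "integrable lborel (\<lambda>z. (?L z)\<^sup>2)" using i3 by (simp add: power2_eq_square)
  have "(\<integral>z. (f z)\<^sup>2 \<partial>lborel) = (\<integral>z. (\<phi> z * \<phi> z + ?t z * ?t z + c\<^sup>2 * (?L z * ?L z)) + ((- 2) * (\<phi> z * ?t z) + (- (2 * c)) * (\<phi> z * ?L z) + (2 * c) * (?t z * ?L z)) \<partial>lborel)"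
    by (intro Bochner_Integration.integral_cong[OF refl]) (simp add: f_eq power2_eq_square algebra_simps)
  also have "\<dots> = ((\<integral>z. \<phi> z * \<phi> z \<partial>lborel) + (\<integral>z. ?t z * ?t z \<partial>lborel) + c\<^sup>2 * (\<integral>z. ?L z * ?L z \<partial>lborel)) + 2 * c * energy"
    using i1 i2 i3 i4 i5 i6 integral_\<phi>_time integral_lap by simp
  also have "\<dots> \<ge> c\<^sup>2 * (\<integral>z. ?L z * ?L z \<partial>lborel)"
  proof -
    have "0 \<le> (\<integral>z. \<phi> z * \<phi> z \<partial>lborel)" "0 \<le> (\<integral>z. ?t z * ?t z \<partial>lborel)" by simp_all
    moreover have "0 \<le> 2 * c * energy" using c energy_nonneg by simp
    ultimately show ?thesis by linarith
  qed
  finally show "c\<^sup>2 * (\<integral>z. (?L z)\<^sup>2 \<partial>lborel) \<le> (\<integral>z. (f z)\<^sup>2 \<partial>lborel)" by (simp add: power2_eq_square)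
  have "(\<integral>z. f z * \<phi> z \<partial>lborel) = (\<integral>z. \<phi> z * \<phi> z - \<phi> z * ?t z - c * (\<phi> z * ?L z) \<partial>lborel)"
    by (intro Bochner_Integration.integral_cong[OF refl]) (simp add: f_eq algebra_simps)
  also have "\<dots> = (\<integral>z. \<phi> z * \<phi> z \<partial>lborel) + c * energy"
    using i1 i4 i5 integral_\<phi>_time integral_lap by simp
  finally show "c * energy \<le> (\<integral>z. f z * \<phi> z \<partial>lborel)" by simp
qed

lemma gradient_energy: "integrable lborel (\<lambda>z. (norm (fst (D\<phi> z)))\<^sup>2)" "(\<integral>z. (norm (fst (D\<phi> z)))\<^sup>2 \<partial>lborel) = energy"
proof -
  have i: "integrable lborel (\<lambda>z. (D\<phi> z \<bullet> (i, 0))\<^sup>2)" for i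
    using integrable_bounded_mult[OF inner_parts(1,3)] by (simp add: power2_eq_square)
  have e: "(norm (fst (D\<phi> z)))\<^sup>2 = (\<Sum>i\<in>Basis. (D\<phi> z \<bullet> (i, 0))\<^sup>2)" for z
    unfolding power2_norm_eq_inner by (subst euclidean_inner) (simp add: inner_prod_def power2_eq_square)
  show "integrable lborel (\<lambda>z. (norm (fst (D\<phi> z)))\<^sup>2)" unfolding e using i by simp
  show "(\<integral>z. (norm (fst (D\<phi> z)))\<^sup>2 \<partial>lborel) = energy" unfolding e energy_def using i by simp
qed

lemma \<phi>_nonneg: "(\<And>z. 0 \<le> f z) \<Longrightarrow> 0 \<le> \<phi> z"
  unfolding \<phi>_def by (intro integral_nonneg_AE) (simp add: kw_nonneg)

text \<open>Split at \<open>\<sigma> = r\<close>, that is at elapsed time \<open>r\<^sup>2\<close>.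
  Earlier times have probability at most \<open>r\<^sup>2\<close>, since the density of
  \<open>\<sigma>\<close> is at most \<open>2 * \<sigma>\<close>, and there \<open>f \<le> M\<close>
  is used. Later the Gaussian has spread over a scale of at least \<open>a * r\<close>, so its
  density is at most \<open>1 / (\<gamma> * (a * r) ^ DIM('a))\<close> and the integral of
  \<open>f\<close> takes over. The radius \<open>r\<close> stays free to be optimized.\<close>

lemma \<phi>_sup_bound:
  assumes nn: "\<And>z. 0 \<le> f z" and M: "\<And>z. f z \<le> M" and r: "0 < r"
  shows "\<phi> z \<le> M * r\<^sup>2 + (1 / (\<gamma> * a ^ DIM('a))) * (1 / r ^ DIM('a)) * (\<integral>z. f z \<partial>lborel)"
proof -
  have M0: "0 \<le> M" using nn M order_trans by blast
  let ?s = "indicator {..r} :: real \<Rightarrow> real" and ?l = "indicator {r<..} :: real \<Rightarrow> real"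
  let ?C = "1 / (\<gamma> * a ^ DIM('a))"
  let ?I = "\<integral>z. f z \<partial>lborel"
  have i_f: "integrable lborel f" by (rule integrable_continuous_bounded_support[OF continuous(1) f_outside])
  have i1: "integrable lborel (\<lambda>w. kw w * (M * ?s (snd w)))"
    using integrable_mult_bounded[OF kw_integrable, of "\<lambda>w. M * ?s (snd w)" M] M0 by (simp add: indicator_def)
  have i2: "integrable lborel (\<lambda>w. ?l (snd w) * (kw w * f (z + Y w)))"
    using integrable_mult_bounded[OF kw_f_integrable(1), of "\<lambda>w. ?l (snd w)" 1 z] by (simp add: mult.commute indicator_def)
  have "\<phi> z \<le> (\<integral>w. kw w * (M * ?s (snd w)) + ?l (snd w) * (kw w * f (z + Y w)) \<partial>lborel)"
    unfolding \<phi>_def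
  proof (rule integral_mono)
    show "integrable lborel (\<lambda>w. kw w * (M * ?s (snd w)) + ?l (snd w) * (kw w * f (z + Y w)))" using i1 i2 by simp
    show "kw w * f (z + Y w) \<le> kw w * (M * ?s (snd w)) + ?l (snd w) * (kw w * f (z + Y w))" for w
      using mult_left_mono[OF M[of "z + Y w"] kw_nonneg[of w]] by (auto simp: indicator_def)
  qed (rule kw_f_integrable)
  also have "\<dots> = (\<integral>w. kw w * (M * ?s (snd w)) \<partial>lborel) + (\<integral>w. ?l (snd w) * (kw w * f (z + Y w)) \<partial>lborel)"
    using i1 i2 by simp
  also have "(\<integral>w. kw w * (M * ?s (snd w)) \<partial>lborel) \<le> M * r\<^sup>2"
  proof -
    have "(\<integral>w. kw w * (M * ?s (snd w)) \<partial>lborel) = (\<integral>x. (\<integral>s. gauss (x::'a) / \<gamma> * (M * (2 * s * half_weight s * ?s s)) \<partial>lborel) \<partial>lborel)"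
      by (subst lborel_Fubini(1)[OF i1, symmetric]) (simp add: kw_def mult_ac)
    also have "\<dots> = M * (\<integral>s. 2 * s * half_weight s * ?s s \<partial>lborel)"
      using \<gamma> by (simp add: \<gamma>_def[symmetric])
    also have "\<dots> \<le> M * r\<^sup>2"
    proof (rule mult_left_mono[OF _ M0])
      have h: "has_bochner_integral lborel (\<lambda>s. indicator {0..r} s *\<^sub>R (2 * s)) (r\<^sup>2 - 0\<^sup>2)"
        by (rule has_bochner_integral_FTC_Icc) (use r in \<open>auto intro!: derivative_eq_intros continuous_intros simp: has_real_derivative_iff_has_vector_derivative[symmetric]\<close>)
      have "(\<integral>s. 2 * s * half_weight s * ?s s \<partial>lborel) \<le> (\<integral>s. indicator {0..r} s *\<^sub>R (2 * s) \<partial>lborel)"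
        by (rule integral_mono') (use h in \<open>auto simp: has_bochner_integral_iff half_weight_def indicator_def mult_left_le\<close>)
      also have "\<dots> = r\<^sup>2" using h by (simp add: has_bochner_integral_iff)
      finally show "(\<integral>s. 2 * s * half_weight s * ?s s \<partial>lborel) \<le> r\<^sup>2" .
    qed
    finally show ?thesis .
  qed
  also have "(\<integral>w. ?l (snd w) * (kw w * f (z + Y w)) \<partial>lborel) \<le> ?C * (1 / r ^ DIM('a)) * ?I"
  proof -
    obtain x t where z: "z = (x, t)" by (cases z)
    let ?K = "1 / \<gamma> * (1 / (a * r) ^ DIM('a))"
    have K: "0 \<le> ?K" using \<gamma> a(1) r by simp
    let ?g = "\<lambda>y s. f (y, s)"
    have "ennreal (\<integral>w. ?l (snd w) * (kw w * f (z + Y w)) \<partial>lborel) = (\<integral>\<^sup>+w. ennreal (?l (snd w) * (kw w * f (z + Y w))) \<partial>lborel)"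
      by (rule nn_integral_eq_integral[OF i2, symmetric]) (simp add: kw_nonneg nn)
    also have "\<dots> = (\<integral>\<^sup>+s. (\<integral>\<^sup>+\<xi>. ennreal (?l s * (kw (\<xi>, s) * f (z + Y (\<xi>, s)))) \<partial>lborel) \<partial>lborel)"
    proof -
      have "(\<lambda>w::'a \<times> real. ennreal (?l (snd w) * (kw w * f (z + Y w)))) \<in> borel_measurable (lborel \<Otimes>\<^sub>M lborel)"
        unfolding lborel_prod by measurable
      from lborel_pair.nn_integral_snd[OF this] show ?thesis by (simp add: lborel_prod)
    qed
    also have "\<dots> \<le> (\<integral>\<^sup>+s. ennreal (?K) * (\<integral>\<^sup>+y. ennreal (2 * s * f (y, t + s\<^sup>2)) * indicator {0<..} s \<partial>lborel) \<partial>lborel)"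
    proof (rule nn_integral_mono)
      fix s :: real
      show "(\<integral>\<^sup>+\<xi>. ennreal (?l s * (kw (\<xi>, s) * f (z + Y (\<xi>, s)))) \<partial>lborel) \<le> ennreal (?K) * (\<integral>\<^sup>+y. ennreal (2 * s * f (y, t + s\<^sup>2)) * indicator {0<..} s \<partial>lborel)"
      proof (cases "r < s")
        case True
        then have s: "0 < s" using r by simp
        have "(\<integral>\<^sup>+\<xi>. ennreal (?l s * (kw (\<xi>, s) * f (z + Y (\<xi>, s)))) \<partial>lborel) \<le> (\<integral>\<^sup>+\<xi>. ennreal (1 / \<gamma>) * ennreal (2 * s * f (x + (a * s) *\<^sub>R \<xi>, t + s\<^sup>2)) \<partial>lborel)"
        proof (rule nn_integral_mono)
          fix \<xi> :: 'a
          \<comment> \<open>All decay of the kernel is discarded here; the finiteness of what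
            remains comes from integrating \<open>f\<close> itself.\<close>
          have "gauss \<xi> * half_weight s \<le> 1 * 1"
            using gauss_le_1[of \<xi>] gauss_pos[of \<xi>] by (intro mult_mono) (auto simp: half_weight_def indicator_def)
          then have "gauss \<xi> * half_weight s * (1 / \<gamma> * (2 * s * f (x + (a * s) *\<^sub>R \<xi>, t + s\<^sup>2))) \<le> 1 * (1 / \<gamma> * (2 * s * f (x + (a * s) *\<^sub>R \<xi>, t + s\<^sup>2)))"
            using \<gamma> s nn by (intro mult_right_mono) auto
          then have "?l s * (kw (\<xi>, s) * f (z + Y (\<xi>, s))) \<le> 1 / \<gamma> * (2 * s * f (x + (a * s) *\<^sub>R \<xi>, t + s\<^sup>2))"
            using True by (simp add: kw_def Y_def z mult_ac)
          then show "ennreal (?l s * (kw (\<xi>, s) * f (z + Y (\<xi>, s)))) \<le> ennreal (1 / \<gamma>) * ennreal (2 * s * f (x + (a * s) *\<^sub>R \<xi>, t + s\<^sup>2))"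
            using \<gamma> s nn by (subst ennreal_mult[symmetric]) (auto intro: ennreal_leI)
        qed
        also have "\<dots> = ennreal (1 / \<gamma>) * (\<integral>\<^sup>+\<xi>. ennreal (2 * s * f (x + (a * s) *\<^sub>R \<xi>, t + s\<^sup>2)) \<partial>lborel)"
          by (rule nn_integral_cmult) measurable
        also have "(\<integral>\<^sup>+\<xi>. ennreal (2 * s * f (x + (a * s) *\<^sub>R \<xi>, t + s\<^sup>2)) \<partial>lborel) = ennreal (1 / (a * s) ^ DIM('a)) * (\<integral>\<^sup>+y. ennreal (2 * s * f (y, t + s\<^sup>2)) \<partial>lborel)"
          using nn_integral_scaled_translate[of "\<lambda>y. 2 * s * f (y, t + s\<^sup>2)" "a * s" x] a(1) s by simp
        also have "\<dots> \<le> ennreal (1 / (a * r) ^ DIM('a)) * (\<integral>\<^sup>+y. ennreal (2 * s * f (y, t + s\<^sup>2)) \<partial>lborel)"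
          using a(1) r True by (intro mult_right_mono ennreal_leI divide_left_mono power_mono mult_left_mono mult_pos_pos zero_less_power) auto
        also have "ennreal (1 / \<gamma>) * (ennreal (1 / (a * r) ^ DIM('a)) * (\<integral>\<^sup>+y. ennreal (2 * s * f (y, t + s\<^sup>2)) \<partial>lborel)) =
           ennreal ?K * (\<integral>\<^sup>+y. ennreal (2 * s * f (y, t + s\<^sup>2)) \<partial>lborel)"
          using \<gamma> a(1) r by (simp add: ennreal_mult[symmetric] mult.assoc[symmetric])
        finally show ?thesis using s by (simp add: mult_left_mono)
      qed simp
    qed
    also have "\<dots> = ennreal ?K * (\<integral>\<^sup>+s. (\<integral>\<^sup>+y. ennreal (2 * s * f (y, t + s\<^sup>2)) * indicator {0<..} s \<partial>lborel) \<partial>lborel)"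
      by (rule nn_integral_cmult) measurable
    also have "(\<integral>\<^sup>+s. (\<integral>\<^sup>+y. ennreal (2 * s * f (y, t + s\<^sup>2)) * indicator {0<..} s \<partial>lborel) \<partial>lborel) =
        (\<integral>\<^sup>+y. (\<integral>\<^sup>+s. ennreal (2 * s * f (y, t + s\<^sup>2)) * indicator {0<..} s \<partial>lborel) \<partial>lborel)"
      by (rule lborel_pair.Fubini') measurable
    also have "\<dots> \<le> (\<integral>\<^sup>+y. (\<integral>\<^sup>+s. ennreal (f (y, s)) \<partial>lborel) \<partial>lborel)"
      by (intro nn_integral_mono nn_integral_square_substitution nn) measurable
    also have "\<dots> = (\<integral>\<^sup>+w. ennreal (f w) \<partial>lborel)"
    proof -
      have "(\<lambda>w. ennreal (f w)) \<in> borel_measurable (lborel \<Otimes>\<^sub>M lborel)"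
        unfolding lborel_prod by measurable
      from lborel.nn_integral_fst[OF this] show ?thesis by (simp add: lborel_prod)
    qed
    also have "\<dots> = ennreal ?I" by (rule nn_integral_eq_integral[OF i_f]) (simp add: nn)
    finally have "ennreal (\<integral>w. ?l (snd w) * (kw w * f (z + Y w)) \<partial>lborel) \<le> ennreal ?K * ennreal ?I"
      by (simp add: mult_left_mono)
    also have "\<dots> = ennreal (?K * ?I)" by (rule ennreal_mult[symmetric, OF K]) (simp add: nn)
    finally have "(\<integral>w. ?l (snd w) * (kw w * f (z + Y w)) \<partial>lborel) \<le> ?K * ?I"
      using K nn by (subst (asm) ennreal_le_iff) (auto intro!: mult_nonneg_nonneg integral_nonneg_AE)
    then show ?thesis by (simp add: power_mult_distrib mult_ac)
  qed
  finally show ?thesis by simp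
qed

end

section \<open>Pointwise lower bounds from small sublevel sets\<close>

lemma smooth_has_hess:
  assumes "smooth f"
  shows "has_hess f (grad f) (\<lambda>v. grad (\<lambda>z. grad f z \<bullet> v))"
  unfolding has_hess_def
  using smooth_has_grad(1)[OF assms] smooth_has_grad(1,3)[OF smooth_has_grad(2)[OF assms]] by blast

lemma has_hess_mult:
  assumes f: "has_hess f D H" and g: "has_hess g E I"
  shows "has_hess (\<lambda>z. f z * g z) (\<lambda>z. g z *\<^sub>R D z + f z *\<^sub>R E z)
    (\<lambda>v z. (D z \<bullet> v) *\<^sub>R E z + g z *\<^sub>R H v z + ((E z \<bullet> v) *\<^sub>R D z + f z *\<^sub>R I v z))"
  unfolding has_hess_def
proof (intro conjI allI)
  note F = has_hessD[OF f] and G = has_hessD[OF g]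
  show "has_grad (\<lambda>z. f z * g z) (\<lambda>z. g z *\<^sub>R D z + f z *\<^sub>R E z)" by (rule has_grad_mult[OF F(1) G(1)])
  fix v
  have 1: "has_grad (\<lambda>z. g z * (D z \<bullet> v)) (\<lambda>z. (D z \<bullet> v) *\<^sub>R E z + g z *\<^sub>R H v z)"
    by (rule has_grad_mult[OF G(1) F(2)])
  have 2: "has_grad (\<lambda>z. f z * (E z \<bullet> v)) (\<lambda>z. (E z \<bullet> v) *\<^sub>R D z + f z *\<^sub>R I v z)"
    by (rule has_grad_mult[OF F(1) G(2)])
  show "has_grad (\<lambda>z. (g z *\<^sub>R D z + f z *\<^sub>R E z) \<bullet> v)
     (\<lambda>z. (D z \<bullet> v) *\<^sub>R E z + g z *\<^sub>R H v z + ((E z \<bullet> v) *\<^sub>R D z + f z *\<^sub>R I v z))"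
    unfolding has_grad_def
  proof
    fix z
    show "((\<lambda>z. (g z *\<^sub>R D z + f z *\<^sub>R E z) \<bullet> v) has_derivative
      (\<lambda>x. ((D z \<bullet> v) *\<^sub>R E z + g z *\<^sub>R H v z + ((E z \<bullet> v) *\<^sub>R D z + f z *\<^sub>R I v z)) \<bullet> x)) (at z)"
      using has_derivative_add[OF has_gradD[OF 1, of z] has_gradD[OF 2, of z]]
      by (simp add: inner_add_left)
  qed
  show "continuous_on UNIV (\<lambda>z. (D z \<bullet> v) *\<^sub>R E z + g z *\<^sub>R H v z + ((E z \<bullet> v) *\<^sub>R D z + f z *\<^sub>R I v z))"
    by (intro continuous_intros F G has_grad_continuous[OF F(1)] has_grad_continuous[OF G(1)])
qed

lemma lap_x_mult:
  "lap_x (\<lambda>v z. (D z \<bullet> v) *\<^sub>R E z + g z *\<^sub>R H v z + ((E z \<bullet> v) *\<^sub>R D z + f z *\<^sub>R I v z)) z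
    = g z * lap_x H z + f z * lap_x I z + 2 * (fst (D z) \<bullet> fst (E z))"
proof -
  have "fst (D z) \<bullet> fst (E z) = (\<Sum>i\<in>Basis. (D z \<bullet> (i, 0)) * (E z \<bullet> (i, 0)))"
    by (subst euclidean_inner) (simp add: inner_prod_def)
  then show ?thesis
    by (simp add: lap_x_def inner_add_left sum.distrib sum_distrib_left mult.commute)
qed

text \<open>The third power is the lowest integer power of the positive part that is of class C^2.
  Vanishing to finite order also leaves the cutoff with a polynomial lower bound near the edge of
  its ball, on which the iteration relies.\<close>

definition cube :: "real \<Rightarrow> real" where "cube s = (if s \<le> 0 then 0 else s ^ 3)"
definition cube' :: "real \<Rightarrow> real" where "cube' s = (if s \<le> 0 then 0 else 3 * s\<^sup>2)"
definition cube'' :: "real \<Rightarrow> real" where "cube'' s = (if s \<le> 0 then 0 else 6 * s)"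

lemma DERIV_cube: "(cube has_real_derivative cube' s) (at s)"
  unfolding cube_def[abs_def] cube'_def by (rule DERIV_cutoff) (auto intro!: derivative_eq_intros)

lemma DERIV_cube': "(cube' has_real_derivative cube'' s) (at s)"
  unfolding cube'_def[abs_def] cube''_def by (rule DERIV_cutoff) (auto intro!: derivative_eq_intros)

lemma continuous_cube'': "continuous_on UNIV cube''"
proof -
  have eq: "cube'' = (\<lambda>s. 6 * max 0 s)" by (auto simp: cube''_def max_def)
  show ?thesis unfolding eq by (intro continuous_intros)
qed

lemma cube_bounds:
  assumes "s \<le> 1"
  shows "0 \<le> cube s" "cube s \<le> 1" "0 \<le> cube' s" "cube' s \<le> 3" "0 \<le> cube'' s" "cube'' s \<le> 6"
  using assms by (auto simp: cube_def cube'_def cube''_def power_le_one abs_square_le_1)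

lemma has_grad_quadratic: "has_grad (\<lambda>z. 1 - k * (norm z)\<^sup>2) (\<lambda>z. (- 2 * k) *\<^sub>R z)"
  unfolding has_grad_def power2_norm_eq_inner
  by (auto intro!: derivative_eq_intros simp: inner_commute)

lemma has_grad_linear: "has_grad (\<lambda>z. k * (z \<bullet> v)) (\<lambda>z. k *\<^sub>R v)"
  unfolding has_grad_def by (auto intro!: derivative_eq_intros simp: inner_commute)

definition cutoff :: "real \<Rightarrow> 'a::euclidean_space \<times> real \<Rightarrow> real" where
  "cutoff \<rho> z = cube (1 - (norm z)\<^sup>2 / \<rho>\<^sup>2)"
definition cutoff_grad :: "real \<Rightarrow> 'a::euclidean_space \<times> real \<Rightarrow> 'a \<times> real" where
  "cutoff_grad \<rho> z = cube' (1 - (norm z)\<^sup>2 / \<rho>\<^sup>2) *\<^sub>R ((- 2 / \<rho>\<^sup>2) *\<^sub>R z)"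
definition cutoff_hess :: "real \<Rightarrow> 'a::euclidean_space \<times> real \<Rightarrow> 'a \<times> real \<Rightarrow> 'a \<times> real" where
  "cutoff_hess \<rho> v z = ((- 2 / \<rho>\<^sup>2) * (z \<bullet> v)) *\<^sub>R (cube'' (1 - (norm z)\<^sup>2 / \<rho>\<^sup>2) *\<^sub>R ((- 2 / \<rho>\<^sup>2) *\<^sub>R z))
     + cube' (1 - (norm z)\<^sup>2 / \<rho>\<^sup>2) *\<^sub>R ((- 2 / \<rho>\<^sup>2) *\<^sub>R v)"

lemma cutoff_has_hess: "has_hess (cutoff \<rho> :: 'a::euclidean_space \<times> real \<Rightarrow> real) (cutoff_grad \<rho>) (cutoff_hess \<rho>)"
proof -
  let ?s = "\<lambda>z::'a \<times> real. 1 - (norm z)\<^sup>2 / \<rho>\<^sup>2"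
  have s: "has_grad ?s (\<lambda>z. (- 2 / \<rho>\<^sup>2) *\<^sub>R z)"
    using has_grad_quadratic[of "1 / \<rho>\<^sup>2"] by simp
  have cs: "continuous_on UNIV ?s" by (rule has_grad_continuous[OF s])
  have c': "continuous_on UNIV cube'" using DERIV_cube' by (auto intro: continuous_at_imp_continuous_on DERIV_isCont)
  show ?thesis
    unfolding has_hess_def
  proof (intro conjI allI)
    show "has_grad (cutoff \<rho> :: 'a \<times> real \<Rightarrow> real) (cutoff_grad \<rho>)"
      using has_grad_compose[OF s DERIV_cube] unfolding cutoff_def[abs_def] cutoff_grad_def[abs_def] .
    fix v :: "'a \<times> real"
    have l: "has_grad (\<lambda>z. (- 2 / \<rho>\<^sup>2) * (z \<bullet> v)) (\<lambda>z. (- 2 / \<rho>\<^sup>2) *\<^sub>R v)"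
      by (rule has_grad_linear)
    have "has_grad (\<lambda>z. cube' (?s z) * ((- 2 / \<rho>\<^sup>2) * (z \<bullet> v))) (cutoff_hess \<rho> v)"
      unfolding cutoff_hess_def[abs_def] by (rule has_grad_mult[OF has_grad_compose[OF s DERIV_cube'] l])
    then show "has_grad (\<lambda>z. cutoff_grad \<rho> z \<bullet> v) (cutoff_hess \<rho> v)" by (simp add: cutoff_grad_def mult.assoc)
    show "continuous_on UNIV (cutoff_hess \<rho> v)"
      unfolding cutoff_hess_def[abs_def]
      by (intro continuous_intros continuous_on_compose2[OF c' cs] continuous_on_compose2[OF continuous_cube'' cs]) auto
  qed
qed

lemma cutoff_outside:
  assumes "0 < \<rho>" "\<rho> \<le> norm z"
  shows "cutoff \<rho> z = 0" "cutoff_grad \<rho> z = 0" "lap_x (cutoff_hess \<rho>) z = 0"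
proof -
  have "\<rho>\<^sup>2 \<le> (norm z)\<^sup>2" using assms by (intro power_mono) auto
  then have "1 - (norm z)\<^sup>2 / \<rho>\<^sup>2 \<le> 0" using assms by simp
  then show "cutoff \<rho> z = 0" "cutoff_grad \<rho> z = 0" "lap_x (cutoff_hess \<rho>) z = 0"
    by (auto simp: cutoff_def cutoff_grad_def cutoff_hess_def lap_x_def cube_def cube'_def cube''_def)
qed

text \<open>For \<open>\<rho> \<ge> 1/2\<close> the factor \<open>2 / \<rho>\<^sup>2\<close> is at
  most 8. With the bounds 3 and 6 on \<open>cube'\<close> and \<open>cube''\<close> this gives
  \<open>3 * 8\<close> for the gradient and \<open>8\<^sup>2 * 6 + 24 * DIM('a)\<close> for the
  Laplacian, uniformly in \<open>\<rho>\<close>: shrinking radii are paid for only in the lower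
  bound of the cutoff on the next ball.\<close>

lemma cutoff_bounds:
  fixes z :: "'a::euclidean_space \<times> real"
  assumes \<rho>: "1/2 \<le> \<rho>" "\<rho> \<le> 1"
  shows "0 \<le> cutoff \<rho> z" "cutoff \<rho> z \<le> 1" "norm (cutoff_grad \<rho> z) \<le> 24"
    "\<bar>lap_x (cutoff_hess \<rho>) z\<bar> \<le> 384 + 24 * real DIM('a)"
proof -
  let ?s = "1 - (norm z)\<^sup>2 / \<rho>\<^sup>2"
  have s1: "?s \<le> 1" by simp
  note b = cube_bounds[OF s1]
  show "0 \<le> cutoff \<rho> z" "cutoff \<rho> z \<le> 1" using b by (auto simp: cutoff_def)
  have "(1/2)\<^sup>2 \<le> \<rho>\<^sup>2" using \<rho> by (intro power_mono) auto
  then have r: "0 \<le> 2 / \<rho>\<^sup>2" "2 / \<rho>\<^sup>2 \<le> 8" using \<rho> by (auto simp: power2_eq_square field_simps)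
  show "norm (cutoff_grad \<rho> z) \<le> 24"
  proof (cases "\<rho> \<le> norm z")
    case True
    then show ?thesis using cutoff_outside(2)[of \<rho> z] \<rho> by simp
  next
    case False
    then have n: "norm z \<le> 1" using \<rho> by simp
    have "norm (cutoff_grad \<rho> z) = cube' ?s * (2 / \<rho>\<^sup>2 * norm z)"
      using b(3) by (simp add: cutoff_grad_def abs_of_nonneg)
    also have "\<dots> \<le> 3 * (8 * 1)" using b r n by (intro mult_mono) auto
    finally show ?thesis by simp
  qed
  show "\<bar>lap_x (cutoff_hess \<rho>) z\<bar> \<le> 384 + 24 * real DIM('a)"
  proof (cases "\<rho> \<le> norm z")
    case True
    then show ?thesis using cutoff_outside(3)[of \<rho> z] \<rho> by simp
  next
    case False
    then have "norm z \<le> 1" using \<rho> by simp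
    then have n: "norm (fst z) \<le> 1" using norm_fst_le[of "fst z" "snd z"] by simp
    have n2: "(norm (fst z))\<^sup>2 \<le> 1" using n by (simp add: power_le_one)
    have fz: "(norm (fst z))\<^sup>2 = (\<Sum>i\<in>Basis. (fst z \<bullet> i) * (fst z \<bullet> i))"
      unfolding power2_norm_eq_inner by (rule euclidean_inner)
    have "lap_x (cutoff_hess \<rho>) z = (\<Sum>i\<in>Basis. (2 / \<rho>\<^sup>2)\<^sup>2 * cube'' ?s * ((fst z \<bullet> i) * (fst z \<bullet> i)) + (- (2 / \<rho>\<^sup>2) * cube' ?s))"
      unfolding lap_x_def
    proof (rule sum.cong[OF refl])
      fix i :: 'a assume i: "i \<in> Basis"
      show "cutoff_hess \<rho> (i, 0) z \<bullet> (i, 0) = (2 / \<rho>\<^sup>2)\<^sup>2 * cube'' ?s * ((fst z \<bullet> i) * (fst z \<bullet> i)) + (- (2 / \<rho>\<^sup>2) * cube' ?s)"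
        using i by (simp add: cutoff_hess_def inner_add_left inner_diff_left inner_prod_def power2_eq_square inner_same_Basis mult_ac)
    qed
    also have "\<dots> = (2 / \<rho>\<^sup>2)\<^sup>2 * cube'' ?s * (norm (fst z))\<^sup>2 - real DIM('a) * ((2 / \<rho>\<^sup>2) * cube' ?s)"
      unfolding fz by (simp add: sum.distrib sum_subtractf sum_distrib_left)
    finally have eq: "lap_x (cutoff_hess \<rho>) z = (2 / \<rho>\<^sup>2)\<^sup>2 * cube'' ?s * (norm (fst z))\<^sup>2 - real DIM('a) * ((2 / \<rho>\<^sup>2) * cube' ?s)" .
    have "(2 / \<rho>\<^sup>2)\<^sup>2 * cube'' ?s * (norm (fst z))\<^sup>2 \<le> 384"
      using mult_mono[OF mult_mono[OF power_mono[OF r(2,1), of 2] b(6)] n2] b by simp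
    moreover have "0 \<le> (2 / \<rho>\<^sup>2)\<^sup>2 * cube'' ?s * (norm (fst z))\<^sup>2" using b by simp
    moreover have "real DIM('a) * ((2 / \<rho>\<^sup>2) * cube' ?s) \<le> 24 * real DIM('a)"
      using mult_left_mono[OF mult_mono[OF r(2) b(4)], of "real DIM('a)"] b by simp
    moreover have "0 \<le> real DIM('a) * ((2 / \<rho>\<^sup>2) * cube' ?s)" using b r by (intro mult_nonneg_nonneg) auto
    ultimately show ?thesis unfolding eq by linarith
  qed
qed

text \<open>\<open>h\<close> and \<open>H\<close> stand for the truncations
  \<open>max 0 (\<kappa> - u)\<close> and \<open>max 0 (\<kappa> powr m - u powr m)\<close> of a
  supersolution rescaled to the unit ball. The ratio \<open>H / h\<close> acts as a measurable
  diffusion coefficient between \<open>\<Lambda>\<^sub>0\<close> and \<open>\<Lambda>\<close>; all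
  derivatives sit on the test function.\<close>

locale very_weak_subsolution =
  fixes h H :: "'a::euclidean_space \<times> real \<Rightarrow> real" and \<Lambda>\<^sub>0 \<Lambda> M :: real
  assumes ell: "0 < \<Lambda>\<^sub>0" "\<Lambda>\<^sub>0 \<le> \<Lambda>" and M: "0 < M"
    and meas[measurable]: "h \<in> borel_measurable borel" "H \<in> borel_measurable borel"
    and h: "\<And>z. 0 \<le> h z" "\<And>z. h z \<le> M" and H: "\<And>z. \<Lambda>\<^sub>0 * h z \<le> H z" "\<And>z. H z \<le> \<Lambda> * h z"
    and weak: "\<And>\<phi> D\<phi> H\<phi> K. has_hess \<phi> D\<phi> H\<phi> \<Longrightarrow> (\<And>z. 0 \<le> \<phi> z) \<Longrightarrow> compact K \<Longrightarrow> K \<subseteq> ball 0 1 \<Longrightarrow>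
       (\<And>z. z \<notin> K \<Longrightarrow> \<phi> z = 0) \<Longrightarrow> 0 \<le> (\<integral>z. h z * (D\<phi> z \<bullet> (0, 1)) + H z * lap_x H\<phi> z \<partial>lborel)"
begin

lemma \<Lambda>: "0 < \<Lambda>" using ell by linarith

definition support :: "real \<Rightarrow> ('a \<times> real) set" where "support \<rho> = {z \<in> ball 0 \<rho>. 0 < h z}"

lemma support_measurable[measurable]: "support \<rho> \<in> sets borel"
  unfolding support_def by measurable

lemma support_fin: "emeasure lborel (support \<rho>) < \<infinity>"
  by (rule emeasure_bounded_finite) (auto simp: support_def intro: bounded_subset[OF bounded_ball[of 0 \<rho>]])

lemma integrable_support: "integrable lborel (indicat_real (support \<rho>))"
  using support_fin by simp

text \<open>The test function is \<open>\<eta> \<phi>\<close>, where \<open>\<phi>\<close> solves \<open>\<phi> - \<phi>\<^sub>t - \<Lambda> \<Delta>\<phi> = f\<close> with \<open>f\<close> close to \<open>h \<eta>\<close>. Since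
  \<open>\<bar>H - \<Lambda> h\<bar> \<le> (\<Lambda> - \<Lambda>\<^sub>0) h\<close> and \<open>\<Lambda> \<parallel>\<Delta>\<phi>\<parallel> \<le> \<parallel>f\<parallel>\<close>, the second order term is absorbed.\<close>

lemma duality_step:
  assumes \<rho>: "1/2 \<le> \<rho>" "\<rho> < 1"
    and f: "has_hess f Df Hf" "\<And>z. 2 \<le> norm z \<Longrightarrow> f z = 0" "\<And>z. 0 \<le> f z" "\<And>z. f z \<le> M"
    and S: "\<And>z. heat_resolvent.\<phi> \<Lambda> f z \<le> S"
  shows "(\<integral>z. (h z * cutoff \<rho> z) * f z \<partial>lborel) \<le>
    (25 + \<Lambda> * (384 + 24 * real DIM('a))) * M * measure lborel (support \<rho>) * S
    + 48 * \<Lambda> * M * (sqrt (measure lborel (support \<rho>)) * sqrt (S * (\<integral>z. f z \<partial>lborel) / \<Lambda>))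
    + (1 - \<Lambda>\<^sub>0 / \<Lambda>) * (sqrt (\<integral>z. (h z * cutoff \<rho> z)\<^sup>2 \<partial>lborel) * sqrt (\<integral>z. (f z)\<^sup>2 \<partial>lborel))"
proof -
  interpret R: heat_resolvent \<Lambda> f Df Hf 2
    by unfold_locales (use \<Lambda> f in auto)
  let ?\<eta> = "cutoff \<rho> :: 'a \<times> real \<Rightarrow> real" and ?D\<eta> = "cutoff_grad \<rho> :: 'a \<times> real \<Rightarrow> 'a \<times> real" and ?L\<eta> = "lap_x (cutoff_hess \<rho>) :: 'a \<times> real \<Rightarrow> real"
  let ?A = "measure lborel (support \<rho>)"
  let ?q = "\<lambda>z. h z * ?\<eta> z"
  let ?L = "lap_x R.H\<phi>" and ?C = "384 + 24 * real DIM('a)"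
  have \<rho>0: "0 < \<rho>" "\<rho> \<le> 1" using \<rho> by auto
  note cb = cutoff_bounds[OF \<rho>(1) \<rho>0(2)]
  note \<eta> = has_hessD[OF cutoff_has_hess[of \<rho>]]
  have [measurable]: "?\<eta> \<in> borel_measurable borel" "?D\<eta> \<in> borel_measurable borel" "?L\<eta> \<in> borel_measurable borel"
    "?L \<in> borel_measurable borel"
  proof -
    show "?\<eta> \<in> borel_measurable borel" "?D\<eta> \<in> borel_measurable borel"
      using has_grad_continuous[OF \<eta>(1)] \<eta>(4) continuous_borel_measurable by blast+
    have "continuous_on UNIV ?L\<eta>" unfolding lap_x_def[abs_def] by (intro continuous_intros \<eta>(3))
    then show "?L\<eta> \<in> borel_measurable borel" by (rule continuous_borel_measurable)
    show "?L \<in> borel_measurable borel" by (rule R.lap_\<phi>_parts(3))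
  qed
  have \<phi>0: "0 \<le> R.\<phi> z" for z by (rule R.\<phi>_nonneg[OF f(3)])
  have S0: "0 \<le> S" using \<phi>0[of 0] S[of 0] by linarith
  have If0: "0 \<le> (\<integral>z. f z \<partial>lborel)" using f(3) by simp
  have i_f: "integrable lborel f"
    by (rule integrable_continuous_bounded_support[OF R.continuous(1) f(2)])
  note tt = has_hess_mult[OF cutoff_has_hess[of \<rho>] R.\<phi>_hess]
  have in_supp: "indicator (support \<rho>) z = (1::real)" if "0 < h z" "norm z < \<rho>" for z
    using that by (simp add: support_def)
  have out: "h z * g z = 0" if "z \<notin> support \<rho>" "\<And>z. \<rho> \<le> norm z \<Longrightarrow> g z = 0" for z and g :: "'a \<times> real \<Rightarrow> real"
  proof (cases "\<rho> \<le> norm z")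
    case False
    then have "h z = 0" using that(1) h(1)[of z] by (auto simp: support_def)
    then show ?thesis by simp
  qed (use that(2) in simp)
  \<comment> \<open>Substituting \<open>\<phi>_t = \<phi> - \<Lambda> \<Delta>\<phi> - f\<close>
    into the weak inequality gives \<open>?P + ?G + ?E - ?q * f\<close>: the terms with
    undifferentiated \<open>\<phi>\<close>, the cross term of the two spatial gradients, and the
    deviation of \<open>H\<close> from \<open>\<Lambda> * h\<close>. In the bounds below, 25 is 1 +
    24 with the gradient bound 24 of the cutoff, and 48 is twice 24.\<close>
  let ?P = "\<lambda>z. ?q z * R.\<phi> z + h z * (R.\<phi> z * (?D\<eta> z \<bullet> (0, 1))) + H z * (R.\<phi> z * ?L\<eta> z)"
  let ?G = "\<lambda>z. 2 * H z * (fst (?D\<eta> z) \<bullet> fst (R.D\<phi> z))"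
  let ?E = "\<lambda>z. (H z - \<Lambda> * h z) * ?\<eta> z * ?L z"
  have H0: "0 \<le> H z" for z using H(1)[of z] h(1)[of z] ell(1) mult_nonneg_nonneg[of \<Lambda>\<^sub>0 "h z"] by linarith
  have Hh: "H z = 0" if "h z = 0" for z using H(1)[of z] H(2)[of z] that by simp
  have HM: "H z \<le> \<Lambda> * M" for z using H(2)[of z] mult_left_mono[OF h(2)[of z] less_imp_le[OF \<Lambda>]] by linarith
  have P_le: "\<bar>?P z\<bar> \<le> (25 + \<Lambda> * ?C) * M * S * indicator (support \<rho>) z" for z
  proof (cases "z \<in> support \<rho>")
    case False
    have "h z * ?\<eta> z = 0" "h z * (?D\<eta> z \<bullet> (0, 1)) = 0" "h z * ?L\<eta> z = 0"
      by (rule out[OF False], simp add: cutoff_outside[OF \<rho>0(1)])+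
    then show ?thesis using False Hh[of z] by auto
  next
    case True
    have t: "\<bar>?D\<eta> z \<bullet> (0, 1)\<bar> \<le> 24"
      using Cauchy_Schwarz_ineq2[of "?D\<eta> z" "(0, 1)"] cb(3)[of z] by (simp add: norm_Pair)
    have p: "R.\<phi> z \<le> S" "0 \<le> R.\<phi> z" using S \<phi>0 by auto
    have "\<bar>?q z * R.\<phi> z\<bar> \<le> M * S"
      using mult_mono[of "h z * ?\<eta> z" "M * 1" "R.\<phi> z" S] mult_mono[of "h z" M "?\<eta> z" 1] h[of z] cb(1,2)[of z] p M S0
      by (simp add: abs_mult abs_of_nonneg)
    moreover have "\<bar>h z * (R.\<phi> z * (?D\<eta> z \<bullet> (0, 1)))\<bar> \<le> M * (S * 24)"
      unfolding abs_mult using h[of z] p t M S0 by (intro mult_mono) auto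
    moreover have "\<bar>H z * (R.\<phi> z * ?L\<eta> z)\<bar> \<le> (\<Lambda> * M) * (S * ?C)"
      unfolding abs_mult using H0[of z] HM[of z] p cb(4)[of z] M S0 \<Lambda> by (intro mult_mono) auto
    moreover have "M * S + M * (S * 24) + (\<Lambda> * M) * (S * ?C) = (25 + \<Lambda> * ?C) * M * S"
      by (simp add: algebra_simps)
    ultimately show ?thesis using True by simp
  qed
  have G_le: "\<bar>?G z\<bar> \<le> 48 * \<Lambda> * M * (indicator (support \<rho>) z * norm (fst (R.D\<phi> z)))" for z
  proof (cases "z \<in> support \<rho>")
    case False
    have "h z * norm (?D\<eta> z) = 0" by (rule out[OF False]) (use cutoff_outside \<rho>0 in auto)
    then show ?thesis using False Hh[of z] by auto
  next
    case True
    have "norm (fst (?D\<eta> z)) \<le> 24" using cb(3)[of z] norm_fst_le[of "fst (?D\<eta> z)" "snd (?D\<eta> z)"] by simp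
    then have "\<bar>fst (?D\<eta> z) \<bullet> fst (R.D\<phi> z)\<bar> \<le> 24 * norm (fst (R.D\<phi> z))"
      using Cauchy_Schwarz_ineq2[of "fst (?D\<eta> z)" "fst (R.D\<phi> z)"] mult_right_mono[of _ 24 "norm (fst (R.D\<phi> z))"]
      by (meson norm_ge_zero order_trans)
    then have "\<bar>?G z\<bar> \<le> 2 * (\<Lambda> * M) * (24 * norm (fst (R.D\<phi> z)))"
      unfolding abs_mult using H0[of z] HM[of z] \<Lambda> M by (intro mult_mono) auto
    then show ?thesis using True by simp
  qed
  have E_le: "\<bar>?E z\<bar> \<le> (\<Lambda> - \<Lambda>\<^sub>0) * (?q z * \<bar>?L z\<bar>)" for z
  proof -
    have "\<bar>H z - \<Lambda> * h z\<bar> \<le> (\<Lambda> - \<Lambda>\<^sub>0) * h z" using H[of z] by (simp add: left_diff_distrib)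
    from mult_right_mono[OF this, of "?\<eta> z * \<bar>?L z\<bar>"] cb(1)[of z]
    show ?thesis by (simp add: abs_mult abs_of_nonneg mult_ac)
  qed
  have q2: "integrable lborel (\<lambda>z. (?q z)\<^sup>2)" and iq: "integrable lborel ?q"
  proof -
    have q_le: "\<bar>?q z\<bar> \<le> M * indicator (support \<rho>) z" for z
    proof (cases "z \<in> support \<rho>")
      case False
      have q0: "?q z = 0" by (rule out[OF False]) (use cutoff_outside \<rho>0 in auto)
      show ?thesis unfolding q0 using M by simp
    next
      case True
      then show ?thesis using mult_mono[of "h z" M "?\<eta> z" 1] h[of z] cb(1,2)[of z] M by (simp add: abs_of_nonneg)
    qed
    show "integrable lborel ?q"
      by (rule Bochner_Integration.integrable_bound[OF integrable_mult_right[OF integrable_support[of \<rho>], of M]])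
        (use q_le M in auto)
    have "(?q z)\<^sup>2 \<le> M\<^sup>2 * indicator (support \<rho>) z" for z
      using power_mono[OF q_le[of z], of 2] by (auto simp: power_mult_distrib indicator_def split: if_splits)
    then show "integrable lborel (\<lambda>z. (?q z)\<^sup>2)"
      by (intro Bochner_Integration.integrable_bound[OF integrable_mult_right[OF integrable_support[of \<rho>], of "M\<^sup>2"]])
        auto
  qed
  have iqf: "integrable lborel (\<lambda>z. ?q z * f z)"
    using integrable_mult_bounded[OF iq, of f M] f(3,4) by simp
  have iA: "integrable lborel (\<lambda>z. (norm (indicat_real (support \<rho>) z))\<^sup>2)"
    using integrable_support[of \<rho>] by (simp add: power2_eq_square indicator_inter_arith[symmetric])
  have iG1: "integrable lborel (\<lambda>z. indicator (support \<rho>) z * norm (fst (R.D\<phi> z)))"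
    and G1: "(\<integral>z. indicator (support \<rho>) z * norm (fst (R.D\<phi> z)) \<partial>lborel) \<le> sqrt ?A * sqrt R.energy"
  proof -
    have e: "integrable lborel (\<lambda>z. (norm (norm (fst (R.D\<phi> z))))\<^sup>2)" using R.gradient_energy(1) by simp
    have [measurable]: "(\<lambda>z. norm (fst (R.D\<phi> z))) \<in> borel_measurable lborel" by measurable
    note cs = integral_inner_Cauchy_Schwarz[OF _ _ iA e]
    show "integrable lborel (\<lambda>z. indicator (support \<rho>) z * norm (fst (R.D\<phi> z)))"
      using cs(1) by simp
    have "\<bar>\<integral>z. indicat_real (support \<rho>) z * norm (fst (R.D\<phi> z)) \<partial>lborel\<bar> \<le> sqrt (\<integral>z. (norm (indicat_real (support \<rho>) z))\<^sup>2 \<partial>lborel) * sqrt R.energy"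
      using cs(2) R.gradient_energy(2) by simp
    also have "(\<integral>z. (norm (indicat_real (support \<rho>) z))\<^sup>2 \<partial>lborel) = ?A"
      by (simp add: power2_eq_square indicator_inter_arith[symmetric])
    finally show "(\<integral>z. indicator (support \<rho>) z * norm (fst (R.D\<phi> z)) \<partial>lborel) \<le> sqrt ?A * sqrt R.energy" by simp
  qed
  have iE1: "integrable lborel (\<lambda>z. ?q z * \<bar>?L z\<bar>)"
    and E1: "(\<integral>z. ?q z * \<bar>?L z\<bar> \<partial>lborel) \<le> sqrt (\<integral>z. (?q z)\<^sup>2 \<partial>lborel) * sqrt (\<integral>z. (?L z)\<^sup>2 \<partial>lborel)"
  proof -
    have a: "integrable lborel (\<lambda>z. (norm (?q z))\<^sup>2)" "integrable lborel (\<lambda>z. (norm \<bar>?L z\<bar>)\<^sup>2)"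
      using q2 R.energy_estimates(3) by auto
    have b: "?q \<in> borel_measurable lborel" "(\<lambda>z. \<bar>?L z\<bar>) \<in> borel_measurable lborel" by measurable
    show "integrable lborel (\<lambda>z. ?q z * \<bar>?L z\<bar>)" using integral_inner_Cauchy_Schwarz(1)[OF b a] by simp
    show "(\<integral>z. ?q z * \<bar>?L z\<bar> \<partial>lborel) \<le> sqrt (\<integral>z. (?q z)\<^sup>2 \<partial>lborel) * sqrt (\<integral>z. (?L z)\<^sup>2 \<partial>lborel)"
      using integral_inner_Cauchy_Schwarz(2)[OF b a] by (simp add: abs_le_iff)
  qed
  have iP: "integrable lborel ?P"
    by (rule Bochner_Integration.integrable_bound[OF integrable_mult_right[OF integrable_support[of \<rho>], of "(25 + \<Lambda> * ?C) * M * S"]])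
      (use P_le order_trans[OF P_le abs_ge_self] in auto)
  have iG: "integrable lborel ?G"
    by (rule Bochner_Integration.integrable_bound[OF integrable_mult_right[OF iG1, of "48 * \<Lambda> * M"]])
      (use order_trans[OF G_le abs_ge_self] in auto)
  have iE: "integrable lborel ?E"
    by (rule Bochner_Integration.integrable_bound[OF integrable_mult_right[OF iE1, of "\<Lambda> - \<Lambda>\<^sub>0"]])
      (use order_trans[OF E_le abs_ge_self] in auto)
  have "0 \<le> (\<integral>z. h z * ((R.\<phi> z *\<^sub>R ?D\<eta> z + ?\<eta> z *\<^sub>R R.D\<phi> z) \<bullet> (0, 1)) + H z *
      lap_x (\<lambda>v z. (?D\<eta> z \<bullet> v) *\<^sub>R R.D\<phi> z + R.\<phi> z *\<^sub>R cutoff_hess \<rho> v z + ((R.D\<phi> z \<bullet> v) *\<^sub>R ?D\<eta> z + ?\<eta> z *\<^sub>R R.H\<phi> v z)) z \<partial>lborel)"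
  proof (rule weak[OF tt])
    show "0 \<le> ?\<eta> z * R.\<phi> z" for z by (intro mult_nonneg_nonneg cutoff_bounds(1)[OF \<rho>(1) \<rho>0(2)] \<phi>0)
    show "compact (cball (0 :: 'a \<times> real) \<rho>)" by (rule compact_cball)
    show "cball (0 :: 'a \<times> real) \<rho> \<subseteq> ball 0 1" using \<rho> by auto
    show "?\<eta> z * R.\<phi> z = 0" if "z \<notin> cball 0 \<rho>" for z using cutoff_outside(1)[OF \<rho>0(1), of z] that by simp
  qed
  also have "\<dots> = (\<integral>z. ?P z + ?G z + ?E z - ?q z * f z \<partial>lborel)"
  proof (rule Bochner_Integration.integral_cong[OF refl])
    fix z
    have f_eq: "f z = R.\<phi> z - R.D\<phi> z \<bullet> (0, 1) - \<Lambda> * ?L z" using R.resolvent_equation[of z] by simp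
    show "h z * ((R.\<phi> z *\<^sub>R ?D\<eta> z + ?\<eta> z *\<^sub>R R.D\<phi> z) \<bullet> (0, 1)) + H z *
      lap_x (\<lambda>v z. (?D\<eta> z \<bullet> v) *\<^sub>R R.D\<phi> z + R.\<phi> z *\<^sub>R cutoff_hess \<rho> v z + ((R.D\<phi> z \<bullet> v) *\<^sub>R ?D\<eta> z + ?\<eta> z *\<^sub>R R.H\<phi> v z)) z
      = ?P z + ?G z + ?E z - ?q z * f z"
      unfolding lap_x_mult inner_add_left inner_scaleR_left f_eq by (simp add: algebra_simps)
  qed
  also have "\<dots> = (\<integral>z. ?P z \<partial>lborel) + (\<integral>z. ?G z \<partial>lborel) + (\<integral>z. ?E z \<partial>lborel) - (\<integral>z. ?q z * f z \<partial>lborel)"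
    using Bochner_Integration.integral_diff[OF Bochner_Integration.integrable_add[OF Bochner_Integration.integrable_add[OF iP iG] iE] iqf]
      Bochner_Integration.integral_add[OF Bochner_Integration.integrable_add[OF iP iG] iE]
      Bochner_Integration.integral_add[OF iP iG] by simp
  finally have main: "(\<integral>z. ?q z * f z \<partial>lborel) \<le> (\<integral>z. ?P z \<partial>lborel) + (\<integral>z. ?G z \<partial>lborel) + (\<integral>z. ?E z \<partial>lborel)" by simp
  have P: "(\<integral>z. ?P z \<partial>lborel) \<le> (25 + \<Lambda> * ?C) * M * ?A * S"
  proof -
    have "(\<integral>z. ?P z \<partial>lborel) \<le> (\<integral>z. (25 + \<Lambda> * ?C) * M * S * indicator (support \<rho>) z \<partial>lborel)"
      by (rule integral_mono[OF iP integrable_mult_right[OF integrable_support]]) (use P_le abs_le_D1 in blast)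
    then show ?thesis by (simp add: mult_ac)
  qed
  have energy: "R.energy \<le> S * (\<integral>z. f z \<partial>lborel) / \<Lambda>"
  proof -
    have "\<Lambda> * R.energy \<le> (\<integral>z. f z * R.\<phi> z \<partial>lborel)" by (rule R.energy_estimates(2))
    also have "\<dots> \<le> (\<integral>z. f z * S \<partial>lborel)"
    proof (rule integral_mono)
      show "integrable lborel (\<lambda>z. f z * R.\<phi> z)"
        by (rule R.integrable_bounded_mult[OF i_f R.\<phi>_parts(2)]) measurable
    qed (use i_f f(3) S in \<open>auto intro: mult_left_mono\<close>)
    finally show ?thesis using \<Lambda> by (simp add: pos_le_divide_eq mult.commute)
  qed
  have G: "(\<integral>z. ?G z \<partial>lborel) \<le> 48 * \<Lambda> * M * (sqrt ?A * sqrt (S * (\<integral>z. f z \<partial>lborel) / \<Lambda>))"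
  proof -
    have "(\<integral>z. ?G z \<partial>lborel) \<le> (\<integral>z. 48 * \<Lambda> * M * (indicator (support \<rho>) z * norm (fst (R.D\<phi> z))) \<partial>lborel)"
      by (rule integral_mono[OF iG integrable_mult_right[OF iG1]]) (use G_le abs_le_D1 in blast)
    also have "\<dots> = 48 * \<Lambda> * M * (\<integral>z. indicator (support \<rho>) z * norm (fst (R.D\<phi> z)) \<partial>lborel)" by simp
    also have "\<dots> \<le> 48 * \<Lambda> * M * (sqrt ?A * sqrt (S * (\<integral>z. f z \<partial>lborel) / \<Lambda>))"
    proof (rule mult_left_mono)
      show "(\<integral>z. indicator (support \<rho>) z * norm (fst (R.D\<phi> z)) \<partial>lborel) \<le> sqrt ?A * sqrt (S * (\<integral>z. f z \<partial>lborel) / \<Lambda>)"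
        using energy by (intro order_trans[OF G1] mult_left_mono) auto
    qed (use \<Lambda> M in auto)
    finally show ?thesis .
  qed
  have E: "(\<integral>z. ?E z \<partial>lborel) \<le> (1 - \<Lambda>\<^sub>0 / \<Lambda>) * (sqrt (\<integral>z. (?q z)\<^sup>2 \<partial>lborel) * sqrt (\<integral>z. (f z)\<^sup>2 \<partial>lborel))"
  proof -
    have "(\<integral>z. ?E z \<partial>lborel) \<le> (\<integral>z. (\<Lambda> - \<Lambda>\<^sub>0) * (?q z * \<bar>?L z\<bar>) \<partial>lborel)"
      by (rule integral_mono[OF iE integrable_mult_right[OF iE1]]) (use E_le abs_le_D1 in blast)
    also have "\<dots> = (\<Lambda> - \<Lambda>\<^sub>0) * (\<integral>z. ?q z * \<bar>?L z\<bar> \<partial>lborel)" by simp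
    also have "\<dots> \<le> (\<Lambda> - \<Lambda>\<^sub>0) * (sqrt (\<integral>z. (?q z)\<^sup>2 \<partial>lborel) * sqrt (\<integral>z. (?L z)\<^sup>2 \<partial>lborel))"
      using E1 ell by (intro mult_left_mono) auto
    also have "\<dots> \<le> (\<Lambda> - \<Lambda>\<^sub>0) * (sqrt (\<integral>z. (?q z)\<^sup>2 \<partial>lborel) * (sqrt (\<integral>z. (f z)\<^sup>2 \<partial>lborel) / \<Lambda>))"
    proof -
      have "\<Lambda> * sqrt (\<integral>z. (?L z)\<^sup>2 \<partial>lborel) = sqrt (\<Lambda>\<^sup>2 * (\<integral>z. (?L z)\<^sup>2 \<partial>lborel))"
        using \<Lambda> by (simp add: real_sqrt_mult)
      also have "\<dots> \<le> sqrt (\<integral>z. (f z)\<^sup>2 \<partial>lborel)" using R.energy_estimates(1) by simp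
      finally have "sqrt (\<integral>z. (?L z)\<^sup>2 \<partial>lborel) \<le> sqrt (\<integral>z. (f z)\<^sup>2 \<partial>lborel) / \<Lambda>"
        using \<Lambda> by (simp add: pos_le_divide_eq mult.commute)
      then show ?thesis using ell by (intro mult_left_mono) auto
    qed
    also have "\<dots> = (1 - \<Lambda>\<^sub>0 / \<Lambda>) * (sqrt (\<integral>z. (?q z)\<^sup>2 \<partial>lborel) * sqrt (\<integral>z. (f z)\<^sup>2 \<partial>lborel))"
      using \<Lambda> by (simp add: field_simps)
    finally show ?thesis .
  qed
  show ?thesis using main P G E by linarith
qed

end

text \<open>The coefficient in the sup bound of the resolvent, restated outside its locale because
  the threshold of \<open>De_Giorgi\<close> must be fixed before any solution is given. The type
  argument carries the dimension.\<close>

definition heat_const :: "'a::euclidean_space itself \<Rightarrow> real \<Rightarrow> real" where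
  "heat_const T \<Lambda> = 1 / ((\<integral>x. gauss (x::'a) \<partial>lborel) * sqrt (2 * \<Lambda>) ^ DIM('a))"

definition gain_const :: "'a::euclidean_space itself \<Rightarrow> real \<Rightarrow> real \<Rightarrow> real" where
  "gain_const T \<Lambda>\<^sub>0 \<Lambda> = \<Lambda> / \<Lambda>\<^sub>0 * ((25 + \<Lambda> * (384 + 24 * real DIM('a))) * (1 + heat_const T \<Lambda>)
     + 48 * \<Lambda> * sqrt ((1 + heat_const T \<Lambda>) / \<Lambda>))"

lemma heat_const_nonneg: "0 < \<Lambda> \<Longrightarrow> 0 \<le> heat_const T \<Lambda>"
  using integral_gauss_pos[where 'a='a] by (simp add: heat_const_def less_imp_le)

section \<open>Superlinear decay of the truncation in terms of its support\<close>

context very_weak_subsolution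
begin

definition q :: "real \<Rightarrow> 'a \<times> real \<Rightarrow> real" where "q \<rho> z = h z * cutoff \<rho> z"

context
  fixes \<rho> :: real
  assumes \<rho>: "1/2 \<le> \<rho>" "\<rho> < 1"
begin

lemma \<rho>': "0 < \<rho>" "\<rho> \<le> 1" using \<rho> by auto

lemma q_measurable[measurable]: "q \<rho> \<in> borel_measurable borel"
proof -
  have [measurable]: "(cutoff \<rho> :: 'a \<times> real \<Rightarrow> real) \<in> borel_measurable borel"
    using has_grad_continuous[OF has_hessD(1)[OF cutoff_has_hess]] continuous_borel_measurable by blast
  show ?thesis unfolding q_def[abs_def] by measurable
qed

lemma q_bounds: "0 \<le> q \<rho> z" "q \<rho> z \<le> M * indicator (support \<rho>) z" "q \<rho> z \<le> M"
  and q_outside: "\<rho> \<le> norm z \<Longrightarrow> q \<rho> z = 0"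
proof -
  note cb = cutoff_bounds[OF \<rho>(1) \<rho>'(2), of z]
  show "0 \<le> q \<rho> z" using h(1) cb(1) by (simp add: q_def)
  show out: "q \<rho> z = 0" if "\<rho> \<le> norm z" for z using cutoff_outside(1)[OF \<rho>'(1) that] by (simp add: q_def)
  show "q \<rho> z \<le> M"
    unfolding q_def using mult_mono[of "h z" M "cutoff \<rho> z" 1] h[of z] cb(1,2) M by simp
  then show "q \<rho> z \<le> M * indicator (support \<rho>) z"
    using out[of z] h(1)[of z] by (cases "\<rho> \<le> norm z"; cases "h z = 0") (auto simp: support_def q_def indicator_def)
qed

lemma q_integrable: "integrable lborel (q \<rho>)" "(\<integral>z. q \<rho> z \<partial>lborel) \<le> M * measure lborel (support \<rho>)"
proof -
  have i: "integrable lborel (\<lambda>z. M * indicator (support \<rho>) z)" using integrable_support by simp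
  show j: "integrable lborel (q \<rho>)"
    by (rule Bochner_Integration.integrable_bound[OF i]) (use q_bounds(1,2) order_trans[OF q_bounds(2) abs_ge_self] in auto)
  have "(\<integral>z. q \<rho> z \<partial>lborel) \<le> (\<integral>z. M * indicator (support \<rho>) z \<partial>lborel)"
    by (rule integral_mono[OF j i q_bounds(2)])
  then show "(\<integral>z. q \<rho> z \<partial>lborel) \<le> M * measure lborel (support \<rho>)" by simp
qed

lemma q_square_integrable: "integrable lborel (\<lambda>z. (q \<rho> z)\<^sup>2)"
  using integrable_mult_bounded[OF q_integrable(1), of "q \<rho>" M] q_bounds(1,3) by (simp add: power2_eq_square)

text \<open>Duality asks for \<open>f = q \<rho>\<close>, which need not be C^2. It is applied to
  mollifications, which keep \<open>0 \<le> f \<le> M\<close> and vanish outside the ball of radius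
  2 because the scale is below 1. In the limit the last term of \<open>duality_step\<close> becomes
  \<open>1 - \<Lambda>\<^sub>0 / \<Lambda>\<close> times the left side and is absorbed; the factor
  \<open>\<Lambda>\<^sub>0 / \<Lambda>\<close> is what is left.\<close>

lemma limit_step:
  assumes r: "0 < r"
  defines "I \<equiv> (\<integral>z. q \<rho> z \<partial>lborel)" and "A \<equiv> measure lborel (support \<rho>)"
  defines "S \<equiv> M * r\<^sup>2 + heat_const TYPE('a) \<Lambda> * (1 / r ^ DIM('a)) * I"
  shows "\<Lambda>\<^sub>0 / \<Lambda> * (\<integral>z. (q \<rho> z)\<^sup>2 \<partial>lborel) \<le>
     (25 + \<Lambda> * (384 + 24 * real DIM('a))) * M * A * S + 48 * \<Lambda> * M * (sqrt A * sqrt (S * I / \<Lambda>))"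
proof -
  have "\<exists>e. 0 < e \<and> e < 1 \<and> integrable lborel (\<lambda>z. norm (conv e (q \<rho>) z - q \<rho> z)) \<and>
     (\<integral>z. norm (conv e (q \<rho>) z - q \<rho> z) \<partial>lborel) \<le> 1 / real (Suc n)" for n
  proof -
    have "0 < 1 / real (Suc n)" by simp
    from conv_L1[OF q_integrable(1) this] obtain d where d: "d > 0" "\<forall>e. 0 < e \<and> e < d \<longrightarrow>
      integrable lborel (\<lambda>z. norm (conv e (q \<rho>) z - q \<rho> z)) \<and> (\<integral>z. norm (conv e (q \<rho>) z - q \<rho> z) \<partial>lborel) \<le> 1 / real (Suc n)"
      by blast
    have "0 < min d 1 / 2" "min d 1 / 2 < 1" "min d 1 / 2 < d" using d(1) by (auto simp: min_def)
    then show ?thesis using d(2) by blast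
  qed
  then have "\<forall>n. \<exists>e. 0 < e \<and> e < 1 \<and> integrable lborel (\<lambda>z. norm (conv e (q \<rho>) z - q \<rho> z)) \<and>
     (\<integral>z. norm (conv e (q \<rho>) z - q \<rho> z) \<partial>lborel) \<le> 1 / real (Suc n)" by blast
  from choice[OF this] obtain e where e: "\<forall>n. 0 < e n \<and> e n < 1 \<and> integrable lborel (\<lambda>z. norm (conv (e n) (q \<rho>) z - q \<rho> z)) \<and>
     (\<integral>z. norm (conv (e n) (q \<rho>) z - q \<rho> z) \<partial>lborel) \<le> 1 / real (Suc n)" by (rule exE)
  define f where "f n = conv (e n) (q \<rho>)" for n
  have e0: "0 < e n" "e n < 1" for n using e by auto
  have ie: "integrable lborel (\<lambda>z. \<bar>f n z - q \<rho> z\<bar>)" and le: "(\<integral>z. \<bar>f n z - q \<rho> z\<bar> \<partial>lborel) \<le> 1 / real (Suc n)" for n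
    using e by (auto simp: f_def)
  have f_nn: "0 \<le> f n z" for n z
    unfolding f_def conv_def by (intro integral_nonneg_AE) (simp add: moll_nonneg[OF e0(1)] q_bounds(1))
  have f_M: "f n z \<le> M" for n z
  proof -
    have "f n z \<le> (\<integral>y. moll (e n) (z - y) * M \<partial>lborel)"
      unfolding f_def conv_def
    proof (rule integral_mono)
      show "integrable lborel (\<lambda>y. moll (e n) (z - y) *\<^sub>R q \<rho> y)" by (rule integrable_moll_shift(2)[OF q_integrable(1) e0(1)])
      show "integrable lborel (\<lambda>y. moll (e n) (z - y) * M)"
      proof (rule integrable_mult_left)
        have "integrable lborel (moll (e n) :: 'a \<times> real \<Rightarrow> real)" by (rule integrable_moll[OF e0(1)])
        then show "integrable lborel (\<lambda>y. moll (e n) (z - y))"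
          using lborel_reflection(2)[of "moll (e n)" z] by simp
      qed
      show "moll (e n) (z - y) *\<^sub>R q \<rho> y \<le> moll (e n) (z - y) * M" for y
        using mult_left_mono[OF q_bounds(3) moll_nonneg[OF e0(1)]] by simp
    qed
    also have "\<dots> = M"
      using lborel_reflection(1)[of "moll (e n)" z] by (simp add: integral_moll[OF e0(1)])
    finally show ?thesis .
  qed
  have f_out: "f n z = 0" if "2 \<le> norm z" for n z
    unfolding f_def
  proof (rule conv_eq_0[OF e0(1)])
    fix y assume "norm (z - y) < e n"
    then have "\<rho> \<le> norm y" using that e0(2)[of n] \<rho>' norm_triangle_ineq2[of z y] by linarith
    then show "q \<rho> y = 0" by (rule q_outside)
  qed
  have sm: "smooth (f n)" for n unfolding f_def by (rule smooth_conv(1)[OF q_integrable(1) e0(1)])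
  have [measurable]: "f n \<in> borel_measurable borel" for n
    by (rule continuous_borel_measurable[OF smooth_continuous[OF sm]])
  have fi: "integrable lborel (f n)" for n
    by (rule integrable_continuous_bounded_support[OF smooth_continuous[OF sm] f_out])
  have z0: "(\<lambda>n. 1 / real (Suc n)) \<longlonglongrightarrow> 0" by (rule lim_1_over_n[THEN LIMSEQ_Suc])
  have convi: "integrable lborel (\<lambda>z. (f n z - q \<rho> z) * g z)"
    if "g \<in> borel_measurable borel" "\<And>z. \<bar>g z\<bar> \<le> B" for g B n
  proof -
    have d: "integrable lborel (\<lambda>z. f n z - q \<rho> z)"
      by (rule Bochner_Integration.integrable_diff[OF fi q_integrable(1)])
    show ?thesis using integrable_mult_bounded[OF d, of g B] that by simp
  qed
  have conv0: "(\<lambda>n. \<integral>z. (f n z - q \<rho> z) * g n z \<partial>lborel) \<longlonglongrightarrow> 0"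
    if gm: "\<And>n. g n \<in> borel_measurable borel" and g: "\<And>n z. \<bar>g n z\<bar> \<le> B" for g B
  proof (rule Lim_null_comparison)
    have B: "0 \<le> B" using g[of 0 0] by linarith
    have "norm (\<integral>z. (f n z - q \<rho> z) * g n z \<partial>lborel) \<le> B * (1 / real (Suc n))" for n
    proof -
      have "norm (\<integral>z. (f n z - q \<rho> z) * g n z \<partial>lborel) \<le> (\<integral>z. norm ((f n z - q \<rho> z) * g n z) \<partial>lborel)" by (rule integral_norm_bound)
      also have "\<dots> \<le> (\<integral>z. \<bar>f n z - q \<rho> z\<bar> * B \<partial>lborel)"
      proof (rule integral_mono)
        show "integrable lborel (\<lambda>z. norm ((f n z - q \<rho> z) * g n z))"
          by (rule integrable_norm[OF convi[OF gm g]])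
        show "integrable lborel (\<lambda>z. \<bar>f n z - q \<rho> z\<bar> * B)" by (rule integrable_mult_left[OF ie])
        show "norm ((f n z - q \<rho> z) * g n z) \<le> \<bar>f n z - q \<rho> z\<bar> * B" for z
          unfolding real_norm_def abs_mult by (rule mult_left_mono[OF g abs_ge_zero])
      qed
      also have "\<dots> = B * (\<integral>z. \<bar>f n z - q \<rho> z\<bar> \<partial>lborel)" by simp
      also have "\<dots> \<le> B * (1 / real (Suc n))" by (rule mult_left_mono[OF le B])
      finally show ?thesis .
    qed
    then show "\<forall>\<^sub>F n in sequentially. norm (\<integral>z. (f n z - q \<rho> z) * g n z \<partial>lborel) \<le> B * (1 / real (Suc n))"
      by (intro always_eventually allI)
    have "(\<lambda>n. B * (1 / real (Suc n))) \<longlonglongrightarrow> B * 0" by (rule tendsto_mult[OF tendsto_const z0])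
    then show "(\<lambda>n. B * (1 / real (Suc n))) \<longlonglongrightarrow> 0" by simp
  qed
  define Q where "Q = (\<integral>z. (q \<rho> z)\<^sup>2 \<partial>lborel)"
  define I' where "I' n = (\<integral>z. f n z \<partial>lborel)" for n
  define S' where "S' n = M * r\<^sup>2 + heat_const TYPE('a) \<Lambda> * (1 / r ^ DIM('a)) * I' n" for n
  define X where "X n = (\<integral>z. q \<rho> z * f n z \<partial>lborel)" for n
  define Y where "Y n = (\<integral>z. (f n z)\<^sup>2 \<partial>lborel)" for n
  have qb: "\<bar>q \<rho> z\<bar> \<le> M" for z using q_bounds(1,3)[of z] by simp
  have I': "I' \<longlonglongrightarrow> I"
  proof -
    have "I' = (\<lambda>n. (\<integral>z. (f n z - q \<rho> z) * 1 \<partial>lborel) + I)"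
      using fi q_integrable by (simp add: I'_def I_def fun_eq_iff)
    then show ?thesis using tendsto_add[OF conv0[of "\<lambda>_ _. 1" 1] tendsto_const[of I]] by simp
  qed
  have X_eq: "X n = (\<integral>z. (f n z - q \<rho> z) * q \<rho> z \<partial>lborel) + Q" for n
    unfolding X_def Q_def
    by (subst Bochner_Integration.integral_add[symmetric, OF convi[OF q_measurable qb] q_square_integrable])
      (simp add: power2_eq_square algebra_simps)
  have X: "X \<longlonglongrightarrow> Q"
  proof -
    have "X = (\<lambda>n. (\<integral>z. (f n z - q \<rho> z) * q \<rho> z \<partial>lborel) + Q)" by (rule ext) (rule X_eq)
    then show ?thesis using tendsto_add[OF conv0[OF q_measurable qb] tendsto_const[of Q]] by simp
  qed
  have fq: "\<bar>f n z + q \<rho> z\<bar> \<le> 2 * M" for n z using f_nn[of n z] f_M[of n z] q_bounds[of z] by linarith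
  have fqm: "(\<lambda>z. f n z + q \<rho> z) \<in> borel_measurable borel" for n by measurable
  have Y_eq: "Y n = (\<integral>z. (f n z - q \<rho> z) * (f n z + q \<rho> z) \<partial>lborel) + Q" for n
    unfolding Y_def Q_def
    by (subst Bochner_Integration.integral_add[symmetric, OF convi[OF fqm fq] q_square_integrable])
      (simp add: power2_eq_square algebra_simps)
  have Y: "Y \<longlonglongrightarrow> Q"
  proof -
    have "Y = (\<lambda>n. (\<integral>z. (f n z - q \<rho> z) * (f n z + q \<rho> z) \<partial>lborel) + Q)" by (rule ext) (rule Y_eq)
    then show ?thesis using tendsto_add[OF conv0[OF fqm fq] tendsto_const[of Q]] by simp
  qed
  have S': "S' \<longlonglongrightarrow> S" unfolding S'_def[abs_def] S_def by (intro tendsto_intros I')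
  have le: "X n \<le> (25 + \<Lambda> * (384 + 24 * real DIM('a))) * M * A * S' n
    + 48 * \<Lambda> * M * (sqrt A * sqrt (S' n * I' n / \<Lambda>)) + (1 - \<Lambda>\<^sub>0 / \<Lambda>) * (sqrt Q * sqrt (Y n))" for n
    unfolding X_def A_def Q_def Y_def q_def I'_def
  proof (rule duality_step[OF \<rho> smooth_has_hess[OF sm] f_out f_nn f_M])
    fix z
    interpret R: heat_resolvent \<Lambda> "f n" "grad (f n)" "\<lambda>v. grad (\<lambda>z. grad (f n) z \<bullet> v)" 2
      by unfold_locales (use \<Lambda> smooth_has_hess[OF sm] f_out in auto)
    show "R.\<phi> z \<le> S' n"
      using R.\<phi>_sup_bound[OF f_nn f_M r, of z] by (simp add: S'_def I'_def heat_const_def R.\<gamma>_def R.a_def)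
  qed
  have "Q \<le> (25 + \<Lambda> * (384 + 24 * real DIM('a))) * M * A * S
    + 48 * \<Lambda> * M * (sqrt A * sqrt (S * I / \<Lambda>)) + (1 - \<Lambda>\<^sub>0 / \<Lambda>) * (sqrt Q * sqrt Q)"
  proof (rule LIMSEQ_le[OF X])
    show "(\<lambda>n. (25 + \<Lambda> * (384 + 24 * real DIM('a))) * M * A * S' n
      + 48 * \<Lambda> * M * (sqrt A * sqrt (S' n * I' n / \<Lambda>)) + (1 - \<Lambda>\<^sub>0 / \<Lambda>) * (sqrt Q * sqrt (Y n))) \<longlonglongrightarrow>
      (25 + \<Lambda> * (384 + 24 * real DIM('a))) * M * A * S
      + 48 * \<Lambda> * M * (sqrt A * sqrt (S * I / \<Lambda>)) + (1 - \<Lambda>\<^sub>0 / \<Lambda>) * (sqrt Q * sqrt Q)"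
      using \<Lambda> by (intro tendsto_intros S' I' Y) auto
  qed (use le in blast)
  moreover have "sqrt Q * sqrt Q = Q" by (simp add: Q_def)
  ultimately show ?thesis unfolding Q_def[symmetric] by (simp add: left_diff_distrib)
qed

text \<open>With \<open>r ^ (DIM('a) + 2) = A\<close> the two parts of \<open>S\<close> balance: the
  integral of \<open>q \<rho>\<close> is at most \<open>M * A\<close>, and
  \<open>A / r ^ DIM('a) = r\<^sup>2\<close>, so \<open>S\<close> is of order
  \<open>M * r\<^sup>2\<close>. The product \<open>S * I\<close> under the root then yields
  \<open>A * r\<close>, a gain of the factor \<open>r\<close> over \<open>A\<close>. The case
  \<open>A = 0\<close> is separate since \<open>r\<close> would vanish.\<close>

lemma gain:
  assumes A1: "measure lborel (support \<rho>) \<le> 1"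
  defines "A \<equiv> measure lborel (support \<rho>)"
  shows "(\<integral>z. (q \<rho> z)\<^sup>2 \<partial>lborel) \<le> gain_const TYPE('a) \<Lambda>\<^sub>0 \<Lambda> * M\<^sup>2 * (A * A powr (1 / (real DIM('a) + 2)))"
proof (cases "A = 0")
  case True
  have "(\<integral>z. (q \<rho> z)\<^sup>2 \<partial>lborel) \<le> (\<integral>z. M * q \<rho> z \<partial>lborel)"
    by (rule integral_mono[OF q_square_integrable integrable_mult_right[OF q_integrable(1)]])
      (use q_bounds in \<open>auto simp: power2_eq_square intro: mult_right_mono\<close>)
  also have "\<dots> \<le> M * (M * A)" using q_integrable(2) M by (simp add: A_def)
  finally show ?thesis using True by simp
next
  case False
  then have A: "0 < A" "A \<le> 1" using A1 measure_nonneg[of lborel "support \<rho>"] by (auto simp: A_def less_le)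
  define r where "r = A powr (1 / (real DIM('a) + 2))"
  define \<theta> where "\<theta> = heat_const TYPE('a) \<Lambda>"
  define I where "I = (\<integral>z. q \<rho> z \<partial>lborel)"
  define S where "S = M * r\<^sup>2 + \<theta> * (1 / r ^ DIM('a)) * I"
  define C where "C = 25 + \<Lambda> * (384 + 24 * real DIM('a))"
  have r: "0 < r" "r \<le> 1" using A by (auto simp: r_def powr_le1)
  have rN: "r ^ (DIM('a) + 2) = A"
  proof -
    have "r ^ (DIM('a) + 2) = r powr real (DIM('a) + 2)" by (rule powr_realpow[OF r(1), symmetric])
    also have "\<dots> = A powr (1 / (real DIM('a) + 2) * real (DIM('a) + 2))" by (simp only: r_def powr_powr)
    also have "1 / (real DIM('a) + 2) * real (DIM('a) + 2) = 1" by (simp add: add_nonneg_eq_0_iff)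
    finally show ?thesis using A by simp
  qed
  have A_eq: "A / r ^ DIM('a) = r\<^sup>2" unfolding rN[symmetric] power_add using r by simp
  have \<theta>: "0 \<le> \<theta>" unfolding \<theta>_def by (rule heat_const_nonneg[OF \<Lambda>])
  have C0: "0 \<le> C" using \<Lambda> by (simp add: C_def)
  have I: "0 \<le> I" "I \<le> M * A" using q_integrable(2) q_bounds(1) by (auto simp: I_def A_def)
  have S0: "0 \<le> S" using M r \<theta> I by (simp add: S_def)
  have S: "S \<le> M * (1 + \<theta>) * r\<^sup>2"
  proof -
    have "\<theta> * (1 / r ^ DIM('a)) * I \<le> \<theta> * (1 / r ^ DIM('a)) * (M * A)"
      using I \<theta> r by (intro mult_left_mono) auto
    also have "\<dots> = \<theta> * M * (A / r ^ DIM('a))" by simp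
    also have "\<dots> = \<theta> * M * r\<^sup>2" unfolding A_eq ..
    finally show ?thesis by (simp add: S_def algebra_simps)
  qed
  \<comment> \<open>The first term would even gain \<open>r\<^sup>2\<close>; it is weakened to
    \<open>r\<close>, the order that the gradient cross term allows.\<close>
  have r2: "r\<^sup>2 \<le> r" using r by (simp add: power2_eq_square mult_left_le)
  have "\<Lambda>\<^sub>0 / \<Lambda> * (\<integral>z. (q \<rho> z)\<^sup>2 \<partial>lborel) \<le> C * M * A * S + 48 * \<Lambda> * M * (sqrt A * sqrt (S * I / \<Lambda>))"
    using limit_step[OF r(1)] by (simp add: C_def S_def I_def A_def \<theta>_def)
  also have "\<dots> \<le> C * (1 + \<theta>) * (M\<^sup>2 * (A * r)) + 48 * \<Lambda> * sqrt ((1 + \<theta>) / \<Lambda>) * (M\<^sup>2 * (A * r))"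
  proof (rule add_mono)
    have "S \<le> M * (1 + \<theta>) * r"
      by (rule order.trans[OF S mult_left_mono[OF r2]]) (use M \<theta> in auto)
    then have "C * M * A * S \<le> C * M * A * (M * (1 + \<theta>) * r)"
      using C0 M A by (intro mult_left_mono) auto
    then show "C * M * A * S \<le> C * (1 + \<theta>) * (M\<^sup>2 * (A * r))" by (simp add: power2_eq_square mult_ac)
    have "S * I / \<Lambda> \<le> (M * (1 + \<theta>) * r\<^sup>2) * (M * A) / \<Lambda>"
      using S I S0 \<Lambda> M \<theta> by (intro divide_right_mono mult_mono) auto
    also have "\<dots> = (M * r)\<^sup>2 * ((1 + \<theta>) / \<Lambda>) * A" by (simp add: power2_eq_square mult_ac)
    finally have "sqrt (S * I / \<Lambda>) \<le> sqrt ((M * r)\<^sup>2 * ((1 + \<theta>) / \<Lambda>) * A)" by (rule real_sqrt_le_mono)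
    also have "\<dots> = M * r * sqrt ((1 + \<theta>) / \<Lambda>) * sqrt A"
      using M r by (simp only: real_sqrt_mult real_sqrt_abs abs_mult abs_of_pos)
    finally have "sqrt A * sqrt (S * I / \<Lambda>) \<le> sqrt A * (M * r * sqrt ((1 + \<theta>) / \<Lambda>) * sqrt A)"
      using A by (intro mult_left_mono) auto
    also have "\<dots> = M * r * sqrt ((1 + \<theta>) / \<Lambda>) * (sqrt A * sqrt A)" by (simp only: mult_ac)
    also have "sqrt A * sqrt A = A" using A by simp
    finally have "48 * \<Lambda> * M * (sqrt A * sqrt (S * I / \<Lambda>)) \<le> 48 * \<Lambda> * M * (M * r * sqrt ((1 + \<theta>) / \<Lambda>) * A)"
      using \<Lambda> M by (intro mult_left_mono) auto
    then show "48 * \<Lambda> * M * (sqrt A * sqrt (S * I / \<Lambda>)) \<le> 48 * \<Lambda> * sqrt ((1 + \<theta>) / \<Lambda>) * (M\<^sup>2 * (A * r))"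
      by (simp only: power2_eq_square mult_ac)
  qed
  also have "\<dots> = (C * (1 + \<theta>) + 48 * \<Lambda> * sqrt ((1 + \<theta>) / \<Lambda>)) * (M\<^sup>2 * (A * r))" by (simp only: distrib_right)
  finally have "\<Lambda> / \<Lambda>\<^sub>0 * (\<Lambda>\<^sub>0 / \<Lambda> * (\<integral>z. (q \<rho> z)\<^sup>2 \<partial>lborel)) \<le> \<Lambda> / \<Lambda>\<^sub>0 * ((C * (1 + \<theta>) + 48 * \<Lambda> * sqrt ((1 + \<theta>) / \<Lambda>)) * (M\<^sup>2 * (A * r)))"
    using \<Lambda> ell by (intro mult_left_mono) auto
  then show ?thesis
    using \<Lambda> ell unfolding gain_const_def C_def[symmetric] \<theta>_def[symmetric] r_def[symmetric] by (simp add: mult.assoc)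
qed

end

end

text \<open>The claim \<open>a j \<le> \<nu> * s ^ j\<close> is inductive:
  \<open>s powr \<delta> = 1 / b\<close> cancels the growth \<open>b ^ j\<close>, and
  \<open>\<nu> powr \<delta> = s / C\<close> supplies one more factor \<open>s\<close>. Since
  \<open>\<nu> \<le> 1\<close>, the terms stay below 1 and \<open>step\<close> remains
  applicable.\<close>

lemma fast_geometric:
  fixes a :: "nat \<Rightarrow> real"
  assumes a: "\<And>j. 0 \<le> a j" and C: "1 \<le> C" and b: "1 < b" and \<delta>: "0 < \<delta>"
    and step: "\<And>j. a j \<le> 1 \<Longrightarrow> a (Suc j) \<le> C * b ^ j * (a j * a j powr \<delta>)"
    and start: "a 0 \<le> C powr (- 1 / \<delta>) * b powr (- 1 / \<delta>\<^sup>2)"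
  shows "a \<longlonglongrightarrow> 0"
proof -
  define s where "s = b powr (- 1 / \<delta>)"
  define \<nu> where "\<nu> = C powr (- 1 / \<delta>) * b powr (- 1 / \<delta>\<^sup>2)"
  have s: "0 < s" "s < 1"
  proof -
    show "0 < s" using b by (simp add: s_def)
    have "b powr (- 1 / \<delta>) < b powr 0" using b \<delta> by (intro powr_less_mono) auto
    then show "s < 1" using b by (simp add: s_def)
  qed
  have sd: "s powr \<delta> = 1 / b"
  proof -
    have "s powr \<delta> = b powr (- 1 / \<delta> * \<delta>)" by (simp only: s_def powr_powr)
    also have "- 1 / \<delta> * \<delta> = - 1" using \<delta> by simp
    finally show ?thesis using b by (simp add: powr_minus_divide)
  qed
  have \<nu>: "0 < \<nu>" "\<nu> \<le> 1"
  proof -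
    show "0 < \<nu>" using b C by (simp add: \<nu>_def)
    have "C powr (- 1 / \<delta>) \<le> 1" using powr_mono[of "- 1 / \<delta>" 0 C] C \<delta> by simp
    moreover have "b powr (- 1 / \<delta>\<^sup>2) \<le> 1" using powr_mono[of "- 1 / \<delta>\<^sup>2" 0 b] b by simp
    ultimately show "\<nu> \<le> 1" unfolding \<nu>_def using mult_mono[of "C powr (- 1 / \<delta>)" 1 "b powr (- 1 / \<delta>\<^sup>2)" 1] by simp
  qed
  have \<nu>d: "\<nu> powr \<delta> = s / C"
  proof -
    have "\<nu> powr \<delta> = C powr (- 1 / \<delta> * \<delta>) * b powr (- 1 / \<delta>\<^sup>2 * \<delta>)"
      by (simp add: \<nu>_def powr_mult powr_powr)
    also have "- 1 / \<delta> * \<delta> = - 1" using \<delta> by simp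
    also have "- 1 / \<delta>\<^sup>2 * \<delta> = - 1 / \<delta>" using \<delta> by (simp add: power2_eq_square)
    finally show ?thesis using C by (simp add: s_def powr_minus_divide)
  qed
  have le: "a j \<le> \<nu> * s ^ j" for j
  proof (induction j)
    case 0
    then show ?case using start by (simp add: \<nu>_def)
  next
    case (Suc j)
    have "\<nu> * s ^ j \<le> 1 * 1" using \<nu> s by (intro mult_mono power_le_one) auto
    then have "a j \<le> 1" using Suc.IH by simp
    then have "a (Suc j) \<le> C * b ^ j * (a j * a j powr \<delta>)" by (rule step)
    also have "\<dots> \<le> C * b ^ j * ((\<nu> * s ^ j) * (\<nu> * s ^ j) powr \<delta>)"
      using Suc.IH a[of j] C b \<delta> \<nu> s by (intro mult_left_mono mult_mono powr_mono2) auto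
    also have "(\<nu> * s ^ j) powr \<delta> = s / C * (1 / b) ^ j"
    proof -
      have "(s ^ j) powr \<delta> = (s powr \<delta>) ^ j" using s by (simp add: powr_realpow[symmetric] powr_powr mult.commute)
      then show ?thesis by (simp add: powr_mult \<nu>d sd)
    qed
    also have "C * b ^ j * ((\<nu> * s ^ j) * (s / C * (1 / b) ^ j)) = \<nu> * s ^ Suc j"
      using C b by (simp add: power_divide)
    finally show ?case .
  qed
  have "(\<lambda>j. \<nu> * s ^ j) \<longlonglongrightarrow> \<nu> * 0" using s by (intro tendsto_intros LIMSEQ_realpow_zero) auto
  then show ?thesis
    using le a by (intro tendsto_sandwich[OF _ _ tendsto_const, of _ a _ "\<lambda>j. \<nu> * s ^ j"]) auto
qed

text \<open>Comparability of the two truncations, with constants depending only on \<open>m\<close>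
  and \<open>\<kappa>\<close>. The lower bound follows from
  \<open>x powr (m - 1) \<le> \<kappa> powr (m - 1)\<close> and holds down to \<open>x = 0\<close>,
  so the degeneracy of the equation costs nothing while \<open>\<kappa>\<close> stays away from 0;
  the upper bound is the mean value theorem.\<close>

lemma powr_diff_bounds:
  fixes x \<kappa> m :: real
  assumes m: "1 < m" and x: "0 \<le> x" "x < \<kappa>"
  shows "\<kappa> powr (m - 1) * (\<kappa> - x) \<le> \<kappa> powr m - x powr m"
    and "\<kappa> powr m - x powr m \<le> m * \<kappa> powr (m - 1) * (\<kappa> - x)"
proof -
  have k: "0 < \<kappa>" using x by simp
  have e: "y powr m = y powr (m - 1) * y" if "0 \<le> y" for y
    using that powr_add[of y "m - 1" 1] by (cases "y = 0") auto
  have "x powr (m - 1) * x \<le> \<kappa> powr (m - 1) * x"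
    using m x by (intro mult_right_mono powr_mono2) auto
  then show "\<kappa> powr (m - 1) * (\<kappa> - x) \<le> \<kappa> powr m - x powr m"
    using e[OF x(1)] e[of \<kappa>] k by (simp add: right_diff_distrib)
  show "\<kappa> powr m - x powr m \<le> m * \<kappa> powr (m - 1) * (\<kappa> - x)"
  proof (cases "x = 0")
    case True
    have "1 * (\<kappa> powr (m - 1) * \<kappa>) \<le> m * (\<kappa> powr (m - 1) * \<kappa>)" using m k by (intro mult_right_mono) auto
    then show ?thesis using True e[of \<kappa>] k by simp
  next
    case False
    then have x0: "0 < x" using x by simp
    have "((\<lambda>t. t powr m) has_real_derivative m * t powr (m - 1)) (at t)" if "x \<le> t" "t \<le> \<kappa>" for t
      using has_real_derivative_powr[of t m] that x0 by simp
    from MVT2[OF x(2) this] obtain t where t: "x < t" "t < \<kappa>" "\<kappa> powr m - x powr m = (\<kappa> - x) * (m * t powr (m - 1))" by blast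
    have "t powr (m - 1) \<le> \<kappa> powr (m - 1)" using t x0 m by (intro powr_mono2) auto
    then have "(\<kappa> - x) * (m * t powr (m - 1)) \<le> (\<kappa> - x) * (m * \<kappa> powr (m - 1))"
      using x m by (intro mult_left_mono) auto
    then show ?thesis using t by (simp add: mult_ac)
  qed
qed

text \<open>Iteration over levels decreasing from \<open>q\<close> to \<open>q - \<epsilon>\<close>
  and radii decreasing from \<open>3/4\<close> to \<open>1/2\<close>. \<open>gain\<close> bounds the
  square integral of the localized truncation by a power above 1 of the measure of its support; on
  the next sublevel set the integrand is bounded below. This closes a superlinear recursion for the
  measures. The threshold is chosen before \<open>u\<close>, and the inequality is assumed for all
  \<open>\<kappa>\<close> because the levels vary.\<close>

theorem De_Giorgi:
  fixes m q \<epsilon> :: real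
  assumes m: "1 < m" and \<epsilon>: "0 < \<epsilon>" "\<epsilon> < q"
  shows "\<exists>\<nu>>0. \<forall>u :: 'a::euclidean_space \<times> real \<Rightarrow> real. u \<in> borel_measurable borel \<longrightarrow> (\<forall>z. 0 \<le> u z) \<longrightarrow>
    (\<forall>\<kappa> \<phi> D\<phi> H\<phi> K. 0 < \<kappa> \<longrightarrow> has_hess \<phi> D\<phi> H\<phi> \<longrightarrow> (\<forall>z. 0 \<le> \<phi> z) \<longrightarrow> compact K \<longrightarrow> K \<subseteq> ball 0 1 \<longrightarrow>
       (\<forall>z. z \<notin> K \<longrightarrow> \<phi> z = 0) \<longrightarrow>
       0 \<le> (\<integral>z. max 0 (\<kappa> - u z) * (D\<phi> z \<bullet> (0, 1)) + max 0 (\<kappa> powr m - u z powr m) * lap_x H\<phi> z \<partial>lborel)) \<longrightarrow>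
    measure lborel {z \<in> ball 0 1. u z < q} \<le> \<nu> \<longrightarrow>
    (AE z in lborel. z \<in> ball 0 (1/2) \<longrightarrow> q - \<epsilon> \<le> u z)"
proof -
  define \<Lambda>\<^sub>0 where "\<Lambda>\<^sub>0 = (q - \<epsilon>) powr (m - 1)"
  define \<Lambda> where "\<Lambda> = m * q powr (m - 1)"
  define \<delta> where "\<delta> = 1 / (real DIM('a) + 2)"
  \<comment> \<open>The lower bound \<open>c\<close> computed below equals
    \<open>\<epsilon>\<^sup>2 / 2 ^ 20 * (1/2) ^ (8 * j)\<close>; dividing by it gives the factor
    \<open>2 ^ 20 / \<epsilon>\<^sup>2\<close> here and the base \<open>2 ^ 8\<close> in
    \<open>\<nu>\<close>. The maximum with 1 serves \<open>fast_geometric\<close>.\<close>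
  define C where "C = max 1 (gain_const TYPE('a) \<Lambda>\<^sub>0 \<Lambda> * q\<^sup>2 * (2 ^ 20 / \<epsilon>\<^sup>2))"
  define \<nu> where "\<nu> = C powr (- 1 / \<delta>) * (2 ^ 8) powr (- 1 / \<delta>\<^sup>2)"
  have q: "0 < q" using \<epsilon> by simp
  have \<delta>: "0 < \<delta>" by (simp add: \<delta>_def add_pos_nonneg)
  have C1: "1 \<le> C" by (simp add: C_def)
  have \<nu>: "0 < \<nu>" using C1 by (simp add: \<nu>_def)
  have \<Lambda>\<^sub>0: "0 < \<Lambda>\<^sub>0" using \<epsilon> by (simp add: \<Lambda>\<^sub>0_def)
  have \<Lambda>: "\<Lambda>\<^sub>0 \<le> \<Lambda>"
  proof -
    have "(q - \<epsilon>) powr (m - 1) \<le> q powr (m - 1)" using \<epsilon> m by (intro powr_mono2) auto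
    also have "\<dots> \<le> m * q powr (m - 1)" using m mult_right_mono[of 1 m "q powr (m - 1)"] by simp
    finally show ?thesis by (simp add: \<Lambda>\<^sub>0_def \<Lambda>_def)
  qed
  have "AE z in lborel. z \<in> ball 0 (1/2) \<longrightarrow> q - \<epsilon> \<le> u z"
    if [measurable]: "u \<in> borel_measurable borel" and u0: "\<And>z. 0 \<le> u z"
      and weak: "\<And>\<kappa> \<phi> D\<phi> H\<phi> K. 0 < \<kappa> \<Longrightarrow> has_hess \<phi> D\<phi> H\<phi> \<Longrightarrow> (\<And>z. 0 \<le> \<phi> z) \<Longrightarrow> compact K \<Longrightarrow> K \<subseteq> ball 0 1 \<Longrightarrow>
       (\<And>z. z \<notin> K \<Longrightarrow> \<phi> z = 0) \<Longrightarrow>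
       0 \<le> (\<integral>z. max 0 (\<kappa> - u z) * (D\<phi> z \<bullet> (0, 1)) + max 0 (\<kappa> powr m - u z powr m) * lap_x H\<phi> z \<partial>lborel)"
      and small: "measure lborel {z \<in> ball 0 1. u z < q} \<le> \<nu>"
    for u :: "'a \<times> real \<Rightarrow> real"
  proof -
    have vw: "very_weak_subsolution (\<lambda>z. max 0 (\<kappa> - u z)) (\<lambda>z. max 0 (\<kappa> powr m - u z powr m)) \<Lambda>\<^sub>0 \<Lambda> q"
      if \<kappa>: "q - \<epsilon> \<le> \<kappa>" "\<kappa> \<le> q" for \<kappa>
    proof
      show "0 < \<Lambda>\<^sub>0" "\<Lambda>\<^sub>0 \<le> \<Lambda>" "0 < q" by fact+
      show "(\<lambda>z. max 0 (\<kappa> - u z)) \<in> borel_measurable borel" "(\<lambda>z. max 0 (\<kappa> powr m - u z powr m)) \<in> borel_measurable borel"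
        by measurable
      fix z
      show "0 \<le> max 0 (\<kappa> - u z)" "max 0 (\<kappa> - u z) \<le> q" using u0[of z] \<kappa> q by auto
      show "\<Lambda>\<^sub>0 * max 0 (\<kappa> - u z) \<le> max 0 (\<kappa> powr m - u z powr m)"
        "max 0 (\<kappa> powr m - u z powr m) \<le> \<Lambda> * max 0 (\<kappa> - u z)"
      proof -
        consider "u z < \<kappa>" | "\<kappa> \<le> u z" by linarith
        then have "\<Lambda>\<^sub>0 * max 0 (\<kappa> - u z) \<le> max 0 (\<kappa> powr m - u z powr m) \<and> max 0 (\<kappa> powr m - u z powr m) \<le> \<Lambda> * max 0 (\<kappa> - u z)"
        proof cases
          case 1
          note p = powr_diff_bounds[OF m u0[of z] 1]
          have "\<Lambda>\<^sub>0 \<le> \<kappa> powr (m - 1)" unfolding \<Lambda>\<^sub>0_def using \<kappa> \<epsilon> m by (intro powr_mono2) auto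
          then have a: "\<Lambda>\<^sub>0 * (\<kappa> - u z) \<le> \<kappa> powr m - u z powr m"
            using 1 by (intro order_trans[OF mult_right_mono p(1)]) auto
          have "m * \<kappa> powr (m - 1) \<le> \<Lambda>" unfolding \<Lambda>_def using \<kappa> \<epsilon> m by (intro mult_left_mono powr_mono2) auto
          then have b: "\<kappa> powr m - u z powr m \<le> \<Lambda> * (\<kappa> - u z)"
            using 1 by (intro order_trans[OF p(2) mult_right_mono]) auto
          have "0 \<le> \<Lambda>\<^sub>0 * (\<kappa> - u z)" using \<Lambda>\<^sub>0 1 by simp
          then show ?thesis using a b 1 by (simp add: max_def)
        next
          case 2
          have "\<kappa> powr m \<le> u z powr m" using 2 \<kappa> \<epsilon> m by (intro powr_mono2) auto
          then show ?thesis using 2 by simp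
        qed
        then show "\<Lambda>\<^sub>0 * max 0 (\<kappa> - u z) \<le> max 0 (\<kappa> powr m - u z powr m)"
          "max 0 (\<kappa> powr m - u z powr m) \<le> \<Lambda> * max 0 (\<kappa> - u z)" by auto
      qed
    next
      fix \<phi> D\<phi> H\<phi> and K :: "('a \<times> real) set"
      assume "has_hess \<phi> D\<phi> H\<phi>" "\<And>z. 0 \<le> \<phi> z" "compact K" "K \<subseteq> ball 0 1" "\<And>z. z \<notin> K \<Longrightarrow> \<phi> z = 0"
      then show "0 \<le> (\<integral>z. max 0 (\<kappa> - u z) * (D\<phi> z \<bullet> (0, 1)) + max 0 (\<kappa> powr m - u z powr m) * lap_x H\<phi> z \<partial>lborel)"
        using \<kappa> \<epsilon> by (intro weak[of \<kappa> \<phi> D\<phi> H\<phi> K]) auto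
    qed
    define \<kappa> where "\<kappa> j = (q - \<epsilon>) + \<epsilon> * (1/2) ^ j" for j :: nat
    define \<rho> where "\<rho> j = (1/2 + (1/4) * (1/2) ^ j :: real)" for j :: nat
    define V where "V j = {z \<in> ball 0 (\<rho> j). u z < \<kappa> j}" for j
    define a where "a j = measure lborel (V j)" for j
    have half: "0 < (1/2::real) ^ j" "(1/2::real) ^ j \<le> 1" for j by (auto simp: power_le_one)
    have \<kappa>: "q - \<epsilon> \<le> \<kappa> j" "\<kappa> j \<le> q" for j
      using half[of j] \<epsilon> mult_left_le[of "(1/2) ^ j" \<epsilon>] by (auto simp: \<kappa>_def)
    have \<rho>: "1/2 \<le> \<rho> j" "\<rho> j < 1" for j using half[of j] by (auto simp: \<rho>_def)
    have V_meas[measurable]: "V j \<in> sets borel" for j unfolding V_def by measurable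
    have V_fin: "emeasure lborel (V j) < \<infinity>" for j
      by (rule emeasure_bounded_finite) (auto simp: V_def intro: bounded_subset[OF bounded_ball[of 0 "\<rho> j"]])
    have step: "a (Suc j) \<le> C * (2 ^ 8) ^ j * (a j * a j powr \<delta>)" if aj: "a j \<le> 1" for j
    proof -
      interpret W: very_weak_subsolution "\<lambda>z. max 0 (\<kappa> j - u z)" "\<lambda>z. max 0 (\<kappa> j powr m - u z powr m)" \<Lambda>\<^sub>0 \<Lambda> q
        by (rule vw[OF \<kappa>])
      have supp: "W.support (\<rho> j) = V j" by (auto simp: W.support_def V_def)
      define t where "t = (1/2::real) ^ j"
      have t: "0 < t" "t \<le> 1" using half[of j] by (auto simp: t_def)
      \<comment> \<open>On \<open>V (Suc j)\<close> the truncation at level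
        \<open>\<kappa> j\<close> is at least the level gap \<open>\<epsilon> * (t / 2)\<close>, and
        the cutoff is at least the cube of the radius gap \<open>t / 8\<close>.\<close>
      define c where "c = (\<epsilon> * (t / 2) * (t / 8) ^ 3)\<^sup>2"
      have c: "0 < c" using t \<epsilon> by (simp add: c_def)
      have low: "c * indicator (V (Suc j)) z \<le> (W.q (\<rho> j) z)\<^sup>2" for z
      proof (cases "z \<in> V (Suc j)")
        case True
        then have z: "norm z < \<rho> (Suc j)" "u z < \<kappa> (Suc j)" by (auto simp: V_def)
        have k: "\<kappa> j - \<kappa> (Suc j) = \<epsilon> * (t / 2)" by (simp add: \<kappa>_def t_def algebra_simps)
        have r: "\<rho> j - \<rho> (Suc j) = t / 8" by (simp add: \<rho>_def t_def)
        have h: "\<epsilon> * (t / 2) \<le> max 0 (\<kappa> j - u z)" using k z by linarith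
        have r1: "0 < \<rho> j" "\<rho> j \<le> 1" using \<rho>[of j] by auto
        define x where "x = norm z / \<rho> j"
        have x: "0 \<le> x" "x \<le> 1 - t / 8"
        proof -
          show "0 \<le> x" using r1 by (simp add: x_def)
          have "norm z \<le> \<rho> j - t / 8" using z r by linarith
          also have "\<dots> \<le> \<rho> j - \<rho> j * (t / 8)" using r1 t mult_left_le_one_le[of "t / 8" "\<rho> j"] by simp
          also have "\<dots> = (1 - t / 8) * \<rho> j" by (simp add: algebra_simps)
          finally show "x \<le> 1 - t / 8" using r1 by (simp add: x_def pos_divide_le_eq)
        qed
        \<comment> \<open>This turns the radius gap \<open>x \<le> 1 - t / 8\<close> into the lower
          bound \<open>t / 8\<close> for the argument of \<open>cube\<close>.\<close>
        have "x\<^sup>2 \<le> x" using x t by (simp add: power2_eq_square mult_left_le)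
        then have s: "t / 8 \<le> 1 - x\<^sup>2" using x by linarith
        have "(t / 8) ^ 3 \<le> (1 - x\<^sup>2) ^ 3" using s t by (intro power_mono) auto
        also have "\<dots> = cutoff (\<rho> j) z" using s t by (simp add: cutoff_def cube_def x_def power_divide)
        finally have "\<epsilon> * (t / 2) * (t / 8) ^ 3 \<le> W.q (\<rho> j) z"
          unfolding W.q_def using h t \<epsilon> by (intro mult_mono) auto
        then have "c \<le> (W.q (\<rho> j) z)\<^sup>2" unfolding c_def using t \<epsilon> by (intro power_mono) auto
        then show ?thesis using True by simp
      qed simp
      have "c * a (Suc j) = (\<integral>z. c * indicator (V (Suc j)) z \<partial>lborel)" by (simp add: a_def)
      also have "\<dots> \<le> (\<integral>z. (W.q (\<rho> j) z)\<^sup>2 \<partial>lborel)"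
        by (rule integral_mono[OF _ W.q_square_integrable[OF \<rho>] low]) (use V_fin in simp)
      also have "\<dots> \<le> gain_const TYPE('a) \<Lambda>\<^sub>0 \<Lambda> * q\<^sup>2 * (a j * a j powr \<delta>)"
        using W.gain[OF \<rho>, of j] aj unfolding supp by (simp add: a_def \<delta>_def)
      finally have "a (Suc j) \<le> gain_const TYPE('a) \<Lambda>\<^sub>0 \<Lambda> * q\<^sup>2 * (a j * a j powr \<delta>) / c"
        using c by (simp add: pos_le_divide_eq mult.commute)
      moreover have "1 / c = 2 ^ 20 / \<epsilon>\<^sup>2 * (2 ^ 8) ^ j"
      proof -
        have c8: "c = \<epsilon>\<^sup>2 / 2 ^ 20 * t ^ 8"
          by (simp add: c_def power_mult_distrib power_divide power2_eq_square eval_nat_numeral)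
        have t8: "t ^ 8 = 1 / (2 ^ 8) ^ j"
          unfolding t_def power_divide power_one power_mult[symmetric] by (simp only: mult.commute)
        show ?thesis unfolding c8 t8 using \<epsilon> by simp
      qed
      ultimately have "a (Suc j) \<le> gain_const TYPE('a) \<Lambda>\<^sub>0 \<Lambda> * q\<^sup>2 * (a j * a j powr \<delta>) *
          (2 ^ 20 / \<epsilon>\<^sup>2 * (2 ^ 8) ^ j)"
        by (metis (no_types) mult.right_neutral times_divide_eq_right)
      also have "\<dots> = gain_const TYPE('a) \<Lambda>\<^sub>0 \<Lambda> * q\<^sup>2 * (2 ^ 20 / \<epsilon>\<^sup>2) * ((2 ^ 8) ^ j * (a j * a j powr \<delta>))"
        by (simp only: mult_ac)
      also have "\<dots> \<le> C * ((2 ^ 8) ^ j * (a j * a j powr \<delta>))"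
        by (rule mult_right_mono) (auto simp: C_def a_def)
      finally show ?thesis by (simp only: mult.assoc)
    qed
    have "a 0 \<le> measure lborel {z \<in> ball 0 1. u z < q}"
      unfolding a_def
    proof (rule measure_mono_fmeasurable)
      show "V 0 \<subseteq> {z \<in> ball 0 1. u z < q}" using \<kappa>[of 0] by (auto simp: V_def \<rho>_def)
      show "{z \<in> ball 0 1. u z < q} \<in> fmeasurable lborel"
        by (intro fmeasurableI emeasure_bounded_finite bounded_subset[OF bounded_ball[of 0 1]]) auto
    qed simp
    with small have a0: "a 0 \<le> C powr (- 1 / \<delta>) * (2 ^ 8) powr (- 1 / \<delta>\<^sup>2)" by (simp add: \<nu>_def)
    have "a \<longlonglongrightarrow> 0"
      by (rule fast_geometric[OF _ C1 _ \<delta> step a0]) (auto simp: a_def)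
    define N where "N = {z \<in> ball 0 (1/2). u z < q - \<epsilon>}"
    have N: "N \<in> sets lborel" unfolding N_def by measurable
    have "emeasure lborel N \<le> ennreal (a j)" for j
    proof -
      have "emeasure lborel N \<le> emeasure lborel (V j)"
      proof (rule emeasure_mono)
        show "N \<subseteq> V j" using \<kappa>(1)[of j] \<rho>(1)[of j] by (force simp: N_def V_def)
      qed simp
      then show ?thesis using V_fin[of j] by (simp add: a_def emeasure_eq_ennreal_measure)
    qed
    moreover have "(\<lambda>j. ennreal (a j)) \<longlonglongrightarrow> ennreal 0" using \<open>a \<longlonglongrightarrow> 0\<close> by (intro tendsto_intros)
    ultimately have "emeasure lborel N \<le> ennreal 0" by (intro LIMSEQ_le_const) auto
    then have "N \<in> null_sets lborel" using N by auto
    then have "AE z in lborel. z \<notin> N" by (rule AE_not_in)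
    then show ?thesis by eventually_elim (auto simp: N_def not_less)
  qed
  then show ?thesis using \<nu> by blast
qed

section \<open>Localization and parabolic scaling\<close>

lemma lebesgue_on_borel_representative:
  fixes f :: "'b::euclidean_space \<Rightarrow> 'c::euclidean_space"
  assumes f: "f \<in> borel_measurable (lebesgue_on S)" and S[measurable]: "S \<in> sets borel"
  obtains g where "g \<in> borel_measurable borel" "\<And>z. z \<notin> S \<Longrightarrow> g z = 0" "AE z in lborel. z \<in> S \<longrightarrow> g z = f z"
proof -
  have f': "(\<lambda>z. indicator S z *\<^sub>R f z) \<in> borel_measurable lebesgue"
    using f by (subst (asm) borel_measurable_restrict_space_iff) auto
  have "\<exists>g. g \<in> borel_measurable lborel \<and> (AE z in lborel. (indicator S z *\<^sub>R f z) \<bullet> i = g z)" for i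
  proof -
    have "(\<lambda>z. (indicator S z *\<^sub>R f z) \<bullet> i) \<in> borel_measurable lebesgue"
      by (rule borel_measurable_inner[OF f']) simp
    from completion_ex_borel_measurable_real[OF this] show ?thesis by blast
  qed
  then obtain g where g: "\<And>i. g i \<in> borel_measurable lborel"
      "\<And>i. AE z in lborel. (indicator S z *\<^sub>R f z) \<bullet> i = g i z" by metis
  define h where "h z = indicator S z *\<^sub>R (\<Sum>i\<in>Basis. g i z *\<^sub>R i)" for z
  have [measurable]: "g i \<in> borel_measurable borel" for i using g(1)[of i] by simp
  have "AE z in lborel. \<forall>i\<in>Basis. (indicator S z *\<^sub>R f z) \<bullet> i = g i z"
    using g(2) by (intro AE_finite_allI) auto
  then have "AE z in lborel. z \<in> S \<longrightarrow> h z = f z"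
  proof eventually_elim
    case (elim z)
    show ?case
    proof
      assume z: "z \<in> S"
      then have "h z = (\<Sum>i\<in>Basis. (f z \<bullet> i) *\<^sub>R i)" using elim by (simp add: h_def)
      then show "h z = f z" by (simp add: euclidean_representation)
    qed
  qed
  moreover have "h \<in> borel_measurable borel" unfolding h_def[abs_def] by measurable
  ultimately show thesis by (intro that[of h]) (auto simp: h_def)
qed

text \<open>Only \<open>g\<close> is known to be measurable; \<open>f\<close> agrees with it almost
  everywhere on \<open>S\<close>, and completeness of Lebesgue measure transfers measurability to
  \<open>f\<close>.\<close>

lemma integral_lebesgue_on_eq_lborel:
  fixes f g :: "'b::euclidean_space \<Rightarrow> 'c::{banach,second_countable_topology}"
  assumes S[measurable]: "S \<in> sets borel" and g[measurable]: "g \<in> borel_measurable borel"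
    and g0: "\<And>z. z \<notin> S \<Longrightarrow> g z = 0" and eq: "AE z in lborel. z \<in> S \<longrightarrow> g z = f z"
  shows "(LINT z|lebesgue_on S. f z) = (\<integral>z. g z \<partial>lborel)"
    and "integrable (lebesgue_on S) f \<longleftrightarrow> integrable lborel g"
proof -
  have gl: "g \<in> borel_measurable lebesgue" by (rule measurable_completion) simp
  have ae: "AE z in lebesgue. indicator S z *\<^sub>R f z = g z"
    by (rule AE_completion, use eq in eventually_elim) (auto simp: g0 indicator_def)
  have fl: "(\<lambda>z. indicator S z *\<^sub>R f z) \<in> borel_measurable lebesgue"
  proof (rule measurableI)
    fix A :: "'c set" assume A: "A \<in> sets borel"
    show "(\<lambda>z. indicator S z *\<^sub>R f z) -` A \<inter> space lebesgue \<in> sets lebesgue"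
      by (rule completion.in_sets_AE[where A = "g -` A \<inter> space lebesgue"])
        (use ae in \<open>eventually_elim, auto\<close>, use measurable_sets[OF gl A] in auto)
  qed simp
  have "(LINT z|lebesgue_on S. f z) = (\<integral>z. indicator S z *\<^sub>R f z \<partial>lebesgue)"
    by (subst integral_restrict_space) auto
  also have "\<dots> = (\<integral>z. g z \<partial>lebesgue)" by (rule integral_cong_AE[OF fl gl ae])
  also have "\<dots> = (\<integral>z. g z \<partial>lborel)" by (rule integral_completion) simp
  finally show "(LINT z|lebesgue_on S. f z) = (\<integral>z. g z \<partial>lborel)" .
  have "integrable (lebesgue_on S) f \<longleftrightarrow> integrable lebesgue (\<lambda>z. indicator S z *\<^sub>R f z)"
    by (subst integrable_restrict_space) auto
  also have "\<dots> \<longleftrightarrow> integrable lebesgue g" by (rule integrable_cong_AE[OF fl gl ae])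
  also have "\<dots> \<longleftrightarrow> integrable lborel g" by (rule integrable_completion) simp
  finally show "integrable (lebesgue_on S) f \<longleftrightarrow> integrable lborel g" .
qed

lemma AE_lebesgue_on_iff:
  assumes "S \<in> sets borel"
  shows "(AE z in lebesgue_on S. P z) \<longleftrightarrow> (AE z in lborel. z \<in> S \<longrightarrow> P z)"
  using assms by (subst AE_restrict_space_iff) (auto simp: AE_completion_iff)

text \<open>Weak gradients live on time slices, whereas representatives agree only almost everywhere
  in space-time. Fubini passes the agreement to almost every slice.\<close>

lemma AE_lborel_slices:
  fixes P :: "'b::euclidean_space \<times> real \<Rightarrow> bool"
  assumes "AE z in lborel. P z"
  shows "AE t in lborel. AE x in lborel. P (x, t)"
proof -
  obtain N where N: "N \<in> null_sets lborel" "{z. \<not> P z} \<subseteq> N"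
    using assms unfolding eventually_ae_filter by auto
  have [measurable]: "N \<in> sets (lborel \<Otimes>\<^sub>M lborel)" unfolding lborel_prod using N(1) by (rule null_setsD2)
  have "AE z in lborel \<Otimes>\<^sub>M lborel. z \<notin> N" unfolding lborel_prod by (rule AE_not_in[OF N(1)])
  then have "AE x in lborel. AE t in lborel. (x, t) \<notin> N" by (rule lborel_pair.AE_pair)
  then have "AE t in lborel. AE x in lborel. (x, t) \<notin> N"
    by (subst (asm) lborel_pair.AE_commute) (simp_all only: prod.collapse, measurable)
  then show ?thesis
  proof eventually_elim
    case (elim t)
    then show ?case by eventually_elim (use N(2) in auto)
  qed
qed

lemma smooth_slice_derivatives:
  fixes \<phi> :: "'a::euclidean_space \<times> real \<Rightarrow> real"
  assumes "smooth \<phi>"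
  shows "deriv (\<lambda>s. \<phi> (x, s)) t = grad \<phi> (x, t) \<bullet> (0, 1)" and "grad (\<lambda>y. \<phi> (y, t)) x = fst (grad \<phi> (x, t))"
proof -
  have g: "(\<phi> has_derivative (\<lambda>v. grad \<phi> z \<bullet> v)) (at z)" for z
    by (rule has_gradD[OF smooth_has_grad(1)[OF assms]])
  have "((\<lambda>s. \<phi> (x, s)) has_derivative (\<lambda>h. grad \<phi> (x, t) \<bullet> (0, h))) (at t)"
    by (rule has_derivative_compose[of "\<lambda>s. (x, s)" "\<lambda>h. (0, h)" t UNIV \<phi>, OF _ g]) (auto intro!: derivative_eq_intros)
  then have "((\<lambda>s. \<phi> (x, s)) has_real_derivative grad \<phi> (x, t) \<bullet> (0, 1)) (at t)"
    unfolding has_field_derivative_def by (rule has_derivative_eq_rhs) (auto simp: inner_prod_def mult.commute)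
  then show "deriv (\<lambda>s. \<phi> (x, s)) t = grad \<phi> (x, t) \<bullet> (0, 1)" by (rule DERIV_imp_deriv)
  have "((\<lambda>y. \<phi> (y, t)) has_derivative (\<lambda>h. grad \<phi> (x, t) \<bullet> (h, 0))) (at x)"
    by (rule has_derivative_compose[of "\<lambda>y. (y, t)" "\<lambda>h. (h, 0)" x UNIV \<phi>, OF _ g]) (auto intro!: derivative_eq_intros)
  then show "grad (\<lambda>y. \<phi> (y, t)) x = fst (grad \<phi> (x, t))"
    by (intro grad_eqI) (rule has_derivative_eq_rhs, auto simp: inner_prod_def)
qed

lemma test_function_grad_outside:
  assumes "test_function S \<phi>" "z \<notin> S"
  shows "grad \<phi> z = 0"
proof (rule has_grad_zero_outside[OF smooth_has_grad(1)])
  show "smooth \<phi>" using assms(1) by (simp add: test_function_def)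
  show "open (- closure {x. \<phi> x \<noteq> 0})" by (simp add: open_Compl)
  show "z \<in> - closure {x. \<phi> x \<noteq> 0}" using assms by (auto simp: test_function_def)
  show "\<phi> x = 0" if "x \<in> - closure {x. \<phi> x \<noteq> 0}" for x
    using that closure_subset[of "{x. \<phi> x \<noteq> 0}"] by auto
qed

text \<open>Passage from the definition to \<open>local_supersolution\<close>: one cylinder with
  compact closure, Borel representatives extended by zero, \<open>lborel\<close> in place of
  restricted Lebesgue measure. Test functions on the small cylinder vanish with their gradients
  outside it, so both integrals agree.\<close>

theorem weak_supersolution_localize:
  fixes \<Omega> :: "'a::euclidean_space set"
  assumes m: "1 < m" and \<Omega>: "open \<Omega>" and super: "weak_supersolution m \<Omega> t\<^sub>1 t\<^sub>2 u"
    and U: "open U" "U \<subseteq> \<Omega>" "bounded U" and s: "s\<^sub>1 < s\<^sub>2"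
    and cl: "compact (closure (U \<times> {s\<^sub>1<..<s\<^sub>2}))" "closure (U \<times> {s\<^sub>1<..<s\<^sub>2}) \<subseteq> \<Omega> \<times> {t\<^sub>1<..<t\<^sub>2}"
  obtains w G where "local_supersolution m U s\<^sub>1 s\<^sub>2 w G"
    "AE z in lborel. z \<in> U \<times> {s\<^sub>1<..<s\<^sub>2} \<longrightarrow> u z = ennreal (w z powr (1 / m))"
proof -
  let ?D = "U \<times> {s\<^sub>1<..<s\<^sub>2}" and ?E = "\<Omega> \<times> {t\<^sub>1<..<t\<^sub>2}"
  define w0 where "w0 = (\<lambda>z. enn2real (u z) powr m)"
  have oD: "open ?D" "open ?E" using U \<Omega> by (auto intro: open_Times)
  have D[measurable]: "?D \<in> sets borel" and D0[measurable]: "?E \<in> sets borel" and [measurable]: "U \<in> sets borel"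
    using oD U by (auto intro: borel_open simp del: sets_borel_eq_count_space)
  have sub: "?D \<subseteq> ?E" by (rule subset_trans[OF closure_subset cl(2)])
  from super[unfolded weak_supersolution_def, folded w0_def]
  obtain G0 where fin0: "AE z in lebesgue_on ?E. u z < \<infinity>" and loc: "L2loc_H1loc_with_gradient \<Omega> t\<^sub>1 t\<^sub>2 w0 G0"
    and int: "\<forall>\<phi>. test_function ?E \<phi> \<and> (\<forall>z. 0 \<le> \<phi> z) \<longrightarrow>
      0 \<le> (LINT (x, t)|lebesgue_on ?E. - enn2real (u (x, t)) * deriv (\<lambda>s. \<phi> (x, s)) t + G0 (x, t) \<bullet> grad (\<lambda>y. \<phi> (y, t)) x)"
    by (elim conjE exE) (rule that)
  have fin: "AE z in lborel. z \<in> ?D \<longrightarrow> u z < \<infinity>"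
    using fin0 unfolding AE_lebesgue_on_iff[OF D0] by eventually_elim (use sub in blast)
  have H: "L2_H1_with_gradient U s\<^sub>1 s\<^sub>2 w0 G0"
    using loc[unfolded L2loc_H1loc_with_gradient_def, rule_format, of U s\<^sub>1 s\<^sub>2] U(1,2) s cl by simp
  obtain w1 where w1: "w1 \<in> borel_measurable borel" "\<And>z. z \<notin> ?D \<Longrightarrow> w1 z = 0" "AE z in lborel. z \<in> ?D \<longrightarrow> w1 z = w0 z"
    using lebesgue_on_borel_representative[OF _ D, of w0] conjunct1[OF H[unfolded L2_H1_with_gradient_def]] by blast
  obtain G where G[measurable]: "G \<in> borel_measurable borel" and G0: "\<And>z. z \<notin> ?D \<Longrightarrow> G z = 0"
    and GAE: "AE z in lborel. z \<in> ?D \<longrightarrow> G z = G0 z"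
    using lebesgue_on_borel_representative[OF _ D, of G0] conjunct1[OF conjunct2[OF H[unfolded L2_H1_with_gradient_def]]] by blast
  \<comment> \<open>The Borel representative is nonnegative only almost everywhere; its positive
    part is nonnegative everywhere.\<close>
  define w where "w z = max 0 (w1 z)" for z
  have [measurable]: "w \<in> borel_measurable borel" using w1(1) unfolding w_def[abs_def] by measurable
  have w0: "\<And>z. 0 \<le> w z" "\<And>z. z \<notin> ?D \<Longrightarrow> w z = 0" using w1(2) by (auto simp: w_def)
  have wAE: "AE z in lborel. z \<in> ?D \<longrightarrow> w z = w0 z"
    using w1(3) by eventually_elim (auto simp: w_def w0_def)
  have "integrable (lebesgue_on ?D) (\<lambda>z. (w0 z)\<^sup>2 + (norm (G0 z))\<^sup>2)"
    using H unfolding L2_H1_with_gradient_def by blast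
  then have sq: "integrable lborel (\<lambda>z. (w z)\<^sup>2 + (norm (G z))\<^sup>2)"
    by (subst (asm) integral_lebesgue_on_eq_lborel(2)[OF D, of "\<lambda>z. (w z)\<^sup>2 + (norm (G z))\<^sup>2"])
      (auto simp: w0 G0 intro: eventually_mono[OF eventually_conj[OF wAE GAE]])
  have uw: "AE z in lborel. z \<in> ?D \<longrightarrow> w z powr (1 / m) = enn2real (u z)"
    using wAE by eventually_elim (use m in \<open>auto simp: w0_def powr_powr\<close>)
  have "local_supersolution m U s\<^sub>1 s\<^sub>2 w G"
  proof
    show "integrable lborel (\<lambda>z. (w z)\<^sup>2)" "integrable lborel (\<lambda>z. (norm (G z))\<^sup>2)"
      by (rule Bochner_Integration.integrable_bound[OF sq]; auto)+
    have "AE t in lborel. s\<^sub>1 < t \<and> t < s\<^sub>2 \<longrightarrow> H1_with_gradient U (\<lambda>x. w0 (x, t)) (\<lambda>x. G0 (x, t))"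
      using H unfolding L2_H1_with_gradient_def by (subst (asm) AE_lebesgue_on_iff) auto
    moreover note AE_lborel_slices[OF wAE] AE_lborel_slices[OF GAE]
    ultimately show "AE t in lborel. s\<^sub>1 < t \<and> t < s\<^sub>2 \<longrightarrow> (\<forall>\<psi>. test_function U \<psi> \<longrightarrow> (\<forall>i\<in>Basis.
        (\<integral>x. w (x, t) * (grad \<psi> x \<bullet> i) \<partial>lborel) = - (\<integral>x. (G (x, t) \<bullet> i) * \<psi> x \<partial>lborel)))"
    proof eventually_elim
      case (elim t)
      show ?case
      proof (intro impI allI ballI)
        fix \<psi> :: "'a \<Rightarrow> real" and i :: 'a
        assume t: "s\<^sub>1 < t \<and> t < s\<^sub>2" and \<psi>: "test_function U \<psi>" and i: "i \<in> Basis"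
        have sm: "smooth \<psi>" using \<psi> by (simp add: test_function_def)
        have [measurable]: "grad \<psi> \<in> borel_measurable borel" "\<psi> \<in> borel_measurable borel"
          using smooth_has_grad(3)[OF sm] smooth_continuous[OF sm] by (auto intro: borel_measurable_continuous_onI)
        have "(LINT x|lebesgue_on U. w0 (x, t) * (grad \<psi> x \<bullet> i)) = - (LINT x|lebesgue_on U. (G0 (x, t) \<bullet> i) * \<psi> x)"
          using elim(1) t \<psi> i unfolding H1_with_gradient_def weak_gradient_on_def by blast
        moreover have "(LINT x|lebesgue_on U. w0 (x, t) * (grad \<psi> x \<bullet> i)) = (\<integral>x. w (x, t) * (grad \<psi> x \<bullet> i) \<partial>lborel)"
          by (rule integral_lebesgue_on_eq_lborel(1)) (use elim(2) t in \<open>auto simp: w0\<close>)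
        moreover have "(LINT x|lebesgue_on U. (G0 (x, t) \<bullet> i) * \<psi> x) = (\<integral>x. (G (x, t) \<bullet> i) * \<psi> x \<partial>lborel)"
          by (rule integral_lebesgue_on_eq_lborel(1)) (use elim(3) t in \<open>auto simp: G0\<close>)
        ultimately show "(\<integral>x. w (x, t) * (grad \<psi> x \<bullet> i) \<partial>lborel) = - (\<integral>x. (G (x, t) \<bullet> i) * \<psi> x \<partial>lborel)" by simp
      qed
    qed
    fix \<phi> :: "'a \<times> real \<Rightarrow> real" assume \<phi>: "test_function ?D \<phi>" "\<And>z. 0 \<le> \<phi> z"
    have sm: "smooth \<phi>" using \<phi>(1) by (simp add: test_function_def)
    have [measurable]: "grad \<phi> \<in> borel_measurable borel"
      using smooth_has_grad(3)[OF sm] by (auto intro: borel_measurable_continuous_onI)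
    have "test_function ?E \<phi>" using \<phi>(1) sub by (auto simp: test_function_def)
    then have "0 \<le> (LINT (x, t)|lebesgue_on ?E. - enn2real (u (x, t)) * deriv (\<lambda>s. \<phi> (x, s)) t + G0 (x, t) \<bullet> grad (\<lambda>y. \<phi> (y, t)) x)"
      using \<phi>(2) by (intro int[rule_format]) simp
    also have "\<dots> = (\<integral>z. - (w z powr (1 / m)) * (grad \<phi> z \<bullet> (0, 1)) + G z \<bullet> fst (grad \<phi> z) \<partial>lborel)"
    proof (rule integral_lebesgue_on_eq_lborel(1)[OF D0])
      have *: "grad \<phi> z = 0" if "z \<notin> ?D" for z by (rule test_function_grad_outside[OF \<phi>(1) that])
      show "- (w z powr (1 / m)) * (grad \<phi> z \<bullet> (0, 1)) + G z \<bullet> fst (grad \<phi> z) = 0" if "z \<notin> ?E" for z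
      proof -
        have "z \<notin> ?D" using that sub by blast
        then show ?thesis using *[of z] by simp
      qed
      show "AE z in lborel. z \<in> ?E \<longrightarrow> - (w z powr (1 / m)) * (grad \<phi> z \<bullet> (0, 1)) + G z \<bullet> fst (grad \<phi> z) =
          (case z of (x, t) \<Rightarrow> - enn2real (u (x, t)) * deriv (\<lambda>s. \<phi> (x, s)) t + G0 (x, t) \<bullet> grad (\<lambda>y. \<phi> (y, t)) x)"
        using uw GAE
      proof eventually_elim
        case (elim z)
        obtain x t where z: "z = (x, t)" by force
        show ?case
        proof (cases "z \<in> ?D")
          case True
          then have "w z powr (1 / m) = enn2real (u z)" "G z = G0 z" using elim by blast+
          then show ?thesis by (simp add: z smooth_slice_derivatives[OF sm])
        next
          case False
          then show ?thesis using *[of z] by (simp add: z smooth_slice_derivatives[OF sm])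
        qed
      qed
    qed measurable
    finally show "0 \<le> (\<integral>z. - (w z powr (1 / m)) * (grad \<phi> z \<bullet> (0, 1)) + G z \<bullet> fst (grad \<phi> z) \<partial>lborel)" .
  qed (use m U w0 G0 in auto)
  \<comment> \<open>Finiteness almost everywhere enters here: \<open>enn2real\<close> sends infinite
    values to 0, so the root of \<open>w\<close> determines \<open>u\<close> only where
    \<open>u\<close> is finite.\<close>
  moreover have "AE z in lborel. z \<in> ?D \<longrightarrow> u z = ennreal (w z powr (1 / m))"
    using uw fin by eventually_elim auto
  ultimately show thesis by (rule that)
qed

section \<open>Parabolic scaling\<close>

definition parabolic_scale :: "'a::euclidean_space \<times> real \<Rightarrow> real \<Rightarrow> 'a \<times> real \<Rightarrow> 'a \<times> real" where
  "parabolic_scale z r y = z + (r *\<^sub>R fst y, r\<^sup>2 * snd y)"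

lemma parabolic_scale_measurable[measurable]: "parabolic_scale z r \<in> borel_measurable borel"
  unfolding parabolic_scale_def[abs_def]
  by (intro borel_measurable_continuous_onI continuous_intros)

text \<open>A diagonal change of variables with factor \<open>r\<close> in space and
  \<open>r\<^sup>2\<close> in time, the time direction being the basis vector with zero first
  component. The Jacobian stays anonymous, since only signs and ratios of integrals are
  transported.\<close>

lemma lborel_parabolic_scale:
  fixes z :: "'a::euclidean_space \<times> real"
  assumes r: "0 < r"
  obtains C where "0 < C" "lborel = density (distr lborel borel (parabolic_scale z r)) (\<lambda>_. ennreal C)"
proof -
  define c where "c j = (if fst j = 0 then r\<^sup>2 else r)" for j :: "'a \<times> real"
  have c: "0 < c j" for j using r by (simp add: c_def)
  have "z + (\<Sum>j\<in>Basis. (c j * (x \<bullet> j)) *\<^sub>R j) = parabolic_scale z r x" for x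
  proof -
    have "(\<Sum>j\<in>Basis. (c j * (x \<bullet> j)) *\<^sub>R j) =
        (\<Sum>i\<in>Basis. (c (i, 0) * (x \<bullet> (i, 0))) *\<^sub>R (i, 0)) + (c (0, 1) * (x \<bullet> (0, 1))) *\<^sub>R (0, 1)"
      by (subst sum_Basis_prod_eq) simp
    also have "(\<Sum>i\<in>Basis. (c (i, 0) * (x \<bullet> (i, 0))) *\<^sub>R (i, 0 :: real)) = (\<Sum>i\<in>Basis. (r *\<^sub>R (fst x \<bullet> i) *\<^sub>R i, 0))"
      by (intro sum.cong) (auto simp: c_def inner_prod_def nonzero_Basis)
    also have "\<dots> = (r *\<^sub>R (\<Sum>i\<in>Basis. (fst x \<bullet> i) *\<^sub>R i), 0)"
      by (simp only: sum_prod scaleR_sum_right sum.neutral_const)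
    also have "\<dots> = (r *\<^sub>R fst x, 0)" by (simp only: euclidean_representation)
    finally show ?thesis by (simp add: parabolic_scale_def c_def inner_prod_def)
  qed
  then have eq: "lborel = density (distr lborel borel (parabolic_scale z r)) (\<lambda>_. ennreal (\<Prod>j\<in>Basis. \<bar>c j\<bar>))"
    using lborel_affine_euclidean[of c z] c by (simp add: less_imp_neq[symmetric])
  show thesis by (rule that[OF _ eq]) (use c in \<open>auto intro!: prod_pos simp: less_imp_neq[symmetric]\<close>)
qed

lemma Q_cyl_iff: "w \<in> Q_cyl z r \<longleftrightarrow> dist (fst w) (fst z) < r \<and> \<bar>snd w - snd z\<bar> < r\<^sup>2"
proof -
  have "w \<in> Q_cyl z r \<longleftrightarrow> w - z \<in> ball 0 r \<times> {- (r\<^sup>2)<..<r\<^sup>2}"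
    unfolding Q_cyl_def
  proof
    assume "w - z \<in> ball 0 r \<times> {- (r\<^sup>2)<..<r\<^sup>2}"
    from imageI[OF this, of "\<lambda>w. z + w"]
    show "w \<in> (\<lambda>w. z + w) ` (ball 0 r \<times> {- (r\<^sup>2)<..<r\<^sup>2})" by simp
  qed auto
  then show ?thesis by (cases w; cases z) (auto simp: dist_norm norm_minus_commute)
qed

lemma Q_cyl_eq: "Q_cyl z r = ball (fst z) r \<times> {snd z - r\<^sup>2<..<snd z + r\<^sup>2}"
proof (rule set_eqI)
  fix w show "w \<in> Q_cyl z r \<longleftrightarrow> w \<in> ball (fst z) r \<times> {snd z - r\<^sup>2<..<snd z + r\<^sup>2}"
    unfolding Q_cyl_iff by (cases w) (auto simp: dist_commute abs_less_iff)
qed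

lemma open_Q_cyl: "open (Q_cyl z r)"
  unfolding Q_cyl_eq by (intro open_Times) auto

lemma Q_cyl_borel[measurable]: "Q_cyl z r \<in> sets borel"
  by (rule borel_open[OF open_Q_cyl])

lemma bounded_Q_cyl: "bounded (Q_cyl z r)"
  unfolding Q_cyl_eq by (intro bounded_Times) auto

lemma Q_cyl_finite: "emeasure lborel (Q_cyl z r) < \<infinity>"
  by (rule emeasure_bounded_finite[OF bounded_Q_cyl])

lemma centre_in_Q_cyl: "0 < r \<Longrightarrow> z \<in> Q_cyl z r"
  by (simp add: Q_cyl_iff)

lemma parabolic_scale_in_Q_cyl_iff:
  "0 < r \<Longrightarrow> 0 < \<rho> \<Longrightarrow> parabolic_scale z r y \<in> Q_cyl z (r * \<rho>) \<longleftrightarrow> norm (fst y) < \<rho> \<and> \<bar>snd y\<bar> < \<rho>\<^sup>2"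
  by (simp add: Q_cyl_iff parabolic_scale_def dist_norm abs_mult power_mult_distrib)

text \<open>Uniqueness of gradients makes \<open>H\<close> homogeneous in the direction. This pulls
  the factor \<open>1 / r\<close> of a dilated direction out of the second derivative.\<close>

lemma has_hess_scaleR:
  assumes "has_hess f D H"
  shows "H (c *\<^sub>R v) z = c *\<^sub>R H v z"
proof -
  have "((\<lambda>z. D z \<bullet> (c *\<^sub>R v)) has_derivative (\<lambda>h. (c *\<^sub>R H v z) \<bullet> h)) (at z)"
    using has_derivative_mult_right[OF has_gradD[OF has_hessD(2)[OF assms, of v]], of c z] by simp
  then have "grad (\<lambda>z. D z \<bullet> (c *\<^sub>R v)) z = c *\<^sub>R H v z" by (rule grad_eqI)
  moreover have "grad (\<lambda>z. D z \<bullet> (c *\<^sub>R v)) z = H (c *\<^sub>R v) z"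
    by (rule grad_eqI[OF has_gradD[OF has_hessD(2)[OF assms]]])
  ultimately show ?thesis by simp
qed

text \<open>The linear part of the inverse of \<open>parabolic_scale\<close>. It is diagonal, hence
  self-adjoint, so the same map also transports gradients.\<close>

definition parabolic_dilation :: "real \<Rightarrow> 'a::euclidean_space \<times> real \<Rightarrow> 'a \<times> real" where
  "parabolic_dilation r v = ((1 / r) *\<^sub>R fst v, (1 / r\<^sup>2) * snd v)"

lemma bounded_linear_parabolic_dilation: "bounded_linear (parabolic_dilation r)"
  unfolding linear_conv_bounded_linear[symmetric] parabolic_dilation_def[abs_def]
  by (rule linearI) (auto simp: scaleR_add_right distrib_left)

lemma continuous_parabolic_dilation: "continuous_on S (parabolic_dilation r)"
  unfolding parabolic_dilation_def[abs_def] by (intro continuous_intros)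

lemma parabolic_dilation_scale: "0 < r \<Longrightarrow> parabolic_dilation r (parabolic_scale z r y - z) = y"
  by (simp add: parabolic_dilation_def parabolic_scale_def)

lemma parabolic_scale_dilation: "0 < r \<Longrightarrow> parabolic_scale z r (parabolic_dilation r (w - z)) = w"
  by (simp add: parabolic_dilation_def parabolic_scale_def prod_eq_iff)

lemma has_grad_dilation:
  assumes "has_grad f D"
  shows "has_grad (\<lambda>w. f (parabolic_dilation r (w - z))) (\<lambda>w. parabolic_dilation r (D (parabolic_dilation r (w - z))))"
  unfolding has_grad_def
proof
  fix w
  have "((\<lambda>w. parabolic_dilation r (w - z)) has_derivative parabolic_dilation r) (at w)"
    by (rule bounded_linear.has_derivative[OF bounded_linear_parabolic_dilation[of r], of "\<lambda>w. w - z" "\<lambda>h. h" "at w"])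
      (auto intro!: derivative_eq_intros)
  from has_derivative_compose[OF this has_gradD[OF assms]]
  show "((\<lambda>w. f (parabolic_dilation r (w - z))) has_derivative
      (\<lambda>v. parabolic_dilation r (D (parabolic_dilation r (w - z))) \<bullet> v)) (at w)"
    by (rule has_derivative_eq_rhs) (auto simp: parabolic_dilation_def inner_prod_def)
qed

lemma has_hess_dilation:
  assumes "has_hess f D H"
  shows "has_hess (\<lambda>w. f (parabolic_dilation r (w - z))) (\<lambda>w. parabolic_dilation r (D (parabolic_dilation r (w - z))))
    (\<lambda>v w. parabolic_dilation r (H (parabolic_dilation r v) (parabolic_dilation r (w - z))))"
  unfolding has_hess_def
proof (intro conjI allI)
  show "has_grad (\<lambda>w. f (parabolic_dilation r (w - z))) (\<lambda>w. parabolic_dilation r (D (parabolic_dilation r (w - z))))"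
    by (rule has_grad_dilation[OF has_hessD(1)[OF assms]])
  fix v
  have "parabolic_dilation r a \<bullet> v = a \<bullet> parabolic_dilation r v" for a :: "'a \<times> real"
    by (simp add: parabolic_dilation_def inner_prod_def)
  then show "has_grad (\<lambda>w. parabolic_dilation r (D (parabolic_dilation r (w - z))) \<bullet> v)
      (\<lambda>w. parabolic_dilation r (H (parabolic_dilation r v) (parabolic_dilation r (w - z))))"
    using has_grad_dilation[OF has_hessD(2)[OF assms]] by simp
  show "continuous_on UNIV (\<lambda>w. parabolic_dilation r (H (parabolic_dilation r v) (parabolic_dilation r (w - z))))"
    by (intro continuous_on_compose2[OF continuous_parabolic_dilation[of UNIV]]
      continuous_on_compose2[OF has_hessD(3)[OF assms]] continuous_intros) auto
qed

lemma lap_x_dilation: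
  assumes "has_hess f D H"
  shows "lap_x (\<lambda>v w. parabolic_dilation r (H (parabolic_dilation r v) (g w))) w = lap_x H (g w) / r\<^sup>2"
proof -
  have "parabolic_dilation r (H (parabolic_dilation r (i, 0)) y) \<bullet> (i, 0) = H (i, 0) y \<bullet> (i, 0) / r\<^sup>2" for i y
  proof -
    have "parabolic_dilation r (i, 0) = (1 / r) *\<^sub>R (i, 0)" by (simp add: parabolic_dilation_def)
    then show ?thesis
      using has_hess_scaleR[OF assms, of "1 / r" "(i, 0)" y]
      by (simp add: parabolic_dilation_def inner_prod_def power2_eq_square)
  qed
  then show ?thesis by (simp add: lap_x_def sum_divide_distrib)
qed

context local_supersolution
begin

text \<open>Under parabolic scaling the time derivative and the spatial Laplacian of the test
  function both acquire the factor \<open>1 / r\<^sup>2\<close>, so the truncated inequality keeps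
  its form with the values of \<open>u\<close> and \<open>\<kappa>\<close> unchanged. The Jacobian
  contributes only a positive factor.\<close>

lemma rescaled_very_weak:
  assumes r: "0 < r" and Q: "Q_cyl z r \<subseteq> D" and \<kappa>: "0 < \<kappa>"
    and hess: "has_hess \<phi> D\<phi> H" and nonneg: "\<And>y. 0 \<le> \<phi> y"
    and K: "compact K" "K \<subseteq> ball 0 1" "\<And>y. y \<notin> K \<Longrightarrow> \<phi> y = 0"
  shows "0 \<le> (\<integral>y. max 0 (\<kappa> - u (parabolic_scale z r y)) * (D\<phi> y \<bullet> (0, 1)) +
      max 0 (\<kappa> powr m - u (parabolic_scale z r y) powr m) * lap_x H y \<partial>lborel)" (is "0 \<le> (\<integral>y. ?F y \<partial>lborel)")
proof -
  let ?T = "\<lambda>w. parabolic_dilation r (w - z)" and ?S = "parabolic_scale z r"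
  obtain C where C: "0 < C" "lborel = density (distr lborel borel ?S) (\<lambda>_. ennreal C)"
    by (rule lborel_parabolic_scale[OF r, of z])
  have [measurable]: "D\<phi> \<in> borel_measurable borel" "H v \<in> borel_measurable borel" for v
    by (rule borel_measurable_continuous_onI, rule has_hessD[OF hess])+
  have [measurable]: "lap_x H \<in> borel_measurable borel" unfolding lap_x_def[abs_def] by measurable
  have [measurable]: "?T \<in> borel_measurable borel"
    by (intro borel_measurable_continuous_onI continuous_on_compose2[OF continuous_parabolic_dilation[of UNIV]] continuous_intros) auto
  have dil: "parabolic_dilation r a \<bullet> (0, 1) = a \<bullet> (0, 1) / r\<^sup>2" for a :: "'a \<times> real"
    by (simp add: parabolic_dilation_def inner_prod_def)
  have inK: "?S ` K \<subseteq> D"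
  proof -
    have "?S y \<in> Q_cyl z r" if "y \<in> K" for y
    proof -
      have "norm y < 1" using that K(2) by auto
      moreover have "norm (fst y) \<le> norm y" "\<bar>snd y\<bar> \<le> norm y"
        using norm_fst_le[of "fst y" "snd y"] norm_snd_le[of "snd y" "fst y"] by auto
      ultimately show ?thesis using parabolic_scale_in_Q_cyl_iff[OF r, of 1 z y] by simp
    qed
    then show ?thesis using Q by blast
  qed
  have "0 \<le> (\<integral>w'. max 0 (\<kappa> - u w') * (parabolic_dilation r (D\<phi> (?T w')) \<bullet> (0, 1)) +
      max 0 (\<kappa> powr m - w w') * lap_x (\<lambda>v w. parabolic_dilation r (H (parabolic_dilation r v) (?T w))) w' \<partial>lborel)"
  proof (rule truncation[OF \<kappa> has_hess_dilation[OF hess]])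
    show "compact (?S ` K)"
      by (intro compact_continuous_image K(1)) (auto simp: parabolic_scale_def[abs_def] intro!: continuous_intros)
    show "?S ` K \<subseteq> D" by (rule inK)
    show "\<phi> (?T y) = 0" if "y \<notin> ?S ` K" for y
      using that parabolic_scale_dilation[OF r, of z y] by (intro K(3)) (metis imageI)
  qed (rule nonneg)
  also have "\<dots> = (\<integral>w. ?F (?T w) / r\<^sup>2 \<partial>lborel)"
    by (intro Bochner_Integration.integral_cong refl, subst lap_x_dilation[OF hess])
      (simp add: parabolic_scale_dilation[OF r] u_powr dil add_divide_distrib)
  also have "\<dots> = (\<integral>w. ?F (?T w) / r\<^sup>2 \<partial>density (distr lborel borel ?S) (\<lambda>_. ennreal C))"
    using C(2) by (rule arg_cong)
  also have "\<dots> = (\<integral>w. C * (?F (?T w) / r\<^sup>2) \<partial>distr lborel borel ?S)"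
    using C(1) by (subst integral_density) auto
  also have "\<dots> = (\<integral>y. C * (?F (?T (?S y)) / r\<^sup>2) \<partial>lborel)"
    by (subst integral_distr) auto
  also have "\<dots> = (\<integral>y. C / r\<^sup>2 * ?F y \<partial>lborel)"
    by (intro Bochner_Integration.integral_cong refl) (simp add: parabolic_dilation_scale[OF r])
  also have "\<dots> = C / r\<^sup>2 * (\<integral>y. ?F y \<partial>lborel)" by (rule integral_mult_right_zero)
  finally show ?thesis using C(1) r by (simp add: zero_le_mult_iff zero_le_divide_iff)
qed

end

text \<open>Transport of \<open>De_Giorgi\<close> from the unit ball to all cylinders by scaling;
  the fraction \<open>\<nu>\<close> is independent of the cylinder and of the solution. As
  \<open>De_Giorgi\<close> works in Euclidean balls of space-time, two inclusions intervene: the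
  unit ball lies in the unit cylinder, and the ball of radius 1/2 contains the cylinder of radius
  1/4.\<close>

lemma critical_mass_density:
  fixes m q \<epsilon> :: real
  assumes m: "1 < m" and \<epsilon>: "0 < \<epsilon>" "\<epsilon> < q"
  shows "\<exists>\<nu>>0. \<forall>U s\<^sub>1 s\<^sub>2 w G z r. local_supersolution m (U :: 'a::euclidean_space set) s\<^sub>1 s\<^sub>2 w G \<longrightarrow> 0 < r \<longrightarrow>
    Q_cyl z r \<subseteq> U \<times> {s\<^sub>1<..<s\<^sub>2} \<longrightarrow>
    measure lborel {y \<in> Q_cyl z r. w y powr (1 / m) < q} \<le> \<nu> * measure lborel (Q_cyl z r) \<longrightarrow>
    (AE y in lborel. y \<in> Q_cyl z (r / 4) \<longrightarrow> q - \<epsilon> \<le> w y powr (1 / m))"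
proof -
  obtain \<nu>' where \<nu>': "0 < \<nu>'" and DG: "\<forall>u :: 'a \<times> real \<Rightarrow> real. u \<in> borel_measurable borel \<longrightarrow> (\<forall>z. 0 \<le> u z) \<longrightarrow>
    (\<forall>\<kappa> \<phi> D\<phi> H\<phi> K. 0 < \<kappa> \<longrightarrow> has_hess \<phi> D\<phi> H\<phi> \<longrightarrow> (\<forall>z. 0 \<le> \<phi> z) \<longrightarrow> compact K \<longrightarrow> K \<subseteq> ball 0 1 \<longrightarrow>
       (\<forall>z. z \<notin> K \<longrightarrow> \<phi> z = 0) \<longrightarrow>
       0 \<le> (\<integral>z. max 0 (\<kappa> - u z) * (D\<phi> z \<bullet> (0, 1)) + max 0 (\<kappa> powr m - u z powr m) * lap_x H\<phi> z \<partial>lborel)) \<longrightarrow>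
    measure lborel {z \<in> ball 0 1. u z < q} \<le> \<nu>' \<longrightarrow>
    (AE z in lborel. z \<in> ball 0 (1/2) \<longrightarrow> q - \<epsilon> \<le> u z)"
    using De_Giorgi[OF m \<epsilon>, where 'a = 'a] by (elim exE conjE) (rule that)
  define B where "B = ball (0::'a) 1 \<times> {- 1<..<1 :: real}"
  have oB: "open B" unfolding B_def by (intro open_Times) auto
  then have B[measurable]: "B \<in> sets borel" by (rule borel_open)
  have "(0, 0) \<in> B" by (simp add: B_def)
  then have B_pos: "0 < measure lborel B" "emeasure lborel B < \<infinity>"
  proof -
    show fin: "emeasure lborel B < \<infinity>"
      unfolding B_def by (intro emeasure_bounded_finite bounded_Times) auto
    obtain e where e: "0 < e" "ball (0, 0) e \<subseteq> B" using oB \<open>(0, 0) \<in> B\<close> open_contains_ball by blast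
    have "0 < measure lborel (ball (0 :: 'a, 0 :: real) e)" using content_ball_pos[OF e(1)] by simp
    also have "\<dots> \<le> measure lborel B"
      by (rule measure_mono_fmeasurable[OF e(2)]) (use fin in \<open>auto simp: fmeasurable_def\<close>)
    finally show "0 < measure lborel B" .
  qed
  show ?thesis
  proof (intro exI conjI allI impI)
    \<comment> \<open>The threshold of \<open>De_Giorgi\<close> is an absolute measure; dividing by
      the measure of the unit cylinder \<open>B\<close> turns it into a fraction.\<close>
    show "0 < \<nu>' / measure lborel B" using \<nu>' B_pos by simp
    fix U :: "'a set" and s\<^sub>1 s\<^sub>2 r :: real and w G z
    assume "local_supersolution m U s\<^sub>1 s\<^sub>2 w G" and r: "0 < r" and Q: "Q_cyl z r \<subseteq> U \<times> {s\<^sub>1<..<s\<^sub>2}"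
      and small: "measure lborel {y \<in> Q_cyl z r. w y powr (1 / m) < q} \<le> \<nu>' / measure lborel B * measure lborel (Q_cyl z r)"
    then interpret local_supersolution m U s\<^sub>1 s\<^sub>2 w G by simp
    let ?S = "parabolic_scale z r"
    obtain C where C: "0 < C" "lborel = density (distr lborel borel ?S) (\<lambda>_. ennreal C)"
      by (rule lborel_parabolic_scale[OF r, of z])
    have em: "measure lborel A = C * measure lborel (?S -` A)" if A[measurable]: "A \<in> sets borel" for A
    proof -
      have "emeasure lborel A = emeasure (density (distr lborel borel ?S) (\<lambda>_. ennreal C)) A"
        using C(2) by (rule arg_cong)
      also have "\<dots> = ennreal C * emeasure lborel (?S -` A)"
        by (simp add: emeasure_density nn_integral_cmult_indicator emeasure_distr)
      finally show ?thesis using C(1) by (simp add: measure_def enn2real_mult)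
    qed
    have SQ: "?S -` Q_cyl z r = B"
    proof (rule set_eqI)
      fix y show "y \<in> ?S -` Q_cyl z r \<longleftrightarrow> y \<in> B"
        using parabolic_scale_in_Q_cyl_iff[OF r, of 1 z y] by (simp add: B_def mem_Times_iff abs_less_iff) auto
    qed
    have "AE y in lborel. y \<in> ball 0 (1/2) \<longrightarrow> q - \<epsilon> \<le> u (?S y)"
    proof (rule DG[rule_format])
      show "(\<lambda>y. u (?S y)) \<in> borel_measurable borel" by measurable
      show "0 \<le> u (?S y)" for y by (rule u_nonneg)
      show "0 \<le> (\<integral>y. max 0 (\<kappa> - u (?S y)) * (D\<phi> y \<bullet> (0, 1)) + max 0 (\<kappa> powr m - u (?S y) powr m) * lap_x H y \<partial>lborel)"
        if "0 < \<kappa>" "has_hess \<phi> D\<phi> H" "\<And>z. 0 \<le> \<phi> z" "compact K" "K \<subseteq> ball 0 1" "\<And>z. z \<notin> K \<Longrightarrow> \<phi> z = 0" for \<kappa> \<phi> D\<phi> H K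
        by (rule rescaled_very_weak[OF r Q that])
      have [measurable]: "{y \<in> Q_cyl z r. u y < q} \<in> sets borel" by measurable
      have "norm (fst y) < 1 \<and> \<bar>snd y\<bar> < 1" if "norm y < 1" for y :: "'a \<times> real"
        using norm_fst_le[of "fst y" "snd y"] norm_snd_le[of "snd y" "fst y"] that by auto
      then have sub: "{y \<in> ball 0 1. u (?S y) < q} \<subseteq> ?S -` {y \<in> Q_cyl z r. u y < q}"
        using parabolic_scale_in_Q_cyl_iff[OF r, of 1 z] by auto
      have "?S -` {y \<in> Q_cyl z r. u y < q} \<inter> space borel \<in> sets borel"
        by (rule measurable_sets[OF parabolic_scale_measurable]) measurable
      moreover have "emeasure lborel (?S -` {y \<in> Q_cyl z r. u y < q}) \<le> emeasure lborel B"
        using SQ by (intro emeasure_mono) auto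
      ultimately have fm: "?S -` {y \<in> Q_cyl z r. u y < q} \<in> fmeasurable lborel"
        using B_pos(2) by (auto simp: fmeasurable_def)
      have "C * measure lborel {y \<in> ball 0 1. u (?S y) < q} \<le> C * measure lborel (?S -` {y \<in> Q_cyl z r. u y < q})"
        using C(1) by (intro mult_left_mono measure_mono_fmeasurable[OF sub _ fm]) auto
      also have "\<dots> = measure lborel {y \<in> Q_cyl z r. u y < q}" by (rule em[symmetric]) measurable
      also have "\<dots> \<le> \<nu>' / measure lborel B * measure lborel (Q_cyl z r)" using small by (simp add: u_def)
      also have "\<dots> = C * \<nu>'" unfolding em[OF Q_cyl_borel] SQ using B_pos(1) by simp
      finally show "measure lborel {y \<in> ball 0 1. u (?S y) < q} \<le> \<nu>'" using C(1) by simp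
    qed
    then have "AE y in lborel. ?S y \<in> Q_cyl z (r / 4) \<longrightarrow> q - \<epsilon> \<le> u (?S y)"
    proof eventually_elim
      case (elim y)
      show ?case
      proof
        assume "?S y \<in> Q_cyl z (r / 4)"
        then have y: "norm (fst y) < 1/4" "\<bar>snd y\<bar> < 1/16"
          using parabolic_scale_in_Q_cyl_iff[OF r, of "1/4" z y] by (auto simp: power2_eq_square)
        \<comment> \<open>The radius is quartered since \<open>1/4 + 1/16 < 1/2\<close>.\<close>
        have "norm y \<le> norm (fst y) + \<bar>snd y\<bar>" using norm_Pair_le[of "fst y" "snd y"] by simp
        then have "norm y < 1/2" using y by linarith
        then show "q - \<epsilon> \<le> u (?S y)" using elim by simp
      qed
    qed
    then have "AE y in distr lborel borel ?S. y \<in> Q_cyl z (r / 4) \<longrightarrow> q - \<epsilon> \<le> u y"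
      by (subst AE_distr_iff) measurable
    then have "AE y in density (distr lborel borel ?S) (\<lambda>_. ennreal C). y \<in> Q_cyl z (r / 4) \<longrightarrow> q - \<epsilon> \<le> u y"
      by (subst AE_density) auto
    then show "AE y in lborel. y \<in> Q_cyl z (r / 4) \<longrightarrow> q - \<epsilon> \<le> w y powr (1 / m)"
      unfolding C(2)[symmetric] u_def .
  qed
qed

section \<open>The lower semicontinuous representative\<close>

lemma Q_cyl_mono: "0 \<le> r \<Longrightarrow> r \<le> R \<Longrightarrow> Q_cyl z r \<subseteq> Q_cyl z R"
  using power_mono[of r R 2] unfolding subset_iff Q_cyl_iff by (meson less_le_trans)

lemma Q_cyl_subset_double:
  assumes "y \<in> Q_cyl z R" "0 < R" "0 < h" "h \<le> R"
  shows "Q_cyl y h \<subseteq> Q_cyl z (2 * R)"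
proof
  fix x assume "x \<in> Q_cyl y h"
  then have x: "dist (fst x) (fst y) < R" "\<bar>snd x - snd y\<bar> < R\<^sup>2"
    using Q_cyl_mono[of h R y] assms by (auto simp: Q_cyl_iff)
  have y: "dist (fst y) (fst z) < R" "\<bar>snd y - snd z\<bar> < R\<^sup>2" using assms(1) by (auto simp: Q_cyl_iff)
  have "dist (fst x) (fst z) < 2 * R" using x(1) y(1) dist_triangle[of "fst x" "fst z" "fst y"] by linarith
  moreover have "\<bar>snd x - snd z\<bar> < 4 * R\<^sup>2"
    using x(2) y(2) zero_le_power2[of R] by linarith
  ultimately show "x \<in> Q_cyl z (2 * R)" by (simp add: Q_cyl_iff power_mult_distrib)
qed

lemma Q_cyl_in_open:
  fixes z :: "'a::euclidean_space \<times> real"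
  assumes "open S" "z \<in> S"
  obtains R where "0 < R" "closure (Q_cyl z R) \<subseteq> S"
proof -
  obtain e where e: "0 < e" "cball z e \<subseteq> S" using assms open_contains_cball by blast
  define R where "R = min 1 (e / 2)"
  have R: "0 < R" "R \<le> 1" "2 * R \<le> e" using e(1) by (auto simp: R_def)
  have R2: "R\<^sup>2 \<le> R" using R by (simp add: power2_eq_square mult_left_le)
  have "w \<in> cball z e" if "w \<in> Q_cyl z R" for w
  proof -
    have "norm (w - z) \<le> norm (fst (w - z)) + \<bar>snd (w - z)\<bar>"
      using norm_Pair_le[of "fst (w - z)" "snd (w - z)"] by (simp only: prod.collapse real_norm_def)
    then show ?thesis using that R R2 by (simp add: Q_cyl_iff dist_norm norm_minus_commute)
  qed
  then have "closure (Q_cyl z R) \<subseteq> cball z e" by (intro closure_minimal) auto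
  then show thesis using e(2) R(1) by (intro that) auto
qed

lemma Q_cyl_measure_pos: "0 < r \<Longrightarrow> 0 < measure lborel (Q_cyl z r)"
proof -
  assume r: "0 < r"
  obtain e where e: "0 < e" "ball z e \<subseteq> Q_cyl z r"
    using open_Q_cyl[of z r] centre_in_Q_cyl[OF r] open_contains_ball by blast
  have "0 < measure lborel (ball z e)" using content_ball_pos[OF e(1)] by simp
  also have "\<dots> \<le> measure lborel (Q_cyl z r)"
    by (rule measure_mono_fmeasurable[OF e(2)]) (use Q_cyl_finite[of z r] in \<open>auto simp: fmeasurable_def\<close>)
  finally show ?thesis .
qed

lemma nn_integral_translation:
  fixes g :: "'b::euclidean_space \<Rightarrow> ennreal"
  assumes [measurable]: "g \<in> borel_measurable borel"
  shows "(\<integral>\<^sup>+x. g (y + x) \<partial>lborel) = (\<integral>\<^sup>+x. g x \<partial>lborel)"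
proof -
  have "(\<integral>\<^sup>+x. g x \<partial>lborel) = (\<integral>\<^sup>+x. g x \<partial>distr lborel borel ((+) y))" by (simp only: lborel_distr_plus)
  also have "\<dots> = (\<integral>\<^sup>+x. g (y + x) \<partial>lborel)" by (rule nn_integral_distr) auto
  finally show ?thesis by simp
qed

lemma indicator_Q_cyl_shift: "indicator (Q_cyl 0 h) x = indicator (Q_cyl y h) (y + x)"
  by (auto simp: indicator_def Q_cyl_iff dist_norm)

lemma emeasure_Q_cyl:
  fixes y :: "'a::euclidean_space \<times> real"
  shows "emeasure lborel (Q_cyl y h) = emeasure lborel (Q_cyl (0 :: 'a \<times> real) h)"
proof -
  have "emeasure lborel (Q_cyl (0 :: 'a \<times> real) h) = (\<integral>\<^sup>+x. indicator (Q_cyl y h) (y + x) \<partial>lborel)"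
    by (simp add: indicator_Q_cyl_shift[symmetric])
  also have "\<dots> = emeasure lborel (Q_cyl y h)" by (subst nn_integral_translation) auto
  finally show ?thesis by simp
qed

text \<open>Integrating the density of \<open>A\<close> in \<open>Q_cyl y h\<close> over \<open>y \<notin> A\<close> gives, by Fubini, an average of
  \<open>|(A - x) \<setminus> A|\<close> over small \<open>x\<close>. This replaces a density theorem for parabolic cylinders.\<close>

lemma parabolic_density:
  fixes A :: "('a::euclidean_space \<times> real) set"
  assumes A[measurable]: "A \<in> sets borel" and fin: "emeasure lborel A < \<infinity>" and \<nu>: "0 < \<nu>" and R: "0 < R"
  shows "AE y in lborel. y \<notin> A \<longrightarrow> (\<exists>h. 0 < h \<and> h < R \<and> measure lborel (A \<inter> Q_cyl y h) \<le> \<nu> * measure lborel (Q_cyl y h))"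
proof -
  \<comment> \<open>The measure of \<open>A \<inter> Q_cyl y h\<close>, written as an integral over
    the fixed cylinder at the origin so that the order of integration can be exchanged.\<close>
  define F where "F h y = (\<integral>\<^sup>+x. indicator A (y + x) * indicator (Q_cyl 0 h) x \<partial>lborel)" for h and y :: "'a \<times> real"
  define B where "B h = {y. y \<notin> A \<and> ennreal \<nu> * emeasure lborel (Q_cyl (0 :: 'a \<times> real) h) < F h y}" for h
  have F: "F h y = emeasure lborel (A \<inter> Q_cyl y h)" for h y
  proof -
    have "F h y = (\<integral>\<^sup>+x. indicator (A \<inter> Q_cyl y h) (y + x) \<partial>lborel)"
      unfolding F_def indicator_Q_cyl_shift[of h _ y] by (simp add: indicator_inter_arith)
    also have "\<dots> = emeasure lborel (A \<inter> Q_cyl y h)" by (subst nn_integral_translation) auto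
    finally show ?thesis .
  qed
  have F_meas[measurable]: "F h \<in> borel_measurable borel" for h
    unfolding F_def[abs_def] by measurable
  have [measurable]: "B h \<in> sets borel" for h unfolding B_def by measurable
  have "\<exists>h. 0 < h \<and> h < R \<and> emeasure lborel (B h) \<le> ennreal (1 / Suc n)" for n
  proof -
    \<comment> \<open>By Chebyshev, \<open>\<nu> * \<mu>\<close> times the measure of the bad set
      \<open>B h\<close> is at most \<open>e * \<mu>\<close>, so this choice leaves
      \<open>1 / Suc n\<close>. The intersection of the bad sets over all \<open>n\<close> is then
      null, and off it at least one good \<open>h\<close> exists.\<close>
    define e where "e = \<nu> / Suc n"
    have e: "0 < e" using \<nu> by (simp add: e_def)
    obtain d where d: "0 < d" "\<And>a. norm a < d \<Longrightarrow> (\<integral>z. \<bar>indicator A (z + a) - indicator A z\<bar> \<partial>lborel) \<le> e"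
      using indicator_translation_small[OF A fin e] by blast
    obtain h0 where h0: "0 < h0" "closure (Q_cyl 0 h0) \<subseteq> ball (0 :: 'a \<times> real) d"
      using Q_cyl_in_open[of "ball (0 :: 'a \<times> real) d" 0] d(1) by auto
    define h where "h = min h0 (R / 2)"
    have h: "0 < h" "h < R" "h \<le> h0" using h0 R by (auto simp: h_def)
    have hd: "norm x < d" if "x \<in> Q_cyl 0 h" for x :: "'a \<times> real"
    proof -
      have "x \<in> Q_cyl 0 h0" using that Q_cyl_mono[of h h0 "0 :: 'a \<times> real"] h by auto
      then have "x \<in> ball 0 d" using h0(2) closure_subset by blast
      then show ?thesis by simp
    qed
    define \<mu> where "\<mu> = emeasure lborel (Q_cyl (0 :: 'a \<times> real) h)"
    have \<mu>: "\<mu> \<noteq> top" "\<mu> \<noteq> 0"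
      using Q_cyl_finite[of "0 :: 'a \<times> real" h] Q_cyl_measure_pos[OF h(1), of "0 :: 'a \<times> real"]
      by (auto simp: \<mu>_def measure_def)
    have inner: "(\<integral>\<^sup>+y. indicator (- A) y * (indicator A (y + x) * indicator (Q_cyl 0 h) x) \<partial>lborel) \<le> ennreal e * indicator (Q_cyl 0 h) x"
      for x
    proof (cases "x \<in> Q_cyl 0 h")
      case True
      have int: "integrable lborel (\<lambda>y. \<bar>indicator A (y + x) - indicat_real A y\<bar>)"
      proof (intro integrable_abs Bochner_Integration.integrable_diff)
        show "integrable lborel (indicat_real A)" using fin by simp
        then show "integrable lborel (\<lambda>y. indicat_real A (y + x))" by (subst lborel_translation(2)) auto
      qed
      have "(\<integral>\<^sup>+y. indicator (- A) y * (indicator A (y + x) * indicator (Q_cyl 0 h) x) \<partial>lborel)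
          \<le> (\<integral>\<^sup>+y. ennreal \<bar>indicator A (y + x) - indicat_real A y\<bar> \<partial>lborel)"
        by (intro nn_integral_mono) (auto simp: indicator_def)
      also have "\<dots> = ennreal (\<integral>y. \<bar>indicator A (y + x) - indicat_real A y\<bar> \<partial>lborel)"
        by (rule nn_integral_eq_integral[OF int]) simp
      also have "\<dots> \<le> ennreal e" by (rule ennreal_leI[OF d(2)[OF hd[OF True]]])
      finally show ?thesis using True by simp
    qed simp
    have "ennreal \<nu> * \<mu> * emeasure lborel (B h) = (\<integral>\<^sup>+y. ennreal \<nu> * \<mu> * indicator (B h) y \<partial>lborel)"
      by (simp add: nn_integral_cmult_indicator)
    also have "\<dots> \<le> (\<integral>\<^sup>+y. indicator (- A) y * F h y \<partial>lborel)"
      by (intro nn_integral_mono) (auto simp: B_def \<mu>_def indicator_def)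
    also have "\<dots> = (\<integral>\<^sup>+y. (\<integral>\<^sup>+x. indicator (- A) y * (indicator A (y + x) * indicator (Q_cyl 0 h) x) \<partial>lborel) \<partial>lborel)"
      unfolding F_def by (intro nn_integral_cong nn_integral_cmult[symmetric]) measurable
    also have "\<dots> = (\<integral>\<^sup>+x. (\<integral>\<^sup>+y. indicator (- A) y * (indicator A (y + x) * indicator (Q_cyl 0 h) x) \<partial>lborel) \<partial>lborel)"
      by (rule lborel_pair.Fubini') measurable
    also have "\<dots> \<le> (\<integral>\<^sup>+x. ennreal e * indicator (Q_cyl (0 :: 'a \<times> real) h) x \<partial>lborel)" by (intro nn_integral_mono inner)
    also have "\<dots> = ennreal e * \<mu>" by (simp add: nn_integral_cmult_indicator \<mu>_def)
    also have "\<dots> = ennreal \<nu> * \<mu> * ennreal (1 / Suc n)"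
      using \<nu> by (simp add: e_def ennreal_mult[symmetric] mult_ac flip: ennreal_mult')
    finally have "emeasure lborel (B h) \<le> ennreal (1 / Suc n)"
      using \<mu> \<nu> by (subst (asm) ennreal_mult_le_mult_iff) (auto simp: ennreal_mult_eq_top_iff)
    then show ?thesis using h by blast
  qed
  then obtain h where h: "\<And>n. 0 < h n" "\<And>n. h n < R" "\<And>n. emeasure lborel (B (h n)) \<le> ennreal (1 / Suc n)" by metis
  have "(\<Inter>n. B (h n)) \<in> null_sets lborel"
  proof (rule null_setsI)
    have "emeasure lborel (\<Inter>n. B (h n)) \<le> ennreal (1 / Suc n)" for n
      by (rule order.trans[OF emeasure_mono h(3)]) auto
    moreover have "(\<lambda>n. ennreal (1 / Suc n)) \<longlonglongrightarrow> ennreal 0"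
      by (intro tendsto_ennrealI LIMSEQ_Suc[OF lim_1_over_n])
    ultimately have "emeasure lborel (\<Inter>n. B (h n)) \<le> ennreal 0"
      by (intro LIMSEQ_le_const) auto
    then show "emeasure lborel (\<Inter>n. B (h n)) = 0" by simp
  qed auto
  from AE_not_in[OF this] show ?thesis
  proof eventually_elim
    case (elim y)
    show ?case
    proof
      assume "y \<notin> A"
      then obtain n where "\<not> ennreal \<nu> * emeasure lborel (Q_cyl (0 :: 'a \<times> real) (h n)) < F (h n) y"
        using elim by (auto simp: B_def)
      then have le: "emeasure lborel (A \<inter> Q_cyl y (h n)) \<le> ennreal \<nu> * emeasure lborel (Q_cyl y (h n))"
        by (simp add: F emeasure_Q_cyl[of y])
      have "measure lborel (A \<inter> Q_cyl y (h n)) \<le> \<nu> * measure lborel (Q_cyl y (h n))"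
        unfolding measure_def using enn2real_mono[OF le] Q_cyl_finite[of y "h n"] \<nu>
        by (simp add: enn2real_mult ennreal_mult_less_top)
      then show "\<exists>h. 0 < h \<and> h < R \<and> measure lborel (A \<inter> Q_cyl y h) \<le> \<nu> * measure lborel (Q_cyl y h)"
        using h by blast
    qed
  qed
qed

section \<open>Essential infima and the lower semicontinuous envelope\<close>

lemma ess_inf_ge:
  assumes "S \<in> sets borel" "AE w in lborel. w \<in> S \<longrightarrow> c \<le> u w"
  shows "c \<le> ess_inf S u"
  unfolding ess_inf_def using assms by (intro Sup_upper) (simp add: AE_lebesgue_on_iff)

lemma ess_inf_AE:
  assumes S: "S \<in> sets borel"
  shows "AE w in lborel. w \<in> S \<longrightarrow> ess_inf S u \<le> u w"
proof -
  let ?A = "{c. AE w in lborel. w \<in> S \<longrightarrow> c \<le> u w}"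
  have eq: "ess_inf S u = Sup ?A" by (simp add: ess_inf_def AE_lebesgue_on_iff[OF S])
  have "0 \<in> ?A" by simp
  then obtain f :: "nat \<Rightarrow> ennreal" where f: "range f \<subseteq> ?A" "Sup ?A = (SUP i. f i)"
    using ennreal_Sup_countable_SUP[of ?A] by blast
  have "AE w in lborel. \<forall>i. w \<in> S \<longrightarrow> f i \<le> u w" unfolding AE_all_countable using f(1) by blast
  then show ?thesis by eventually_elim (auto simp: eq f(2) intro: SUP_least)
qed

lemma ess_inf_antimono:
  assumes "S \<subseteq> T" "S \<in> sets borel" "T \<in> sets borel"
  shows "ess_inf T u \<le> ess_inf S u"
  by (rule ess_inf_ge[OF assms(2)], use ess_inf_AE[OF assms(3), of u] in eventually_elim) (use assms(1) in auto)

text \<open>The essential infimum grows as \<open>r\<close> shrinks, so this supremum is the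
  essential limit inferior. Written as a supremum it is lower semicontinuous for every
  \<open>u\<close>; the equation enters only in showing that it is not smaller than
  \<open>u\<close>.\<close>

definition lsc_envelope :: "('a::euclidean_space \<times> real \<Rightarrow> ennreal) \<Rightarrow> 'a \<times> real \<Rightarrow> ennreal" where
  "lsc_envelope u z = (SUP r\<in>{0<..}. ess_inf (Q_cyl z r) u)"

lemma ess_inf_le_lsc_envelope: "0 < r \<Longrightarrow> ess_inf (Q_cyl z r) u \<le> lsc_envelope u z"
  unfolding lsc_envelope_def by (rule SUP_upper) simp

lemma lower_semicontinuous_lsc_envelope: "lower_semicontinuous_on S (lsc_envelope u)"
  unfolding lower_semicontinuous_on_def
proof (intro ballI allI impI)
  fix z c assume "c < lsc_envelope u z"
  then obtain r where r: "0 < r" "c < ess_inf (Q_cyl z r) u" unfolding lsc_envelope_def less_SUP_iff by auto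
  have "c < lsc_envelope u w" if w: "w \<in> Q_cyl z r" for w
  proof -
    obtain R where R: "0 < R" "closure (Q_cyl w R) \<subseteq> Q_cyl z r" by (rule Q_cyl_in_open[OF open_Q_cyl w])
    have "ess_inf (Q_cyl z r) u \<le> ess_inf (Q_cyl w R) u"
      by (rule ess_inf_antimono) (use R(2) closure_subset in auto)
    then show ?thesis using r(2) ess_inf_le_lsc_envelope[OF R(1), of w u] by auto
  qed
  then show "\<forall>\<^sub>F w in at z within S. c < lsc_envelope u w"
    unfolding eventually_at_topological using open_Q_cyl[of z r] centre_in_Q_cyl[OF r(1), of z] by blast
qed

text \<open>A null set cannot be discarded for each of uncountably many cylinders. A countable basis
  suffices: every cylinder around \<open>y\<close> contains a basic open set around
  \<open>y\<close>, whose essential infimum is at least as large.\<close>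

lemma lsc_envelope_le_AE: "AE y in lborel. lsc_envelope u y \<le> u y"
proof -
  obtain \<B> :: "('a \<times> real) set set" where \<B>: "countable \<B>" "topological_basis \<B>"
    using ex_countable_basis by blast
  have "AE y in lborel. \<forall>B\<in>\<B>. y \<in> B \<longrightarrow> ess_inf B u \<le> u y"
    using \<B>(1) by (subst AE_ball_countable) (auto intro!: ess_inf_AE borel_open topological_basis_open[OF \<B>(2)] simp del: sets_borel_eq_count_space)
  then show ?thesis
  proof eventually_elim
    case (elim y)
    show ?case unfolding lsc_envelope_def
    proof (rule SUP_least)
      fix r :: real assume "r \<in> {0<..}"
      then have "y \<in> Q_cyl y r" by (simp add: centre_in_Q_cyl)
      from topological_basisE[OF \<B>(2) open_Q_cyl this]
      obtain B where B: "B \<in> \<B>" "y \<in> B" "B \<subseteq> Q_cyl y r" .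
      have "ess_inf (Q_cyl y r) u \<le> ess_inf B u"
        by (rule ess_inf_antimono[OF B(3)]) (auto intro: borel_open topological_basis_open[OF \<B>(2) B(1)])
      then show "ess_inf (Q_cyl y r) u \<le> u y" using elim B by force
    qed
  qed
qed

section \<open>Comparison of a supersolution with its envelope\<close>

context local_supersolution
begin

text \<open>Almost every point outside \<open>{u < q}\<close> has a small cylinder in which that set
  has density at most \<open>\<nu>\<close>; then \<open>critical_mass_density\<close> makes the
  essential infimum on the quarter cylinder at least \<open>q - \<epsilon>\<close>. One scale is
  enough, the envelope being a supremum over scales. Rational pairs \<open>q\<close>,
  \<open>\<epsilon>\<close> exhaust all values below \<open>u y\<close> while keeping the null sets
  countable in number.\<close>

lemma le_lsc_envelope_AE:
  fixes U' :: "'a \<times> real \<Rightarrow> ennreal"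
  assumes R: "0 < R" and Q: "Q_cyl z (2 * R) \<subseteq> D"
    and U': "AE y in lborel. y \<in> D \<longrightarrow> U' y = ennreal (u y)"
  shows "AE y in lborel. y \<in> Q_cyl z R \<longrightarrow> ennreal (u y) \<le> lsc_envelope U' y"
proof -
  have claim: "AE y in lborel. y \<in> Q_cyl z R \<longrightarrow> q \<le> u y \<longrightarrow> ennreal (q - \<epsilon>) \<le> lsc_envelope U' y"
    if \<epsilon>: "0 < \<epsilon>" "\<epsilon> < q" for q \<epsilon>
  proof -
    from critical_mass_density[OF m \<epsilon>, where 'a = 'a] obtain \<nu> where \<nu>: "0 < \<nu>"
      "\<forall>U s\<^sub>1 s\<^sub>2 w G z r. local_supersolution m (U :: 'a set) s\<^sub>1 s\<^sub>2 w G \<longrightarrow> 0 < r \<longrightarrow> Q_cyl z r \<subseteq> U \<times> {s\<^sub>1<..<s\<^sub>2} \<longrightarrow>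
        measure lborel {y \<in> Q_cyl z r. w y powr (1 / m) < q} \<le> \<nu> * measure lborel (Q_cyl z r) \<longrightarrow>
        (AE y in lborel. y \<in> Q_cyl z (r / 4) \<longrightarrow> q - \<epsilon> \<le> w y powr (1 / m))"
      by (elim exE conjE) (rule that)
    define A where "A = {y \<in> Q_cyl z (2 * R). u y < q}"
    have A: "A \<in> sets borel" unfolding A_def by measurable
    have "emeasure lborel A \<le> emeasure lborel (Q_cyl z (2 * R))" by (rule emeasure_mono) (auto simp: A_def)
    then have "emeasure lborel A < \<infinity>" using Q_cyl_finite[of z "2 * R"] by (rule le_less_trans)
    from parabolic_density[OF A this \<nu>(1) R] show ?thesis
    proof eventually_elim
      case (elim y)
      show ?case
      proof (intro impI)
        assume y: "y \<in> Q_cyl z R" "q \<le> u y"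
        then have "y \<notin> A" by (simp add: A_def)
        then obtain h where h: "0 < h" "h < R" "measure lborel (A \<inter> Q_cyl y h) \<le> \<nu> * measure lborel (Q_cyl y h)"
          using elim by blast
        have sub: "Q_cyl y h \<subseteq> Q_cyl z (2 * R)" using Q_cyl_subset_double[OF y(1) R h(1)] h(2) by simp
        then have eq: "{x \<in> Q_cyl y h. w x powr (1 / m) < q} = A \<inter> Q_cyl y h" by (auto simp: A_def u_def)
        have "AE x in lborel. x \<in> Q_cyl y (h / 4) \<longrightarrow> q - \<epsilon> \<le> w x powr (1 / m)"
          by (rule \<nu>(2)[rule_format, OF local_supersolution_axioms h(1)]) (use sub Q h(3) eq in auto)
        with U' have "AE x in lborel. x \<in> Q_cyl y (h / 4) \<longrightarrow> ennreal (q - \<epsilon>) \<le> U' x"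
        proof eventually_elim
          case (elim x)
          show ?case
          proof
            assume x: "x \<in> Q_cyl y (h / 4)"
            then have "x \<in> D" using Q_cyl_mono[of "h / 4" h y] h(1) sub Q by auto
            then show "ennreal (q - \<epsilon>) \<le> U' x" using elim x by (simp add: u_def ennreal_leI)
          qed
        qed
        then have "ennreal (q - \<epsilon>) \<le> ess_inf (Q_cyl y (h / 4)) U'" by (rule ess_inf_ge[OF Q_cyl_borel])
        also have "\<dots> \<le> lsc_envelope U' y" using h(1) by (intro ess_inf_le_lsc_envelope) simp
        finally show "ennreal (q - \<epsilon>) \<le> lsc_envelope U' y" .
      qed
    qed
  qed
  have "AE y in lborel. \<forall>q\<in>\<rat>. \<forall>\<epsilon>\<in>\<rat>. 0 < \<epsilon> \<and> \<epsilon> < q \<longrightarrow> y \<in> Q_cyl z R \<longrightarrow> q \<le> u y \<longrightarrow> ennreal (q - \<epsilon>) \<le> lsc_envelope U' y"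
    by (simp only: AE_ball_countable[OF countable_rat]) (use claim in \<open>auto intro!: AE_I2 AE_impI\<close>)
  then show ?thesis
  proof eventually_elim
    case (elim y)
    show ?case
    proof (rule impI, rule ccontr)
      assume y: "y \<in> Q_cyl z R" and "\<not> ennreal (u y) \<le> lsc_envelope U' y"
      then have lt: "lsc_envelope U' y < ennreal (u y)" by simp
      obtain v where v: "0 \<le> v" "lsc_envelope U' y = ennreal v"
        using lt by (cases "lsc_envelope U' y") auto
      have vu: "v < u y" using lt v by (simp add: ennreal_less_iff)
      obtain q where q: "q \<in> \<rat>" "v < q" "q < u y" using Rats_dense_in_real[OF vu] by blast
      obtain \<epsilon> where \<epsilon>: "\<epsilon> \<in> \<rat>" "0 < \<epsilon>" "\<epsilon> < q - v" using Rats_dense_in_real[of 0 "q - v"] q(2) by auto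
      have "\<epsilon> < q" using \<epsilon>(3) v(1) by simp
      then have "ennreal (q - \<epsilon>) \<le> ennreal v"
        using elim q \<epsilon> y unfolding v(2)[symmetric] by (meson less_imp_le)
      then show False using \<epsilon>(3) v(1) by (simp add: ennreal_le_iff)
    qed
  qed
qed

end

lemma weak_supersolution_on_cylinder:
  fixes \<Omega> :: "'a::euclidean_space set"
  assumes m: "1 < m" and \<Omega>: "open \<Omega>" and super: "weak_supersolution m \<Omega> t\<^sub>1 t\<^sub>2 u"
    and R: "0 < R" and cl: "closure (Q_cyl z R) \<subseteq> \<Omega> \<times> {t\<^sub>1<..<t\<^sub>2}"
  obtains w G where "local_supersolution m (ball (fst z) R) (snd z - R\<^sup>2) (snd z + R\<^sup>2) w G"
    "AE y in lborel. y \<in> Q_cyl z R \<longrightarrow> u y = ennreal (w y powr (1 / m))"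
proof -
  have sub: "Q_cyl z R \<subseteq> \<Omega> \<times> {t\<^sub>1<..<t\<^sub>2}" using cl closure_subset by blast
  have "ball (fst z) R \<subseteq> \<Omega>"
  proof
    fix x assume "x \<in> ball (fst z) R"
    then have "(x, snd z) \<in> Q_cyl z R" using R by (simp add: Q_cyl_iff dist_commute)
    then show "x \<in> \<Omega>" using sub by auto
  qed
  then show thesis
  proof (rule weak_supersolution_localize[OF m \<Omega> super open_ball _ bounded_ball])
    show "snd z - R\<^sup>2 < snd z + R\<^sup>2" using R by simp
    show "compact (closure (ball (fst z) R \<times> {snd z - R\<^sup>2<..<snd z + R\<^sup>2}))"
      unfolding Q_cyl_eq[symmetric] compact_closure by (rule bounded_Q_cyl)
    show "closure (ball (fst z) R \<times> {snd z - R\<^sup>2<..<snd z + R\<^sup>2}) \<subseteq> \<Omega> \<times> {t\<^sub>1<..<t\<^sub>2}"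
      using cl unfolding Q_cyl_eq .
    fix w G assume "local_supersolution m (ball (fst z) R) (snd z - R\<^sup>2) (snd z + R\<^sup>2) w G"
      "AE y in lborel. y \<in> ball (fst z) R \<times> {snd z - R\<^sup>2<..<snd z + R\<^sup>2} \<longrightarrow> u y = ennreal (w y powr (1 / m))"
    then show thesis by (rule that[unfolded Q_cyl_eq])
  qed
qed

text \<open>Above: the essential infimum exceeds \<open>u z\<close> by at most the mean oscillation.
  Below: by Chebyshev the mean oscillation controls the fraction of the cylinder where
  \<open>u < q\<close>, and \<open>critical_mass_density\<close> applies. If \<open>u z = 0\<close>
  the lower bound is vacuous.\<close>

lemma tendsto_ess_inf:
  fixes \<Omega> :: "'a::euclidean_space set"
  assumes m: "1 < m" and \<Omega>: "open \<Omega>" and super: "weak_supersolution m \<Omega> t\<^sub>1 t\<^sub>2 u"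
    and z: "z \<in> \<Omega> \<times> {t\<^sub>1<..<t\<^sub>2}" and leb: "lebesgue_point u z" and fin: "u z < \<infinity>"
  shows "((\<lambda>r. ess_inf (Q_cyl z r) u) \<longlongrightarrow> u z) (at_right 0)"
proof -
  define J where "J r = (\<integral>\<^sup>+w. ((u z - u w) + (u w - u z)) * indicator (Q_cyl z r) w \<partial>lborel)" for r
  define \<mu> where "\<mu> r = emeasure lborel (Q_cyl z r)" for r
  have \<mu>: "\<mu> r \<noteq> 0" "\<mu> r \<noteq> top" "\<mu> r = ennreal (measure lborel (Q_cyl z r))" if "0 < r" for r
    using Q_cyl_measure_pos[OF that, of z] Q_cyl_finite[of z r] by (auto simp: \<mu>_def measure_def)
  have I: "((\<lambda>r. J r / \<mu> r) \<longlongrightarrow> 0) (at_right 0)"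
    using leb unfolding lebesgue_point_def J_def \<mu>_def
    by (simp add: nn_integral_restrict_space nn_integral_completion)
  \<comment> \<open>Truncated subtraction makes \<open>c - u z\<close> vanish unless
    \<open>c\<close> exceeds \<open>u z\<close>, so both cases are treated at once.\<close>
  have upper: "ess_inf (Q_cyl z r) u \<le> u z + J r / \<mu> r" if r: "0 < r" for r
  proof -
    define c where "c = ess_inf (Q_cyl z r) u"
    have "(c - u z) * \<mu> r = (\<integral>\<^sup>+w. (c - u z) * indicator (Q_cyl z r) w \<partial>lborel)"
      by (simp add: \<mu>_def nn_integral_cmult_indicator)
    also have "\<dots> \<le> J r" unfolding J_def
    proof (rule nn_integral_mono_AE, use ess_inf_AE[OF Q_cyl_borel, of z r u] in eventually_elim)
      fix w assume w: "w \<in> Q_cyl z r \<longrightarrow> ess_inf (Q_cyl z r) u \<le> u w"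
      show "(c - u z) * indicator (Q_cyl z r) w \<le> (u z - u w + (u w - u z)) * indicator (Q_cyl z r) w"
      proof (cases "w \<in> Q_cyl z r")
        case True
        then have "c - u z \<le> u w - u z" using w by (intro ennreal_minus_mono) (auto simp: c_def)
        then show ?thesis using True by (simp add: add_increasing)
      qed simp
    qed
    finally have "(c - u z) * \<mu> r / \<mu> r \<le> J r / \<mu> r" by (rule divide_right_mono_ennreal)
    then have "c - u z \<le> J r / \<mu> r" using \<mu>[OF r] by (simp add: ennreal_mult_divide_eq)
    then show ?thesis by (simp add: c_def ennreal_minus_le_iff)
  qed
  show ?thesis
  proof (rule order_tendstoI)
    fix b assume b: "u z < b"
    have "((\<lambda>r. u z + J r / \<mu> r) \<longlongrightarrow> u z + 0) (at_right 0)" by (intro tendsto_add tendsto_const I)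
    then have "\<forall>\<^sub>F r in at_right 0. u z + J r / \<mu> r < b" using b by (intro order_tendstoD(2)) auto
    with eventually_at_right_less[of 0] show "\<forall>\<^sub>F r in at_right 0. ess_inf (Q_cyl z r) u < b"
      by eventually_elim (use upper le_less_trans in blast)
  next
    fix a assume a: "a < u z"
    define k where "k = enn2real (u z)"
    have k: "u z = ennreal k" using fin by (simp add: k_def)
    obtain a' where a': "0 \<le> a'" "a = ennreal a'" using a fin by (cases a) auto
    have ak: "a' < k" using a a' by (simp add: k ennreal_less_iff)
    \<comment> \<open>Thirds: \<open>k = a' + 3 * \<epsilon>\<close>, so
      \<open>q = k - \<epsilon>\<close> lies below the value at \<open>z\<close>,
      \<open>q - \<epsilon>\<close> still exceeds \<open>a'\<close>, and
      \<open>\<epsilon> < q\<close> because \<open>a' \<ge> 0\<close>.\<close>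
    define \<epsilon> where "\<epsilon> = (k - a') / 3"
    define q where "q = k - \<epsilon>"
    have \<epsilon>: "0 < \<epsilon>" "\<epsilon> < q" "a' < q - \<epsilon>" using ak a'(1) by (auto simp: \<epsilon>_def q_def field_simps)
    from critical_mass_density[OF m \<epsilon>(1,2), where 'a = 'a] obtain \<nu> where \<nu>: "0 < \<nu>"
      "\<forall>U s\<^sub>1 s\<^sub>2 w G z r. local_supersolution m (U :: 'a set) s\<^sub>1 s\<^sub>2 w G \<longrightarrow> 0 < r \<longrightarrow> Q_cyl z r \<subseteq> U \<times> {s\<^sub>1<..<s\<^sub>2} \<longrightarrow>
        measure lborel {y \<in> Q_cyl z r. w y powr (1 / m) < q} \<le> \<nu> * measure lborel (Q_cyl z r) \<longrightarrow>
        (AE y in lborel. y \<in> Q_cyl z (r / 4) \<longrightarrow> q - \<epsilon> \<le> w y powr (1 / m))"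
      by (elim exE conjE) (rule that)
    have "open (\<Omega> \<times> {t\<^sub>1<..<t\<^sub>2})" using \<Omega> by (intro open_Times) auto
    from Q_cyl_in_open[OF this z] obtain R where R: "0 < R" "closure (Q_cyl z R) \<subseteq> \<Omega> \<times> {t\<^sub>1<..<t\<^sub>2}" .
    obtain w G where loc: "local_supersolution m (ball (fst z) R) (snd z - R\<^sup>2) (snd z + R\<^sup>2) w G"
      and uw: "AE y in lborel. y \<in> Q_cyl z R \<longrightarrow> u y = ennreal (w y powr (1 / m))"
      by (rule weak_supersolution_on_cylinder[OF m \<Omega> super R])
    have [measurable]: "w \<in> borel_measurable borel" by (rule local_supersolution.w_meas[OF loc])
    \<comment> \<open>On the sublevel set the oscillation is at least \<open>\<epsilon>\<close>, so
      this rate leaves it at most the fraction \<open>\<nu>\<close> of the cylinder.\<close>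
    have "\<forall>\<^sub>F r in at_right 0. J r / \<mu> r < ennreal (\<nu> * \<epsilon>)"
      using \<nu>(1) \<epsilon>(1) by (intro order_tendstoD(2)[OF I]) simp
    moreover have "\<forall>\<^sub>F r in at_right 0. r \<in> {0<..<R}" by (rule eventually_at_right_real[OF R(1)])
    ultimately have "\<forall>\<^sub>F r in at_right 0. J r / \<mu> r < ennreal (\<nu> * \<epsilon>) \<and> 0 < r \<and> r < R" by eventually_elim simp
    then obtain r where r: "0 < r" "r < R" "J r / \<mu> r < ennreal (\<nu> * \<epsilon>)"
      using eventually_happens'[OF trivial_limit_at_right_real] by blast
    have sub: "Q_cyl z r \<subseteq> Q_cyl z R" using r by (intro Q_cyl_mono) auto
    define A where "A = {y \<in> Q_cyl z r. w y powr (1 / m) < q}"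
    have [measurable]: "A \<in> sets borel" unfolding A_def by measurable
    have "emeasure lborel A \<le> emeasure lborel (Q_cyl z r)" by (rule emeasure_mono) (auto simp: A_def)
    then have Afin: "emeasure lborel A = ennreal (measure lborel A)"
      using Q_cyl_finite[of z r] by (intro emeasure_eq_ennreal_measure) (auto simp: top_unique)
    have "ennreal \<epsilon> * emeasure lborel A = (\<integral>\<^sup>+y. ennreal \<epsilon> * indicator A y \<partial>lborel)"
      by (simp add: nn_integral_cmult_indicator)
    also have "\<dots> \<le> J r" unfolding J_def
    proof (rule nn_integral_mono_AE, use uw in eventually_elim)
      fix y assume y: "y \<in> Q_cyl z R \<longrightarrow> u y = ennreal (w y powr (1 / m))"
      show "ennreal \<epsilon> * indicator A y \<le> (u z - u y + (u y - u z)) * indicator (Q_cyl z r) y"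
      proof (cases "y \<in> A")
        case True
        then have Q: "y \<in> Q_cyl z r" and lt: "w y powr (1 / m) < q" by (auto simp: A_def)
        then have "u y = ennreal (w y powr (1 / m))" using y sub by blast
        then have "u z - u y = ennreal (k - w y powr (1 / m))" by (simp add: k ennreal_minus)
        moreover have "ennreal \<epsilon> \<le> ennreal (k - w y powr (1 / m))" using lt by (intro ennreal_leI) (simp add: q_def)
        ultimately show ?thesis using True Q by (simp add: add_increasing2)
      qed simp
    qed
    also have "J r \<le> ennreal (\<nu> * \<epsilon>) * \<mu> r"
      using r(3) \<mu>[OF r(1)] by (subst (asm) divide_less_ennreal) (auto simp: less_top)
    finally have "ennreal (\<epsilon> * measure lborel A) \<le> ennreal (\<epsilon> * (\<nu> * measure lborel (Q_cyl z r)))"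
      using \<nu>(1) \<epsilon>(1) unfolding Afin \<mu>(3)[OF r(1)] by (simp add: ennreal_mult[symmetric] mult_ac)
    then have "\<epsilon> * measure lborel A \<le> \<epsilon> * (\<nu> * measure lborel (Q_cyl z r))"
      using \<nu>(1) \<epsilon>(1) by (subst (asm) ennreal_le_iff) auto
    then have small: "measure lborel A \<le> \<nu> * measure lborel (Q_cyl z r)" using \<epsilon>(1) by simp
    have "AE y in lborel. y \<in> Q_cyl z (r / 4) \<longrightarrow> q - \<epsilon> \<le> w y powr (1 / m)"
      by (rule \<nu>(2)[rule_format, OF loc r(1)]) (use sub small in \<open>auto simp: Q_cyl_eq[symmetric] A_def\<close>)
    with uw have "AE y in lborel. y \<in> Q_cyl z (r / 4) \<longrightarrow> ennreal (q - \<epsilon>) \<le> u y"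
    proof eventually_elim
      case (elim y)
      show ?case
      proof
        assume y: "y \<in> Q_cyl z (r / 4)"
        then have "y \<in> Q_cyl z R" using Q_cyl_mono[of "r / 4" R z] r by auto
        then show "ennreal (q - \<epsilon>) \<le> u y" using elim y by (simp add: ennreal_leI)
      qed
    qed
    then have low: "ennreal (q - \<epsilon>) \<le> ess_inf (Q_cyl z (r / 4)) u" by (rule ess_inf_ge[OF Q_cyl_borel])
    have "a < ennreal (q - \<epsilon>)" using a' \<epsilon> by (simp add: ennreal_less_iff)
    with low have "a < ess_inf (Q_cyl z (r / 4)) u" by (rule less_le_trans[rotated])
    \<comment> \<open>One good radius settles all smaller ones, since essential infima only grow as
      the cylinder shrinks.\<close>
    moreover have "ess_inf (Q_cyl z (r / 4)) u \<le> ess_inf (Q_cyl z s) u" if "s \<in> {0<..<r / 4}" for s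
      using that by (intro ess_inf_antimono Q_cyl_mono) auto
    moreover have "\<forall>\<^sub>F s in at_right 0. s \<in> {0<..<r / 4}" using r(1) by (intro eventually_at_right_real) simp
    ultimately show "\<forall>\<^sub>F s in at_right 0. a < ess_inf (Q_cyl z s) u"
      by (elim eventually_mono) (auto intro: less_le_trans)
  qed
qed

text \<open>The estimate \<open>u \<le> lsc_envelope u\<close> is local, on cylinders whose double
  has its closure in the domain. The Lindelof property reduces these to countably many, so the
  exceptional null sets can be united.\<close>

lemma lsc_envelope_eq_AE:
  fixes \<Omega> :: "'a::euclidean_space set"
  assumes m: "1 < m" and \<Omega>: "open \<Omega>" and super: "weak_supersolution m \<Omega> t\<^sub>1 t\<^sub>2 u"
  shows "AE y in lborel. y \<in> \<Omega> \<times> {t\<^sub>1<..<t\<^sub>2} \<longrightarrow> lsc_envelope u y = u y"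
proof -
  let ?E = "\<Omega> \<times> {t\<^sub>1<..<t\<^sub>2}"
  define \<F> where "\<F> = {Q_cyl z R |z R. 0 < R \<and> closure (Q_cyl z (2 * R)) \<subseteq> ?E}"
  have oE: "open ?E" using \<Omega> by (intro open_Times) auto
  have "open S" if "S \<in> \<F>" for S using that by (auto simp: \<F>_def open_Q_cyl)
  then obtain \<F>' where \<F>': "\<F>' \<subseteq> \<F>" "countable \<F>'" "\<Union>\<F>' = \<Union>\<F>" using Lindelof[of \<F>] by blast
  have "?E \<subseteq> \<Union>\<F>"
  proof
    fix z assume z: "z \<in> ?E"
    obtain R where R: "0 < R" "closure (Q_cyl z R) \<subseteq> ?E" by (rule Q_cyl_in_open[OF oE z])
    then have "Q_cyl z (R / 2) \<in> \<F>" unfolding \<F>_def by (intro CollectI exI[of _ z] exI[of _ "R / 2"]) simp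
    then show "z \<in> \<Union>\<F>" using centre_in_Q_cyl[of "R / 2" z] R(1) by auto
  qed
  have "AE y in lborel. y \<in> S \<longrightarrow> u y \<le> lsc_envelope u y" if SF: "S \<in> \<F>" for S
  proof -
    obtain z R where S: "S = Q_cyl z R" "0 < R" "closure (Q_cyl z (2 * R)) \<subseteq> ?E" using SF unfolding \<F>_def by blast
    obtain w G where loc: "local_supersolution m (ball (fst z) (2 * R)) (snd z - (2 * R)\<^sup>2) (snd z + (2 * R)\<^sup>2) w G"
      and uw: "AE y in lborel. y \<in> Q_cyl z (2 * R) \<longrightarrow> u y = ennreal (w y powr (1 / m))"
      by (rule weak_supersolution_on_cylinder[OF m \<Omega> super _ S(3)]) (use S(2) in auto)
    interpret local_supersolution m "ball (fst z) (2 * R)" "snd z - (2 * R)\<^sup>2" "snd z + (2 * R)\<^sup>2" w G by (rule loc)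
    have eq: "AE y in lborel. y \<in> ball (fst z) (2 * R) \<times> {snd z - (2 * R)\<^sup>2<..<snd z + (2 * R)\<^sup>2} \<longrightarrow>
        u y = ennreal (local_supersolution.u m w y)"
      using uw unfolding Q_cyl_eq u_def .
    have "AE y in lborel. y \<in> Q_cyl z R \<longrightarrow> ennreal (local_supersolution.u m w y) \<le> lsc_envelope u y"
      by (rule le_lsc_envelope_AE[OF S(2) _ eq]) (simp add: Q_cyl_eq)
    with uw show ?thesis unfolding S(1)
    proof eventually_elim
      case (elim y)
      show ?case
      proof
        assume y: "y \<in> Q_cyl z R"
        then have "y \<in> Q_cyl z (2 * R)" using Q_cyl_mono[of R "2 * R" z] S(2) by auto
        then show "u y \<le> lsc_envelope u y" using elim y by (simp add: local_supersolution.u_def[OF loc])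
      qed
    qed
  qed
  then have "AE y in lborel. \<forall>S\<in>\<F>'. y \<in> S \<longrightarrow> u y \<le> lsc_envelope u y"
    using \<F>'(1,2) by (subst AE_ball_countable) auto
  with lsc_envelope_le_AE[of u] show ?thesis
  proof eventually_elim
    case (elim y)
    show ?case
    proof
      assume "y \<in> ?E"
      then have "\<exists>S\<in>\<F>'. y \<in> S" using \<open>?E \<subseteq> \<Union>\<F>\<close> \<F>'(3) by blast
      then show "lsc_envelope u y = u y" using elim by (auto intro: antisym)
    qed
  qed
qed

theorem theorem1p1:
  fixes m t\<^sub>1 t\<^sub>2 :: real
    and \<Omega> :: "'a::euclidean_space set"
    and u :: "'a \<times> real \<Rightarrow> ennreal"
  assumes "1 < m"
    and "open \<Omega>" and "bounded \<Omega>"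
    and "0 < t\<^sub>1" and "t\<^sub>1 < t\<^sub>2"
    and "weak_supersolution m \<Omega> t\<^sub>1 t\<^sub>2 u"
  shows "(\<forall>z \<in> \<Omega> \<times> {t\<^sub>1<..<t\<^sub>2}. lebesgue_point u z \<and> u z < \<infinity> \<longrightarrow>
            u z = ess_lim_inf u z \<and> ((\<lambda>r. ess_inf (Q_cyl z r) u) \<longlongrightarrow> u z) (at_right 0))
       \<and> (\<exists>v :: 'a \<times> real \<Rightarrow> ennreal.
            lower_semicontinuous_on (\<Omega> \<times> {t\<^sub>1<..<t\<^sub>2}) v \<and>
            (AE z in lebesgue_on (\<Omega> \<times> {t\<^sub>1<..<t\<^sub>2}). v z = u z))"
proof (intro conjI ballI impI exI)
  fix z assume z: "z \<in> \<Omega> \<times> {t\<^sub>1<..<t\<^sub>2}" and "lebesgue_point u z \<and> u z < \<infinity>"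
  then show lim: "((\<lambda>r. ess_inf (Q_cyl z r) u) \<longlongrightarrow> u z) (at_right 0)"
    using tendsto_ess_inf[OF assms(1,2,6) z] by blast
  show "u z = ess_lim_inf u z"
    unfolding ess_lim_inf_def by (rule tendsto_Lim[OF trivial_limit_at_right_real lim, symmetric])
next
  show "lower_semicontinuous_on (\<Omega> \<times> {t\<^sub>1<..<t\<^sub>2}) (lsc_envelope u)"
    by (rule lower_semicontinuous_lsc_envelope)
  have "open (\<Omega> \<times> {t\<^sub>1<..<t\<^sub>2})" using assms(2) by (intro open_Times) auto
  then show "AE z in lebesgue_on (\<Omega> \<times> {t\<^sub>1<..<t\<^sub>2}). lsc_envelope u z = u z"
    by (subst AE_lebesgue_on_iff) (auto intro: borel_open lsc_envelope_eq_AE[OF assms(1,2,6)])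
qed

end
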